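(* Let $\alpha>0$, $\beta>0$, $0<p\le 1$, $p\le q\le\infty$ and $m>\alpha-1$. For a double indexed sequence of complex numbers $c=\{c_k^j : k\ge 0,\ 1\le j\le d_k\}$ the following conditions are equivalent: 1. $c\in M_H(B^{p,1}_\alpha, B^{q,1}_\beta)$. 2. The function $g(x)=\sum_{k\ge 0} r^k\sum_{j=1}^{d_k} c_k^j Y_j^{(k)}(x')$, $x=rx'$, is harmonic in $\mathbb B$ and $$N_1(g)=\sup_{0\le\rho<1}\ \sup_{y'\in\mathbb S}\ (1-\rho)^{m+1-\alpha+\beta}\int_{\mathbb S}|\Lambda_{m+1}(g\ast P_{x'})(\rho y')|\,dx'<\infty .$$
   Context: Let $n\ge 2$, let $\mathbb B$ be the open unit ball of $\mathbb R^n$, $\mathbb S=\partial\mathbb B$, and write $x=rx'$ with $r=|x|$, $x'\in\mathbb S$. $dx'$ is the rotation-invariant surface measure on $\mathbb S$ (fixed normalization). $h(\mathbb B)$ is the space of (complex-valued) harmonic functions on $\mathbb B$. For each $k\ge0$ let $Y^{(k)}_j$, $1\le j\le d_k$, be real-valued spherical harmonics of order $k$ ($d_k$ is the dimension of the space of spherical harmonics of order $k$), chosen so that the whole family $\{Y_j^{(k)}\}_{k\ge 0,\,1\le j\le d_k}$ is an orthonormal basis of $L^2(\mathbb S,dx')$; this basis is fixed. Every $f\in h(\mathbb B)$ has an expansion $f(rx')=\sum_{k\ge0} r^k\sum_{j=1}^{d_k} b_k^j(f)Y_j^{(k)}(x')$. For $y'\in\mathbb S$ the Poisson kernel is $P_{y'}(rx')=\sum_{k\ge0}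 r^k\sum_{j=1}^{d_k}Y_j^{(k)}(y')Y_j^{(k)}(x')$. For $f,g\in h(\mathbb B)$ the convolution is $(f\ast g)(rx')=\sum_{k\ge 0}\sum_{j=1}^{d_k} r^k b_k^j(f)b_k^j(g)Y_j^{(k)}(x')$, which is harmonic in $\mathbb B$. For a double indexed sequence $c$ and $f\in h(\mathbb B)$, $(c\ast f)(rx')=\sum_{k\ge 0}\sum_{j=1}^{d_k} r^k c_k^j b_k^j(f)Y_j^{(k)}(x')$, if the series converges in $\mathbb B$. For $t>0$ the fractional derivative of $f\in h(\mathbb B)$ of order $t$ is $$(\Lambda_t f)(rx')=\sum_{k\ge 0} r^k\frac{\Gamma(k+n/2+t)}{\Gamma(k+n/2)\Gamma(t)}\sum_{j=1}^{d_k}b_k^j(f)Y_j^{(k)}(x').$$ In $\Lambda_{m+1}(g\ast P_{x'})(\rho y')$ the operator acts on the harmonic function $g\ast P_{x'}$ ($x'$ fixed), and the result is evaluated at $\rho y'$. For subspaces $X,Y\subset h(\mathbb B)$, $M_H(X,Y)$ is the set of all double indexed sequences $c$ such that $c\ast f\in Y$ for every $f\in X$ (multipliers from $X$ to $Y$). $M_q(f,r)=\left(\int_{\mathbb S}|f(rx')|^q dx'\right)^{1/q}$ for $0<q<\infty$ and $M_\infty(f,r)=\sup_{x'\in\mathbb S}|f(rx')|$. For $0<p,q\le\infty$, $\alpha>0$, $B^{p,q}_\alpha$ is the space of $f\in h(\mathbb B)$ with $\|f\|_{p,q;\alpha}<\infty$, where $\|f\|_{p,q;\alpha}=\left(\int_0^1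 M_q(f,r)^p(1-r^2)^{\alpha p-1}r^{n-1}dr\right)^{1/p}$ for $p<\infty$ and $\|f\|_{\infty,q;\alpha}=\sup_{0\le r<1}M_q(f,r)(1-r^2)^\alpha$. *)

theory Defs
  imports "HOL-Analysis.Analysis" "HOL-Library.Function_Algebras"
begin

section \<open>Harmonic functions\<close>

text \<open>
  \<open>f'\<close> and \<open>f''\<close> are the first and second Frechet derivatives of \<open>f\<close>, so this says that \<open>f\<close> is
  of class \<open>C\<^sup>2\<close> with vanishing Laplacian. It is meant for open \<open>S\<close>.
\<close>

definition harmonic_on ::
  "'a::euclidean_space set \<Rightarrow> ('a \<Rightarrow> 'b::real_normed_vector) \<Rightarrow> bool" where
  "harmonic_on S f \<longleftrightarrow>
     (\<exists>(f' :: 'a \<Rightarrow> 'a \<Rightarrow>\<^sub>L 'b) (f'' :: 'a \<Rightarrow> 'a \<Rightarrow>\<^sub>L 'a \<Rightarrow>\<^sub>L 'b).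
        (\<forall>x\<in>S. (f has_derivative blinfun_apply (f' x)) (at x)) \<and>
        (\<forall>x\<in>S. (f' has_derivative blinfun_apply (f'' x)) (at x)) \<and>
        continuous_on S f'' \<and>
        (\<forall>x\<in>S. (\<Sum>i\<in>Basis. blinfun_apply (blinfun_apply (f'' x) i) i) = 0))"

text \<open>Values outside the unit ball are irrelevant for membership in this space.\<close>

definition harmonic_ball :: "('a::euclidean_space \<Rightarrow> complex) set" where
  "harmonic_ball = {f. harmonic_on (ball 0 1) f}"


section \<open>Surface measure and spherical harmonics\<close>

text \<open>
  The measure of a Borel set \<open>A\<close> of the sphere is \<open>n\<close> times the volume of the cone
  \<open>{r *\<^sub>R u | r u. 0 < r \<and> r < 1 \<and> u \<in> A}\<close>. Every other rotation-invariant finite Borel measure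
  on the sphere is a constant multiple of this one.
\<close>

definition surface_measure :: "'a::euclidean_space measure" where
  "surface_measure =
     scale_measure (of_nat DIM('a))
       (distr (restrict_space lborel (ball 0 1 - {0})) (restrict_space borel (sphere 0 1)) sgn)"

text \<open>
  Real-valued spherical harmonics of order \<open>k\<close>: restrictions to the unit sphere of homogeneous
  harmonic polynomials of degree \<open>k\<close>. Functions on the sphere are represented by their extension
  by zero, so that pointwise operations on functions give the right vector space structure.
\<close>

definition spherical_harmonics :: "nat \<Rightarrow> ('a::euclidean_space \<Rightarrow> real) set" where
  "spherical_harmonics k =
     {(\<lambda>x. if x \<in> sphere 0 1 then p x else 0) | p.
        real_polynomial_function p \<and> (\<forall>t x. p (t *\<^sub>R x) = t ^ k * p x) \<and> harmonic_on UNIV p}"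

definition sph_dim :: "'a::euclidean_space itself \<Rightarrow> nat \<Rightarrow> nat" where
  "sph_dim _ k =
     vector_space.dim (\<lambda>(a::real) (f::'a \<Rightarrow> real). (\<lambda>x. a * f x)) (spherical_harmonics k)"

text \<open>
  \<open>Y k j\<close> with \<open>1 \<le> j \<le> d\<^sub>k\<close> is the fixed basis; the values of \<open>Y k j\<close> for other \<open>j\<close> are never used.
  The last conjunct says that the finite linear combinations are dense in complex \<open>L\<^sup>2\<close>.
\<close>

definition spherical_harmonic_basis ::
  "'a::euclidean_space measure \<Rightarrow> (nat \<Rightarrow> nat \<Rightarrow> 'a \<Rightarrow> real) \<Rightarrow> bool" where
  "spherical_harmonic_basis \<sigma> Y \<longleftrightarrow>
     (\<forall>k. \<forall>j\<in>{1..sph_dim TYPE('a) k}. Y k j \<in> spherical_harmonics k) \<and>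
     (\<forall>k l. \<forall>i\<in>{1..sph_dim TYPE('a) k}. \<forall>j\<in>{1..sph_dim TYPE('a) l}.
        (LINT x|\<sigma>. Y k i x * Y l j x) = (if k = l \<and> i = j then 1 else 0)) \<and>
     (\<forall>f :: 'a \<Rightarrow> complex.
        f \<in> borel_measurable \<sigma> \<and> integrable \<sigma> (\<lambda>x. (cmod (f x))\<^sup>2) \<longrightarrow>
        (\<forall>\<epsilon>>0. \<exists>N a.
           (LINT x|\<sigma>. (cmod (f x - (\<Sum>k\<le>N. \<Sum>j=1..sph_dim TYPE('a) k.
              a k j * complex_of_real (Y k j x))))\<^sup>2) < \<epsilon>))"


section \<open>Expansions\<close>

text \<open>
  The unit vector \<open>x'\<close> in \<open>x = r x'\<close>. At the origin any unit vector will do, since there the terms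
  of an expansion with \<open>k > 0\<close> vanish and spherical harmonics of order \<open>0\<close> are constant.
\<close>

definition unit_dir :: "'a::euclidean_space \<Rightarrow> 'a" where
  "unit_dir x = (if x = 0 then (SOME u. u \<in> sphere 0 1) else sgn x)"

definition sph_term ::
  "(nat \<Rightarrow> nat \<Rightarrow> 'a::euclidean_space \<Rightarrow> real) \<Rightarrow> (nat \<Rightarrow> nat \<Rightarrow> complex) \<Rightarrow> 'a \<Rightarrow> nat \<Rightarrow> complex" where
  "sph_term Y a x k =
     complex_of_real (norm x ^ k) *
       (\<Sum>j=1..sph_dim TYPE('a) k. a k j * complex_of_real (Y k j (unit_dir x)))"

definition sph_series ::
  "(nat \<Rightarrow> nat \<Rightarrow> 'a::euclidean_space \<Rightarrow> real) \<Rightarrow> (nat \<Rightarrow> nat \<Rightarrow> complex) \<Rightarrow> 'a \<Rightarrow> complex" where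
  "sph_series Y a x = (\<Sum>k. sph_term Y a x k)"

definition sph_convergent ::
  "(nat \<Rightarrow> nat \<Rightarrow> 'a::euclidean_space \<Rightarrow> real) \<Rightarrow> (nat \<Rightarrow> nat \<Rightarrow> complex) \<Rightarrow> bool" where
  "sph_convergent Y a \<longleftrightarrow> (\<forall>x\<in>ball 0 1. summable (sph_term Y a x))"

text \<open>
  The coefficients \<open>b\<^sub>k\<^sup>j(f)\<close> of a harmonic function \<open>f\<close>. They are unique once the entries with
  \<open>j\<close> outside \<open>{1..d\<^sub>k}\<close>, which carry no information, are set to zero.
\<close>

definition sph_coeff ::
  "(nat \<Rightarrow> nat \<Rightarrow> 'a::euclidean_space \<Rightarrow> real) \<Rightarrow> ('a \<Rightarrow> complex) \<Rightarrow> nat \<Rightarrow> nat \<Rightarrow> complex" where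
  "sph_coeff Y f =
     (THE b. (\<forall>k j. j \<notin> {1..sph_dim TYPE('a) k} \<longrightarrow> b k j = 0) \<and>
             (\<forall>x\<in>ball 0 1. sph_term Y b x sums f x))"

definition poisson ::
  "(nat \<Rightarrow> nat \<Rightarrow> 'a::euclidean_space \<Rightarrow> real) \<Rightarrow> 'a \<Rightarrow> 'a \<Rightarrow> complex" where
  "poisson Y y = sph_series Y (\<lambda>k j. complex_of_real (Y k j y))"

definition hconv ::
  "(nat \<Rightarrow> nat \<Rightarrow> 'a::euclidean_space \<Rightarrow> real) \<Rightarrow> ('a \<Rightarrow> complex) \<Rightarrow> ('a \<Rightarrow> complex) \<Rightarrow> 'a \<Rightarrow> complex"
  where
  "hconv Y f g = sph_series Y (\<lambda>k j. sph_coeff Y f k j * sph_coeff Y g k j)"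

definition frac_deriv ::
  "(nat \<Rightarrow> nat \<Rightarrow> 'a::euclidean_space \<Rightarrow> real) \<Rightarrow> real \<Rightarrow> ('a \<Rightarrow> complex) \<Rightarrow> 'a \<Rightarrow> complex" where
  "frac_deriv Y t f =
     sph_series Y (\<lambda>k j.
       complex_of_real
         (Gamma (real k + real DIM('a) / 2 + t) / (Gamma (real k + real DIM('a) / 2) * Gamma t)) *
       sph_coeff Y f k j)"

definition multipliers ::
  "(nat \<Rightarrow> nat \<Rightarrow> 'a::euclidean_space \<Rightarrow> real) \<Rightarrow> ('a \<Rightarrow> complex) set \<Rightarrow> ('a \<Rightarrow> complex) set \<Rightarrow>
     (nat \<Rightarrow> nat \<Rightarrow> complex) set" where
  "multipliers Y A B =
     {c. \<forall>f\<in>A. sph_convergent Y (\<lambda>k j. c k j * sph_coeff Y f k j) \<and>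
               sph_series Y (\<lambda>k j. c k j * sph_coeff Y f k j) \<in> B}"


section \<open>Mixed norm spaces\<close>

text \<open>
  For \<open>f\<close> continuous on the unit ball and \<open>0 \<le> r < 1\<close> the integral and the supremum below are
  finite, so real-valued integrals and suprema suffice.
\<close>

definition sph_mean ::
  "'a::euclidean_space measure \<Rightarrow> ereal \<Rightarrow> ('a \<Rightarrow> complex) \<Rightarrow> real \<Rightarrow> real" where
  "sph_mean \<sigma> q f r =
     (if q = \<infinity> then (SUP x\<in>sphere 0 1. cmod (f (r *\<^sub>R x)))
      else (LINT x|\<sigma>. cmod (f (r *\<^sub>R x)) powr real_of_ereal q) powr (1 / real_of_ereal q))"

definition mixed_norm ::
  "'a::euclidean_space measure \<Rightarrow> ereal \<Rightarrow> ereal \<Rightarrow> real \<Rightarrow> ('a \<Rightarrow> complex) \<Rightarrow> ennreal" where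
  "mixed_norm \<sigma> p q \<alpha> f =
     (if p = \<infinity> then (SUP r\<in>{0..<1}. ennreal (sph_mean \<sigma> q f r * (1 - r\<^sup>2) powr \<alpha>))
      else
        let s = real_of_ereal p;
            I = (\<integral>\<^sup>+r\<in>{0..<1}. ennreal (sph_mean \<sigma> q f r powr s * (1 - r\<^sup>2) powr (\<alpha> * s - 1) *
                                     r ^ (DIM('a) - 1)) \<partial>lborel)
        in if I = \<infinity> then \<infinity> else ennreal (enn2real I powr (1 / s)))"

definition mixed_norm_space ::
  "'a::euclidean_space measure \<Rightarrow> ereal \<Rightarrow> ereal \<Rightarrow> real \<Rightarrow> ('a \<Rightarrow> complex) set" where
  "mixed_norm_space \<sigma> p q \<alpha> = {f \<in> harmonic_ball. mixed_norm \<sigma> p q \<alpha> f < \<infinity>}"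

definition N1 ::
  "'a::euclidean_space measure \<Rightarrow> (nat \<Rightarrow> nat \<Rightarrow> 'a \<Rightarrow> real) \<Rightarrow> real \<Rightarrow> real \<Rightarrow> real \<Rightarrow>
     ('a \<Rightarrow> complex) \<Rightarrow> ennreal" where
  "N1 \<sigma> Y \<alpha> \<beta> m g =
     (SUP \<rho>\<in>{0..<1}. SUP y\<in>sphere 0 1.
        ennreal ((1 - \<rho>) powr (m + 1 - \<alpha> + \<beta>)) *
        (\<integral>\<^sup>+x. ennreal (cmod (frac_deriv Y (m + 1) (hconv Y g (poisson Y x)) (\<rho> *\<^sub>R y))) \<partial>\<sigma>))"

end

theory Submission
  imports Defs
begin

text \<open>
  Green's formula shows that the integral of a harmonic function over a sphere against a spherical
  harmonic depends on the radius \<open>r\<close> only through \<open>r^k\<close>, and completeness of the basis turns this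
  into the expansion; a series is harmonic exactly when its coefficients grow subexponentially.
  Positivity of the Poisson kernel yields the estimate of the mean of a fractional derivative of
  order \<open>t\<close> of the kernel by a multiple of \<open>(1 - r) powr (- t)\<close>, and the means of a convolution at
  \<open>r * s\<close> are bounded by the largest kernel mean at \<open>r\<close> times the mean at \<open>s\<close>.

  The mixed norms are equivalent to weighted \<open>l\<^sup>p\<close> norms of the means at the radii \<open>1 - 2\<^sup>-\<^sup>i\<close>.
  For sufficiency, the image of \<open>f\<close> is a fractional integral of order \<open>m + 1\<close> of the convolution of
  \<open>f\<close> with the fractional derivative of \<open>g\<close>, so its means on the dyadic scales are dominated by a
  discrete convolution of those of \<open>f\<close> with a geometric sequence, and \<open>p \<le> 1\<close> makes the \<open>p\<close>-th
  powers subadditive. For necessity, the dilated kernels, normalized on their own scale, are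
  superposed along a very sparse sequence of scales.
\<close>

section \<open>Surface measure and polar coordinates\<close>

text \<open>Membership in \<open>multipliers\<close> is a bare inclusion of spaces and gives no norm
  inequality. Instead of a closed graph theorem for quasi-normed spaces, one explicit function is
  built whose image would violate any bound; this is what forces a gliding hump in the necessity
  half. Write t = m + 1. The hypothesis m > \<alpha> - 1 says t > \<alpha>. A Poisson kernel
  differentiated to order t, dilated by 1 - 2^-L and multiplied by 2^(-L (t - \<alpha>)) has
  weighted means that decay geometrically in |i - L|, with ratio 2^-\<alpha> towards the boundary
  and 2^-(t - \<alpha>) towards the centre. Both ratios are below 1, so the norm of such an atom is
  bounded independently of L. Apart from harmonicity, q enters through two facts: l^p lies in l^q
  for p \<le> q, and members of the target space have bounded weighted dyadic means. That is why the
  second condition does not mention q. The bound n \<ge> 2 gives n/2 \<ge> 1, which controls the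
  weight s^(n/2 - 1) of the Beta integral that inverts the fractional derivative.\<close>

lemma space_surface_measure [simp]: "space (surface_measure :: 'a::euclidean_space measure) = sphere 0 1"
  by (simp add: surface_measure_def space_restrict_space space_scale_measure)

lemma sets_surface_measure [measurable_cong]:
  "sets (surface_measure :: 'a::euclidean_space measure) = sets (restrict_space borel (sphere 0 1))"
  by (simp add: surface_measure_def)

lemma sgn_borel_measurable [measurable]: "(sgn :: 'a::euclidean_space \<Rightarrow> 'a) \<in> borel_measurable borel"
  unfolding sgn_div_norm by measurable

lemma sgn_measurable_sphere [measurable]:
  "sgn \<in> measurable (restrict_space lborel (ball 0 1 - {0::'a::euclidean_space})) (restrict_space borel (sphere 0 1))"
  by (intro measurable_restrict_space2 measurable_restrict_space1)
     (auto simp: space_restrict_space norm_sgn)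

lemma emeasure_surface_measure:
  fixes A :: "'a::euclidean_space set"
  assumes "A \<in> sets borel" "A \<subseteq> sphere 0 1"
  shows "emeasure surface_measure A = of_nat DIM('a) * emeasure lborel {x \<in> ball 0 1 - {0}. sgn x \<in> A}"
proof -
  have A: "A \<in> sets (restrict_space borel (sphere 0 1))"
    using assms by (auto simp: sets_restrict_space)
  have "emeasure surface_measure A = of_nat DIM('a) *
     emeasure (restrict_space lborel (ball 0 1 - {0})) (sgn -` A \<inter> space (restrict_space lborel (ball 0 1 - {0})))"
    unfolding surface_measure_def emeasure_scale_measure
    by (subst emeasure_distr[OF sgn_measurable_sphere A]) simp
  also have "emeasure (restrict_space lborel (ball 0 1 - {0})) (sgn -` A \<inter> space (restrict_space lborel (ball 0 1 - {0})))
    = emeasure lborel (sgn -` A \<inter> space (restrict_space lborel (ball 0 1 - {0})))"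
    by (rule emeasure_restrict_space) (auto simp: space_restrict_space)
  also have "sgn -` A \<inter> space (restrict_space lborel (ball 0 1 - {0})) = {x \<in> ball 0 1 - {0}. sgn x \<in> A}"
    by (auto simp: space_restrict_space)
  finally show ?thesis .
qed

lemma finite_surface_measure: "finite_measure (surface_measure :: 'a::euclidean_space measure)"
proof
  have "emeasure lborel {x \<in> ball (0::'a) 1 - {0}. sgn x \<in> sphere (0::'a) 1} \<le> emeasure lborel (ball (0::'a) 1)"
    by (rule emeasure_mono) auto
  also have "\<dots> < \<infinity>" by (rule emeasure_lborel_ball_finite)
  finally show "emeasure surface_measure (space (surface_measure :: 'a measure)) \<noteq> \<infinity>"
    by (simp add: emeasure_surface_measure ennreal_mult_eq_top_iff)
qed

text \<open>The radial factor of Lebesgue measure on the unit ball. The cutoff to 0 < r < 1 makes it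
  finite, with total mass 1/n.\<close>

definition radial_measure :: "nat \<Rightarrow> real measure" where
  "radial_measure n = density lborel (\<lambda>r. ennreal (indicator {0<..<1} r * r ^ (n - 1)))"

lemma sets_radial_measure [measurable_cong, simp]: "sets (radial_measure n) = sets borel"
  and space_radial_measure [simp]: "space (radial_measure n) = UNIV"
  by (simp_all add: radial_measure_def)

lemma emeasure_radial_measure_lessThan:
  assumes n: "n \<ge> 1" and t: "0 \<le> t" "t \<le> 1"
  shows "emeasure (radial_measure n) {..<t} = ennreal (t ^ n / n)"
proof -
  have "emeasure (radial_measure n) {..<t} =
     (\<integral>\<^sup>+r. ennreal (indicator {0<..<1} r * r ^ (n - 1)) * indicator {..<t} r \<partial>lborel)"
    unfolding radial_measure_def by (subst emeasure_density) auto
  also have "\<dots> = (\<integral>\<^sup>+r. ennreal (r ^ (n - 1)) * indicator {0..t} r \<partial>lborel)"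
  proof (rule nn_integral_cong_AE)
    show "AE r in lborel. ennreal (indicator {0<..<1} r * r ^ (n - 1)) * indicator {..<t} r
       = ennreal (r ^ (n - 1)) * indicator {0..t} r"
      using AE_lborel_singleton[of "0::real"] AE_lborel_singleton[of t]
      by eventually_elim (use t in \<open>auto simp: indicator_def\<close>)
  qed
  also have "\<dots> = ennreal (t ^ n / n - 0 ^ n / n)"
  proof (rule nn_integral_FTC_Icc)
    fix x :: real
    show "DERIV (\<lambda>r. r ^ n / n) x :> x ^ (n - 1)"
      using n by (auto intro!: derivative_eq_intros)
  qed (use n t in auto)
  finally show ?thesis using n by (simp add: power_0_left)
qed

lemma finite_radial_measure:
  assumes "n \<ge> 1" shows "finite_measure (radial_measure n)"
proof
  have "emeasure (radial_measure n) (space (radial_measure n)) = emeasure (radial_measure n) {..<1}"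
    unfolding radial_measure_def
    by (subst (1 2) emeasure_density) (auto intro!: nn_integral_cong simp: indicator_def)
  then show "emeasure (radial_measure n) (space (radial_measure n)) \<noteq> \<infinity>"
    using emeasure_radial_measure_lessThan[OF assms, of 1] by simp
qed

text \<open>The dilation x -> t x carries the full cone over \<open>A\<close> onto its part of
  radius below t, and Lebesgue measure scales by \<open>t ^ DIM('a)\<close>.\<close>

lemma emeasure_cone_scale:
  fixes A :: "'a::euclidean_space set"
  assumes [measurable]: "A \<in> sets borel" and t: "0 < t" "t \<le> 1"
  shows "emeasure lborel {x \<in> ball 0 1 - {0}. norm x < t \<and> sgn x \<in> A}
     = ennreal (t ^ DIM('a)) * emeasure lborel {x \<in> ball 0 1 - {0}. sgn x \<in> A}"
proof -
  let ?C = "{x \<in> ball 0 1 - {0}. norm x < t \<and> sgn x \<in> A}"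
  have m: "?C \<in> sets borel"
    by measurable
  have "emeasure lborel ?C = emeasure (density (distr lborel borel (\<lambda>x::'a. 0 + t *\<^sub>R x)) (\<lambda>_. \<bar>t\<bar>^DIM('a))) ?C"
    by (subst lborel_affine[of t 0]) (use t in auto)
  also have "\<dots> = ennreal (t ^ DIM('a)) * emeasure (distr lborel borel (\<lambda>x::'a. 0 + t *\<^sub>R x)) ?C"
    by (subst emeasure_density) (use m t in \<open>auto simp: nn_integral_cmult\<close>)
  also have "emeasure (distr lborel borel (\<lambda>x::'a. 0 + t *\<^sub>R x)) ?C = emeasure lborel {x \<in> ball 0 1 - {0}. sgn x \<in> A}"
  proof (subst emeasure_distr)
    have "t * norm x < 1" if "norm x < 1" for x :: 'a
      using that t mult_left_le_one_le[of "norm x" t] by (simp add: order.strict_trans1)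
    then have "(\<lambda>x. 0 + t *\<^sub>R x) -` ?C \<inter> space lborel = {x \<in> ball 0 1 - {0}. sgn x \<in> A}"
      using t by (auto simp: sgn_scaleR)
    then show "emeasure lborel ((\<lambda>x. 0 + t *\<^sub>R x) -` ?C \<inter> space lborel) = emeasure lborel {x \<in> ball 0 1 - {0}. sgn x \<in> A}"
      by simp
  qed (use m in auto)
  finally show ?thesis .
qed

text \<open>As functions of \<open>B\<close> both sides are measures that are finite on the
  half-lines \<open>{..<t}\<close>. These generate the Borel sets and are closed under intersection,
  so it is enough to compare there. On them the scaling of cones applies, and the factor n in
  \<open>surface_measure\<close> cancels the 1/n in the radial mass.\<close>

lemma emeasure_cone:
  fixes A :: "'a::euclidean_space set"
  assumes A: "A \<in> sets borel" "A \<subseteq> sphere 0 1" and B: "B \<in> sets borel"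
  shows "emeasure (radial_measure DIM('a)) B * emeasure surface_measure A =
     emeasure lborel {x \<in> ball 0 1 - {0}. norm x \<in> B \<and> sgn x \<in> A}"
proof -
  note [measurable] = A(1) B
  define C where "C = {x \<in> ball (0::'a) 1 - {0}. sgn x \<in> A}"
  have C [measurable]: "C \<in> sets borel" unfolding C_def by measurable
  have Csub: "C \<subseteq> ball 0 1" by (auto simp: C_def)
  let ?S = "emeasure surface_measure A"
  let ?R = "radial_measure DIM('a)"
  define M where "M = scale_measure ?S ?R"
  define N where "N = distr (restrict_space lborel C) borel norm"
  have Nem: "emeasure N X = emeasure lborel {x \<in> ball 0 1 - {0}. norm x \<in> X \<and> sgn x \<in> A}" if [measurable]: "X \<in> sets borel" for X
  proof -
    have "emeasure N X = emeasure (restrict_space lborel C) (norm -` X \<inter> space (restrict_space lborel C))"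
      unfolding N_def by (rule emeasure_distr) (auto intro!: measurable_restrict_space1)
    also have "\<dots> = emeasure lborel (norm -` X \<inter> space (restrict_space lborel C))"
      by (rule emeasure_restrict_space) (auto simp: space_restrict_space)
    also have "norm -` X \<inter> space (restrict_space lborel C) = {x \<in> ball 0 1 - {0}. norm x \<in> X \<and> sgn x \<in> A}"
      by (auto simp: space_restrict_space C_def)
    finally show ?thesis .
  qed
  have C1: "emeasure lborel {x \<in> ball (0::'a) 1 - {0}. sgn x \<in> A} < \<infinity>"
    by (rule le_less_trans[OF emeasure_mono[of _ "ball 0 1"] emeasure_lborel_ball_finite]) auto
  have ran: "emeasure M {..<t} = emeasure N {..<t}" for t :: real
  proof -
    have Sn: "?S = of_nat DIM('a) * emeasure lborel {x \<in> ball 0 1 - {0}. sgn x \<in> A}"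
      by (rule emeasure_surface_measure[OF A])
    consider "t \<le> 0" | "0 < t" "t \<le> 1" | "t > 1" by linarith
    then show ?thesis
    proof cases
      case 1
      have "emeasure ?R {..<t} \<le> emeasure ?R {..<0}" using 1 by (intro emeasure_mono) auto
      moreover have "emeasure ?R {..<0} = 0" using emeasure_radial_measure_lessThan[of "DIM('a)" 0] by simp
      ultimately have "emeasure ?R {..<t} = 0" by simp
      moreover have e: "{x \<in> ball 0 1 - {0}. norm x \<in> {..<t} \<and> sgn x \<in> A} = {}"
        using 1 by (auto simp: not_less intro: order_trans)
      have "emeasure N {..<t} = 0"
        by (subst Nem) (simp_all only: e, simp_all)
      ultimately show ?thesis by (simp add: M_def)
    next
      case 2
      define V where "V = emeasure lborel {x \<in> ball (0::'a) 1 - {0}. sgn x \<in> A}"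
      have "emeasure M {..<t} = ennreal (real DIM('a)) * V * ennreal (t ^ DIM('a) / real DIM('a))"
        using 2 emeasure_radial_measure_lessThan[of "DIM('a)" t]
        by (simp add: M_def Sn V_def ennreal_of_nat_eq_real_of_nat)
      also have "\<dots> = (ennreal (real DIM('a)) * ennreal (t ^ DIM('a) / real DIM('a))) * V"
        by (simp only: mult_ac)
      also have "ennreal (real DIM('a)) * ennreal (t ^ DIM('a) / real DIM('a)) = ennreal (t ^ DIM('a))"
        using 2 by (subst ennreal_mult[symmetric]) auto
      also have "ennreal (t ^ DIM('a)) * V = emeasure N {..<t}"
        unfolding V_def emeasure_cone_scale[OF A(1) 2, symmetric] by (subst Nem) auto
      finally show ?thesis .
    next
      case 3
      have "emeasure ?R {..<t} = emeasure ?R {..<1}"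
        unfolding radial_measure_def
        by (subst (1 2) emeasure_density) (use 3 in \<open>auto intro!: nn_integral_cong simp: indicator_def\<close>)
      also have "\<dots> = ennreal (1 / DIM('a))" using emeasure_radial_measure_lessThan[of "DIM('a)" 1] by simp
      finally have "emeasure ?R {..<t} = ennreal (1 / DIM('a))" .
      moreover have e: "{x \<in> ball 0 1 - {0}. norm x \<in> {..<t} \<and> sgn x \<in> A} = {x \<in> ball 0 1 - {0}. sgn x \<in> A}"
        using 3 by auto
      have "emeasure N {..<t} = emeasure lborel {x \<in> ball 0 1 - {0}. sgn x \<in> A}" 
        by (subst Nem) (simp_all only: e, simp)
      moreover have "emeasure M {..<t} = ennreal (DIM('a)) * emeasure lborel {x \<in> ball (0::'a) 1 - {0}. sgn x \<in> A} * ennreal (1 / DIM('a))"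
        using calculation by (simp add: M_def Sn ennreal_of_nat_eq_real_of_nat)
      moreover have "ennreal (DIM('a)) * ennreal (1 / DIM('a)) = 1"
        by (subst ennreal_mult[symmetric]) auto
      ultimately show ?thesis by (metis mult.assoc mult.commute mult_1)
    qed
  qed
  have sig: "sets borel = sigma_sets UNIV (range (\<lambda>t::real. {..<t}))"
    by (subst borel_Iio) simp
  have "M = N"
  proof (rule measure_eqI_generator_eq[where E = "range (\<lambda>t::real. {..<t})" and \<Omega> = UNIV and A = "\<lambda>i::nat. {..<real i}"])
    show "Int_stable (range (\<lambda>t::real. {..<t}))"
    proof -
      have "{..<a} \<inter> {..<b} = {..<min a b}" for a b :: real by auto
      then show ?thesis by (auto simp: Int_stable_def)
    qed
    show "sets M = sigma_sets UNIV (range (\<lambda>t::real. {..<t}))" "sets N = sigma_sets UNIV (range (\<lambda>t::real. {..<t}))"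
      by (simp_all add: M_def N_def sig)
    show "(\<Union>i. {..<real i}) = UNIV"
      by (auto intro: reals_Archimedean2)
    show "emeasure M {..<real i} \<noteq> \<infinity>" for i
    proof -
      have "emeasure M {..<real i} \<le> emeasure lborel {x \<in> ball (0::'a) 1 - {0}. sgn x \<in> A}"
        by (subst ran, subst Nem) (auto intro!: emeasure_mono)
      then show ?thesis using C1 by (auto simp: top_unique)
    qed
  qed (use ran in auto)
  then have "emeasure M B = emeasure N B" by simp
  then show ?thesis by (simp add: M_def Nem mult.commute)
qed

lemma norm_sgn_measurable [measurable]:
  "(\<lambda>x::'a::euclidean_space. (norm x, sgn x)) \<in>
    measurable (restrict_space lborel (ball 0 1 - {0})) (borel \<Otimes>\<^sub>M surface_measure)"
proof -
  have "sgn \<in> measurable (restrict_space lborel (ball 0 1 - {0::'a})) surface_measure"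
    using sgn_measurable_sphere measurable_cong_sets[OF refl sets_surface_measure] by blast
  moreover have "norm \<in> measurable (restrict_space lborel (ball 0 1 - {0::'a})) borel"
    by (intro measurable_restrict_space1) auto
  ultimately show ?thesis by simp
qed

text \<open>Equality on rectangles is \<open>emeasure_cone\<close>; as both factors are finite
  measures, rectangles determine the product.\<close>

lemma distr_polar:
  "distr (restrict_space lborel (ball 0 1 - {0::'a::euclidean_space})) (borel \<Otimes>\<^sub>M surface_measure) (\<lambda>x. (norm x, sgn x))
     = radial_measure DIM('a) \<Otimes>\<^sub>M surface_measure"
proof -
  interpret R: finite_measure "radial_measure DIM('a)" by (rule finite_radial_measure) simp
  interpret S: finite_measure "surface_measure :: 'a measure" by (rule finite_surface_measure)
  have 1: "sigma_finite_measure (radial_measure DIM('a))" "sigma_finite_measure (surface_measure :: 'a measure)"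
    by unfold_locales
  show ?thesis
  proof (rule pair_measure_eqI[OF 1, symmetric], goal_cases)
    case 1
    show ?case by (simp cong: sets_pair_measure_cong)
  next
    case (2 A B)
    have B: "B \<in> sets borel" "B \<subseteq> sphere 0 1"
      using 2(2) by (auto simp: sets_surface_measure sets_restrict_space)
    have A: "A \<in> sets borel" using 2(1) by simp
    have "emeasure (distr (restrict_space lborel (ball 0 1 - {0})) (borel \<Otimes>\<^sub>M surface_measure) (\<lambda>x. (norm x, sgn x))) (A \<times> B)
       = emeasure (restrict_space lborel (ball 0 1 - {0})) ((\<lambda>x. (norm x, sgn x)) -` (A \<times> B) \<inter> space (restrict_space lborel (ball 0 1 - {0})))"
      using A 2(2) by (intro emeasure_distr) auto
    also have "\<dots> = emeasure lborel ((\<lambda>x. (norm x, sgn x)) -` (A \<times> B) \<inter> space (restrict_space lborel (ball 0 1 - {0})))"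
      by (rule emeasure_restrict_space) (auto simp: space_restrict_space)
    also have "((\<lambda>x. (norm x, sgn x)) -` (A \<times> B) \<inter> space (restrict_space lborel (ball 0 1 - {0})))
        = {x \<in> ball 0 1 - {0}. norm x \<in> A \<and> sgn x \<in> B}"
      by (auto simp: space_restrict_space)
    finally show ?case using emeasure_cone[OF B A] by simp
  qed
qed

text \<open>Boundedness of \<open>F\<close> and finiteness of both polar factors give integrability,
  so Fubini applies. The origin, where \<open>sgn\<close> is not a unit vector, is a null
  set.\<close>

lemma integral_polar:
  fixes F :: "'a::euclidean_space \<Rightarrow> real"
  assumes F [measurable]: "F \<in> borel_measurable borel" and B: "\<And>x. \<bar>F x\<bar> \<le> B"
  shows "(\<integral>x. indicator (ball 0 1) x * F x \<partial>lborel) =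
     (\<integral>r. indicator {0<..<1} r * (r ^ (DIM('a) - 1) * (\<integral>y. F (r *\<^sub>R y) \<partial>surface_measure)) \<partial>lborel)"
proof -
  interpret R: finite_measure "radial_measure DIM('a)" by (rule finite_radial_measure) simp
  interpret S: finite_measure "surface_measure :: 'a measure" by (rule finite_surface_measure)
  interpret P: pair_sigma_finite "radial_measure DIM('a)" "surface_measure :: 'a measure" by unfold_locales
  interpret RS: finite_measure "radial_measure DIM('a) \<Otimes>\<^sub>M (surface_measure :: 'a measure)"
    by (rule finite_measure_pair_measure) unfold_locales
  have b0: "B \<ge> 0" using B[of 0] by linarith
  have S1 [measurable]: "(\<lambda>y::'a. y) \<in> borel_measurable surface_measure"
    by (metis measurable_ident_sets measurable_restrict_space1 sets_surface_measure measurable_cong_sets measurable_ident sets_borel id_def)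
  have meas: "(\<lambda>z. F (fst z *\<^sub>R snd z)) \<in> borel_measurable (borel \<Otimes>\<^sub>M (surface_measure :: 'a measure))"
  proof -
    have "(\<lambda>z. fst z *\<^sub>R (snd z::'a)) \<in> borel_measurable (borel \<Otimes>\<^sub>M (surface_measure :: 'a measure))"
      by (intro borel_measurable_scaleR measurable_compose[OF measurable_snd S1]) auto
    from measurable_compose[OF this F] show ?thesis .
  qed
  have meas': "(\<lambda>z. F (fst z *\<^sub>R snd z)) \<in> borel_measurable (radial_measure DIM('a) \<Otimes>\<^sub>M (surface_measure :: 'a measure))"
    using meas by (simp cong: measurable_cong_sets sets_pair_measure_cong)
  have int: "integrable (radial_measure DIM('a) \<Otimes>\<^sub>M (surface_measure :: 'a measure)) (\<lambda>z. F (fst z *\<^sub>R snd z))"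
    by (rule RS.integrable_const_bound[of _ B]) (use meas' B in auto)
  have "(\<integral>x. indicator (ball 0 1) x * F x \<partial>lborel) = (\<integral>x. indicator (ball 0 1 - {0}) x *\<^sub>R F x \<partial>lborel)"
    using AE_lborel_singleton[of "0::'a"]
    by (intro integral_cong_AE) (auto elim!: eventually_mono simp: indicator_def)
  also have "\<dots> = (\<integral>x. F x \<partial>restrict_space lborel (ball 0 1 - {0}))"
    by (rule integral_restrict_space[symmetric]) auto
  also have "\<dots> = (\<integral>x. F (norm x *\<^sub>R sgn x) \<partial>restrict_space lborel (ball 0 1 - {0}))"
    by (intro Bochner_Integration.integral_cong) (auto simp: sgn_div_norm space_restrict_space)
  also have "\<dots> = (\<integral>z. F (fst z *\<^sub>R snd z) \<partial>distr (restrict_space lborel (ball 0 1 - {0})) (borel \<Otimes>\<^sub>M surface_measure) (\<lambda>x. (norm x, sgn x)))"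
    by (subst integral_distr[OF norm_sgn_measurable meas]) simp
  also have "\<dots> = (\<integral>z. F (fst z *\<^sub>R snd z) \<partial>(radial_measure DIM('a) \<Otimes>\<^sub>M surface_measure))"
    by (simp add: distr_polar)
  also have "\<dots> = (\<integral>r. (\<integral>y. F (r *\<^sub>R y) \<partial>surface_measure) \<partial>radial_measure DIM('a))"
    using P.integral_fst'[OF int] by simp
  also have "\<dots> = (\<integral>r. (indicator {0<..<1} r * r ^ (DIM('a) - 1)) *\<^sub>R (\<integral>y. F (r *\<^sub>R y) \<partial>surface_measure) \<partial>lborel)"
    unfolding radial_measure_def
  proof (rule integral_density)
    show "(\<lambda>r. \<integral>y. F (r *\<^sub>R y) \<partial>surface_measure) \<in> borel_measurable lborel"
      using S.borel_measurable_lebesgue_integral[of "\<lambda>r y. F (r *\<^sub>R y)" borel] meas by (simp add: case_prod_beta')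
  qed (auto simp: indicator_def)
  finally show ?thesis by (simp add: mult.assoc)
qed

section \<open>Integrals with parameters and convolutions\<close>

text \<open>A convergent sequence of parameters together with its limit is compact. So the integrand
  is bounded along it, and that bound is the dominating constant.\<close>

lemma continuous_on_integral_param:
  fixes F :: "'b::heine_borel \<Rightarrow> 'a::euclidean_space \<Rightarrow> 'c::{banach,second_countable_topology}"
  assumes M: "finite_measure M" and sets: "sets M = sets (restrict_space borel K)" and K: "compact K"
    and F: "continuous_on (T \<times> K) (\<lambda>z. F (fst z) (snd z))"
  shows "continuous_on T (\<lambda>t. \<integral>y. F t y \<partial>M)"
proof -
  interpret M: finite_measure M by fact
  have sp: "space M = K"
    using sets_eq_imp_space_eq[OF sets] by (simp add: space_restrict_space)
  have contF: "continuous_on K (F t)" if "t \<in> T" for t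
  proof -
    have "continuous_on K (\<lambda>y. (t, y))" by (intro continuous_intros)
    from continuous_on_compose2[OF F this] that show ?thesis by auto
  qed
  have meas: "F t \<in> borel_measurable M" if "t \<in> T" for t
    using borel_measurable_continuous_on_restrict[OF contF[OF that]] measurable_cong_sets[OF sets refl] by blast
  show ?thesis
    unfolding continuous_on_sequentially
  proof (intro ballI allI impI, elim conjE)
    fix t X assume t: "t \<in> T" and X: "\<forall>n. X n \<in> T" and lim: "X \<longlonglongrightarrow> t"
    have "compact (insert t (range X) \<times> K)"
      using compact_sequence_with_limit[OF lim] K by (rule compact_Times)
    moreover have "continuous_on (insert t (range X) \<times> K) (\<lambda>z. F (fst z) (snd z))"
      using X t by (intro continuous_on_subset[OF F]) auto
    ultimately have "bounded ((\<lambda>z. F (fst z) (snd z)) ` (insert t (range X) \<times> K))"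
      by (intro compact_imp_bounded compact_continuous_image)
    then obtain B where B: "\<And>s y. s \<in> insert t (range X) \<Longrightarrow> y \<in> K \<Longrightarrow> norm (F s y) \<le> B"
      unfolding bounded_iff by fastforce
    have "(\<lambda>n. \<integral>y. F (X n) y \<partial>M) \<longlonglongrightarrow> (\<integral>y. F t y \<partial>M)"
    proof (rule integral_dominated_convergence[where w = "\<lambda>_. B"])
      show "AE y in M. (\<lambda>n. F (X n) y) \<longlonglongrightarrow> F t y"
      proof (rule AE_I2)
        fix y assume y: "y \<in> space M"
        then have "continuous_on T (\<lambda>s. F s y)"
          using sp by (intro continuous_on_compose2[OF F, of T "\<lambda>s. (s, y)", simplified]) (auto intro!: continuous_intros)
        then show "(\<lambda>n. F (X n) y) \<longlonglongrightarrow> F t y"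
          using t X lim unfolding continuous_on_sequentially by (auto simp: o_def)
      qed
    qed (use X t meas B sp in auto)
    then show "((\<lambda>t. \<integral>y. F t y \<partial>M) \<circ> X) \<longlonglongrightarrow> (\<integral>y. F t y \<partial>M)"
      by (simp add: o_def)
  qed
qed

text \<open>The mean value theorem bounds the difference quotients by the maximum of
  \<open>D\<close> over a compact parameter interval around t, and dominated convergence
  applies.\<close>

lemma has_real_derivative_integral_param:
  fixes F D :: "real \<Rightarrow> 'a::euclidean_space \<Rightarrow> real"
  assumes M: "finite_measure M" and sets: "sets M = sets (restrict_space borel K)" and K: "compact K"
    and F: "\<And>t. t \<in> {a<..<b} \<Longrightarrow> continuous_on K (F t)"
    and deriv: "\<And>t y. t \<in> {a<..<b} \<Longrightarrow> y \<in> K \<Longrightarrow> ((\<lambda>t. F t y) has_real_derivative D t y) (at t)"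
    and D: "continuous_on ({a<..<b} \<times> K) (\<lambda>z. D (fst z) (snd z))"
    and t: "t \<in> {a<..<b}"
  shows "((\<lambda>t. \<integral>y. F t y \<partial>M) has_real_derivative (\<integral>y. D t y \<partial>M)) (at t)"
proof -
  interpret M: finite_measure M by fact
  have sp: "space M = K"
    using sets_eq_imp_space_eq[OF sets] by (simp add: space_restrict_space)
  have meas: "F t \<in> borel_measurable M" if "t \<in> {a<..<b}" for t
    using borel_measurable_continuous_on_restrict[OF F[OF that]] measurable_cong_sets[OF sets refl] by blast
  have int: "integrable M (F t)" if t: "t \<in> {a<..<b}" for t
  proof -
    have "bounded (F t ` K)"
      using F[OF t] K by (intro compact_imp_bounded compact_continuous_image)
    then obtain B where "\<And>y. y \<in> K \<Longrightarrow> norm (F t y) \<le> B" unfolding bounded_iff by fastforce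
    then show ?thesis
      using sp meas[OF t] by (intro M.integrable_const_bound[of _ B]) auto
  qed
  have contD: "continuous_on K (D t)" 
  proof -
    have "continuous_on K (\<lambda>y. (t, y))" by (intro continuous_intros)
    moreover have "(\<lambda>y. (t, y)) ` K \<subseteq> {a<..<b} \<times> K" using t by auto
    ultimately show ?thesis using continuous_on_compose2[OF D] by fastforce
  qed
  have measD: "D t \<in> borel_measurable M"
    using borel_measurable_continuous_on_restrict[OF contD] measurable_cong_sets[OF sets refl] by blast
  obtain e where e: "e > 0" "{t - e..t + e} \<subseteq> {a<..<b}"
  proof
    show "min (t - a) (b - t) / 2 > 0" "{t - min (t - a) (b - t) / 2..t + min (t - a) (b - t) / 2} \<subseteq> {a<..<b}"
      using t by (auto simp: min_def field_simps split: if_splits)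
  qed
  have "bounded ((\<lambda>z. D (fst z) (snd z)) ` ({t - e..t + e} \<times> K))"
    using e K by (intro compact_imp_bounded compact_continuous_image continuous_on_subset[OF D] compact_Times) auto
  then obtain B where B: "\<And>s y. s \<in> {t-e..t+e} \<Longrightarrow> y \<in> K \<Longrightarrow> norm (D s y) \<le> B"
    unfolding bounded_iff by fastforce
  show ?thesis
    unfolding has_field_derivative_iff tendsto_at_iff_sequentially
  proof (intro allI impI)
    fix X :: "nat \<Rightarrow> real" assume X: "\<forall>i. X i \<in> UNIV - {t}" and lim: "X \<longlonglongrightarrow> t"
    from lim e(1) obtain N where N: "\<And>n. n \<ge> N \<Longrightarrow> dist (X n) t < e"
      unfolding lim_sequentially by blast
    \<comment> \<open>Dropping the first N terms keeps the whole sequence in the interval where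
      \<open>B\<close> bounds \<open>D\<close>; \<open>LIMSEQ_offset\<close> puts them back at the
      end.\<close>
    define Z where "Z n = X (n + N)" for n
    have Z: "Z n \<in> {t-e..t+e}" "Z n \<noteq> t" for n
      using N[of "n + N"] X by (auto simp: Z_def dist_real_def)
    have limZ: "Z \<longlonglongrightarrow> t"
      unfolding Z_def using lim by (rule LIMSEQ_ignore_initial_segment)
    have Zab: "Z n \<in> {a<..<b}" for n using Z e by blast
    have "(\<lambda>n. \<integral>y. (F (Z n) y - F t y) / (Z n - t) \<partial>M) \<longlonglongrightarrow> (\<integral>y. D t y \<partial>M)"
    proof (rule integral_dominated_convergence[where w = "\<lambda>_. B"])
      show "AE y in M. (\<lambda>n. (F (Z n) y - F t y) / (Z n - t)) \<longlonglongrightarrow> D t y"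
      proof (rule AE_I2)
        fix y assume y: "y \<in> space M"
        have "((\<lambda>s. (F s y - F t y) / (s - t)) \<longlongrightarrow> D t y) (at t)"
          using deriv[OF t, of y] y sp unfolding has_field_derivative_iff by auto
        then show "(\<lambda>n. (F (Z n) y - F t y) / (Z n - t)) \<longlonglongrightarrow> D t y"
          using limZ Z unfolding tendsto_at_iff_sequentially by (auto simp: o_def)
      qed
      show "AE y in M. norm ((F (Z n) y - F t y) / (Z n - t)) \<le> B" for n
      proof (rule AE_I2)
        fix y assume y: "y \<in> space M"
        have "norm (F (Z n) y - F t y) \<le> B * norm (Z n - t)"
        proof (rule field_differentiable_bound[where S = "{t-e..t+e}"])
          fix s assume "s \<in> {t-e..t+e}"
          moreover from this have "s \<in> {a<..<b}" using e by blast
          ultimately show "((\<lambda>s. F s y) has_real_derivative D s y) (at s within {t-e..t+e})" "norm (D s y) \<le> B"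
            using deriv[of s y] B[of s y] y sp e by (auto intro: has_field_derivative_at_within)
        qed (use Z e in auto)
        then show "norm ((F (Z n) y - F t y) / (Z n - t)) \<le> B"
          using Z[of n] by (simp add: divide_simps)
      qed
    qed (use meas[OF Zab] meas[OF t] measD in auto)
    moreover have "(\<integral>y. (F (Z n) y - F t y) / (Z n - t) \<partial>M) = ((\<integral>y. F (Z n) y \<partial>M) - (\<integral>y. F t y \<partial>M)) / (Z n - t)" for n
      using int[OF Zab] int[OF t] by simp
    ultimately have "(\<lambda>n. ((\<integral>y. F (Z n) y \<partial>M) - (\<integral>y. F t y \<partial>M)) / (Z n - t)) \<longlonglongrightarrow> (\<integral>y. D t y \<partial>M)"
      by (simp only:)
    then show "((\<lambda>s. ((\<integral>y. F s y \<partial>M) - (\<integral>y. F t y \<partial>M)) / (s - t)) \<circ> X) \<longlonglongrightarrow> (\<integral>y. D t y \<partial>M)"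
      by (intro LIMSEQ_offset[of "(\<lambda>s. ((\<integral>y. F s y \<partial>M) - (\<integral>y. F t y \<partial>M)) / (s - t)) \<circ> X" N]) (simp add: o_def Z_def)
  qed
qed

section \<open>Compact support, translation and convolution in space\<close>

lemma integrable_continuous_compact_support:
  fixes f :: "'a::euclidean_space \<Rightarrow> 'b::{banach,second_countable_topology}"
  assumes "continuous_on UNIV f" and "\<And>x. norm x > R \<Longrightarrow> f x = 0"
  shows "integrable lborel f"
proof -
  have "integrable lborel (\<lambda>x. indicator (cball 0 R) x *\<^sub>R f x)"
    by (rule borel_integrable_compact) (auto intro: continuous_on_subset assms)
  also have "(\<lambda>x. indicator (cball 0 R) x *\<^sub>R f x) = f"
    using assms(2) by (force simp: indicator_def)
  finally show ?thesis .
qed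

lemma integral_lborel_translate:
  fixes f :: "'a::euclidean_space \<Rightarrow> 'b::{banach,second_countable_topology}"
  assumes [measurable]: "f \<in> borel_measurable borel"
  shows "(\<integral>x. f (a + x) \<partial>lborel) = (\<integral>x. f x \<partial>lborel)"
  by (subst (2) lborel_distr_plus[of a, symmetric], subst integral_distr) auto

text \<open>By translation invariance every difference quotient in direction e has integral zero,
  and dominated convergence passes this to the derivative.\<close>

lemma integral_directional_derivative_zero:
  fixes G :: "'a::euclidean_space \<Rightarrow> real"
  assumes G: "\<And>x. (G has_derivative G' x) (at x)" and G': "continuous_on UNIV (\<lambda>x. G' x e)"
    and supp: "\<And>x. norm x > R \<Longrightarrow> G x = 0"
  shows "(\<integral>x. G' x e \<partial>lborel) = 0"
proof -
  have contG: "continuous_on UNIV G"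
    using G by (intro has_derivative_continuous_on[of UNIV G G']) auto
  then have [measurable]: "G \<in> borel_measurable borel" by (rule borel_measurable_continuous_onI)
  have intG: "integrable lborel G"
    by (rule integrable_continuous_compact_support[OF contG supp])
  define t where "t n = 1 / real (Suc n)" for n
  have t: "0 < t n" "t n \<le> 1" for n by (auto simp: t_def)
  have tlim: "t \<longlonglongrightarrow> 0" unfolding t_def by (rule lim_1_over_real_power[of 1, simplified] LIMSEQ_Suc[OF lim_1_over_n])
  \<comment> \<open>A quotient with step at most 1 vanishes unless |x| \<le> R + |e|, and then the
    segment of length at most |e| from x stays within radius R + 2|e|. Hence the two different
    radii.\<close>
  have "bounded ((\<lambda>x. G' x e) ` cball 0 (R + 2 * norm e))"
    by (intro compact_imp_bounded compact_continuous_image continuous_on_subset[OF G']) auto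
  then obtain B where B: "\<And>x. norm x \<le> R + 2 * norm e \<Longrightarrow> \<bar>G' x e\<bar> \<le> B"
    unfolding bounded_iff by fastforce
  have der: "((\<lambda>s. G (x + s *\<^sub>R e)) has_real_derivative G' (x + s *\<^sub>R e) e) (at s)" for x s
  proof -
    have "((\<lambda>s. G (x + s *\<^sub>R e)) has_derivative (\<lambda>h. G' (x + s *\<^sub>R e) (h *\<^sub>R e))) (at s)"
      by (rule has_derivative_compose[OF _ G]) (auto intro!: derivative_eq_intros)
    moreover have "(\<lambda>h. G' (x + s *\<^sub>R e) (h *\<^sub>R e)) = (*) (G' (x + s *\<^sub>R e) e)"
      using linear_cmul[OF bounded_linear.linear[OF has_derivative_bounded_linear[OF G]]] by (auto simp: mult.commute)
    ultimately show ?thesis by (simp add: has_field_derivative_def)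
  qed
  have "(\<lambda>n. \<integral>x. (G (x + t n *\<^sub>R e) - G x) / t n \<partial>lborel) \<longlonglongrightarrow> (\<integral>x. G' x e \<partial>lborel)"
  proof (rule integral_dominated_convergence[where w = "\<lambda>x. indicator (cball 0 (R + norm e)) x *\<^sub>R B"])
    show "(\<lambda>x. G' x e) \<in> borel_measurable lborel"
      using borel_measurable_continuous_onI[OF G'] by simp
    show "AE x in lborel. (\<lambda>n. (G (x + t n *\<^sub>R e) - G x) / t n) \<longlonglongrightarrow> G' x e"
    proof (rule AE_I2)
      fix x
      have "((\<lambda>s. (G (x + s *\<^sub>R e) - G x) / s) \<longlongrightarrow> G' x e) (at 0)"
        using der[of x 0] unfolding has_field_derivative_iff by simp
      then show "(\<lambda>n. (G (x + t n *\<^sub>R e) - G x) / t n) \<longlonglongrightarrow> G' x e"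
        using tlim t unfolding tendsto_at_iff_sequentially by (auto simp: o_def less_imp_neq[symmetric] order.strict_implies_not_eq dest!: spec[of _ t])
    qed
    show "AE x in lborel. norm ((G (x + t n *\<^sub>R e) - G x) / t n) \<le> indicator (cball 0 (R + norm e)) x *\<^sub>R B" for n
    proof (rule AE_I2)
      fix x :: 'a
      have tn: "norm (t n *\<^sub>R e) \<le> norm e" using t[of n] by (simp add: mult_left_le_one_le)
      show "norm ((G (x + t n *\<^sub>R e) - G x) / t n) \<le> indicator (cball 0 (R + norm e)) x *\<^sub>R B"
      proof (cases "norm x \<le> R + norm e")
        case True
        have "norm (G (x + t n *\<^sub>R e) - G (x + 0 *\<^sub>R e)) \<le> B * norm (t n - 0)"
        proof (rule field_differentiable_bound[where S = "{0..1}" and f = "\<lambda>s. G (x + s *\<^sub>R e)"])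
          fix s :: real assume s: "s \<in> {0..1}"
          then have "norm (s *\<^sub>R e) \<le> norm e" by (simp add: mult_left_le_one_le)
          then have "norm (x + s *\<^sub>R e) \<le> R + 2 * norm e" using True norm_triangle_ineq[of x "s *\<^sub>R e"] by linarith
          then show "norm (G' (x + s *\<^sub>R e) e) \<le> B" using B by simp
        qed (use t der in \<open>auto intro: has_field_derivative_at_within simp: less_imp_le\<close>)
        then show ?thesis using True t[of n] by (simp add: divide_simps)
      next
        case False
        then have "norm (x + t n *\<^sub>R e) > R" using norm_triangle_ineq2[of x "- (t n *\<^sub>R e)"] tn by simp
        moreover have "norm x > R" using False norm_ge_zero[of e] by linarith
        ultimately show ?thesis using False supp by simp
      qed
    qed
    show "integrable lborel (\<lambda>x. indicator (cball (0::'a) (R + norm e)) x *\<^sub>R B)"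
      by (intro borel_integrable_compact) auto
  qed auto
  moreover have "(\<integral>x. (G (x + t n *\<^sub>R e) - G x) / t n \<partial>lborel) = 0" for n
  proof -
    have i2: "integrable lborel (\<lambda>x. G (x + t n *\<^sub>R e))"
    proof (rule integrable_continuous_compact_support[where R = "R + norm (t n *\<^sub>R e)"])
      show "continuous_on UNIV (\<lambda>x. G (x + t n *\<^sub>R e))"
        by (rule continuous_on_compose2[OF contG]) (auto intro!: continuous_intros)
      fix x :: 'a assume "norm x > R + norm (t n *\<^sub>R e)"
      then have "norm (x + t n *\<^sub>R e) > R" using norm_triangle_ineq2[of x "- (t n *\<^sub>R e)"] by simp
      then show "G (x + t n *\<^sub>R e) = 0" by (rule supp)
    qed
    have "(\<integral>x. G (x + t n *\<^sub>R e) \<partial>lborel) = (\<integral>x. G x \<partial>lborel)"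
      using integral_lborel_translate[of G "t n *\<^sub>R e"] by (simp add: add.commute)
    then show ?thesis using intG i2 by simp
  qed
  ultimately have "(\<lambda>n::nat. 0::real) \<longlonglongrightarrow> (\<integral>x. G' x e \<partial>lborel)" by (simp only:)
  then show ?thesis by (simp add: LIMSEQ_const_iff)
qed

lemma integrable_convolution:
  fixes u :: "'a::euclidean_space \<Rightarrow> real" and k :: "'a \<Rightarrow> 'v::euclidean_space"
  assumes u: "integrable lborel u" and k: "continuous_on UNIV k" and B: "\<And>z. norm (k z) \<le> B"
  shows "integrable lborel (\<lambda>z. u z *\<^sub>R k (x - z))"
proof (rule Bochner_Integration.integrable_bound[where f = "\<lambda>z. B * norm (u z)"])
  show "integrable lborel (\<lambda>z. B * norm (u z))" using u by simp
  have "continuous_on UNIV (\<lambda>z. k (x - z))"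
    by (rule continuous_on_compose2[OF k]) (auto intro!: continuous_intros)
  then have "(\<lambda>z. k (x - z)) \<in> borel_measurable lborel"
    by (simp add: borel_measurable_continuous_onI)
  then show "(\<lambda>z. u z *\<^sub>R k (x - z)) \<in> borel_measurable lborel"
    using borel_measurable_integrable[OF u] by simp
  show "AE z in lborel. norm (u z *\<^sub>R k (x - z)) \<le> norm (B * norm (u z))"
  proof (rule AE_I2)
    fix z
    have "\<bar>u z\<bar> * norm (k (x - z)) \<le> \<bar>u z\<bar> * \<bar>B\<bar>" using B[of "x - z"] by (intro mult_left_mono) auto
    then show "norm (u z *\<^sub>R k (x - z)) \<le> norm (B * norm (u z))" by (simp add: abs_mult mult.commute)
  qed
qed

lemma continuous_on_convolution:
  fixes u :: "'a::euclidean_space \<Rightarrow> real" and k :: "'a \<Rightarrow> 'v::euclidean_space"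
  assumes u: "integrable lborel u" and k: "continuous_on UNIV k" and B: "\<And>z. norm (k z) \<le> B"
  shows "continuous_on UNIV (\<lambda>x. \<integral>z. u z *\<^sub>R k (x - z) \<partial>lborel)"
  unfolding continuous_on_sequentially
proof (intro ballI allI impI, elim conjE)
  fix x :: 'a and X assume lim: "X \<longlonglongrightarrow> x"
  have "(\<lambda>n. \<integral>z. u z *\<^sub>R k (X n - z) \<partial>lborel) \<longlonglongrightarrow> (\<integral>z. u z *\<^sub>R k (x - z) \<partial>lborel)"
  proof (rule integral_dominated_convergence[where w = "\<lambda>z. \<bar>B\<bar> * norm (u z)"])
    show "AE z in lborel. (\<lambda>n. u z *\<^sub>R k (X n - z)) \<longlonglongrightarrow> u z *\<^sub>R k (x - z)"
      using k lim by (intro AE_I2 tendsto_scaleR tendsto_const continuous_on_tendsto_compose[OF k] tendsto_diff) auto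
    show "AE z in lborel. norm (u z *\<^sub>R k (X n - z)) \<le> \<bar>B\<bar> * norm (u z)" for n
    proof (rule AE_I2)
      fix z
      have "\<bar>u z\<bar> * norm (k (X n - z)) \<le> \<bar>u z\<bar> * \<bar>B\<bar>" using B[of "X n - z"] by (intro mult_left_mono) auto
      then show "norm (u z *\<^sub>R k (X n - z)) \<le> \<bar>B\<bar> * norm (u z)" by (simp add: mult.commute)
    qed
  qed (use u integrable_convolution[OF u k B] in auto)
  then show "((\<lambda>x. \<integral>z. u z *\<^sub>R k (x - z) \<partial>lborel) \<circ> X) \<longlonglongrightarrow> (\<integral>z. u z *\<^sub>R k (x - z) \<partial>lborel)"
    by (simp add: o_def)
qed

text \<open>A bound on \<open>k'\<close> makes \<open>k\<close> Lipschitz with constant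
  \<open>B\<close>, so the remainder quotient at z is at most 2 * B * |u z|, which is integrable.
  All smoothness is carried by \<open>k\<close>, so \<open>u\<close> may be a function cut off to a
  ball.\<close>

lemma has_derivative_convolution:
  fixes u :: "'a::euclidean_space \<Rightarrow> real" and k :: "'a \<Rightarrow> 'v::euclidean_space"
  assumes u: "integrable lborel u" and k: "\<And>z. (k has_derivative k' z) (at z)" and B0: "\<And>z. norm (k z) \<le> B0"
    and B: "\<And>z h. norm (k' z h) \<le> B * norm h" and k': "\<And>h. continuous_on UNIV (\<lambda>z. k' z h)"
  shows "((\<lambda>x. \<integral>z. u z *\<^sub>R k (x - z) \<partial>lborel) has_derivative (\<lambda>h. \<integral>z. u z *\<^sub>R k' (x - z) h \<partial>lborel)) (at x)"
proof -
  have contk: "continuous_on UNIV k"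
    using k by (intro has_derivative_continuous_on[of UNIV k k']) auto
  have ik: "integrable lborel (\<lambda>z. u z *\<^sub>R k (x - z))" for x
    by (rule integrable_convolution[OF u contk B0])
  have ik': "integrable lborel (\<lambda>z. u z *\<^sub>R k' (x - z) h)" for x h
    by (rule integrable_convolution[OF u k' B])
  have lin: "k' z (a + b) = k' z a + k' z b" "k' z (r *\<^sub>R a) = r *\<^sub>R k' z a" for z a b r
    using bounded_linear.linear[OF has_derivative_bounded_linear[OF k[of z]]]
    by (auto simp: linear_add linear_cmul)
  have Bpos: "0 \<le> B"
  proof -
    obtain b :: 'a where "b \<in> Basis" by (meson nonempty_Basis ex_in_conv)
    then show ?thesis using B[of 0 b] norm_ge_zero[of "k' 0 b"] by simp (meson order_trans norm_ge_zero)
  qed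
  let ?L = "\<lambda>h. \<integral>z. u z *\<^sub>R k' (x - z) h \<partial>lborel"
  have bl: "bounded_linear ?L"
  proof (rule bounded_linear_intro[where K = "B * (\<integral>z. \<bar>u z\<bar> \<partial>lborel)"])
    show "?L (a + b) = ?L a + ?L b" for a b
      by (simp add: lin scaleR_add_right ik')
    show "?L (r *\<^sub>R a) = r *\<^sub>R ?L a" for r a
    proof -
      have "?L (r *\<^sub>R a) = (\<integral>z. r *\<^sub>R (u z *\<^sub>R k' (x - z) a) \<partial>lborel)" by (simp add: lin mult.commute)
      also have "\<dots> = r *\<^sub>R ?L a" by (rule integral_scaleR_right)
      finally show ?thesis .
    qed
    fix h
    have "norm (?L h) \<le> (\<integral>z. norm (u z *\<^sub>R k' (x - z) h) \<partial>lborel)" by (rule integral_norm_bound)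
    also have "\<dots> \<le> (\<integral>z. \<bar>u z\<bar> * (B * norm h) \<partial>lborel)"
    proof (rule integral_mono)
      show "integrable lborel (\<lambda>z. norm (u z *\<^sub>R k' (x - z) h))" by (rule integrable_norm[OF ik'])
      show "integrable lborel (\<lambda>z. \<bar>u z\<bar> * (B * norm h))" using u by (intro integrable_mult_left integrable_abs)
    qed (simp add: B mult_left_mono)
    also have "\<dots> = norm h * (B * (\<integral>z. \<bar>u z\<bar> \<partial>lborel))" by (simp add: mult_ac)
    finally show "norm (?L h) \<le> norm h * (B * (\<integral>z. \<bar>u z\<bar> \<partial>lborel))" .
  qed
  have bd: "norm (k (z + h) - k z) \<le> B * norm h" for z h
  proof -
    have "norm (k (z + h) - k z) \<le> B * norm (z + h - z)"
    proof (rule differentiable_bound[where S = UNIV and f' = k'])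
      show "onorm (k' y) \<le> B" for y by (rule onorm_bound[OF Bpos B])
    qed (use k in auto)
    then show ?thesis by simp
  qed
  let ?Q = "\<lambda>h z. u z *\<^sub>R ((1 / norm h) *\<^sub>R (k (x - z + h) - (k (x - z) + k' (x - z) h)))"
  show ?thesis
    unfolding has_derivative_at2
  proof (intro conjI bl)
    show "((\<lambda>y. (1 / norm (y - x)) *\<^sub>R ((\<integral>z. u z *\<^sub>R k (y - z) \<partial>lborel) - ((\<integral>z. u z *\<^sub>R k (x - z) \<partial>lborel) + ?L (y - x)))) \<longlongrightarrow> 0) (at x)"
      unfolding tendsto_at_iff_sequentially
    proof (intro allI impI)
      fix X assume X: "\<forall>i. X i \<in> UNIV - {x}" and lim: "X \<longlonglongrightarrow> x"
      have eq: "u z *\<^sub>R (k (X n - z) - (k (x - z) + k' (x - z) (X n - x))) = u z *\<^sub>R k (X n - z) - (u z *\<^sub>R k (x - z) + u z *\<^sub>R k' (x - z) (X n - x))" for z n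
        by (simp add: algebra_simps)
      have "(\<lambda>n. \<integral>z. ?Q (X n - x) z \<partial>lborel) \<longlonglongrightarrow> (\<integral>z. 0 \<partial>(lborel :: 'a measure))"
      proof (rule integral_dominated_convergence[where w = "\<lambda>z. 2 * B * norm (u z)"])
        show "AE z in lborel. (\<lambda>n. ?Q (X n - x) z) \<longlonglongrightarrow> 0"
        proof (rule AE_I2)
          fix z
          have "((\<lambda>y. (1 / norm (y - (x - z))) *\<^sub>R (k y - (k (x - z) + k' (x - z) (y - (x - z))))) \<longlongrightarrow> 0) (at (x - z))"
            using k[of "x - z"] unfolding has_derivative_at2 by simp
          moreover have "(\<lambda>n. X n - z) \<longlonglongrightarrow> x - z" using lim by (intro tendsto_intros)
          ultimately have "(\<lambda>n. (1 / norm (X n - z - (x - z))) *\<^sub>R (k (X n - z) - (k (x - z) + k' (x - z) (X n - z - (x - z))))) \<longlonglongrightarrow> 0"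
            using X unfolding tendsto_at_iff_sequentially by (auto simp: o_def dest!: spec[of _ "\<lambda>n. X n - z"])
          from tendsto_scaleR[OF tendsto_const[of "u z"] this] show "(\<lambda>n. ?Q (X n - x) z) \<longlonglongrightarrow> 0"
            by (simp add: algebra_simps)
        qed
        show "AE z in lborel. norm (?Q (X n - x) z) \<le> 2 * B * norm (u z)" for n
        proof (rule AE_I2)
          fix z
          have "norm (k (x - z + (X n - x)) - (k (x - z) + k' (x - z) (X n - x))) \<le> B * norm (X n - x) + B * norm (X n - x)"
            using norm_triangle_ineq4[of "k (x - z + (X n - x)) - k (x - z)" "k' (x - z) (X n - x)"] bd[of "x - z" "X n - x"] B[of "x - z" "X n - x"]
            by (simp add: algebra_simps)
          then have "norm ((1 / norm (X n - x)) *\<^sub>R (k (x - z + (X n - x)) - (k (x - z) + k' (x - z) (X n - x)))) \<le> 2 * B"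
            using X by (simp add: divide_simps)
          then have "\<bar>u z\<bar> * norm ((1 / norm (X n - x)) *\<^sub>R (k (x - z + (X n - x)) - (k (x - z) + k' (x - z) (X n - x)))) \<le> \<bar>u z\<bar> * (2 * B)"
            by (rule mult_left_mono) auto
          then show "norm (?Q (X n - x) z) \<le> 2 * B * norm (u z)" by (simp add: mult_ac)
        qed
        show "(\<lambda>z. ?Q (X n - x) z) \<in> borel_measurable lborel" for n
        proof -
          have "(\<lambda>z. (1 / norm (X n - x)) *\<^sub>R (u z *\<^sub>R (k (X n - z) - (k (x - z) + k' (x - z) (X n - x))))) \<in> borel_measurable lborel"
            unfolding eq by (intro borel_measurable_scaleR[OF borel_measurable_const] borel_measurable_diff borel_measurable_add borel_measurable_integrable ik ik')
          then show ?thesis by (simp add: scaleR_left_commute)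
        qed
        show "integrable lborel (\<lambda>z. 2 * B * norm (u z))" using u by simp
      qed auto
      moreover have "(\<integral>z. ?Q (X n - x) z \<partial>lborel) = (1 / norm (X n - x)) *\<^sub>R ((\<integral>z. u z *\<^sub>R k (X n - z) \<partial>lborel) - ((\<integral>z. u z *\<^sub>R k (x - z) \<partial>lborel) + ?L (X n - x)))" for n
      proof -
        have "(\<integral>z. ?Q (X n - x) z \<partial>lborel) = (\<integral>z. (1 / norm (X n - x)) *\<^sub>R (u z *\<^sub>R (k (X n - z) - (k (x - z) + k' (x - z) (X n - x)))) \<partial>lborel)"
          by (simp add: scaleR_left_commute)
        also have "\<dots> = (1 / norm (X n - x)) *\<^sub>R (\<integral>z. u z *\<^sub>R k (X n - z) - (u z *\<^sub>R k (x - z) + u z *\<^sub>R k' (x - z) (X n - x)) \<partial>lborel)"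
          unfolding eq by (rule integral_scaleR_right)
        also have "(\<integral>z. u z *\<^sub>R k (X n - z) - (u z *\<^sub>R k (x - z) + u z *\<^sub>R k' (x - z) (X n - x)) \<partial>lborel)
          = (\<integral>z. u z *\<^sub>R k (X n - z) \<partial>lborel) - ((\<integral>z. u z *\<^sub>R k (x - z) \<partial>lborel) + ?L (X n - x))"
          by (simp add: ik ik')
        finally show ?thesis .
      qed
      ultimately show "((\<lambda>y. (1 / norm (y - x)) *\<^sub>R ((\<integral>z. u z *\<^sub>R k (y - z) \<partial>lborel) - ((\<integral>z. u z *\<^sub>R k (x - z) \<partial>lborel) + ?L (y - x)))) \<circ> X) \<longlonglongrightarrow> 0"
        by (simp add: o_def)
    qed
  qed
qed

section \<open>Green's formula and the mean value property\<close>

text \<open>Real harmonic functions with the gradient as a vector field \<open>g\<close> and the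
  Hessian as the derivative \<open>J\<close> of \<open>g\<close>. With inner products in place of
  bounded linear maps, product rules and traces become plain algebra.\<close>

definition harmonic_grad :: "'a::euclidean_space set \<Rightarrow> ('a \<Rightarrow> real) \<Rightarrow> ('a \<Rightarrow> 'a) \<Rightarrow> ('a \<Rightarrow> 'a \<Rightarrow> 'a) \<Rightarrow> bool" where
  "harmonic_grad S f g J \<longleftrightarrow>
     (\<forall>x\<in>S. (f has_derivative (\<lambda>h. g x \<bullet> h)) (at x)) \<and>
     (\<forall>x\<in>S. (g has_derivative J x) (at x)) \<and>
     (\<forall>i\<in>Basis. continuous_on S (\<lambda>x. J x i)) \<and>
     (\<forall>x\<in>S. (\<Sum>i\<in>Basis. J x i \<bullet> i) = 0)"

lemma harmonic_on_imp_grad: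
  fixes f :: "'a::euclidean_space \<Rightarrow> real"
  assumes "harmonic_on S f"
  obtains g J where "harmonic_grad S f g J"
proof -
  obtain f' :: "'a \<Rightarrow> 'a \<Rightarrow>\<^sub>L real" and f'' :: "'a \<Rightarrow> 'a \<Rightarrow>\<^sub>L 'a \<Rightarrow>\<^sub>L real"
    where f': "\<And>x. x \<in> S \<Longrightarrow> (f has_derivative blinfun_apply (f' x)) (at x)"
      and f'': "\<And>x. x \<in> S \<Longrightarrow> (f' has_derivative blinfun_apply (f'' x)) (at x)"
      and cont: "continuous_on S f''"
      and tr: "\<And>x. x \<in> S \<Longrightarrow> (\<Sum>i\<in>Basis. blinfun_apply (blinfun_apply (f'' x) i) i) = 0"
    using assms unfolding harmonic_on_def by blast
  define g where "g x = (\<Sum>i\<in>Basis. blinfun_apply (f' x) i *\<^sub>R i)" for x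
  define J where "J x h = (\<Sum>i\<in>Basis. blinfun_apply (blinfun_apply (f'' x) h) i *\<^sub>R i)" for x h
  have eq: "blinfun_apply (f' x) = (\<lambda>h. g x \<bullet> h)" for x
  proof
    fix h
    have "blinfun_apply (f' x) h = blinfun_apply (f' x) (\<Sum>i\<in>Basis. (h \<bullet> i) *\<^sub>R i)"
      by (simp add: euclidean_representation)
    also have "\<dots> = g x \<bullet> h"
      unfolding g_def inner_sum_left by (simp add: blinfun.sum_right blinfun.scaleR_right inner_commute[of h] mult.commute)
    finally show "blinfun_apply (f' x) h = g x \<bullet> h" .
  qed
  have "(f has_derivative (\<lambda>h. g x \<bullet> h)) (at x)" if "x \<in> S" for x
    using f'[OF that] by (simp only: eq)
  moreover have "(g has_derivative J x) (at x)" if "x \<in> S" for x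
    unfolding g_def J_def
    by (intro has_derivative_sum has_derivative_scaleR_left bounded_linear.has_derivative[OF blinfun.bounded_linear_left] f'' that)
  moreover have "continuous_on S (\<lambda>x. J x i)" for i
    unfolding J_def by (intro continuous_intros cont)
  moreover have "(\<Sum>i\<in>Basis. J x i \<bullet> i) = 0" if "x \<in> S" for x
    using tr[OF that] by (simp add: J_def inner_sum_left inner_Basis if_distrib sum.delta cong: if_cong sum.cong)
  ultimately have "harmonic_grad S f g J"
    unfolding harmonic_grad_def by blast
  then show ?thesis by (rule that)
qed

lemma harmonic_on_grad:
  fixes f :: "'a::euclidean_space \<Rightarrow> real"
  assumes "harmonic_grad S f g J"
  shows "harmonic_on S f"
proof -
  let ?L = "blinfun_inner_right :: 'a \<Rightarrow> 'a \<Rightarrow>\<^sub>L real"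
  have f: "\<And>x. x \<in> S \<Longrightarrow> (f has_derivative (\<lambda>h. g x \<bullet> h)) (at x)"
    and g: "\<And>x. x \<in> S \<Longrightarrow> (g has_derivative J x) (at x)"
    and cont: "\<And>i. i \<in> Basis \<Longrightarrow> continuous_on S (\<lambda>x. J x i)"
    and tr: "\<And>x. x \<in> S \<Longrightarrow> (\<Sum>i\<in>Basis. J x i \<bullet> i) = 0"
    using assms by (auto simp: harmonic_grad_def)
  define f'' where "f'' x = Blinfun (\<lambda>h. ?L (J x h))" for x
  have f'': "blinfun_apply (f'' x) = (\<lambda>h. ?L (J x h))" if "x \<in> S" for x
    unfolding f''_def
    by (intro bounded_linear_Blinfun_apply bounded_linear_compose[OF bounded_linear_blinfun_inner_right]
        has_derivative_bounded_linear[OF g[OF that]])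
  show ?thesis
    unfolding harmonic_on_def
  proof (intro exI conjI ballI)
    fix x assume x: "x \<in> S"
    show "(f has_derivative blinfun_apply (?L (g x))) (at x)" using f[OF x] by (simp add: blinfun_inner_right.rep_eq)
    show "((\<lambda>x. ?L (g x)) has_derivative blinfun_apply (f'' x)) (at x)"
      unfolding f''[OF x] by (rule bounded_linear.has_derivative[OF bounded_linear_blinfun_inner_right g[OF x]])
    show "(\<Sum>i\<in>Basis. blinfun_apply (blinfun_apply (f'' x) i) i) = 0"
      using tr[OF x] by (simp add: f''[OF x])
  next
    show "continuous_on S f''"
    proof (rule continuous_on_blinfun_componentwise)
      fix i :: 'a assume "i \<in> Basis"
      then have "continuous_on S (\<lambda>x. ?L (J x i))"
        by (intro bounded_linear.continuous_on[OF bounded_linear_blinfun_inner_right] cont)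
      then show "continuous_on S (\<lambda>x. blinfun_apply (f'' x) i)"
        by (rule continuous_on_eq) (simp add: f'')
    qed
  qed
qed

lemma harmonic_grad_continuous:
  assumes "harmonic_grad S f g J"
  shows "continuous_on S f" "continuous_on S g"
proof -
  show "continuous_on S f"
    by (rule has_derivative_continuous_on[of S f "\<lambda>x h. g x \<bullet> h"])
       (use assms in \<open>auto simp: harmonic_grad_def intro: has_derivative_at_withinI\<close>)
  show "continuous_on S g"
    by (rule has_derivative_continuous_on[of S g J])
       (use assms in \<open>auto simp: harmonic_grad_def intro: has_derivative_at_withinI\<close>)
qed

lemma less_inner_self_outside_ball:
  fixes x :: "'a::real_inner"
  assumes "x \<notin> ball 0 1" "s < 1"
  shows "s < x \<bullet> x"
proof -
  have "1 \<le> (norm x)^2" using assms(1) by (intro one_le_power) auto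
  then show ?thesis using assms(2) unfolding dot_square_norm by linarith
qed

text \<open>The ball and the open set where s1 < |x|^2 cover the space, and \<open>F\<close>
  vanishes on their overlap, so two continuous pieces are glued.\<close>

lemma continuous_on_ball_extend_zero:
  fixes F :: "'a::euclidean_space \<Rightarrow> 'b::real_normed_vector"
  assumes F: "continuous_on (ball 0 1) F" and z: "\<And>x. x \<in> ball 0 1 \<Longrightarrow> s1 < x \<bullet> x \<Longrightarrow> F x = 0" and s1: "s1 < 1"
  shows "continuous_on UNIV (\<lambda>x. if x \<in> ball 0 1 then F x else 0)"
proof -
  let ?F = "\<lambda>x. if x \<in> ball 0 1 then F x else 0"
  have "continuous_on (ball 0 1 \<union> {x. s1 < x \<bullet> x}) ?F"
  proof (rule continuous_on_open_Un)
    show "open {x::'a. s1 < x \<bullet> x}" by (intro open_Collect_less continuous_intros)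
    show "continuous_on (ball 0 1) ?F" by (rule continuous_on_eq[OF F]) simp
    show "continuous_on {x. s1 < x \<bullet> x} ?F"
      by (rule continuous_on_eq[OF continuous_on_const[of _ 0]]) (auto simp: z)
  qed auto
  moreover have "ball 0 1 \<union> {x::'a. s1 < x \<bullet> x} = UNIV"
    using less_inner_self_outside_ball[OF _ s1] by blast
  ultimately show ?thesis by simp
qed

text \<open>
  \<open>F\<close> is the divergence of \<open>\<eta>(|x|\<^sup>2) (h \<nabla>f - f \<nabla>h)\<close>. Using a radial cutoff \<open>\<eta>\<close> replaces the boundary
  integral of Green's formula by an integral over the ball.
\<close>

lemma harmonic_Green:
  fixes f h :: "'a::euclidean_space \<Rightarrow> real"
  assumes f: "harmonic_grad (ball 0 1) f gf Jf" and h: "harmonic_grad (ball 0 1) h gh Jh"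
    and \<eta>: "\<And>s. -1 < s \<Longrightarrow> s < 1 \<Longrightarrow> (\<eta> has_real_derivative \<eta>' s) (at s)" and \<eta>': "continuous_on UNIV \<eta>'"
    and z: "\<And>s. s1 \<le> s \<Longrightarrow> s < 1 \<Longrightarrow> \<eta> s = 0" "\<And>s. s1 \<le> s \<Longrightarrow> s < 1 \<Longrightarrow> \<eta>' s = 0" and s1: "0 < s1" "s1 < 1"
  defines "F \<equiv> \<lambda>x. if x \<in> ball 0 1 then 2 * \<eta>' (x \<bullet> x) * (h x * (gf x \<bullet> x) - f x * (gh x \<bullet> x)) else 0"
  shows "continuous_on UNIV F" "(\<integral>x. F x \<partial>lborel) = 0"
proof -
  let ?B = "ball (0::'a) 1"
  have df: "\<And>x. x \<in> ?B \<Longrightarrow> (f has_derivative (\<lambda>v. gf x \<bullet> v)) (at x)" "\<And>x. x \<in> ?B \<Longrightarrow> (gf has_derivative Jf x) (at x)"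
    and cJf: "\<And>i. i \<in> Basis \<Longrightarrow> continuous_on ?B (\<lambda>x. Jf x i)"
    and tf: "\<And>x. x \<in> ?B \<Longrightarrow> (\<Sum>i\<in>Basis. Jf x i \<bullet> i) = 0"
    using f by (auto simp: harmonic_grad_def)
  have dh: "\<And>x. x \<in> ?B \<Longrightarrow> (h has_derivative (\<lambda>v. gh x \<bullet> v)) (at x)" "\<And>x. x \<in> ?B \<Longrightarrow> (gh has_derivative Jh x) (at x)"
    and cJh: "\<And>i. i \<in> Basis \<Longrightarrow> continuous_on ?B (\<lambda>x. Jh x i)"
    and th: "\<And>x. x \<in> ?B \<Longrightarrow> (\<Sum>i\<in>Basis. Jh x i \<bullet> i) = 0"
    using h by (auto simp: harmonic_grad_def)
  note cf = harmonic_grad_continuous[OF f] and ch = harmonic_grad_continuous[OF h]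
  have xx: "-1 < x \<bullet> x" "x \<bullet> x < 1" if "x \<in> ?B" for x :: 'a
  proof -
    show "-1 < x \<bullet> x" using inner_ge_zero[of x] by linarith
    show "x \<bullet> x < 1" using that power_strict_mono[of "norm x" 1 2] by (auto simp: dot_square_norm)
  qed
  have c\<eta>: "continuous_on ?B (\<lambda>x. \<eta> (x \<bullet> x))"
  proof (rule continuous_on_compose2[of "{-1<..<1}" \<eta>])
    show "continuous_on {-1<..<1} \<eta>"
      using \<eta> by (intro DERIV_continuous_on[of _ \<eta> \<eta>']) (auto intro: has_field_derivative_at_within)
    show "(\<lambda>x. x \<bullet> x) ` ?B \<subseteq> {-1<..<1}" using xx by (auto simp del: inner_ge_zero mem_ball_0)
  qed (intro continuous_intros)
  have c\<eta>': "continuous_on ?B (\<lambda>x. \<eta>' (x \<bullet> x))"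
    by (rule continuous_on_compose2[OF \<eta>']) (auto intro!: continuous_intros)
  show contF: "continuous_on UNIV F"
    unfolding F_def using s1(2)
  proof (rule continuous_on_ball_extend_zero[rotated 2])
    show "continuous_on ?B (\<lambda>x. 2 * \<eta>' (x \<bullet> x) * (h x * (gf x \<bullet> x) - f x * (gh x \<bullet> x)))"
      by (intro continuous_intros c\<eta>' cf ch)
  qed (use z(2) xx in \<open>auto simp: less_imp_le\<close>)
  \<comment> \<open>The components of the vector field, extended by zero across the sphere. The
    cutoff vanishes near the sphere, so the extension is differentiable everywhere.\<close>
  define G where "G i x = (if x \<in> ?B then \<eta> (x \<bullet> x) * (h x * (gf x \<bullet> i) - f x * (gh x \<bullet> i)) else 0)" for i x
  define G' where "G' i x v = (if x \<in> ?B then 2 * \<eta>' (x \<bullet> x) * (x \<bullet> v) * (h x * (gf x \<bullet> i) - f x * (gh x \<bullet> i))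
     + \<eta> (x \<bullet> x) * ((gh x \<bullet> v) * (gf x \<bullet> i) + h x * (Jf x v \<bullet> i) - (gf x \<bullet> v) * (gh x \<bullet> i) - f x * (Jh x v \<bullet> i)) else 0)" for i x v
  have Gder: "(G i has_derivative G' i x) (at x)" for i x
  proof (cases "x \<in> ?B")
    case True
    have "((\<lambda>x. \<eta> (x \<bullet> x)) has_derivative (\<lambda>v. (v \<bullet> x + x \<bullet> v) * \<eta>' (x \<bullet> x))) (at x)"
      using xx[OF True] by (intro DERIV_compose_FDERIV[OF \<eta>]) (auto intro!: derivative_eq_intros)
    then have "((\<lambda>x. \<eta> (x \<bullet> x) * (h x * (gf x \<bullet> i) - f x * (gh x \<bullet> i))) has_derivative G' i x) (at x)"
      using True unfolding G'_def
      by (auto intro!: derivative_eq_intros df dh simp: inner_commute algebra_simps fun_eq_iff)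
    then show ?thesis
      by (rule has_derivative_transform_within_open[of _ _ _ _ ?B]) (use True in \<open>auto simp: G_def\<close>)
  next
    case False
    have "s1 < x \<bullet> x"
      using False s1(2) by (rule less_inner_self_outside_ball)
    have "((\<lambda>_. 0) has_derivative (\<lambda>_. 0)) (at x)" by simp
    then have "(G i has_derivative (\<lambda>_. 0)) (at x)"
    proof (rule has_derivative_transform_within_open[of _ _ _ _ "{x. s1 < x \<bullet> x}"])
      show "open {x::'a. s1 < x \<bullet> x}" by (intro open_Collect_less continuous_intros)
    qed (use \<open>s1 < x \<bullet> x\<close> z(1) xx in \<open>auto simp: G_def less_imp_le\<close>)
    moreover have "G' i x = (\<lambda>_. 0)" using False by (auto simp: G'_def)
    ultimately show ?thesis by simp
  qed
  have contG': "continuous_on UNIV (\<lambda>x. G' i x i)" if i: "i \<in> Basis" for i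
    unfolding G'_def using s1(2)
  proof (rule continuous_on_ball_extend_zero[rotated 2])
    show "continuous_on ?B (\<lambda>x. 2 * \<eta>' (x \<bullet> x) * (x \<bullet> i) * (h x * (gf x \<bullet> i) - f x * (gh x \<bullet> i))
       + \<eta> (x \<bullet> x) * ((gh x \<bullet> i) * (gf x \<bullet> i) + h x * (Jf x i \<bullet> i) - (gf x \<bullet> i) * (gh x \<bullet> i) - f x * (Jh x i \<bullet> i)))"
      by (intro continuous_intros c\<eta> c\<eta>' cf ch cJf cJh i)
  qed (use z xx in \<open>auto simp: less_imp_le\<close>)
  have zG: "G i x = 0" "norm x > 1 \<Longrightarrow> G' i x v = 0" if "norm x > 1" for i x v
    using that by (auto simp: G_def G'_def)
  have "(\<integral>x. (\<Sum>i\<in>Basis. G' i x i) \<partial>lborel) = (\<Sum>i\<in>Basis. \<integral>x. G' i x i \<partial>lborel)"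
    by (rule Bochner_Integration.integral_sum)
       (use zG contG' in \<open>auto intro!: integrable_continuous_compact_support[where R = 1]\<close>)
  also have "\<dots> = 0"
    using integral_directional_derivative_zero[OF Gder contG' zG(1)] by (intro sum.neutral ballI) blast
  also have "(\<lambda>x. \<Sum>i\<in>Basis. G' i x i) = F"
  proof
    fix x
    show "(\<Sum>i\<in>Basis. G' i x i) = F x"
    proof (cases "x \<in> ?B")
      case True
      have e: "(\<Sum>i\<in>Basis. (a \<bullet> i) * (b \<bullet> i)) = a \<bullet> b" for a b :: 'a by (rule euclidean_inner[symmetric])
      \<comment> \<open>The two mixed products of gradients have already cancelled, and the traces
        of the Hessians will vanish; only the terms with the derivative of the cutoff
        survive.\<close>
      have "(\<Sum>i\<in>Basis. G' i x i) = (\<Sum>i\<in>Basis. 2 * \<eta>' (x \<bullet> x) * h x * ((gf x \<bullet> i) * (x \<bullet> i)) - 2 * \<eta>' (x \<bullet> x) * f x * ((gh x \<bullet> i) * (x \<bullet> i))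
          + \<eta> (x \<bullet> x) * h x * (Jf x i \<bullet> i) - \<eta> (x \<bullet> x) * f x * (Jh x i \<bullet> i))"
        using True by (intro sum.cong) (auto simp: G'_def algebra_simps)
      also have "\<dots> = 2 * \<eta>' (x \<bullet> x) * h x * (gf x \<bullet> x) - 2 * \<eta>' (x \<bullet> x) * f x * (gh x \<bullet> x)"
        unfolding sum_subtractf sum.distrib sum_distrib_left[symmetric] e tf[OF True] th[OF True] by simp
      finally show ?thesis using True by (simp add: F_def algebra_simps)
    qed (simp add: F_def G'_def)
  qed
  finally show "(\<integral>x. F x \<partial>lborel) = 0" .
qed


text \<open>Euler's identity: t -> h (t x) is differentiated at t = 1 once by the chain rule and
  once as a power.\<close>

lemma homogeneous_gradient_inner:
  fixes h :: "'a::euclidean_space \<Rightarrow> real"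
  assumes hom: "\<And>t x. h (t *\<^sub>R x) = t ^ k * h x" and d: "(h has_derivative (\<lambda>v. g \<bullet> v)) (at x)"
  shows "g \<bullet> x = real k * h x"
proof -
  have "((\<lambda>t. h (t *\<^sub>R x)) has_derivative (\<lambda>t. g \<bullet> (t *\<^sub>R x))) (at (1::real))"
  proof (rule has_derivative_compose[where g = h])
    show "((\<lambda>t. t *\<^sub>R x) has_derivative (\<lambda>t. t *\<^sub>R x)) (at (1::real))"
      by (auto intro!: derivative_eq_intros)
  qed (simp add: d)
  then have "((\<lambda>t. h (t *\<^sub>R x)) has_real_derivative (g \<bullet> x)) (at 1)"
    by (simp add: has_field_derivative_def mult.commute[of _ "g \<bullet> x"])
  moreover have "((\<lambda>t. t ^ k * h x) has_real_derivative (real k * h x)) (at 1)"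
    by (auto intro!: derivative_eq_intros)
  ultimately show ?thesis unfolding hom by (rule DERIV_unique)
qed

section \<open>Radial dependence of spherical coefficients\<close>

lemma open_null_imp_empty:
  fixes U :: "'a::euclidean_space set"
  assumes "open U" "AE x in lborel. x \<notin> U"
  shows "U = {}"
proof (rule ccontr)
  assume "U \<noteq> {}"
  have "U \<in> null_sets lborel"
    using assms AE_iff_null_sets[of U lborel] by auto
  then have "negligible U"
    by (simp add: negligible_iff_null_sets null_sets_completionI)
  then show False using open_not_negligible[OF assms(1) \<open>U \<noteq> {}\<close>] by blast
qed

lemma continuous_on_scaleR_ball:
  fixes f :: "'a::euclidean_space \<Rightarrow> 'b::topological_space"
  assumes "continuous_on (ball 0 1) f"
  shows "continuous_on ({-1<..<1} \<times> sphere 0 1) (\<lambda>z. f (fst z *\<^sub>R snd z))"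
  by (rule continuous_on_compose2[OF assms]) (auto intro!: continuous_intros)

text \<open>
  If the integral were nonzero at some radius, then a cutoff \<open>\<eta>\<close> with \<open>\<eta>'\<close> proportional to it near
  that radius would contradict the vanishing of the integral in \<open>harmonic_Green\<close>.
\<close>

lemma harmonic_radial_integral_zero:
  fixes f h :: "'a::euclidean_space \<Rightarrow> real"
  assumes f: "harmonic_grad (ball 0 1) f gf Jf" and h: "harmonic_grad UNIV h gh Jh"
    and hom: "\<And>t x. h (t *\<^sub>R x) = t ^ k * h x" and r: "r \<in> {0<..<1}"
  shows "(\<integral>y. h y * (gf (r *\<^sub>R y) \<bullet> (r *\<^sub>R y) - real k * f (r *\<^sub>R y)) \<partial>surface_measure) = 0"
proof (rule ccontr)
  \<comment> \<open>Up to a power of the radius, \<open>A\<close> is the derivative of the spherical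
    coefficient divided by \<open>r ^ k\<close>.\<close>
  define A where "A r = (\<integral>y. h y * (gf (r *\<^sub>R y) \<bullet> (r *\<^sub>R y) - real k * f (r *\<^sub>R y)) \<partial>surface_measure)" for r
  assume "\<not> ?thesis"
  then have Ar: "A r \<noteq> 0" by (simp add: A_def)
  note cf = harmonic_grad_continuous[OF f]
  have ch: "continuous_on UNIV h" using harmonic_grad_continuous[OF h] by simp
  have hB: "harmonic_grad (ball 0 1) h gh Jh"
    using h unfolding harmonic_grad_def by (auto intro: continuous_on_subset)
  have Euler: "gh x \<bullet> x = real k * h x" for x
    by (rule homogeneous_gradient_inner[OF hom]) (use h in \<open>auto simp: harmonic_grad_def\<close>)
  have contA: "continuous_on {-1<..<1} A"
    unfolding A_def
  proof (rule continuous_on_integral_param[OF finite_surface_measure sets_surface_measure compact_sphere])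
    show "continuous_on ({-1<..<1} \<times> sphere 0 1)
       (\<lambda>z. h (snd z) * (gf (fst z *\<^sub>R snd z) \<bullet> (fst z *\<^sub>R snd z) - real k * f (fst z *\<^sub>R snd z)))"
      by (intro continuous_intros continuous_on_scaleR_ball cf continuous_on_compose2[OF ch]) auto
  qed
  \<comment> \<open>A window for the squared radius around \<open>r^2\<close>, compactly inside (0,
    1).\<close>
  define s0 s1 where "s0 = r^2 / 2" and "s1 = (1 + r^2) / 2"
  have r1: "r^2 < 1" "0 < r^2" using r by (auto simp: power_less_one_iff)
  have s: "0 < s0" "s0 < r^2" "r^2 < s1" "s1 < 1" using r1 by (auto simp: s0_def s1_def)
  define b where "b s = max 0 ((s - s0) * (s1 - s))" for s
  have b_pos: "s0 \<le> t \<and> t \<le> s1" if "b t \<noteq> 0" for t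
  proof -
    have "0 < b t" using that by (simp add: b_def)
    then have "0 < (t - s0) * (s1 - t)" by (simp add: b_def)
    then show ?thesis using s by (auto simp: zero_less_mult_iff)
  qed
  \<comment> \<open>\<open>w\<close> serves as the derivative of the cutoff. The factor
    \<open>A\<close> turns Green's integral over a sphere into \<open>b\<close> times the square of
    \<open>A\<close>, up to a power of the radius, hence nonnegative. Clamping to [s0, s1] keeps
    \<open>A\<close> where it is continuous and changes nothing where \<open>b\<close> is
    nonzero.\<close>
  define w where "w s = b s * A (sqrt (max s0 (min s1 s)))" for s
  have cl: "sqrt (max s0 (min s1 s)) \<in> {-1<..<1}" for s
    using s by (auto simp: less_max_iff_disj min_def max_def intro: less_le_trans[of _ 0] real_sqrt_ge_zero)
  have contAc: "continuous_on UNIV (\<lambda>s. A (sqrt (max s0 (min s1 s))))"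
    by (rule continuous_on_compose2[OF contA]) (use cl in \<open>auto intro!: continuous_intros simp del: greaterThanLessThan_iff\<close>)
  have contw: "continuous_on UNIV w"
    unfolding w_def b_def by (intro continuous_intros contAc)
  have w0: "w s = 0" if "s \<ge> s1" for s
  proof -
    have "(s - s0) * (s1 - s) \<le> 0" using that s by (intro mult_nonneg_nonpos) auto
    then show ?thesis by (simp add: w_def b_def)
  qed
  \<comment> \<open>The primitive of \<open>w\<close>, shifted so that it vanishes from s1
    on.\<close>
  define \<eta> where "\<eta> s = integral {-1..s} w - integral {-1..s1} w" for s
  have int: "w integrable_on {a..b}" for a b
    by (intro integrable_continuous_interval continuous_on_subset[OF contw]) auto
  have \<eta>: "(\<eta> has_real_derivative w s) (at s)" if "-1 < s" "s < 1" for s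
  proof -
    have "((\<lambda>x. integral {-1..x} w) has_real_derivative w s) (at s within {-1..1})"
      using that by (intro integral_has_real_derivative continuous_on_subset[OF contw]) auto
    then have "((\<lambda>x. integral {-1..x} w) has_real_derivative w s) (at s)"
      using that by (simp add: at_within_Icc_at)
    then show ?thesis unfolding \<eta>_def by (auto intro!: derivative_eq_intros)
  qed
  have \<eta>0: "\<eta> t = 0" if "s1 \<le> t" "t < 1" for t
  proof -
    have "integral {-1..s1} w + integral {s1..t} w = integral {-1..t} w"
      using that s by (intro Henstock_Kurzweil_Integration.integral_combine int) auto
    moreover have "integral {s1..t} w = 0"
      by (rule integral_unique, rule has_integral_is_0) (use w0 in auto)
    ultimately show ?thesis by (simp add: \<eta>_def)
  qed
  define F where "F x = (if x \<in> ball 0 1 then 2 * w (x \<bullet> x) * (h x * (gf x \<bullet> x) - f x * (gh x \<bullet> x)) else 0)" for x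
  have s10: "0 < s1" using s by linarith
  have contF: "continuous_on UNIV F" and intF: "(\<integral>x. F x \<partial>lborel) = 0"
    unfolding F_def by (rule harmonic_Green[OF f hB \<eta> contw \<eta>0 w0 s10 s(4)]; assumption)+
  have "bounded (F ` cball 0 1)"
    by (intro compact_imp_bounded compact_continuous_image continuous_on_subset[OF contF]) auto
  then obtain B where B: "\<And>x. norm x \<le> 1 \<Longrightarrow> \<bar>F x\<bar> \<le> B" unfolding bounded_iff by fastforce
  have B': "\<bar>F x\<bar> \<le> B" for x
    using B[of x] B[of 0] by (cases "norm x \<le> 1") (auto simp: F_def)
  have [measurable]: "F \<in> borel_measurable borel" by (rule borel_measurable_continuous_onI[OF contF])
  \<comment> \<open>The radial density of Green's integral. On (0, 1) it is continuous and
    nonnegative with integral zero, hence zero there, yet it would be positive at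
    \<open>r\<close>.\<close>
  define \<psi> where "\<psi> t = 2 * (t ^ (DIM('a) - 1) * t ^ k) * b (t^2) * (A (sqrt (max s0 (min s1 (t^2)))))^2" for t :: real
  have cont\<psi>: "continuous_on UNIV \<psi>"
  proof -
    have "continuous_on UNIV (\<lambda>t. A (sqrt (max s0 (min s1 (t^2)))))"
      by (rule continuous_on_compose2[OF contAc]) (auto intro!: continuous_intros)
    then show ?thesis unfolding \<psi>_def b_def by (intro continuous_intros)
  qed
  have eq: "indicator {0<..<1} t * (t ^ (DIM('a) - 1) * (\<integral>y. F (t *\<^sub>R y) \<partial>surface_measure)) = indicator {0<..<1} t * \<psi> t" for t :: real
  proof (cases "t \<in> {0<..<1}")
    case True
    have "(\<integral>y. F (t *\<^sub>R y) \<partial>surface_measure) = (\<integral>y. 2 * w (t^2) * t ^ k * (h y * (gf (t *\<^sub>R y) \<bullet> (t *\<^sub>R y) - real k * f (t *\<^sub>R y))) \<partial>surface_measure)"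
    proof (rule Bochner_Integration.integral_cong[OF refl])
      fix y :: 'a assume "y \<in> space surface_measure"
      then have y: "norm y = 1" by simp
      then have "y \<bullet> y = 1" by (simp add: dot_square_norm)
      then have "(t *\<^sub>R y) \<bullet> (t *\<^sub>R y) = t^2" by (simp add: power2_eq_square)
      then show "F (t *\<^sub>R y) = 2 * w (t^2) * t ^ k * (h y * (gf (t *\<^sub>R y) \<bullet> (t *\<^sub>R y) - real k * f (t *\<^sub>R y)))"
        using True y unfolding F_def Euler hom by (simp add: algebra_simps)
    qed
    also have "\<dots> = 2 * w (t^2) * t ^ k * A t" unfolding A_def by simp
    also have "w (t^2) * A t = b (t^2) * (A (sqrt (max s0 (min s1 (t^2)))))^2"
    proof (cases "b (t^2) = 0")
      case False
      then have "s0 \<le> t^2" "t^2 \<le> s1"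
        using b_pos[of "t^2"] by auto
      then have "sqrt (max s0 (min s1 (t^2))) = t" using True by simp
      then show ?thesis by (simp add: w_def power2_eq_square)
    qed (simp add: w_def)
    then have "2 * w (t^2) * t ^ k * A t = 2 * t ^ k * b (t^2) * (A (sqrt (max s0 (min s1 (t^2)))))^2"
      by (simp add: mult_ac)
    finally show ?thesis by (simp add: \<psi>_def mult_ac)
  qed simp
  have "0 = (\<integral>x. indicator (ball 0 1) x * F x \<partial>lborel)"
    unfolding intF[symmetric] by (rule Bochner_Integration.integral_cong) (auto simp: F_def)
  also have "\<dots> = (\<integral>t. indicator {0<..<1} t * \<psi> t \<partial>lborel)"
    by (subst integral_polar[OF _ B']) (simp_all only: eq, simp)
  finally have i0: "(\<integral>t. indicator {0<..<1} t * \<psi> t \<partial>lborel) = 0" by simp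
  have "integrable lborel (\<lambda>t. indicator {0<..<1} t * \<psi> t)"
  proof -
    have "integrable lborel (\<lambda>t. indicator {0..1} t *\<^sub>R \<psi> t)"
      by (rule borel_integrable_compact) (auto intro: continuous_on_subset[OF cont\<psi>])
    moreover have "AE t in lborel. indicator {0..1} t *\<^sub>R \<psi> t = indicator {0<..<1} t * \<psi> t"
      using AE_lborel_singleton[of "0::real"] AE_lborel_singleton[of "1::real"]
      by eventually_elim (auto simp: indicator_def)
    moreover have "\<psi> \<in> borel_measurable borel" by (rule borel_measurable_continuous_onI[OF cont\<psi>])
    ultimately show ?thesis by (subst integrable_cong_AE) (auto elim: eventually_mono)
  qed
  moreover have "AE t in lborel. 0 \<le> indicator {0<..<1} t * \<psi> t"
    by (rule AE_I2) (auto simp: indicator_def \<psi>_def b_def)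
  ultimately have "AE t in lborel. indicator {0<..<1} t * \<psi> t = 0"
    using i0 by (simp add: integral_nonneg_eq_0_iff_AE)
  then have ae: "AE t in lborel. t \<notin> {0<..<1} \<inter> {t. 0 < \<psi> t}"
    by eventually_elim (auto simp: indicator_def split: if_splits)
  have "open ({0<..<1} \<inter> {t. 0 < \<psi> t})"
    by (intro open_Int open_Collect_less continuous_intros cont\<psi>)
  from open_null_imp_empty[OF this ae] have "\<not> 0 < \<psi> r" using r by blast
  moreover have "0 < \<psi> r"
  proof -
    have "sqrt (max s0 (min s1 (r^2))) = r" using s r by simp
    moreover have "b (r^2) > 0" using s by (simp add: b_def)
    ultimately show ?thesis using r Ar by (simp add: \<psi>_def)
  qed
  ultimately show False by blast
qed

text \<open>Divide the coefficient by \<open>r ^ k\<close>. On (0, 1) the derivative of the quotient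
  is the integral just shown to vanish, over \<open>r ^ Suc k\<close>, so the quotient is
  constant.\<close>

lemma harmonic_sphere_coefficient:
  fixes f h :: "'a::euclidean_space \<Rightarrow> real"
  assumes f: "harmonic_on (ball 0 1) f" and h: "harmonic_on UNIV h"
    and hom: "\<And>t x. h (t *\<^sub>R x) = t ^ k * h x"
  shows "\<exists>b. \<forall>r\<in>{0..<1}. (\<integral>y. f (r *\<^sub>R y) * h y \<partial>surface_measure) = b * r ^ k"
proof -
  obtain gf Jf where f: "harmonic_grad (ball 0 1) f gf Jf" using harmonic_on_imp_grad[OF f] .
  obtain gh Jh where h: "harmonic_grad UNIV h gh Jh" using harmonic_on_imp_grad[OF h] .
  note cf = harmonic_grad_continuous[OF f]
  have ch: "continuous_on UNIV h" using harmonic_grad_continuous[OF h] by simp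
  define \<phi> where "\<phi> r = (\<integral>y. f (r *\<^sub>R y) * h y \<partial>surface_measure)" for r
  have cont\<phi>: "continuous_on {-1<..<1} \<phi>"
    unfolding \<phi>_def
    by (rule continuous_on_integral_param[OF finite_surface_measure sets_surface_measure compact_sphere])
       (intro continuous_intros continuous_on_scaleR_ball cf continuous_on_compose2[OF ch], auto)
  define D where "D t y = h y * ((gf (t *\<^sub>R y) \<bullet> (t *\<^sub>R y) - real k * f (t *\<^sub>R y)) / t ^ Suc k)" for t y
  have der: "((\<lambda>t. \<integral>y. f (t *\<^sub>R y) * h y / t ^ k \<partial>surface_measure) has_real_derivative 0) (at t)" if t: "t \<in> {0<..<1}" for t :: real
  proof -
    have "((\<lambda>t. \<integral>y. f (t *\<^sub>R y) * h y / t ^ k \<partial>surface_measure) has_real_derivative (\<integral>y. D t y \<partial>surface_measure)) (at t)"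
    proof (rule has_real_derivative_integral_param[OF finite_surface_measure sets_surface_measure compact_sphere _ _ _ t])
      show "continuous_on (sphere 0 1) (\<lambda>y. f (s *\<^sub>R y) * h y / s ^ k)" if "s \<in> {0<..<1}" for s
        using that by (intro continuous_intros continuous_on_compose2[OF cf(1)] continuous_on_subset[OF ch]) auto
      show "continuous_on ({0<..<1} \<times> sphere 0 1) (\<lambda>z. D (fst z) (snd z))"
        unfolding D_def
        by (intro continuous_intros continuous_on_subset[OF continuous_on_scaleR_ball] cf continuous_on_compose2[OF ch]) auto
      fix s :: real and y :: 'a assume s: "s \<in> {0<..<1}" and y: "y \<in> sphere 0 1"
      then have b: "s *\<^sub>R y \<in> ball 0 1" by simp
      have "((\<lambda>s. f (s *\<^sub>R y)) has_derivative (\<lambda>v. gf (s *\<^sub>R y) \<bullet> (v *\<^sub>R y))) (at s)"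
      proof (rule has_derivative_compose[where g = f])
        show "((\<lambda>s. s *\<^sub>R y) has_derivative (\<lambda>v. v *\<^sub>R y)) (at s)" by (auto intro!: derivative_eq_intros)
        show "(f has_derivative (\<lambda>v. gf (s *\<^sub>R y) \<bullet> v)) (at (s *\<^sub>R y))" using f b unfolding harmonic_grad_def by blast
      qed
      then have "((\<lambda>s. f (s *\<^sub>R y)) has_real_derivative (gf (s *\<^sub>R y) \<bullet> y)) (at s)"
        by (simp add: has_field_derivative_def mult.commute[of _ "gf (s *\<^sub>R y) \<bullet> y"])
      then have "((\<lambda>s. f (s *\<^sub>R y) * h y / s ^ k) has_real_derivative
          ((gf (s *\<^sub>R y) \<bullet> y) * h y * s ^ k - f (s *\<^sub>R y) * h y * (real k * s ^ (k - 1))) / (s ^ k * s ^ k)) (at s)"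
        using s by (auto intro!: derivative_eq_intros)
      also have "((gf (s *\<^sub>R y) \<bullet> y) * h y * s ^ k - f (s *\<^sub>R y) * h y * (real k * s ^ (k - 1))) / (s ^ k * s ^ k) = D s y"
        using s unfolding D_def by (cases k) (auto simp: field_simps)
      finally show "((\<lambda>s. f (s *\<^sub>R y) * h y / s ^ k) has_real_derivative D s y) (at s)" .
    qed
    also have "(\<integral>y. D t y \<partial>surface_measure) = (\<integral>y. h y * (gf (t *\<^sub>R y) \<bullet> (t *\<^sub>R y) - real k * f (t *\<^sub>R y)) \<partial>surface_measure) / t ^ Suc k"
      unfolding D_def by simp
    also have "\<dots> = 0" using harmonic_radial_integral_zero[OF f h hom t] by simp
    finally show ?thesis .
  qed
  have "\<exists>c. \<forall>t\<in>{0<..<1}. (\<integral>y. f (t *\<^sub>R y) * h y / t ^ k \<partial>surface_measure) = c"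
    by (rule has_field_derivative_zero_constant) (use der in \<open>auto intro: has_field_derivative_at_within\<close>)
  then obtain c where c: "\<And>t. 0 < t \<Longrightarrow> t < 1 \<Longrightarrow> (\<integral>y. f (t *\<^sub>R y) * h y / t ^ k \<partial>surface_measure) = c"
    by auto
  have \<phi>c: "\<phi> t = c * t ^ k" if "0 < t" "t < 1" for t
    using c[OF that] that by (simp add: \<phi>_def field_simps)
  \<comment> \<open>For k > 0 the quotient carries no information at radius 0, so the value there is
    taken as a limit from the right; for k = 0 the right side is c, because
    \<open>0 ^ 0 = 1\<close>.\<close>
  have "\<phi> 0 = c * 0 ^ k"
  proof -
    have "isCont \<phi> 0" using cont\<phi> by (simp add: continuous_on_eq_continuous_at)
    then have "(\<phi> \<longlongrightarrow> \<phi> 0) (at_right 0)" unfolding isCont_def by (rule filterlim_mono) (auto simp: at_within_le_at)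
    moreover have "((\<lambda>t. c * t ^ k) \<longlongrightarrow> c * 0 ^ k) (at_right 0)" by (intro tendsto_intros)
    moreover have "eventually (\<lambda>t. \<phi> t = c * t ^ k) (at_right 0)"
      using \<phi>c by (auto simp: eventually_at_right[of 0 1] intro!: exI[of _ 1])
    ultimately have "(\<phi> \<longlongrightarrow> c * 0 ^ k) (at_right 0)" "(\<phi> \<longlongrightarrow> \<phi> 0) (at_right 0)"
      using tendsto_cong[of \<phi> "\<lambda>t. c * t ^ k" "at_right 0"] by blast+
    then show ?thesis using tendsto_unique[OF trivial_limit_at_right_real] by blast
  qed
  then have "\<forall>r\<in>{0..<1}. \<phi> r = c * r ^ k" using \<phi>c by (metis atLeastLessThan_iff order_le_less)
  then show ?thesis unfolding \<phi>_def by blast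
qed

text \<open>The cone over the set where \<open>u\<close> is nonzero is open. Its Lebesgue measure is
  proportional to the surface measure of that set, hence zero, and a null open set is empty.\<close>

lemma integral_surface_eq_0D:
  fixes u :: "'a::euclidean_space \<Rightarrow> real"
  assumes u: "continuous_on (sphere 0 1) u" and nn: "\<And>y. norm y = 1 \<Longrightarrow> 0 \<le> u y"
    and i0: "(\<integral>y. u y \<partial>surface_measure) = 0" and y: "norm y = 1"
  shows "u y = 0"
proof (rule ccontr)
  assume uy: "u y \<noteq> 0"
  interpret S: finite_measure "surface_measure :: 'a measure" by (rule finite_surface_measure)
  have meas: "u \<in> borel_measurable surface_measure"
    using borel_measurable_continuous_on_restrict[OF u] measurable_cong_sets[OF sets_surface_measure refl] by blast
  have "bounded (u ` sphere 0 1)"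
    using u by (intro compact_imp_bounded compact_continuous_image) auto
  then obtain B where "\<And>y. norm y = 1 \<Longrightarrow> norm (u y) \<le> B" unfolding bounded_iff by fastforce
  then have "integrable surface_measure u"
    using meas by (intro S.integrable_const_bound[of _ B]) auto
  then have "AE y in surface_measure. u y = 0"
    using i0 nn by (subst (asm) integral_nonneg_eq_0_iff_AE) auto
  moreover have N: "{y \<in> space surface_measure. u y \<noteq> 0} \<in> sets surface_measure" using meas by measurable
  ultimately have e0: "emeasure surface_measure {y \<in> sphere 0 1. u y \<noteq> 0} = 0"
    by (simp add: AE_iff_measurable[OF N refl])
  have Nb: "{y \<in> sphere 0 1. u y \<noteq> 0} \<in> sets borel"
    using N by (auto simp: sets_surface_measure sets_restrict_space)
  define U where "U = {x \<in> ball 0 1 - {0::'a}. u (sgn x) \<noteq> 0}"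
  have "emeasure lborel {x \<in> ball 0 1 - {0}. sgn x \<in> {y \<in> sphere 0 1. u y \<noteq> 0}} = 0"
  proof -
    have "{y \<in> sphere 0 1. u y \<noteq> 0} \<subseteq> sphere 0 1" by auto
    from emeasure_surface_measure[OF Nb this] show ?thesis unfolding e0 by simp
  qed
  also have "{x \<in> ball 0 1 - {0::'a}. sgn x \<in> {y \<in> sphere 0 1. u y \<noteq> 0}} = U"
    by (auto simp: U_def norm_sgn)
  finally have eU: "emeasure lborel U = 0" .
  have "open U"
  proof -
    have "continuous_on (ball 0 1 - {0}) (\<lambda>x::'a. u (sgn x))"
      by (rule continuous_on_compose2[OF u]) (auto intro!: continuous_intros simp: norm_sgn split: if_splits)
    then have "open ((ball 0 1 - {0}) \<inter> (\<lambda>x. u (sgn x)) -` (- {0}))"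
      by (rule continuous_open_preimage) auto
    also have "(ball 0 1 - {0}) \<inter> (\<lambda>x. u (sgn x)) -` (- {0}) = U" by (auto simp: U_def)
    finally show ?thesis .
  qed
  then have "AE x in lborel. x \<notin> U"
    using eU by (intro AE_not_in) (auto simp: null_sets_def)
  with open_null_imp_empty[OF \<open>open U\<close>] have "U = {}" by blast
  moreover have "(1/2) *\<^sub>R y \<in> U"
    using y uy by (auto simp: U_def sgn_div_norm)
  ultimately show False by blast
qed

text \<open>In polar coordinates around x the weight is constant on each sphere, where the mean
  value property replaces \<open>u\<close> by \<open>u x\<close>. Spheres of radius at least e lie
  outside the support of the weight.\<close>

lemma integral_radial_mean_value:
  fixes u :: "'a::euclidean_space \<Rightarrow> real" and k :: "real \<Rightarrow> real"
  assumes u [measurable]: "u \<in> borel_measurable borel" and B: "\<And>x. \<bar>u x\<bar> \<le> B"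
    and k: "continuous_on UNIV k" and k0: "\<And>s. s \<ge> e^2 \<Longrightarrow> k s = 0" and e: "0 < e" "e < 1"
    and mv: "\<And>r. 0 < r \<Longrightarrow> r < e \<Longrightarrow> (\<integral>y. u (x + r *\<^sub>R y) \<partial>surface_measure) = u x * measure surface_measure (sphere 0 (1::real) :: 'a set)"
  shows "(\<integral>z. u z * k ((x - z) \<bullet> (x - z)) \<partial>lborel) = u x * (\<integral>z. k (z \<bullet> z) \<partial>(lborel :: 'a measure))"
proof -
  interpret S: finite_measure "surface_measure :: 'a measure" by (rule finite_surface_measure)
  have [measurable]: "k \<in> borel_measurable borel" by (rule borel_measurable_continuous_onI[OF k])
  have "bounded (k ` {0..e^2})"
    by (intro compact_imp_bounded compact_continuous_image continuous_on_subset[OF k]) auto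
  then obtain K where K0: "\<And>s. 0 \<le> s \<Longrightarrow> s \<le> e^2 \<Longrightarrow> \<bar>k s\<bar> \<le> K" unfolding bounded_iff by fastforce
  have K: "\<bar>k (z \<bullet> z)\<bar> \<le> K" for z :: 'a
    using K0[of "z \<bullet> z"] K0[of 0] k0[of "z \<bullet> z"] by (cases "z \<bullet> z \<le> e^2") auto
  have kz: "k (z \<bullet> z) = 0" if "norm z \<ge> e" for z :: 'a
    using that e by (intro k0) (auto simp: dot_square_norm intro!: power_mono)
  have ib: "indicator (ball 0 1) z * (c * k (z \<bullet> z)) = c * k (z \<bullet> z)" for z :: 'a and c :: real
    using kz[of z] e by (cases "norm z < 1") auto
  have "(\<integral>z. u z * k ((x - z) \<bullet> (x - z)) \<partial>lborel) = (\<integral>z. u (x + z) * k ((x - (x + z)) \<bullet> (x - (x + z))) \<partial>lborel)"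
    by (rule integral_lborel_translate[symmetric]) measurable
  also have "\<dots> = (\<integral>z. indicator (ball 0 1) z * (u (x + z) * k (z \<bullet> z)) \<partial>lborel)"
    by (simp add: ib)
  also have "\<dots> = (\<integral>r. indicator {0<..<1} r * (r ^ (DIM('a) - 1) * (\<integral>y. u (x + r *\<^sub>R y) * k ((r *\<^sub>R y) \<bullet> (r *\<^sub>R y)) \<partial>surface_measure)) \<partial>lborel)"
  proof (rule integral_polar[where B = "B * K"])
    fix z :: 'a
    show "\<bar>u (x + z) * k (z \<bullet> z)\<bar> \<le> B * K"
      unfolding abs_mult using B K by (intro mult_mono) (auto intro: order_trans[OF abs_ge_zero B])
  qed measurable
  also have "\<dots> = (\<integral>r. u x * (indicator {0<..<1} r * (r ^ (DIM('a) - 1) * (\<integral>y. k ((r *\<^sub>R y) \<bullet> (r *\<^sub>R y)) \<partial>(surface_measure :: 'a measure)))) \<partial>lborel)"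
  proof (rule Bochner_Integration.integral_cong[OF refl])
    fix r :: real
    have kr: "(r *\<^sub>R y) \<bullet> (r *\<^sub>R y) = r^2" if "y \<in> space surface_measure" for y :: 'a
      using that by (simp add: dot_square_norm power2_eq_square)
    have 1: "(\<integral>y. u (x + r *\<^sub>R y) * k ((r *\<^sub>R y) \<bullet> (r *\<^sub>R y)) \<partial>surface_measure) = (\<integral>y. u (x + r *\<^sub>R y) * k (r^2) \<partial>surface_measure)"
      by (rule Bochner_Integration.integral_cong) (simp_all only: kr)
    have 2: "(\<integral>y. k ((r *\<^sub>R y) \<bullet> (r *\<^sub>R y)) \<partial>(surface_measure :: 'a measure)) = (\<integral>y. k (r^2) \<partial>(surface_measure :: 'a measure))"
      by (rule Bochner_Integration.integral_cong) (simp_all only: kr)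
    show "indicator {0<..<1} r * (r ^ (DIM('a) - 1) * (\<integral>y. u (x + r *\<^sub>R y) * k ((r *\<^sub>R y) \<bullet> (r *\<^sub>R y)) \<partial>surface_measure))
      = u x * (indicator {0<..<1} r * (r ^ (DIM('a) - 1) * (\<integral>y. k ((r *\<^sub>R y) \<bullet> (r *\<^sub>R y)) \<partial>(surface_measure :: 'a measure))))"
      unfolding 1 2 using mv[of r] k0[of "r^2"] e
      by (cases "0 < r"; cases "r < e") (auto simp: mult_ac power_mono not_less)
  qed
  also have "\<dots> = u x * (\<integral>z. indicator (ball 0 1) z * k (z \<bullet> z) \<partial>(lborel :: 'a measure))"
    by (subst integral_polar[OF _ K]) simp_all
  also have "\<dots> = u x * (\<integral>z. k (z \<bullet> z) \<partial>(lborel :: 'a measure))"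
    using ib[of _ 1] by (simp only: mult_1)
  finally show ?thesis .
qed

text \<open>An exponent of at least 2 removes the kink: at s = a the difference quotient towards t
  is at most |a - t| ^ Suc k.\<close>

lemma has_real_derivative_max_power:
  "((\<lambda>s::real. max 0 (a - s) ^ Suc (Suc k)) has_real_derivative - (real (Suc (Suc k)) * max 0 (a - s) ^ Suc k)) (at s)"
proof -
  consider "s < a" | "s > a" | "s = a" by linarith
  then show ?thesis
  proof cases
    case 1
    have "((\<lambda>s::real. (a - s) ^ Suc (Suc k)) has_real_derivative - (real (Suc (Suc k)) * (a - s) ^ Suc k)) (at s)"
    proof -
      have "((\<lambda>s. a - s) has_real_derivative -1) (at s)" by (auto intro!: derivative_eq_intros)
      from DERIV_power[OF this, of "Suc (Suc k)"] show ?thesis by simp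
    qed
    then have "((\<lambda>s::real. max 0 (a - s) ^ Suc (Suc k)) has_real_derivative - (real (Suc (Suc k)) * (a - s) ^ Suc k)) (at s)"
      by (rule has_field_derivative_transform_within_open[of _ _ _ "{..<a}"]) (use 1 in auto)
    then show ?thesis using 1 by simp
  next
    case 2
    have "((\<lambda>s::real. 0) has_real_derivative 0) (at s)" by simp
    then have "((\<lambda>s::real. max 0 (a - s) ^ Suc (Suc k)) has_real_derivative 0) (at s)"
      by (rule has_field_derivative_transform_within_open[of _ _ _ "{a<..}"]) (use 2 in auto)
    then show ?thesis using 2 by simp
  next
    case 3
    have "((\<lambda>t. (max 0 (a - t) ^ Suc (Suc k)) / (t - a)) \<longlongrightarrow> 0) (at a)"
    proof (rule tendsto_norm_zero_cancel, rule tendsto_sandwich[of "\<lambda>_. 0"])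
      show "eventually (\<lambda>t. norm (max 0 (a - t) ^ Suc (Suc k) / (t - a)) \<le> \<bar>a - t\<bar> ^ Suc k) (at a)"
      proof (rule always_eventually, rule allI)
        fix t
        show "norm (max 0 (a - t) ^ Suc (Suc k) / (t - a)) \<le> \<bar>a - t\<bar> ^ Suc k"
        proof (cases "t < a")
          case True
          then have "norm (max 0 (a - t) ^ Suc (Suc k) / (t - a)) = (\<bar>a - t\<bar> ^ Suc k * \<bar>a - t\<bar>) / \<bar>a - t\<bar>"
            by (simp add: abs_mult power_abs)
          also have "\<dots> = \<bar>a - t\<bar> ^ Suc k" using True by (subst nonzero_mult_div_cancel_right) auto
          finally show ?thesis by simp
        qed simp
      qed
      have "((\<lambda>t. \<bar>a - t\<bar> ^ Suc k) \<longlongrightarrow> \<bar>a - a\<bar> ^ Suc k) (at a)" by (intro tendsto_intros)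
      then show "((\<lambda>t. \<bar>a - t\<bar> ^ Suc k) \<longlongrightarrow> 0) (at a)" by simp
    qed auto
    then show ?thesis using 3 by (simp add: has_field_derivative_iff)
  qed
qed

text \<open>
  By the mean value property \<open>u\<close> is a multiple of its convolution with the \<open>C\<^sup>2\<close> radial bump
  \<open>\<eta>\<close>, and the Laplacian of \<open>\<eta>\<close> is radial with integral zero.
\<close>

lemma harmonic_of_mean_value:
  fixes u :: "'a::euclidean_space \<Rightarrow> real"
  assumes u: "continuous_on (cball x0 (2 * e)) u" and e: "0 < e" "e < 1"
    and mv: "\<And>x r. x \<in> ball x0 e \<Longrightarrow> 0 < r \<Longrightarrow> r < e \<Longrightarrow>
       (\<integral>y. u (x + r *\<^sub>R y) \<partial>surface_measure) = u x * measure surface_measure (sphere 0 1 :: 'a set)"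
  shows "harmonic_on (ball x0 e) u"
proof -
  \<comment> \<open>The bump is the fourth power of \<open>p\<close>: its gradient, containing
    \<open>p ^ 3\<close>, is still differentiable at the edge of the support, and its Hessian,
    containing \<open>p ^ 2\<close>, is continuous there.\<close>
  define p where "p s = max 0 (e^2 - s)" for s
  define \<eta> where "\<eta> z = p (z \<bullet> z) ^ 4" for z :: 'a
  define g where "g z = (- 8 * p (z \<bullet> z) ^ 3) *\<^sub>R z" for z :: 'a
  define J where "J z h = (48 * p (z \<bullet> z) ^ 2 * (z \<bullet> h)) *\<^sub>R z - (8 * p (z \<bullet> z) ^ 3) *\<^sub>R h" for z h :: 'a
  \<comment> \<open>The Laplacian of the bump as a function of s = |z|^2.\<close>
  define q where "q s = 48 * p s ^ 2 * s - 8 * real DIM('a) * p s ^ 3" for s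
  have contp: "continuous_on S (\<lambda>x. p (f x))" if "continuous_on S f" for f :: "'b::topological_space \<Rightarrow> real" and S
    unfolding p_def by (intro continuous_intros that)
  have p: "0 \<le> p s" "s \<ge> 0 \<Longrightarrow> p s \<le> e^2" "s \<ge> e^2 \<Longrightarrow> p s = 0" for s by (auto simp: p_def)
  have pz: "p (z \<bullet> z) = 0" if "norm z > e" for z :: 'a
    using that e by (intro p) (auto simp: dot_square_norm intro!: power_mono)
  have sq: "((\<lambda>x::'a. x \<bullet> x) has_derivative (\<lambda>h. 2 * (z \<bullet> h))) (at z)" for z
    by (auto intro!: derivative_eq_intros simp: inner_commute)
  have d\<eta>: "(\<eta> has_derivative (\<lambda>h. g z \<bullet> h)) (at z)" for z
  proof -
    have "((\<lambda>s. p s ^ 4) has_real_derivative - (4 * p s ^ 3)) (at s)" for s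
      using has_real_derivative_max_power[of "e^2" 2 s] by (simp add: p_def numeral_eq_Suc)
    from DERIV_compose_FDERIV[OF this sq] show ?thesis
      unfolding \<eta>_def g_def by (rule has_derivative_eq_rhs) (auto simp: fun_eq_iff)
  qed
  have dg: "(g has_derivative J z) (at z)" for z
  proof -
    have "((\<lambda>s. p s ^ 3) has_real_derivative - (3 * p s ^ 2)) (at s)" for s
      using has_real_derivative_max_power[of "e^2" 1 s] by (simp add: p_def numeral_eq_Suc)
    from DERIV_compose_FDERIV[OF this sq]
    have "((\<lambda>x. p (x \<bullet> x) ^ 3) has_derivative (\<lambda>h. 2 * (z \<bullet> h) * - (3 * p (z \<bullet> z) ^ 2))) (at z)" .
    then have "((\<lambda>x. (- 8 * p (x \<bullet> x) ^ 3) *\<^sub>R x) has_derivative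
        (\<lambda>h. (- 8 * p (z \<bullet> z) ^ 3) *\<^sub>R h + (- 8 * (2 * (z \<bullet> h) * - (3 * p (z \<bullet> z) ^ 2))) *\<^sub>R z)) (at z)"
      by (intro has_derivative_scaleR has_derivative_mult_right has_derivative_ident)
    then show ?thesis
      unfolding g_def J_def by (rule has_derivative_eq_rhs) (auto simp: fun_eq_iff)
  qed
  have B\<eta>: "norm (\<eta> z) \<le> (e^2)^4" for z
    using power_mono[OF p(2)[of "z \<bullet> z"] p(1), of 4] p(1)[of "z \<bullet> z"] by (simp add: \<eta>_def)
  have pbd: "norm z * p (z \<bullet> z) ^ k \<le> e * (e^2) ^ k" if "k > 0" for k and z :: 'a
  proof (cases "norm z > e")
    case False
    then show ?thesis using p[of "z \<bullet> z"] e by (intro mult_mono power_mono) auto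
  next
    case True
    then have "p (z \<bullet> z) = 0" by (rule pz)
    then show ?thesis using that e by (simp add: zero_power)
  qed
  have Bg: "norm (g z) \<le> 8 * (e * (e^2)^3)" for z
    using pbd[of 3 z] p(1)[of "z \<bullet> z"] by (simp add: g_def mult_ac)
  have BJ: "norm (J z h) \<le> (48 * (e * (e * (e^2)^2)) + 8 * (e^2)^3) * norm h" for z h
  proof -
    have "norm (J z h) \<le> 48 * p (z \<bullet> z) ^ 2 * \<bar>z \<bullet> h\<bar> * norm z + 8 * p (z \<bullet> z) ^ 3 * norm h"
      unfolding J_def using p(1)[of "z \<bullet> z"]
      by (intro order_trans[OF norm_triangle_ineq4]) (simp add: abs_mult)
    also have "\<dots> \<le> 48 * p (z \<bullet> z) ^ 2 * (norm z * norm h) * norm z + 8 * (e^2) ^ 3 * norm h"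
      using p[of "z \<bullet> z"] Cauchy_Schwarz_ineq2[of z h]
      by (intro add_mono mult_mono power_mono mult_nonneg_nonneg) auto
    also have "48 * p (z \<bullet> z) ^ 2 * (norm z * norm h) * norm z + 8 * (e^2) ^ 3 * norm h = 48 * norm h * (norm z * (norm z * p (z \<bullet> z) ^ 2)) + 8 * (e^2) ^ 3 * norm h" by (simp add: mult_ac)
    also have "\<dots> \<le> 48 * norm h * (e * (e * (e^2)^2)) + 8 * (e^2) ^ 3 * norm h"
    proof (rule add_right_mono, rule mult_left_mono)
      show "norm z * (norm z * p (z \<bullet> z) ^ 2) \<le> e * (e * (e^2)^2)"
      proof (cases "norm z > e")
        case False
        then show ?thesis using pbd[of 2 z] p(1)[of "z \<bullet> z"] e by (intro mult_mono[of "norm z" e "norm z * p (z \<bullet> z) ^ 2"]) auto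
      qed (use pz e in auto)
    qed simp
    finally show ?thesis by (simp add: algebra_simps)
  qed
  have c\<eta>: "continuous_on UNIV \<eta>" and cg: "continuous_on UNIV g" and cJ: "continuous_on UNIV (\<lambda>z. J z h)" for h
    unfolding \<eta>_def g_def J_def by (intro continuous_intros contp)+
  \<comment> \<open>\<open>u\<close> is controlled only near x0. Cutting it off at radius 2 * e
    makes it integrable and keeps every value at distance below e from a point of
    \<open>ball x0 e\<close>.\<close>
  define v where "v z = indicator (cball x0 (2 * e)) z *\<^sub>R u z" for z
  have iv: "integrable lborel v"
    unfolding v_def by (rule borel_integrable_compact) (use u in auto)
  have mv': "v \<in> borel_measurable borel" using borel_measurable_integrable[OF iv] by simp
  have "bounded (u ` cball x0 (2 * e))"
    using u by (intro compact_imp_bounded compact_continuous_image) auto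
  then obtain B where B: "\<And>x. x \<in> cball x0 (2 * e) \<Longrightarrow> \<bar>u x\<bar> \<le> B" unfolding bounded_iff by fastforce
  have Bv: "\<bar>v x\<bar> \<le> B" for x
    using B[of x] B[of x0] e by (auto simp: v_def indicator_def)
  have vmv: "(\<integral>y. v (x + r *\<^sub>R y) \<partial>surface_measure) = v x * measure surface_measure (sphere 0 1 :: 'a set)"
    if x: "x \<in> ball x0 e" and r: "0 < r" "r < e" for x r
  proof -
    have "x + r *\<^sub>R y \<in> cball x0 (2 * e)" if "norm y = 1" for y
    proof -
      have "dist x0 (x + r *\<^sub>R y) \<le> dist x0 x + norm (r *\<^sub>R y)" using dist_triangle[of x0 "x + r *\<^sub>R y" x] by (simp add: dist_norm)
      also have "\<dots> \<le> e + e" using x r that by simp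
      finally show ?thesis by simp
    qed
    then have "(\<integral>y. v (x + r *\<^sub>R y) \<partial>surface_measure) = (\<integral>y. u (x + r *\<^sub>R y) \<partial>surface_measure)"
      by (intro Bochner_Integration.integral_cong) (auto simp: v_def)
    moreover have "v x = u x" using x e by (auto simp: v_def)
    ultimately show ?thesis using mv[OF x r] by simp
  qed
  have conv: "(\<integral>z. v z * k ((x - z) \<bullet> (x - z)) \<partial>lborel) = u x * (\<integral>z. k (z \<bullet> z) \<partial>(lborel :: 'a measure))"
    if x: "x \<in> ball x0 e" and k: "continuous_on UNIV k" "\<And>s. s \<ge> e^2 \<Longrightarrow> k s = 0" for x k
  proof -
    have "v x = u x" using x e by (auto simp: v_def)
    then show ?thesis using integral_radial_mean_value[OF mv' Bv k e vmv[OF x]] by simp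
  qed
  define c where "c = (\<integral>z. \<eta> z \<partial>(lborel :: 'a measure))"
  have c0: "c \<noteq> 0"
  proof
    assume "c = 0"
    have "integrable lborel \<eta>"
      by (rule integrable_continuous_compact_support[OF c\<eta>, of e]) (simp add: \<eta>_def pz)
    then have "AE z in lborel. \<eta> z = 0"
      using \<open>c = 0\<close> unfolding c_def by (subst (asm) integral_nonneg_eq_0_iff_AE) (auto simp: \<eta>_def p)
    then have "{z. \<eta> z \<noteq> 0} = {}"
      by (intro open_null_imp_empty open_Collect_neq c\<eta> continuous_on_const) auto
    moreover have "\<eta> 0 \<noteq> 0" using e by (simp add: \<eta>_def p_def)
    ultimately show False by blast
  qed
  define F where "F x = (\<integral>z. v z *\<^sub>R \<eta> (x - z) \<partial>lborel)" for x
  define gF where "gF x = (\<integral>z. v z *\<^sub>R g (x - z) \<partial>lborel)" for x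
  define JF where "JF x h = (\<integral>z. v z *\<^sub>R J (x - z) h \<partial>lborel)" for x h
  have dF: "(F has_derivative (\<lambda>h. gF x \<bullet> h)) (at x)" for x
  proof -
    have "(F has_derivative (\<lambda>h. \<integral>z. v z *\<^sub>R (g (x - z) \<bullet> h) \<partial>lborel)) (at x)"
      unfolding F_def
    proof (rule has_derivative_convolution[OF iv d\<eta> B\<eta>])
      show "norm (g z \<bullet> h) \<le> 8 * (e * (e^2)^3) * norm h" for z h
        using Cauchy_Schwarz_ineq2[of "g z" h] mult_right_mono[OF Bg[of z], of "norm h"] by simp
    qed (intro continuous_intros cg)
    moreover have "(\<integral>z. v z *\<^sub>R (g (x - z) \<bullet> h) \<partial>lborel) = gF x \<bullet> h" for h
      unfolding gF_def using integral_inner_left[of h lborel "\<lambda>z. v z *\<^sub>R g (x - z)"] integrable_convolution[OF iv cg Bg, of x] by simp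
    ultimately show ?thesis by simp
  qed
  have dgF: "(gF has_derivative JF x) (at x)" for x
    unfolding gF_def JF_def using has_derivative_convolution[OF iv dg Bg BJ cJ] .
  have cJF: "continuous_on UNIV (\<lambda>x. JF x h)" for h
    unfolding JF_def by (rule continuous_on_convolution[OF iv cJ BJ])
  have trJ: "(\<Sum>i\<in>Basis. J z i \<bullet> i) = q (z \<bullet> z)" for z
  proof -
    have "(\<Sum>i\<in>Basis. J z i \<bullet> i) = (\<Sum>i\<in>Basis. 48 * p (z \<bullet> z)^2 * ((z \<bullet> i) * (z \<bullet> i)) - 8 * p (z \<bullet> z) ^ 3)"
      by (intro sum.cong) (auto simp: J_def inner_diff_left inner_Basis)
    also have "\<dots> = 48 * p (z \<bullet> z)^2 * (z \<bullet> z) - real DIM('a) * (8 * p (z \<bullet> z)^3)"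
      unfolding sum_subtractf sum_distrib_left[symmetric] euclidean_inner[symmetric] by simp
    finally show ?thesis by (simp add: q_def)
  qed
  have cq: "continuous_on UNIV q" unfolding q_def by (intro continuous_intros contp)
  have q0: "q s = 0" if "s \<ge> e^2" for s using p(3)[OF that] by (simp add: q_def)
  have iJ: "integrable lborel (\<lambda>z. J z i)" for i
    by (rule integrable_continuous_compact_support[OF cJ, of e]) (simp add: J_def pz)
  have zero: "(\<integral>z. J z i \<bullet> i \<partial>lborel) = 0" for i
  proof (rule integral_directional_derivative_zero[where G = "\<lambda>z. g z \<bullet> i" and G' = "\<lambda>z h. J z h \<bullet> i" and R = e])
    show "((\<lambda>z. g z \<bullet> i) has_derivative (\<lambda>h. J z h \<bullet> i)) (at z)" for z
      by (rule has_derivative_inner_left[OF dg])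
  qed (auto simp: g_def pz intro!: continuous_intros cJ)
  \<comment> \<open>Second derivatives of a compactly supported function integrate to zero. Since
    the Laplacian is again radial, the radial mean value identity turns this into the vanishing of
    the Laplacian of \<open>F\<close>.\<close>
  have iq: "(\<integral>z. q (z \<bullet> z) \<partial>(lborel :: 'a measure)) = 0"
  proof -
    have "(\<integral>z. q (z \<bullet> z) \<partial>(lborel :: 'a measure)) = (\<integral>z. (\<Sum>i\<in>Basis. J z i \<bullet> i) \<partial>(lborel :: 'a measure))"
      by (simp add: trJ)
    also have "\<dots> = (\<Sum>i\<in>Basis. \<integral>z. J z i \<bullet> i \<partial>(lborel :: 'a measure))"
      by (rule Bochner_Integration.integral_sum) (intro integrable_inner_left impI iJ)
    also have "\<dots> = 0" by (simp add: zero)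
    finally show ?thesis .
  qed
  have trF: "(\<Sum>i\<in>Basis. JF x i \<bullet> i) = 0" if x: "x \<in> ball x0 e" for x
  proof -
    have "(\<Sum>i\<in>Basis. JF x i \<bullet> i) = (\<Sum>i\<in>Basis. \<integral>z. (v z *\<^sub>R J (x - z) i) \<bullet> i \<partial>lborel)"
      unfolding JF_def using integrable_convolution[OF iv cJ BJ] by (intro sum.cong refl integral_inner_left[symmetric]) blast
    also have "\<dots> = (\<integral>z. (\<Sum>i\<in>Basis. (v z *\<^sub>R J (x - z) i) \<bullet> i) \<partial>lborel)"
      by (rule Bochner_Integration.integral_sum[symmetric]) (intro integrable_inner_left impI integrable_convolution[OF iv cJ BJ])
    also have "\<dots> = (\<integral>z. v z * q ((x - z) \<bullet> (x - z)) \<partial>lborel)"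
      by (simp add: trJ flip: sum_distrib_left)
    also have "\<dots> = 0" using conv[OF x cq q0] iq by simp
    finally show ?thesis .
  qed
  \<comment> \<open>The convolution reproduces \<open>u\<close> up to the factor c, so the
    derivatives of \<open>u\<close> are those of \<open>F\<close> divided by c.\<close>
  have Fu: "F x = u x * c" if x: "x \<in> ball x0 e" for x
  proof -
    have "F x = (\<integral>z. v z * (\<lambda>s. p s ^ 4) ((x - z) \<bullet> (x - z)) \<partial>lborel)" by (simp add: F_def \<eta>_def)
    also have "\<dots> = u x * c" unfolding c_def \<eta>_def
    proof (rule conv[OF x])
      show "continuous_on UNIV (\<lambda>s. p s ^ 4)" by (intro continuous_intros contp)
    qed (simp add: p)
    finally show ?thesis .
  qed
  have "harmonic_grad (ball x0 e) u (\<lambda>x. (1 / c) *\<^sub>R gF x) (\<lambda>x h. (1 / c) *\<^sub>R JF x h)"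
    unfolding harmonic_grad_def
  proof (intro conjI ballI)
    fix x assume x: "x \<in> ball x0 e"
    have "((\<lambda>x. (1 / c) * F x) has_derivative (\<lambda>h. (1 / c) * (gF x \<bullet> h))) (at x)"
      by (intro has_derivative_mult_right dF)
    then have "(u has_derivative (\<lambda>h. (1 / c) * (gF x \<bullet> h))) (at x)"
      by (rule has_derivative_transform_within_open[of _ _ _ _ "ball x0 e"]) (use x Fu c0 in auto)
    then show "(u has_derivative (\<lambda>h. (1 / c) *\<^sub>R gF x \<bullet> h)) (at x)" by simp
    show "((\<lambda>x. (1 / c) *\<^sub>R gF x) has_derivative (\<lambda>h. (1 / c) *\<^sub>R JF x h)) (at x)"
      by (intro has_derivative_scaleR_right dgF)
    show "(\<Sum>i\<in>Basis. (1 / c) *\<^sub>R JF x i \<bullet> i) = 0"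
      using trF[OF x] by (simp flip: sum_divide_distrib)
  next
    fix i show "continuous_on (ball x0 e) (\<lambda>x. (1 / c) *\<^sub>R JF x i)"
      by (intro continuous_intros continuous_on_subset[OF cJF]) auto
  qed
  then show ?thesis by (rule harmonic_on_grad)
qed

text \<open>The definition asks for one pair of derivatives on all of \<open>S\<close>. At each
  point the pair of its own neighbourhood is taken; uniqueness of Frechet derivatives makes the
  local pairs agree on overlaps.\<close>

lemma harmonic_on_local:
  fixes f :: "'a::euclidean_space \<Rightarrow> 'b::real_normed_vector"
  assumes "\<And>x. x \<in> S \<Longrightarrow> \<exists>T. open T \<and> x \<in> T \<and> T \<subseteq> S \<and> harmonic_on T f"
  shows "harmonic_on S f"
proof -
  define P where "P T f' f'' \<longleftrightarrow>
        (\<forall>x\<in>T. (f has_derivative blinfun_apply (f' x)) (at x)) \<and>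
        (\<forall>x\<in>T. (f' has_derivative blinfun_apply (f'' x)) (at x)) \<and>
        continuous_on T f'' \<and>
        (\<forall>x\<in>T. (\<Sum>i\<in>Basis. blinfun_apply (blinfun_apply (f'' x) i) i) = 0)"
    for T and f' :: "'a \<Rightarrow> 'a \<Rightarrow>\<^sub>L 'b" and f'' :: "'a \<Rightarrow> 'a \<Rightarrow>\<^sub>L 'a \<Rightarrow>\<^sub>L 'b"
  have "harmonic_on T f \<longleftrightarrow> (\<exists>f' f''. P T f' f'')" for T
    by (simp only: harmonic_on_def P_def)
  then have "\<forall>x\<in>S. \<exists>z. open (fst z) \<and> x \<in> fst z \<and> fst z \<subseteq> S \<and> P (fst z) (fst (snd z)) (snd (snd z))"
    using assms by (metis fst_conv snd_conv)
  from bchoice[OF this] obtain Z where Z: "\<forall>x\<in>S. open (fst (Z x)) \<and> x \<in> fst (Z x) \<and> fst (Z x) \<subseteq> S \<and> P (fst (Z x)) (fst (snd (Z x))) (snd (snd (Z x)))"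
    by blast
  define T F' F'' where "T x = fst (Z x)" and "F' x = fst (snd (Z x))" and "F'' x = snd (snd (Z x))" for x
  have T: "open (T x) \<and> x \<in> T x \<and> T x \<subseteq> S \<and> P (T x) (F' x) (F'' x)" if "x \<in> S" for x
    using Z that by (simp add: T_def F'_def F''_def)
  define f' where "f' x = F' x x" for x
  define f'' where "f'' x = F'' x x" for x
  have eq1: "f' y = F' x y" if "x \<in> S" "y \<in> T x" for x y
  proof -
    have "y \<in> S" using T that by blast
    then have "blinfun_apply (F' y y) = blinfun_apply (F' x y)"
      using T[OF that(1)] T[OF \<open>y \<in> S\<close>] that(2) unfolding P_def by (blast intro: has_derivative_unique[of f _ y])
    then show ?thesis by (simp add: f'_def blinfun_apply_inject)
  qed
  have d2: "(f' has_derivative blinfun_apply (F'' x y)) (at y)" if "x \<in> S" "y \<in> T x" for x y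
  proof -
    have "(F' x has_derivative blinfun_apply (F'' x y)) (at y)" using T[OF that(1)] that(2) unfolding P_def by blast
    then show ?thesis
    proof (rule has_derivative_transform_within_open)
      show "open (T x)" using T[OF that(1)] by blast
      show "F' x w = f' w" if "w \<in> T x" for w using eq1[OF \<open>x \<in> S\<close> that] by simp
    qed (use that in blast)
  qed
  have eq2: "f'' y = F'' x y" if "x \<in> S" "y \<in> T x" for x y
  proof -
    have "y \<in> S" using T that by blast
    then have "blinfun_apply (F'' y y) = blinfun_apply (F'' x y)"
      using d2[OF \<open>y \<in> S\<close>, of y] d2[OF that] T[OF \<open>y \<in> S\<close>] by (blast intro: has_derivative_unique[of f' _ y])
    then show ?thesis by (simp add: f''_def blinfun_apply_inject)
  qed
  have "P S f' f''"
    unfolding P_def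
  proof (intro conjI ballI)
    fix x assume x: "x \<in> S"
    then have xT: "x \<in> T x" using T by blast
    show "(f has_derivative blinfun_apply (f' x)) (at x)"
      "(\<Sum>i\<in>Basis. blinfun_apply (blinfun_apply (f'' x) i) i) = 0"
      using T[OF x] unfolding f'_def f''_def P_def by blast+
    show "(f' has_derivative blinfun_apply (f'' x)) (at x)"
      using d2[OF x xT] by (simp add: f''_def)
  next
    have "continuous_on (\<Union>x\<in>S. T x) f''"
    proof (rule continuous_on_open_UN)
      fix x assume x: "x \<in> S"
      show "open (T x)" using T[OF x] by blast
      have "continuous_on (T x) (F'' x)" using T[OF x] by (simp add: P_def)
      then show "continuous_on (T x) f''" by (rule continuous_on_eq) (use eq2[OF x] in simp)
    qed
    moreover have "(\<Union>x\<in>S. T x) = S" using T by blast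
    ultimately show "continuous_on S f''" by simp
  qed
  then show ?thesis unfolding harmonic_on_def P_def by blast
qed

section \<open>Linear operations on harmonic functions\<close>

lemma harmonic_on_bounded_linear:
  fixes f :: "'a::euclidean_space \<Rightarrow> 'b::real_normed_vector" and L :: "'b \<Rightarrow> 'c::real_normed_vector"
  assumes f: "harmonic_on S f" and L: "bounded_linear L"
  shows "harmonic_on S (\<lambda>x. L (f x))"
proof -
  obtain f' :: "'a \<Rightarrow> 'a \<Rightarrow>\<^sub>L 'b" and f'' :: "'a \<Rightarrow> 'a \<Rightarrow>\<^sub>L 'a \<Rightarrow>\<^sub>L 'b"
    where f': "\<And>x. x \<in> S \<Longrightarrow> (f has_derivative blinfun_apply (f' x)) (at x)"
      and f'': "\<And>x. x \<in> S \<Longrightarrow> (f' has_derivative blinfun_apply (f'' x)) (at x)"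
      and cont: "continuous_on S f''"
      and tr: "\<And>x. x \<in> S \<Longrightarrow> (\<Sum>i\<in>Basis. blinfun_apply (blinfun_apply (f'' x) i) i) = 0"
    using f unfolding harmonic_on_def by blast
  define BL where "BL = Blinfun L"
  have BL: "blinfun_apply BL = L" unfolding BL_def by (rule bounded_linear_Blinfun_apply[OF L])
  define C where "C = (Blinfun ((o\<^sub>L) BL) :: ('a \<Rightarrow>\<^sub>L 'b) \<Rightarrow>\<^sub>L ('a \<Rightarrow>\<^sub>L 'c))"
  have bC: "bounded_linear ((o\<^sub>L) BL :: ('a \<Rightarrow>\<^sub>L 'b) \<Rightarrow> ('a \<Rightarrow>\<^sub>L 'c))"
    by (rule bounded_bilinear.bounded_linear_right[OF bounded_bilinear_blinfun_compose])
  have C: "blinfun_apply C = (o\<^sub>L) BL" unfolding C_def by (rule bounded_linear_Blinfun_apply[OF bC])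
  show ?thesis
    unfolding harmonic_on_def
  proof (intro exI conjI ballI)
    fix x assume x: "x \<in> S"
    have "((\<lambda>x. L (f x)) has_derivative (\<lambda>h. L (blinfun_apply (f' x) h))) (at x)"
      by (rule bounded_linear.has_derivative[OF L f'[OF x]])
    then show "((\<lambda>x. L (f x)) has_derivative blinfun_apply (BL o\<^sub>L f' x)) (at x)"
      by (simp add: blinfun_compose.rep_eq BL o_def)
    have "((\<lambda>x. BL o\<^sub>L f' x) has_derivative (\<lambda>h. BL o\<^sub>L (blinfun_apply (f'' x) h))) (at x)"
      by (rule bounded_linear.has_derivative[OF bC f''[OF x]])
    then show "((\<lambda>x. BL o\<^sub>L f' x) has_derivative blinfun_apply (C o\<^sub>L f'' x)) (at x)"
      by (simp add: blinfun_compose.rep_eq C o_def)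
    have "(\<Sum>i\<in>Basis. blinfun_apply (blinfun_apply (C o\<^sub>L f'' x) i) i) = L (\<Sum>i\<in>Basis. blinfun_apply (blinfun_apply (f'' x) i) i)"
      by (simp add: blinfun_compose.rep_eq C BL linear_sum[OF bounded_linear.linear[OF L]])
    then show "(\<Sum>i\<in>Basis. blinfun_apply (blinfun_apply (C o\<^sub>L f'' x) i) i) = 0"
      using tr[OF x] linear_0[OF bounded_linear.linear[OF L]] by simp
  next
    show "continuous_on S (\<lambda>x. C o\<^sub>L f'' x)"
      by (intro bounded_bilinear.continuous_on[OF bounded_bilinear_blinfun_compose] continuous_on_const cont)
  qed
qed

lemma harmonic_on_add:
  fixes f g :: "'a::euclidean_space \<Rightarrow> 'b::real_normed_vector"
  assumes f: "harmonic_on S f" and g: "harmonic_on S g"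
  shows "harmonic_on S (\<lambda>x. f x + g x)"
proof -
  obtain f' :: "'a \<Rightarrow> 'a \<Rightarrow>\<^sub>L 'b" and f'' :: "'a \<Rightarrow> 'a \<Rightarrow>\<^sub>L 'a \<Rightarrow>\<^sub>L 'b"
    where f': "\<forall>x\<in>S. (f has_derivative blinfun_apply (f' x)) (at x)"
      "\<forall>x\<in>S. (f' has_derivative blinfun_apply (f'' x)) (at x)" "continuous_on S f''"
      "\<forall>x\<in>S. (\<Sum>i\<in>Basis. blinfun_apply (blinfun_apply (f'' x) i) i) = 0"
    using f unfolding harmonic_on_def by blast
  obtain g' :: "'a \<Rightarrow> 'a \<Rightarrow>\<^sub>L 'b" and g'' :: "'a \<Rightarrow> 'a \<Rightarrow>\<^sub>L 'a \<Rightarrow>\<^sub>L 'b"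
    where g': "\<forall>x\<in>S. (g has_derivative blinfun_apply (g' x)) (at x)"
      "\<forall>x\<in>S. (g' has_derivative blinfun_apply (g'' x)) (at x)" "continuous_on S g''"
      "\<forall>x\<in>S. (\<Sum>i\<in>Basis. blinfun_apply (blinfun_apply (g'' x) i) i) = 0"
    using g unfolding harmonic_on_def by blast
  show ?thesis
    unfolding harmonic_on_def
  proof (intro exI conjI ballI)
    fix x assume x: "x \<in> S"
    have "((\<lambda>x. f x + g x) has_derivative (\<lambda>h. blinfun_apply (f' x) h + blinfun_apply (g' x) h)) (at x)"
      by (intro has_derivative_add f'(1)[rule_format] g'(1)[rule_format] x)
    then show "((\<lambda>x. f x + g x) has_derivative blinfun_apply (f' x + g' x)) (at x)"
      by (simp add: plus_blinfun.rep_eq)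
    have "((\<lambda>x. f' x + g' x) has_derivative (\<lambda>h. blinfun_apply (f'' x) h + blinfun_apply (g'' x) h)) (at x)"
      by (intro has_derivative_add f'(2)[rule_format] g'(2)[rule_format] x)
    then show "((\<lambda>x. f' x + g' x) has_derivative blinfun_apply (f'' x + g'' x)) (at x)"
      by (simp add: plus_blinfun.rep_eq)
    show "(\<Sum>i\<in>Basis. blinfun_apply (blinfun_apply (f'' x + g'' x) i) i) = 0"
      using f'(4) g'(4) x by (simp add: plus_blinfun.rep_eq sum.distrib)
  next
    show "continuous_on S (\<lambda>x. f'' x + g'' x)" by (intro continuous_intros f' g')
  qed
qed

lemma harmonic_on_complex_iff:
  fixes f :: "'a::euclidean_space \<Rightarrow> complex"
  shows "harmonic_on S f \<longleftrightarrow> harmonic_on S (\<lambda>x. Re (f x)) \<and> harmonic_on S (\<lambda>x. Im (f x))"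
proof
  assume "harmonic_on S f"
  then show "harmonic_on S (\<lambda>x. Re (f x)) \<and> harmonic_on S (\<lambda>x. Im (f x))"
    using harmonic_on_bounded_linear[OF _ bounded_linear_Re] harmonic_on_bounded_linear[OF _ bounded_linear_Im] by blast
next
  assume *: "harmonic_on S (\<lambda>x. Re (f x)) \<and> harmonic_on S (\<lambda>x. Im (f x))"
  have bi: "bounded_linear (\<lambda>x. \<i> * complex_of_real x)"
    by (rule bounded_linear_const_mult[OF bounded_linear_of_real])
  have "harmonic_on S (\<lambda>x. complex_of_real (Re (f x)) + \<i> * complex_of_real (Im (f x)))"
    using * harmonic_on_bounded_linear[OF _ bounded_linear_of_real, of S "\<lambda>x. Re (f x)"]
      harmonic_on_bounded_linear[OF _ bi, of S "\<lambda>x. Im (f x)"] by (intro harmonic_on_add) blast+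
  then show "harmonic_on S f" by (simp flip: complex_eq)
qed

section \<open>The Poisson kernel\<close>

text \<open>Not normalized: its integral over the sphere is the total mass \<open>\<omega>\<close>.
  The kernel \<open>poisson\<close> is this one divided by \<open>\<omega>\<close>, as
  \<open>kern_one\<close> shows.\<close>

definition poisson_kernel :: "'a::euclidean_space \<Rightarrow> 'a \<Rightarrow> real" where
  "poisson_kernel x y = (1 - (norm x)^2) / norm (x - y) ^ DIM('a)"

lemma poisson_kernel_harmonic_grad:
  fixes y :: "'a::euclidean_space"
  assumes y: "norm y = 1"
  shows "\<exists>g J. harmonic_grad (ball 0 1) (\<lambda>x. poisson_kernel x y) g J"
proof -
  define N where "N = real DIM('a) / 2"
  define D where "D x = (x - y) \<bullet> (x - y)" for x
  \<comment> \<open>For |y| = 1 one has 1 - |x|^2 = - (|x - y|^2 + 2 (x - y) \<bullet> y). So the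
    kernel is built from powers of \<open>D\<close> and one affine function of x, which keeps both
    derivatives short.\<close>
  define f where "f x = - (D x powr (1 - N) + 2 * ((x - y) \<bullet> y) * D x powr (- N))" for x
  define g where "g x = - (((2 - 2 * N) * D x powr (- N)) *\<^sub>R (x - y) + (2 * D x powr (- N)) *\<^sub>R y
      - (4 * N * ((x - y) \<bullet> y) * D x powr (- N - 1)) *\<^sub>R (x - y))" for x
  define J where "J x h = - ((((2 - 2 * N) * D x powr (- N)) *\<^sub>R h + ((2 - 2 * N) * (2 * (- N) * D x powr (- N - 1) * ((x - y) \<bullet> h))) *\<^sub>R (x - y))
       + (2 * (2 * (- N) * D x powr (- N - 1) * ((x - y) \<bullet> h))) *\<^sub>R y
       - ((4 * N * ((x - y) \<bullet> y) * D x powr (- N - 1)) *\<^sub>R h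
         + (4 * N * ((x - y) \<bullet> y) * (2 * (- N - 1) * D x powr (- N - 1 - 1) * ((x - y) \<bullet> h)) + 4 * N * (h \<bullet> y) * D x powr (- N - 1)) *\<^sub>R (x - y)))" for x h
  have D0: "D x > 0" if "x \<in> ball 0 1" for x
    using that y by (auto simp: D_def)
  have dD: "(D has_derivative (\<lambda>h. 2 * ((x - y) \<bullet> h))) (at x)" for x
    unfolding D_def by (auto intro!: derivative_eq_intros simp: inner_commute)
  have dp: "((\<lambda>x. D x powr a) has_derivative (\<lambda>h. 2 * a * D x powr (a - 1) * ((x - y) \<bullet> h))) (at x)" if "x \<in> ball 0 1" for a x
  proof -
    have "((\<lambda>s. s powr a) has_real_derivative (a * D x powr (a - 1))) (at (D x))"
      using D0[OF that] by (rule has_real_derivative_powr)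
    from DERIV_compose_FDERIV[OF this dD] show ?thesis
      by (rule has_derivative_eq_rhs) (auto simp: fun_eq_iff)
  qed
  have cD: "continuous_on S (\<lambda>x. D x)" for S unfolding D_def by (intro continuous_intros)
  have cp: "continuous_on (ball 0 1) (\<lambda>x. D x powr a)" for a
    by (intro continuous_on_powr cD continuous_on_const) (use D0 in force)
  have fP: "f x = poisson_kernel x y" if "x \<in> ball 0 1" for x
  proof -
    have "D x powr (1 - N) = D x * D x powr (- N)"
      using D0[OF that] by (simp add: powr_diff powr_minus divide_inverse)
    then have "f x = - (D x + 2 * ((x - y) \<bullet> y)) * D x powr (- N)"
      by (simp add: f_def algebra_simps)
    also have "y \<bullet> y = 1" using y by (simp add: dot_square_norm)
    then have "- (D x + 2 * ((x - y) \<bullet> y)) = 1 - x \<bullet> x"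
      by (simp add: D_def inner_diff_left inner_diff_right inner_commute)
    also have "1 - x \<bullet> x = 1 - (norm x)^2" by (simp add: dot_square_norm)
    also have "D x powr (- N) = 1 / norm (x - y) ^ DIM('a)"
    proof -
      have n0: "norm (x - y) > 0" using D0[OF that] by (auto simp: D_def)
      have "D x = norm (x - y) powr real 2" using n0 powr_realpow[OF n0, of 2] by (simp add: D_def dot_square_norm)
      then have "D x powr (- N) = (norm (x - y) powr real 2) powr (- N)" by (simp only:)
      also have "\<dots> = norm (x - y) powr (real 2 * - N)" by (rule powr_powr)
      also have "real 2 * - N = - real DIM('a)" by (simp add: N_def)
      finally show ?thesis using n0 by (simp add: powr_minus powr_realpow divide_inverse)
    qed
    finally show ?thesis by (simp add: poisson_kernel_def)
  qed
  have "harmonic_grad (ball 0 1) f g J"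
    unfolding harmonic_grad_def
  proof (intro conjI ballI)
    fix x :: 'a assume x: "x \<in> ball 0 1"
    have xy: "((\<lambda>x. x - y) has_derivative (\<lambda>h. h)) (at x)" by (auto intro!: derivative_eq_intros)
    have L: "((\<lambda>x. c * ((x - y) \<bullet> y)) has_derivative (\<lambda>h. c * (h \<bullet> y))) (at x)" for c
      by (rule has_derivative_mult_right[OF has_derivative_inner_left[OF xy]])
    have "(f has_derivative (\<lambda>h. - (2 * (1 - N) * D x powr (1 - N - 1) * ((x - y) \<bullet> h) +
        (2 * ((x - y) \<bullet> y) * (2 * (- N) * D x powr (- N - 1) * ((x - y) \<bullet> h)) + 2 * (h \<bullet> y) * D x powr (- N))))) (at x)"
      unfolding f_def
      by (rule has_derivative_minus[OF has_derivative_add[OF dp[OF x, of "1 - N"] has_derivative_mult[OF L[of 2] dp[OF x, of "- N"]]]])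
    then show "(f has_derivative (\<lambda>h. g x \<bullet> h)) (at x)"
    proof (rule has_derivative_eq_rhs)
      define z where "z = x - y"
      define A B where "A = D x powr (- N)" and "B = D x powr (- N - 1)"
      have gx: "g x = - (((2 - 2 * N) * A) *\<^sub>R z + (2 * A) *\<^sub>R y - (4 * N * (z \<bullet> y) * B) *\<^sub>R z)"
        by (simp add: g_def z_def A_def B_def)
      have "- (2 * (1 - N) * A * (z \<bullet> h) + (2 * (z \<bullet> y) * (2 * (- N) * B * (z \<bullet> h)) + 2 * (h \<bullet> y) * A)) = g x \<bullet> h" for h
        unfolding gx inner_minus_left inner_add_left inner_diff_left inner_scaleR_left inner_commute[of h y]
        by (simp add: algebra_simps)
      then show "(\<lambda>h. - (2 * (1 - N) * D x powr (1 - N - 1) * ((x - y) \<bullet> h) +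
        (2 * ((x - y) \<bullet> y) * (2 * (- N) * D x powr (- N - 1) * ((x - y) \<bullet> h)) + 2 * (h \<bullet> y) * D x powr (- N)))) = (\<lambda>h. g x \<bullet> h)"
        by (simp add: A_def B_def z_def)
    qed
    have 1: "((\<lambda>x. (2 - 2 * N) * D x powr (- N)) has_derivative (\<lambda>h. (2 - 2 * N) * (2 * (- N) * D x powr (- N - 1) * ((x - y) \<bullet> h)))) (at x)"
      by (rule has_derivative_mult_right[OF dp[OF x]])
    have 2: "((\<lambda>x. 2 * D x powr (- N)) has_derivative (\<lambda>h. 2 * (2 * (- N) * D x powr (- N - 1) * ((x - y) \<bullet> h)))) (at x)"
      by (rule has_derivative_mult_right[OF dp[OF x]])
    have 3: "((\<lambda>x. 4 * N * ((x - y) \<bullet> y) * D x powr (- N - 1)) has_derivative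
        (\<lambda>h. 4 * N * ((x - y) \<bullet> y) * (2 * (- N - 1) * D x powr (- N - 1 - 1) * ((x - y) \<bullet> h)) + 4 * N * (h \<bullet> y) * D x powr (- N - 1))) (at x)"
      by (rule has_derivative_mult[OF L[of "4 * N"] dp[OF x, of "- N - 1"]])
    have "(g has_derivative (\<lambda>h. - ((((2 - 2 * N) * D x powr (- N)) *\<^sub>R h + ((2 - 2 * N) * (2 * (- N) * D x powr (- N - 1) * ((x - y) \<bullet> h))) *\<^sub>R (x - y))
       + (2 * (2 * (- N) * D x powr (- N - 1) * ((x - y) \<bullet> h))) *\<^sub>R y
       - ((4 * N * ((x - y) \<bullet> y) * D x powr (- N - 1)) *\<^sub>R h
         + (4 * N * ((x - y) \<bullet> y) * (2 * (- N - 1) * D x powr (- N - 1 - 1) * ((x - y) \<bullet> h)) + 4 * N * (h \<bullet> y) * D x powr (- N - 1)) *\<^sub>R (x - y))))) (at x)"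
      unfolding g_def
      by (rule has_derivative_minus[OF has_derivative_diff[OF has_derivative_add[OF has_derivative_scaleR[OF 1 xy]
           has_derivative_scaleR_left[OF 2]] has_derivative_scaleR[OF 3 xy]]])
    then show "(g has_derivative J x) (at x)"
      by (simp only: J_def[abs_def])
    have e: "(\<Sum>i\<in>Basis. (a \<bullet> i) * (b \<bullet> i)) = a \<bullet> b" for a b :: 'a by (rule euclidean_inner[symmetric])
    define z where "z = x - y"
    define A B C where "A = D x powr (- N)" and "B = D x powr (- N - 1)" and "C = D x powr (- N - 1 - 1)"
    \<comment> \<open>Lowering the exponent by one divides by \<open>D\<close>. With 2 * N = n,
      these two relations make all terms of the trace cancel.\<close>
    have BD: "B * (z \<bullet> z) = A" and CD: "C * (z \<bullet> z) = B"
    proof -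
      have "D x powr (a - 1) * D x = D x powr a" for a
        using powr_mult_base[of "D x" "a - 1"] D0[OF x] by (simp add: mult.commute)
      then show "B * (z \<bullet> z) = A" "C * (z \<bullet> z) = B"
        unfolding A_def B_def C_def z_def D_def[symmetric] by blast+
    qed
    have "J x i \<bullet> i = - ((2 - 2 * N) * A - (2 - 2 * N) * (2 * N) * B * ((z \<bullet> i) * (z \<bullet> i)) - 4 * N * B * ((z \<bullet> i) * (y \<bullet> i))
         - (4 * N * (z \<bullet> y) * B + 4 * N * B * ((z \<bullet> i) * (y \<bullet> i)) - 8 * N * (N + 1) * C * (z \<bullet> y) * ((z \<bullet> i) * (z \<bullet> i))))"
      if "i \<in> Basis" for i
      using that unfolding J_def A_def[symmetric] B_def[symmetric] C_def[symmetric] z_def[symmetric]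
      unfolding inner_minus_left inner_add_left inner_diff_left inner_scaleR_left inner_commute[of i y] inner_same_Basis[OF that]
      by (simp add: algebra_simps)
    then have "(\<Sum>i\<in>Basis. J x i \<bullet> i) = (\<Sum>i\<in>Basis. - ((2 - 2 * N) * A - (2 - 2 * N) * (2 * N) * B * ((z \<bullet> i) * (z \<bullet> i)) - 4 * N * B * ((z \<bullet> i) * (y \<bullet> i))
         - (4 * N * (z \<bullet> y) * B + 4 * N * B * ((z \<bullet> i) * (y \<bullet> i)) - 8 * N * (N + 1) * C * (z \<bullet> y) * ((z \<bullet> i) * (z \<bullet> i)))))"
      by (rule sum.cong[OF refl])
    also have "\<dots> = - (real DIM('a) * ((2 - 2 * N) * A) - (2 - 2 * N) * (2 * N) * B * (z \<bullet> z) - 4 * N * B * (z \<bullet> y)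
         - (real DIM('a) * (4 * N * (z \<bullet> y) * B) + 4 * N * B * (z \<bullet> y) - 8 * N * (N + 1) * C * (z \<bullet> y) * (z \<bullet> z)))"
      unfolding sum_negf sum_subtractf sum.distrib sum_distrib_left[symmetric] e by simp
    also have "\<dots> = - (2 * N * ((2 - 2 * N) * A) - (2 - 2 * N) * (2 * N) * (B * (z \<bullet> z)) - 4 * N * B * (z \<bullet> y)
         - (2 * N * (4 * N * (z \<bullet> y) * B) + 4 * N * B * (z \<bullet> y) - 8 * N * (N + 1) * (z \<bullet> y) * (C * (z \<bullet> z))))"
      by (simp add: N_def mult_ac)
    also have "\<dots> = 0" unfolding BD CD by (simp add: algebra_simps)
    finally show "(\<Sum>i\<in>Basis. J x i \<bullet> i) = 0" .
  next
    fix i :: 'a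
    show "continuous_on (ball 0 1) (\<lambda>x. J x i)"
      unfolding J_def by (intro continuous_on_minus continuous_on_add continuous_on_diff continuous_on_scaleR
        continuous_on_mult continuous_on_inner cp continuous_on_const continuous_on_id)
  qed
  then have hg: "\<And>x. x \<in> ball 0 1 \<Longrightarrow> (f has_derivative (\<lambda>h. g x \<bullet> h)) (at x)"
    and rest: "(\<forall>x\<in>ball 0 1. (g has_derivative J x) (at x)) \<and>
      (\<forall>i\<in>Basis. continuous_on (ball 0 1) (\<lambda>x. J x i)) \<and> (\<forall>x\<in>ball 0 1. (\<Sum>i\<in>Basis. J x i \<bullet> i) = 0)"
    unfolding harmonic_grad_def by blast+
  have "((\<lambda>x. poisson_kernel x y) has_derivative (\<lambda>h. g x \<bullet> h)) (at x)" if "x \<in> ball 0 1" for x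
    by (rule has_derivative_transform_within_open[OF hg[OF that] open_ball that fP])
  with rest have "harmonic_grad (ball 0 1) (\<lambda>x. poisson_kernel x y) g J"
    unfolding harmonic_grad_def by blast
  then show ?thesis by blast
qed

section \<open>The sphere with a fixed measure and basis\<close>

lemma scale_measure_eq_density: "scale_measure c M = density M (\<lambda>_. c)"
  by (rule measure_eqI) (auto simp: emeasure_density_const)

locale sphere_basis =
  fixes \<sigma> :: "'a::euclidean_space measure"
    and Y :: "nat \<Rightarrow> nat \<Rightarrow> 'a \<Rightarrow> real"
    and \<kappa> :: real
  assumes dim: "DIM('a) \<ge> 2"
    and \<kappa>: "\<kappa> > 0" and \<sigma>_eq: "\<sigma> = scale_measure (ennreal \<kappa>) surface_measure"
    and basis: "spherical_harmonic_basis \<sigma> Y"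
begin

definition \<omega> :: real where "\<omega> = measure \<sigma> (sphere 0 1)"

lemma sets_\<sigma> [measurable_cong]: "sets \<sigma> = sets (restrict_space borel (sphere 0 1))"
  by (simp add: \<sigma>_eq sets_surface_measure)

lemma space_\<sigma> [simp]: "space \<sigma> = sphere 0 1"
  by (simp add: \<sigma>_eq space_scale_measure)

lemma integral_\<sigma>:
  fixes f :: "'a \<Rightarrow> 'b::{banach,second_countable_topology}"
  assumes "f \<in> borel_measurable \<sigma>"
  shows "integral\<^sup>L \<sigma> f = \<kappa> *\<^sub>R integral\<^sup>L surface_measure f"
proof -
  have "f \<in> borel_measurable surface_measure"
    using assms measurable_cong_sets[OF sets_\<sigma> refl] measurable_cong_sets[OF sets_surface_measure refl] by blast
  then show ?thesis
    unfolding \<sigma>_eq scale_measure_eq_density using \<kappa> by (subst integral_density) auto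
qed

lemma finite_\<sigma>: "finite_measure \<sigma>"
  using finite_measure.emeasure_finite[OF finite_surface_measure, of "sphere (0::'a) 1"]
  by (intro finite_measureI) (simp add: \<sigma>_eq ennreal_mult_eq_top_iff space_scale_measure)

sublocale finite_measure \<sigma> by (rule finite_\<sigma>)

lemma meas_\<sigma>: 
  fixes f :: "'a \<Rightarrow> 'b::topological_space"
  assumes "continuous_on (sphere 0 1) f" shows "f \<in> borel_measurable \<sigma>"
  using borel_measurable_continuous_on_restrict[OF assms] measurable_cong_sets[OF sets_\<sigma> refl] by blast

lemma integrable_\<sigma>:
  fixes f :: "'a \<Rightarrow> 'b::{banach,second_countable_topology}"
  assumes "continuous_on (sphere 0 1) f" shows "integrable \<sigma> f"
proof -
  have "bounded (f ` sphere 0 1)"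
    using assms by (intro compact_imp_bounded compact_continuous_image) auto
  then obtain B where "\<And>y. norm y = 1 \<Longrightarrow> norm (f y) \<le> B" unfolding bounded_iff by fastforce
  then show ?thesis
    using meas_\<sigma>[OF assms] by (intro integrable_const_bound[of _ B]) auto
qed

lemma integral_\<sigma>_eq_0D:
  fixes u :: "'a \<Rightarrow> real"
  assumes u: "continuous_on (sphere 0 1) u" and "\<And>y. norm y = 1 \<Longrightarrow> 0 \<le> u y" "(\<integral>y. u y \<partial>\<sigma>) = 0" "norm y = 1"
  shows "u y = 0"
proof (rule integral_surface_eq_0D[OF u assms(2) _ assms(4)])
  show "(\<integral>y. u y \<partial>surface_measure) = 0"
    using integral_\<sigma>[OF meas_\<sigma>[OF u]] assms(3) \<kappa> by simp
qed

lemma measure_\<sigma> [simp]: "measure \<sigma> (sphere 0 1) = \<omega>"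
  by (simp only: \<omega>_def)

lemma \<omega>_pos: "\<omega> > 0"
proof -
  obtain b :: 'a where "b \<in> Basis" by (meson nonempty_Basis ex_in_conv)
  then have "norm b = 1" by simp
  have "\<omega> \<noteq> 0"
  proof
    assume "\<omega> = 0"
    then have "(\<integral>y. 1 \<partial>\<sigma>) = (0::real)" by simp
    from integral_\<sigma>_eq_0D[OF continuous_on_const _ this \<open>norm b = 1\<close>] show False by simp
  qed
  moreover have "0 \<le> \<omega>" unfolding \<omega>_def by (rule measure_nonneg)
  ultimately show ?thesis by simp
qed

text \<open>The solid harmonic whose restriction is \<open>Y k j\<close>. As \<open>Y k j\<close> is
  zero off the sphere, statements about points inside the ball are made with
  \<open>H\<close>.\<close>

definition H :: "nat \<Rightarrow> nat \<Rightarrow> 'a \<Rightarrow> real" where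
  "H k j = (SOME p. Y k j = (\<lambda>x. if x \<in> sphere 0 1 then p x else 0) \<and>
     real_polynomial_function p \<and> (\<forall>t x. p (t *\<^sub>R x) = t ^ k * p x) \<and> harmonic_on UNIV p)"

lemma H:
  assumes "j \<in> {1..sph_dim TYPE('a) k}"
  shows Y_eq_H: "\<And>x. norm x = 1 \<Longrightarrow> Y k j x = H k j x" and H_hom: "\<And>t x. H k j (t *\<^sub>R x) = t ^ k * H k j x"
    and H_harmonic: "harmonic_on UNIV (H k j)"
proof -
  have "\<exists>p. Y k j = (\<lambda>x. if x \<in> sphere 0 1 then p x else 0) \<and>
     real_polynomial_function p \<and> (\<forall>t x. p (t *\<^sub>R x) = t ^ k * p x) \<and> harmonic_on UNIV p"
    using basis assms unfolding spherical_harmonic_basis_def spherical_harmonics_def by blast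
  from someI_ex[OF this, folded H_def]
  show "\<And>x. norm x = 1 \<Longrightarrow> Y k j x = H k j x" "\<And>t x. H k j (t *\<^sub>R x) = t ^ k * H k j x" "harmonic_on UNIV (H k j)"
    by auto
qed

lemma harmonic_on_continuous:
  fixes f :: "'a \<Rightarrow> 'b::real_normed_vector"
  assumes "harmonic_on S f" shows "continuous_on S f"
proof -
  obtain f' :: "'a \<Rightarrow> 'a \<Rightarrow>\<^sub>L 'b" where f': "\<And>x. x \<in> S \<Longrightarrow> (f has_derivative blinfun_apply (f' x)) (at x)"
    using assms unfolding harmonic_on_def by blast
  show ?thesis
    by (rule has_derivative_continuous_on[OF has_derivative_at_withinI[OF f']])
qed

lemma H_continuous: "j \<in> {1..sph_dim TYPE('a) k} \<Longrightarrow> continuous_on S (H k j)"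
  using harmonic_on_continuous[OF H_harmonic] continuous_on_subset by blast

lemma Y_continuous: "j \<in> {1..sph_dim TYPE('a) k} \<Longrightarrow> continuous_on (sphere 0 1) (Y k j)"
  by (rule continuous_on_eq[OF H_continuous[of j k]]) (auto simp: Y_eq_H)

lemma unit_dir: "norm (unit_dir x :: 'a) = 1"
proof (cases "x = 0")
  case True
  obtain b :: 'a where "b \<in> Basis" by (meson nonempty_Basis ex_in_conv)
  then have "\<exists>u::'a. u \<in> sphere 0 1" by (intro exI[of _ b]) simp
  from someI_ex[OF this] True show ?thesis by (simp add: unit_dir_def)
qed (simp add: unit_dir_def norm_sgn)

lemma norm_scaleR_unit_dir: "norm x *\<^sub>R unit_dir x = (x :: 'a)"
  by (cases "x = 0") (simp_all add: unit_dir_def sgn_div_norm)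

lemma H_polar: "j \<in> {1..sph_dim TYPE('a) k} \<Longrightarrow> norm x ^ k * Y k j (unit_dir x) = H k j x"
  using H_hom[of j k "norm x" "unit_dir x"] by (simp add: Y_eq_H unit_dir norm_scaleR_unit_dir)

lemma Y_orthonormal:
  "i \<in> {1..sph_dim TYPE('a) k} \<Longrightarrow> j \<in> {1..sph_dim TYPE('a) l} \<Longrightarrow> (\<integral>x. Y k i x * Y l j x \<partial>\<sigma>) = (if k = l \<and> i = j then 1 else 0)"
  using basis unfolding spherical_harmonic_basis_def by blast

lemma coefficient_power:
  fixes f :: "'a \<Rightarrow> real"
  assumes f: "harmonic_on (ball 0 1) f" and h: "harmonic_on UNIV h"
    and hom: "\<And>t x. h (t *\<^sub>R x) = t ^ k * h x"
  shows "\<exists>b. \<forall>r\<in>{0..<1}. (\<integral>y. f (r *\<^sub>R y) * h y \<partial>\<sigma>) = b * r ^ k"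
proof -
  obtain b where b: "\<forall>r\<in>{0..<1}. (\<integral>y. f (r *\<^sub>R y) * h y \<partial>surface_measure) = b * r ^ k"
    using harmonic_sphere_coefficient[OF f h hom] by blast
  have "(\<integral>y. f (r *\<^sub>R y) * h y \<partial>\<sigma>) = (\<kappa> * b) * r ^ k" if "r \<in> {0..<1}" for r
  proof -
    have "continuous_on (sphere 0 1) (\<lambda>y. f (r *\<^sub>R y) * h y)"
    proof (rule continuous_on_mult)
      show "continuous_on (sphere 0 1) (\<lambda>y. f (r *\<^sub>R y))"
        by (rule continuous_on_compose2[OF harmonic_on_continuous[OF f]]) (use that in \<open>auto intro!: continuous_intros\<close>)
      show "continuous_on (sphere 0 1) h"
        by (rule continuous_on_subset[OF harmonic_on_continuous[OF h]]) simp
    qed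
    from integral_\<sigma>[OF meas_\<sigma>[OF this]] b that show ?thesis by simp
  qed
  then show ?thesis by blast
qed

section \<open>Boundary behaviour and coefficients of the Poisson kernel\<close>

lemma poisson_kernel_harmonic: "norm y = 1 \<Longrightarrow> harmonic_on (ball 0 1) (\<lambda>x. poisson_kernel x y)"
  using poisson_kernel_harmonic_grad harmonic_on_grad by blast

lemma poisson_kernel_sphere_continuous:
  assumes "0 \<le> r" "r < 1"
  shows "continuous_on (sphere (0::'a) 1 \<times> sphere (0::'a) 1) (\<lambda>z. poisson_kernel (r *\<^sub>R fst z) (snd z))"
  unfolding poisson_kernel_def
proof (rule continuous_on_divide)
  show "continuous_on (sphere (0::'a) 1 \<times> sphere (0::'a) 1) (\<lambda>z. 1 - (norm (r *\<^sub>R fst z))\<^sup>2)"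
    "continuous_on (sphere (0::'a) 1 \<times> sphere (0::'a) 1) (\<lambda>z. norm (r *\<^sub>R fst z - snd z) ^ DIM('a))"
    by (intro continuous_intros)+
  show "\<forall>z\<in>sphere (0::'a) 1 \<times> sphere (0::'a) 1. norm (r *\<^sub>R fst z - snd z) ^ DIM('a) \<noteq> 0"
  proof
  fix z assume "z \<in> sphere (0::'a) 1 \<times> sphere (0::'a) 1"
  then have "norm (r *\<^sub>R fst z) < norm (snd z)" using assms by auto
  then have "r *\<^sub>R fst z \<noteq> snd z" by (metis less_irrefl)
  then show "norm (r *\<^sub>R fst z - snd z) ^ DIM('a) \<noteq> 0" by simp
  qed
qed

lemma poisson_kernel_continuous:
  fixes y :: 'a
  assumes "0 \<le> r" "r < 1" "norm y = 1"
  shows "continuous_on (sphere 0 1) (\<lambda>x. poisson_kernel (r *\<^sub>R x) y)"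
proof -
  have "continuous_on (sphere 0 1) (\<lambda>x. (x, y))" by (intro continuous_intros)
  moreover have "(\<lambda>x. (x, y)) ` sphere 0 1 \<subseteq> sphere 0 1 \<times> sphere 0 1" using assms by auto
  ultimately show ?thesis
    using continuous_on_compose2[OF poisson_kernel_sphere_continuous[OF assms(1,2)]] by fastforce
qed

lemma poisson_kernel_nonneg: "norm x \<le> 1 \<Longrightarrow> 0 \<le> poisson_kernel x y"
  by (simp add: poisson_kernel_def power_le_one)

lemma poisson_kernel_le:
  fixes x y :: 'a
  assumes "norm x \<le> 1" "0 < e" "e \<le> norm (x - y)"
  shows "poisson_kernel x y \<le> (1 - (norm x)^2) / e ^ DIM('a)"
  unfolding poisson_kernel_def using assms by (intro divide_left_mono power_mono mult_pos_pos zero_less_power) (auto simp: power_le_one)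

text \<open>The coefficient of order zero does not depend on the radius, and at the centre the
  kernel equals 1.\<close>

lemma poisson_kernel_integral:
  assumes r: "0 \<le> r" "r < 1" and y: "norm y = 1"
  shows "(\<integral>x. poisson_kernel (r *\<^sub>R x) y \<partial>\<sigma>) = \<omega>"
proof -
  have "harmonic_on UNIV (\<lambda>_::'a. 1::real)"
    by (rule harmonic_on_grad[of _ _ "\<lambda>_. 0" "\<lambda>_ _. 0"]) (simp add: harmonic_grad_def)
  from coefficient_power[OF poisson_kernel_harmonic[OF y] this, of 0] obtain b
    where b: "\<And>r. r \<in> {0..<1} \<Longrightarrow> (\<integral>x. poisson_kernel (r *\<^sub>R x) y \<partial>\<sigma>) = b"
    by auto
  have "b = \<omega>" using b[of 0] y by (simp add: poisson_kernel_def)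
  then show ?thesis using b[of r] r by simp
qed

lemma poisson_kernel_approximate_identity:
  assumes u: "continuous_on (sphere 0 1) u" and y: "norm y = 1"
  shows "((\<lambda>r. \<integral>x. poisson_kernel (r *\<^sub>R x) y * u x \<partial>\<sigma>) \<longlongrightarrow> \<omega> * u y) (at_left 1)"
proof (rule tendstoI)
  fix e :: real assume e: "e > 0"
  have "bounded (u ` sphere 0 1)"
    using u by (intro compact_imp_bounded compact_continuous_image) auto
  then obtain B where B: "\<And>y. norm y = 1 \<Longrightarrow> \<bar>u y\<bar> \<le> B" unfolding bounded_iff by fastforce
  have B0: "0 \<le> B" using B[OF y] by linarith
  define e' where "e' = e / (2 * \<omega>)"
  have e': "e' > 0" using e \<omega>_pos by (simp add: e'_def)
  obtain \<delta> where \<delta>: "\<delta> > 0" "\<And>x. norm x = 1 \<Longrightarrow> dist x y < \<delta> \<Longrightarrow> \<bar>u x - u y\<bar> < e'"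
    using u y e' unfolding continuous_on_iff dist_real_def by fastforce
  \<comment> \<open>Away from y, |x - y| \<ge> \<delta> and 1 - r \<le> \<delta>/2 give |r x - y|
    \<ge> \<delta>/2. \<open>K\<close> collects this bound, the oscillation 2 * B and the total
    mass. The part near y costs e' * \<omega> = e/2.\<close>
  define K where "K = 2 * B * \<omega> / (\<delta> / 2) ^ DIM('a)"
  have bd: "\<bar>(\<integral>x. poisson_kernel (r *\<^sub>R x) y * u x \<partial>\<sigma>) - \<omega> * u y\<bar> \<le> e / 2 + K * (1 - r^2)"
    if r: "0 \<le> r" "r < 1" "1 - r \<le> \<delta> / 2" for r
  proof -
    note cP = poisson_kernel_continuous[OF r(1,2) y]
    have "(\<integral>x. poisson_kernel (r *\<^sub>R x) y * u x \<partial>\<sigma>) - \<omega> * u y = (\<integral>x. poisson_kernel (r *\<^sub>R x) y * (u x - u y) \<partial>\<sigma>)"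
      using integrable_\<sigma>[OF continuous_on_mult[OF cP u]] integrable_\<sigma>[OF cP] poisson_kernel_integral[OF r(1,2) y]
      by (simp add: right_diff_distrib)
    also have "\<bar>\<dots>\<bar> \<le> (\<integral>x. \<bar>poisson_kernel (r *\<^sub>R x) y * (u x - u y)\<bar> \<partial>\<sigma>)"
      by (rule integral_abs_bound)
    also have "\<dots> \<le> (\<integral>x. e' * poisson_kernel (r *\<^sub>R x) y + 2 * B * ((1 - r^2) / (\<delta> / 2) ^ DIM('a)) \<partial>\<sigma>)"
    proof (rule integral_mono)
      show "integrable \<sigma> (\<lambda>x. \<bar>poisson_kernel (r *\<^sub>R x) y * (u x - u y)\<bar>)"
        by (intro integrable_\<sigma> continuous_intros cP u)
      show "integrable \<sigma> (\<lambda>x. e' * poisson_kernel (r *\<^sub>R x) y + 2 * B * ((1 - r^2) / (\<delta> / 2) ^ DIM('a)))"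
        by (intro integrable_\<sigma> continuous_intros cP) (use \<delta> in auto)
      fix x assume "x \<in> space \<sigma>"
      then have x: "norm x = 1" by simp
      have P0: "0 \<le> poisson_kernel (r *\<^sub>R x) y" using r x by (intro poisson_kernel_nonneg) auto
      have nn: "0 \<le> 2 * B * ((1 - r^2) / (\<delta> / 2) ^ DIM('a))"
        using B0 r \<delta> by (auto simp: power_le_one)
      show "\<bar>poisson_kernel (r *\<^sub>R x) y * (u x - u y)\<bar> \<le> e' * poisson_kernel (r *\<^sub>R x) y + 2 * B * ((1 - r^2) / (\<delta> / 2) ^ DIM('a))"
      proof (cases "dist x y < \<delta>")
        case True
        then have "\<bar>poisson_kernel (r *\<^sub>R x) y * (u x - u y)\<bar> \<le> poisson_kernel (r *\<^sub>R x) y * e'"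
          using \<delta>(2)[OF x True] P0 by (simp add: abs_mult mult_left_mono)
        then show ?thesis using nn by (simp add: mult.commute)
      next
        case False
        have "dist x y \<le> norm (x - r *\<^sub>R x) + norm (r *\<^sub>R x - y)"
          using norm_triangle_ineq[of "x - r *\<^sub>R x" "r *\<^sub>R x - y"] by (simp add: dist_norm)
        also have "norm (x - r *\<^sub>R x) = 1 - r"
          using x r norm_scaleR[of "1 - r" x] by (simp add: scaleR_diff_left)
        finally have "\<delta> / 2 \<le> norm (r *\<^sub>R x - y)" using False r by simp
        then have "poisson_kernel (r *\<^sub>R x) y \<le> (1 - (norm (r *\<^sub>R x))^2) / (\<delta> / 2) ^ DIM('a)"
          using r x \<delta> by (intro poisson_kernel_le) auto
        moreover have "\<bar>u x - u y\<bar> \<le> 2 * B" using B[OF x] B[OF y] by linarith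
        ultimately have "\<bar>poisson_kernel (r *\<^sub>R x) y * (u x - u y)\<bar> \<le> (1 - r^2) / (\<delta> / 2) ^ DIM('a) * (2 * B)"
          unfolding abs_mult using P0 x by (intro mult_mono) (auto simp: power_mult_distrib)
        then show ?thesis using P0 e' by (simp add: mult.commute add_increasing)
      qed
    qed
    also have "\<dots> = e' * \<omega> + 2 * B * ((1 - r^2) / (\<delta> / 2) ^ DIM('a)) * \<omega>"
      using integrable_\<sigma>[OF cP] poisson_kernel_integral[OF r(1,2) y] by (subst Bochner_Integration.integral_add) auto
    also have "\<dots> = e / 2 + K * (1 - r^2)" using \<omega>_pos by (simp add: e'_def K_def)
    finally show ?thesis .
  qed
  have "((\<lambda>r::real. e / 2 + K * (1 - r^2)) \<longlongrightarrow> e / 2 + K * (1 - 1^2)) (at_left 1)"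
    by (intro tendsto_intros)
  then have "eventually (\<lambda>r. e / 2 + K * (1 - r^2) < e) (at_left 1)"
    using e by (intro order_tendstoD(2)[where y = "e/2 + K * (1 - 1^2)"]) auto
  moreover have "eventually (\<lambda>r::real. r \<in> {max 0 (1 - \<delta> / 2)<..<1}) (at_left 1)"
    using \<delta> by (intro eventually_at_left_real) auto
  ultimately show "eventually (\<lambda>r. dist (\<integral>x. poisson_kernel (r *\<^sub>R x) y * u x \<partial>\<sigma>) (\<omega> * u y) < e) (at_left 1)"
  proof eventually_elim
    case (elim r)
    then show ?case using bd[of r] by (auto simp: dist_real_def)
  qed
qed

text \<open>The coefficient is a constant times \<open>r ^ k\<close>; letting r tend to 1 identifies
  the constant, since the kernels form an approximate identity.\<close>

lemma poisson_kernel_coefficient: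
  assumes j: "j \<in> {1..sph_dim TYPE('a) k}" and r: "0 \<le> r" "r < 1" and y: "norm y = 1"
  shows "(\<integral>x. poisson_kernel (r *\<^sub>R x) y * Y k j x \<partial>\<sigma>) = \<omega> * Y k j y * r ^ k"
proof -
  obtain b where b: "\<And>r. r \<in> {0..<1} \<Longrightarrow> (\<integral>x. poisson_kernel (r *\<^sub>R x) y * H k j x \<partial>\<sigma>) = b * r ^ k"
    using coefficient_power[OF poisson_kernel_harmonic[OF y] H_harmonic[OF j] H_hom[OF j]] by blast
  have eq: "(\<integral>x. poisson_kernel (r *\<^sub>R x) y * H k j x \<partial>\<sigma>) = (\<integral>x. poisson_kernel (r *\<^sub>R x) y * Y k j x \<partial>\<sigma>)" for r
    by (rule Bochner_Integration.integral_cong) (auto simp: Y_eq_H[OF j])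
  have lim: "((\<lambda>r. \<integral>x. poisson_kernel (r *\<^sub>R x) y * Y k j x \<partial>\<sigma>) \<longlongrightarrow> \<omega> * Y k j y) (at_left 1)"
    by (rule poisson_kernel_approximate_identity[OF Y_continuous[OF j] y])
  have ev: "eventually (\<lambda>r. (\<integral>x. poisson_kernel (r *\<^sub>R x) y * Y k j x \<partial>\<sigma>) = b * r ^ k) (at_left 1)"
    using eventually_at_left_real[of 0 "1::real"] by (rule eventually_mono) (use b eq in auto)
  have "((\<lambda>r. b * r ^ k) \<longlongrightarrow> \<omega> * Y k j y) (at_left 1)"
    using lim unfolding tendsto_cong[OF ev] .
  moreover have "((\<lambda>r::real. b * r ^ k) \<longlongrightarrow> b * 1 ^ k) (at_left 1)" by (intro tendsto_intros)
  ultimately have "b = \<omega> * Y k j y"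
    using tendsto_unique[OF trivial_limit_at_left_real] by fastforce
  then show ?thesis using b[of r] r eq by simp
qed

text \<open>The reproducing kernel of the spherical harmonics of order k (the zonal
  harmonic).\<close>

definition Z :: "nat \<Rightarrow> 'a \<Rightarrow> 'a \<Rightarrow> real" where
  "Z k x y = (\<Sum>j=1..sph_dim TYPE('a) k. Y k j x * Y k j y)"

lemma Z_continuous: "continuous_on (sphere 0 1) (\<lambda>x. Z k x y)"
  unfolding Z_def by (intro continuous_intros Y_continuous)

lemma Z_diag_nonneg: "0 \<le> Z k y y"
  unfolding Z_def by (intro sum_nonneg) auto

text \<open>Bessel's inequality: \<open>v\<close> is the projection of the Poisson kernel onto order
  k, with squared norm \<omega>^2 r^(2k) Z k y y, while the kernel itself is at most 1 / (1 -
  r)^n.\<close>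

lemma Z_diag_le:
  assumes r: "0 \<le> r" "r < 1" and y: "norm y = 1"
  shows "\<omega> * Z k y y * (r ^ k)^2 \<le> 1 / (1 - r) ^ (2 * DIM('a))"
proof -
  note cP = poisson_kernel_continuous[OF r y]
  define v where "v x = (\<omega> * r ^ k) * Z k x y" for x
  have cv: "continuous_on (sphere 0 1) v" unfolding v_def by (rule continuous_on_mult[OF continuous_on_const Z_continuous])
  have iY: "integrable \<sigma> (\<lambda>x. Y k i x * Y k j x)" if "i \<in> {1..sph_dim TYPE('a) k}" "j \<in> {1..sph_dim TYPE('a) k}" for i j
    by (rule integrable_\<sigma>[OF continuous_on_mult[OF Y_continuous[OF that(1)] Y_continuous[OF that(2)]]])
  have iPY: "integrable \<sigma> (\<lambda>x. poisson_kernel (r *\<^sub>R x) y * Y k j x)" if "j \<in> {1..sph_dim TYPE('a) k}" for j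
    by (rule integrable_\<sigma>[OF continuous_on_mult[OF cP Y_continuous[OF that]]])
  have vv: "(\<integral>x. v x * v x \<partial>\<sigma>) = \<omega>^2 * (r ^ k)^2 * Z k y y"
  proof -
    have "(\<integral>x. v x * v x \<partial>\<sigma>) = (\<omega> * r ^ k)^2 * (\<integral>x. Z k x y * Z k x y \<partial>\<sigma>)"
      unfolding v_def by (simp add: power2_eq_square mult_ac flip: integral_mult_right_zero)
    also have "(\<integral>x. Z k x y * Z k x y \<partial>\<sigma>) = (\<integral>x. (\<Sum>i=1..sph_dim TYPE('a) k. \<Sum>j=1..sph_dim TYPE('a) k. Y k i y * Y k j y * (Y k i x * Y k j x)) \<partial>\<sigma>)"
      unfolding Z_def sum_product by (simp add: mult_ac)
    also have "\<dots> = (\<Sum>i=1..sph_dim TYPE('a) k. \<Sum>j=1..sph_dim TYPE('a) k. Y k i y * Y k j y * (\<integral>x. Y k i x * Y k j x \<partial>\<sigma>))"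
      by (subst Bochner_Integration.integral_sum, intro Bochner_Integration.integrable_sum integrable_mult_right iY, assumption+,
          intro sum.cong refl, subst Bochner_Integration.integral_sum, intro integrable_mult_right iY, assumption+, simp)
    also have "\<dots> = (\<Sum>i=1..sph_dim TYPE('a) k. \<Sum>j=1..sph_dim TYPE('a) k. Y k i y * Y k j y * (if i = j then 1 else 0))"
      by (intro sum.cong refl) (simp add: Y_orthonormal)
    also have "\<dots> = Z k y y" unfolding Z_def by (simp add: sum.delta if_distrib cong: if_cong)
    finally show ?thesis by (simp add: power_mult_distrib)
  qed
  have Pv: "(\<integral>x. poisson_kernel (r *\<^sub>R x) y * v x \<partial>\<sigma>) = \<omega>^2 * (r ^ k)^2 * Z k y y"
  proof -
    have "(\<integral>x. poisson_kernel (r *\<^sub>R x) y * v x \<partial>\<sigma>) = (\<integral>x. (\<Sum>j=1..sph_dim TYPE('a) k. \<omega> * r ^ k * Y k j y * (poisson_kernel (r *\<^sub>R x) y * Y k j x)) \<partial>\<sigma>)"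
      unfolding v_def Z_def by (simp add: sum_distrib_left mult_ac)
    also have "\<dots> = (\<Sum>j=1..sph_dim TYPE('a) k. \<omega> * r ^ k * Y k j y * (\<integral>x. poisson_kernel (r *\<^sub>R x) y * Y k j x \<partial>\<sigma>))"
      by (subst Bochner_Integration.integral_sum, intro integrable_mult_right iPY, assumption, simp)
    also have "\<dots> = (\<Sum>j=1..sph_dim TYPE('a) k. \<omega> * r ^ k * Y k j y * (\<omega> * Y k j y * r ^ k))"
      by (intro sum.cong refl) (simp add: poisson_kernel_coefficient r y)
    also have "\<dots> = \<omega>^2 * (r ^ k)^2 * Z k y y"
      unfolding Z_def by (simp add: sum_distrib_left power2_eq_square mult_ac)
    finally show ?thesis .
  qed
  have "0 \<le> (\<integral>x. (poisson_kernel (r *\<^sub>R x) y - v x)^2 \<partial>\<sigma>)" by simp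
  also have "\<dots> = (\<integral>x. (poisson_kernel (r *\<^sub>R x) y)^2 - 2 * (poisson_kernel (r *\<^sub>R x) y * v x) + v x * v x \<partial>\<sigma>)"
    by (simp add: power2_diff power2_eq_square algebra_simps)
  also have "\<dots> = (\<integral>x. (poisson_kernel (r *\<^sub>R x) y)^2 \<partial>\<sigma>) - 2 * (\<integral>x. poisson_kernel (r *\<^sub>R x) y * v x \<partial>\<sigma>) + (\<integral>x. v x * v x \<partial>\<sigma>)"
  proof -
    have "integrable \<sigma> (\<lambda>x. (poisson_kernel (r *\<^sub>R x) y)^2)" "integrable \<sigma> (\<lambda>x. poisson_kernel (r *\<^sub>R x) y * v x)" "integrable \<sigma> (\<lambda>x. v x * v x)"
      by (intro integrable_\<sigma> continuous_on_mult continuous_on_power cP cv)+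
    then show ?thesis by simp
  qed
  also have "\<dots> = (\<integral>x. (poisson_kernel (r *\<^sub>R x) y)^2 \<partial>\<sigma>) - \<omega>^2 * (r ^ k)^2 * Z k y y"
    unfolding vv Pv by simp
  finally have "\<omega>^2 * (r ^ k)^2 * Z k y y \<le> (\<integral>x. (poisson_kernel (r *\<^sub>R x) y)^2 \<partial>\<sigma>)" by simp
  also have "\<dots> \<le> (\<integral>x. (1 / (1 - r) ^ DIM('a))^2 \<partial>\<sigma>)"
  proof (rule integral_mono)
    show "integrable \<sigma> (\<lambda>x. (poisson_kernel (r *\<^sub>R x) y)^2)" by (intro integrable_\<sigma> continuous_on_power cP)
    fix x assume "x \<in> space \<sigma>"
    then have x: "norm x = 1" by simp
    have "1 - r \<le> norm (r *\<^sub>R x - y)" using norm_triangle_ineq3[of "r *\<^sub>R x" y] r x y by simp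
    then have "poisson_kernel (r *\<^sub>R x) y \<le> (1 - (norm (r *\<^sub>R x))^2) / (1 - r) ^ DIM('a)"
      using r x by (intro poisson_kernel_le) auto
    also have "\<dots> \<le> 1 / (1 - r) ^ DIM('a)" using r by (intro divide_right_mono) auto
    finally show "(poisson_kernel (r *\<^sub>R x) y)^2 \<le> (1 / (1 - r) ^ DIM('a))^2"
      using r x by (intro power_mono poisson_kernel_nonneg) auto
  qed auto
  also have "\<dots> = \<omega> * (1 / (1 - r) ^ (2 * DIM('a)))" by (simp add: power_divide power_mult[symmetric] mult.commute)
  finally have "\<omega> * (\<omega> * Z k y y * (r ^ k)^2) \<le> \<omega> * (1 / (1 - r) ^ (2 * DIM('a)))"
    by (simp add: power2_eq_square mult_ac)
  then show ?thesis using \<omega>_pos mult_le_cancel_left_pos by blast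
qed

end

section \<open>Subexponential coefficients and spherical harmonic series\<close>

text \<open>Growth slower than every geometric rate, that is, limsup |s k|^(1/k) \<le> 1.
  Quantifying over radii instead of taking roots makes closure under sums and products easy.\<close>

definition subexp :: "(nat \<Rightarrow> real) \<Rightarrow> bool" where
  "subexp s \<longleftrightarrow> (\<forall>r\<in>{0<..<1}. \<exists>C. \<forall>k. \<bar>s k\<bar> * r ^ k \<le> C)"

lemma subexpD: "subexp s \<Longrightarrow> 0 < r \<Longrightarrow> r < 1 \<Longrightarrow> \<exists>C. \<forall>k. \<bar>s k\<bar> * r ^ k \<le> C"
  by (simp add: subexp_def)

lemma subexp_mono:
  assumes "subexp t" "\<And>k. \<bar>s k\<bar> \<le> \<bar>t k\<bar>"
  shows "subexp s"
  unfolding subexp_def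
proof
  fix r :: real assume r: "r \<in> {0<..<1}"
  obtain C where C: "\<And>k. \<bar>t k\<bar> * r ^ k \<le> C" using subexpD[OF assms(1), of r] r by auto
  have "\<bar>s k\<bar> * r ^ k \<le> C" for k
    using r by (intro order_trans[OF mult_right_mono C] assms) auto
  then show "\<exists>C. \<forall>k. \<bar>s k\<bar> * r ^ k \<le> C" by blast
qed

text \<open>Half of the decay goes to each factor: r is the product of two copies of sqrt r.\<close>

lemma subexp_mult:
  assumes s: "subexp s" and t: "subexp t"
  shows "subexp (\<lambda>k. s k * t k)"
  unfolding subexp_def
proof
  fix r :: real assume r: "r \<in> {0<..<1}"
  obtain C where C: "\<And>k. \<bar>s k\<bar> * sqrt r ^ k \<le> C" using subexpD[OF s, of "sqrt r"] r by auto
  obtain D where D: "\<And>k. \<bar>t k\<bar> * sqrt r ^ k \<le> D" using subexpD[OF t, of "sqrt r"] r by auto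
  have "\<bar>s k * t k\<bar> * r ^ k \<le> C * D" for k
  proof -
    have "r ^ k = sqrt r ^ k * sqrt r ^ k" using r by (simp flip: power_mult_distrib)
    then have "\<bar>s k * t k\<bar> * r ^ k = (\<bar>s k\<bar> * sqrt r ^ k) * (\<bar>t k\<bar> * sqrt r ^ k)" by (simp add: abs_mult mult_ac)
    also have "\<dots> \<le> C * D"
    proof (rule mult_mono[OF C D])
      have "0 \<le> \<bar>s k\<bar> * sqrt r ^ k" using r by simp
      then show "0 \<le> C" using C[of k] by linarith
    qed (use r in auto)
    finally show ?thesis .
  qed
  then show "\<exists>C. \<forall>k. \<bar>s k * t k\<bar> * r ^ k \<le> C" by blast
qed

lemma subexp_add:
  assumes s: "subexp s" and t: "subexp t"
  shows "subexp (\<lambda>k. s k + t k)"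
  unfolding subexp_def
proof
  fix r :: real assume r: "r \<in> {0<..<1}"
  obtain C where C: "\<And>k. \<bar>s k\<bar> * r ^ k \<le> C" using subexpD[OF s, of r] r by auto
  obtain D where D: "\<And>k. \<bar>t k\<bar> * r ^ k \<le> D" using subexpD[OF t, of r] r by auto
  have "\<bar>s k + t k\<bar> * r ^ k \<le> C + D" for k
  proof -
    have "\<bar>s k + t k\<bar> * r ^ k \<le> (\<bar>s k\<bar> + \<bar>t k\<bar>) * r ^ k" using r by (intro mult_right_mono) auto
    also have "\<dots> \<le> C + D" using C[of k] D[of k] by (simp add: distrib_right)
    finally show ?thesis .
  qed
  then show "\<exists>C. \<forall>k. \<bar>s k + t k\<bar> * r ^ k \<le> C" by blast
qed

lemma subexp_const [simp]: "subexp (\<lambda>_. c)"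
  unfolding subexp_def
proof
  fix r :: real assume "r \<in> {0<..<1}"
  then have "\<bar>c\<bar> * r ^ k \<le> \<bar>c\<bar>" for k by (simp add: mult_left_le power_le_one)
  then show "\<exists>C. \<forall>k. \<bar>c\<bar> * r ^ k \<le> C" by blast
qed

text \<open>Powers of r decrease, so (k + 1) r^k is at most 1 + r + ... + r^k.\<close>

lemma subexp_Suc: "subexp (\<lambda>k. real (Suc k))"
  unfolding subexp_def
proof
  fix r :: real assume r: "r \<in> {0<..<1}"
  have "\<bar>real (Suc k)\<bar> * r ^ k \<le> 1 / (1 - r)" for k
  proof -
    have "\<bar>real (Suc k)\<bar> * r ^ k = (\<Sum>i<Suc k. r ^ k)" by simp
    also have "\<dots> \<le> (\<Sum>i<Suc k. r ^ i)" using r by (intro sum_mono power_decreasing) auto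
    also have "\<dots> \<le> (\<Sum>i. r ^ i)" using r by (intro sum_le_suminf summable_geometric) auto
    also have "\<dots> = 1 / (1 - r)" using r by (intro suminf_geometric) auto
    finally show ?thesis .
  qed
  then show "\<exists>C. \<forall>k. \<bar>real (Suc k)\<bar> * r ^ k \<le> C" by blast
qed

text \<open>The bound at a radius strictly between r and 1 leaves a convergent geometric series at
  r.\<close>

lemma subexp_summable:
  assumes s: "subexp s" and r: "0 \<le> r" "r < 1"
  shows "summable (\<lambda>k. \<bar>s k\<bar> * r ^ k)"
proof -
  define \<rho> where "\<rho> = (1 + r) / 2"
  have \<rho>: "0 < \<rho>" "\<rho> < 1" "r < \<rho>" using r by (auto simp: \<rho>_def)
  obtain C where C: "\<And>k. \<bar>s k\<bar> * \<rho> ^ k \<le> C" using subexpD[OF s \<rho>(1,2)] by auto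
  show ?thesis
  proof (rule summable_comparison_test)
    show "summable (\<lambda>k. C * (r / \<rho>) ^ k)" using \<rho> r by (intro summable_mult summable_geometric) auto
    have "norm (\<bar>s k\<bar> * r ^ k) \<le> C * (r / \<rho>) ^ k" for k
    proof -
      have "norm (\<bar>s k\<bar> * r ^ k) = (\<bar>s k\<bar> * \<rho> ^ k) * (r / \<rho>) ^ k"
        using \<rho> r by (simp add: power_divide abs_mult)
      also have "\<dots> \<le> C * (r / \<rho>) ^ k" using \<rho> r by (intro mult_right_mono C) auto
      finally show ?thesis .
    qed
    then show "\<exists>N. \<forall>n\<ge>N. norm (\<bar>s n\<bar> * r ^ n) \<le> C * (r / \<rho>) ^ n" by blast
  qed
qed

text \<open>The sum is known only for real radii in (0, 1). The lowest remaining coefficient is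
  isolated by dividing off \<open>r ^ m\<close> and letting r tend to 0 along a sequence.\<close>

lemma power_series_zero_imp_coeff_zero:
  fixes c :: "nat \<Rightarrow> complex"
  assumes z: "\<And>r. 0 < r \<Longrightarrow> r < 1 \<Longrightarrow> (\<lambda>k. complex_of_real (r ^ k) * c k) sums 0"
  shows "c k = 0"
proof (induction k rule: less_induct)
  case (less m)
  have s: "(\<lambda>k. c (k + m) * complex_of_real r ^ k) sums 0" if r: "0 < r" "r < 1" for r
  proof -
    have "(\<lambda>k. complex_of_real (r ^ (k + m)) * c (k + m)) sums (0 - (\<Sum>i<m. complex_of_real (r ^ i) * c i))"
      using sums_iff_shift[of "\<lambda>k. complex_of_real (r ^ k) * c k" m "0 - (\<Sum>i<m. complex_of_real (r ^ i) * c i)"] z[OF r] by simp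
    also have "(\<Sum>i<m. complex_of_real (r ^ i) * c i) = 0" by (rule sum.neutral) (use less in auto)
    finally have "(\<lambda>k. (1 / complex_of_real (r ^ m)) * (complex_of_real (r ^ (k + m)) * c (k + m))) sums ((1 / complex_of_real (r ^ m)) * 0)"
      by (intro sums_mult) simp
    moreover have "(1 / complex_of_real (r ^ m)) * (complex_of_real (r ^ (k + m)) * c (k + m)) = c (k + m) * complex_of_real r ^ k" for k
      using r by (simp add: power_add field_simps)
    ultimately show ?thesis by simp
  qed
  define f where "f x = (\<Sum>k. c (k + m) * x ^ k)" for x :: complex
  have sm: "(\<lambda>k. c (k + m) * x ^ k) sums f x" if "norm x < 1/2" for x
  proof -
    have "summable (\<lambda>k. c (k + m) * complex_of_real (1/2) ^ k)" using s[of "1/2"] sums_summable by auto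
    from powser_inside[OF this, of x] that show ?thesis by (simp add: f_def summable_sums)
  qed
  have "(f \<longlongrightarrow> c (0 + m)) (at 0)"
    by (rule powser_limit_0[where s = "1/2"]) (use sm in auto)
  \<comment> \<open>The shift by 3 keeps the points below 1/2, where \<open>f\<close> is known to be
    the sum of its series.\<close>
  moreover have "filterlim (\<lambda>n::nat. complex_of_real (1 / real (n + 3))) (at 0) sequentially"
  proof (rule filterlim_atI)
    have "(\<lambda>n. 1 / real (n + 3)) \<longlonglongrightarrow> 0" using LIMSEQ_ignore_initial_segment[OF lim_1_over_n, of 3] by simp
    from tendsto_of_real[OF this] show "(\<lambda>n::nat. complex_of_real (1 / real (n + 3))) \<longlonglongrightarrow> 0"
      by (simp only: of_real_0)
    show "\<forall>\<^sub>F n in sequentially. complex_of_real (1 / real (n + 3)) \<noteq> 0"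
      by (rule always_eventually) (simp only: of_real_eq_0_iff, simp)
  qed
  ultimately have "(\<lambda>n. f (complex_of_real (1 / real (n + 3)))) \<longlonglongrightarrow> c m"
    using filterlim_compose by fastforce
  moreover have "f (complex_of_real (1 / real (n + 3))) = 0" for n
  proof (rule sums_unique2[OF sm])
    show "norm (complex_of_real (1 / real (n + 3))) < 1 / 2" by (simp add: norm_divide del: of_real_divide of_real_add)
    show "(\<lambda>k. c (k + m) * complex_of_real (1 / real (n + 3)) ^ k) sums 0" by (rule s) auto
  qed
  ultimately show ?case by (simp add: LIMSEQ_const_iff)
qed

lemma harmonic_on_translate:
  fixes f :: "'a::euclidean_space \<Rightarrow> real"
  assumes "harmonic_on UNIV f"
  shows "harmonic_on S (\<lambda>z. f (x + z))"
proof -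
  obtain g J where gJ: "harmonic_grad UNIV f g J" using harmonic_on_imp_grad[OF assms] .
  have tr: "((\<lambda>z. x + z) has_derivative (\<lambda>h. h)) (at y)" for y by (auto intro!: derivative_eq_intros)
  have "harmonic_grad S (\<lambda>z. f (x + z)) (\<lambda>z. g (x + z)) (\<lambda>z. J (x + z))"
    unfolding harmonic_grad_def
  proof (intro conjI ballI)
    fix y
    have 1: "(f has_derivative (\<lambda>h. g (x + y) \<bullet> h)) (at (x + y))" and 2: "(g has_derivative J (x + y)) (at (x + y))"
      and 3: "(\<Sum>i\<in>Basis. J (x + y) i \<bullet> i) = 0"
      using gJ unfolding harmonic_grad_def by blast+
    show "((\<lambda>z. f (x + z)) has_derivative (\<lambda>h. g (x + y) \<bullet> h)) (at y)" by (rule has_derivative_compose[OF tr 1])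
    show "((\<lambda>z. g (x + z)) has_derivative J (x + y)) (at y)" by (rule has_derivative_compose[OF tr 2])
    show "(\<Sum>i\<in>Basis. J (x + y) i \<bullet> i) = 0" by (rule 3)
  next
    fix i :: 'a assume "i \<in> Basis"
    then have "continuous_on UNIV (\<lambda>z. J z i)" using gJ by (simp add: harmonic_grad_def)
    then show "continuous_on S (\<lambda>z. J (x + z) i)"
      by (rule continuous_on_compose2) (auto intro!: continuous_intros)
  qed
  then show ?thesis by (rule harmonic_on_grad)
qed

section \<open>Growth of the basis functions\<close>

context sphere_basis
begin

text \<open>A single majorant for order k. The summand 1 turns the bound on squares into one on |Y k
  j| through |a| \<le> 1 + a^2 and keeps the majorant at least 1; times \<open>\<omega>\<close> it
  also bounds the dimension.\<close>

definition ybound :: "nat \<Rightarrow> real" where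
  "ybound k = 1 + (SUP y\<in>sphere 0 1. Z k y y)"

lemma sphere_nonempty: "\<exists>y::'a. norm y = 1"
proof -
  obtain b :: 'a where "b \<in> Basis" by (meson nonempty_Basis ex_in_conv)
  then show ?thesis by (intro exI[of _ b]) simp
qed

lemma Z_le_ybound:
  assumes "norm y = 1" shows "1 + Z k y y \<le> ybound k"
proof -
  have "continuous_on (sphere 0 1) (\<lambda>y. Z k y y)"
    unfolding Z_def by (intro continuous_intros Y_continuous)
  then have "bdd_above ((\<lambda>y. Z k y y) ` sphere 0 1)"
    by (intro bounded_imp_bdd_above compact_imp_bounded compact_continuous_image) auto
  from cSUP_upper[OF _ this, of y] show ?thesis unfolding ybound_def using assms by simp
qed

lemma ybound_ge_1: "1 \<le> ybound k"
proof -
  obtain y :: 'a where y: "norm y = 1" using sphere_nonempty by blast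
  show ?thesis using Z_le_ybound[OF y, of k] Z_diag_nonneg[of k y] by linarith
qed

lemma Y_le_ybound:
  assumes j: "j \<in> {1..sph_dim TYPE('a) k}" and y: "norm y = 1"
  shows "\<bar>Y k j y\<bar> \<le> ybound k"
proof -
  have "Y k j y * Y k j y \<le> Z k y y"
    unfolding Z_def using j by (intro member_le_sum) auto
  moreover have "\<bar>Y k j y\<bar> \<le> 1 + Y k j y * Y k j y"
    using zero_le_power2[of "\<bar>Y k j y\<bar> - 1"] by (simp add: power2_eq_square algebra_simps)
  ultimately show ?thesis using Z_le_ybound[OF y, of k] by linarith
qed

text \<open>The trace of the reproducing kernel: integrating \<open>Z k y y\<close> counts the basis
  functions of order k.\<close>

lemma d_le_ybound: "real (sph_dim TYPE('a) k) \<le> \<omega> * ybound k"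
proof -
  have "(\<integral>y. Z k y y \<partial>\<sigma>) = (\<Sum>j=1..sph_dim TYPE('a) k. (\<integral>y. Y k j y * Y k j y \<partial>\<sigma>))"
    unfolding Z_def
    by (rule Bochner_Integration.integral_sum) (intro integrable_\<sigma> continuous_on_mult Y_continuous)
  also have "\<dots> = (\<Sum>j=1..sph_dim TYPE('a) k. 1)" by (rule sum.cong[OF refl]) (simp add: Y_orthonormal)
  finally have "real (sph_dim TYPE('a) k) = (\<integral>y. Z k y y \<partial>\<sigma>)" by simp
  also have "\<dots> \<le> (\<integral>y. ybound k \<partial>\<sigma>)"
  proof (rule integral_mono)
    show "integrable \<sigma> (\<lambda>y. Z k y y)"
      unfolding Z_def by (intro Bochner_Integration.integrable_sum integrable_\<sigma> continuous_on_mult Y_continuous)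
    fix y assume "y \<in> space \<sigma>"
    then have "norm y = 1" by simp
    from Z_le_ybound[OF this, of k] show "Z k y y \<le> ybound k" by linarith
  qed auto
  finally show ?thesis by simp
qed

text \<open>\<open>Z_diag_le\<close> is applied at radius sqrt r, because it contains the square of
  the k-th power.\<close>

lemma subexp_ybound: "subexp ybound"
  unfolding ybound_def
proof (rule subexp_add[OF subexp_const])
  show "subexp (\<lambda>k. SUP y\<in>sphere 0 1. Z k y y)"
    unfolding subexp_def
  proof
    fix r :: real assume r: "r \<in> {0<..<1}"
    define C where "C = 1 / (1 - sqrt r) ^ (2 * DIM('a)) / \<omega>"
    have "\<bar>SUP y\<in>sphere 0 1. Z k y y\<bar> * r ^ k \<le> C" for k
    proof -
      have le: "Z k y y \<le> C / r ^ k" if y: "norm y = 1" for y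
      proof -
        have "\<omega> * Z k y y * (sqrt r ^ k)^2 \<le> 1 / (1 - sqrt r) ^ (2 * DIM('a))"
          using r by (intro Z_diag_le y) auto
        also have "(sqrt r ^ k)^2 = r ^ k" using r by (simp add: power_mult[symmetric] mult.commute[of k 2] power_mult)
        finally show ?thesis using r \<omega>_pos by (simp add: C_def field_simps)
      qed
      obtain y0 :: 'a where y0: "norm y0 = 1" using sphere_nonempty by blast
      have "(SUP y\<in>sphere 0 1. Z k y y) \<le> C / r ^ k"
        using le y0 by (intro cSUP_least) auto
      moreover have "0 \<le> (SUP y\<in>sphere 0 1. Z k y y)"
        using Z_le_ybound[OF y0, of k] Z_diag_nonneg[of k y0] by (simp add: ybound_def)
      ultimately show ?thesis using r by (simp add: field_simps)
    qed
    then show "\<exists>C. \<forall>k. \<bar>SUP y\<in>sphere 0 1. Z k y y\<bar> * r ^ k \<le> C" by blast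
  qed
qed

section \<open>Series with subexponential coefficients\<close>

definition sph_part :: "(nat \<Rightarrow> nat \<Rightarrow> complex) \<Rightarrow> nat \<Rightarrow> 'a \<Rightarrow> complex" where
  "sph_part a k y = (\<Sum>j=1..sph_dim TYPE('a) k. a k j * complex_of_real (Y k j y))"

text \<open>The l^1 norm of the coefficients of order k. As the dimensions are themselves
  subexponential, any other l^p norm would give the same growth class.\<close>

definition coeff_norm :: "(nat \<Rightarrow> nat \<Rightarrow> complex) \<Rightarrow> nat \<Rightarrow> real" where
  "coeff_norm a k = (\<Sum>j=1..sph_dim TYPE('a) k. cmod (a k j))"

lemma coeff_norm_nonneg [simp]: "0 \<le> coeff_norm a k"
  unfolding coeff_norm_def by (intro sum_nonneg) auto

text \<open>Written with solid harmonics the term is a polynomial in x, which disposes of the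
  arbitrary unit vector at the origin and of continuity there.\<close>

lemma sph_term_eq_H: "sph_term Y a x k = (\<Sum>j=1..sph_dim TYPE('a) k. a k j * complex_of_real (H k j x))"
  unfolding sph_term_def sum_distrib_left
  by (rule sum.cong[OF refl]) (simp add: H_polar[symmetric])

lemma sph_term_polar:
  assumes "norm y = 1"
  shows "sph_term Y a (r *\<^sub>R y) k = complex_of_real (r ^ k) * sph_part a k y"
  unfolding sph_term_eq_H sph_part_def sum_distrib_left
  by (rule sum.cong[OF refl]) (simp add: H_hom Y_eq_H[OF _ assms])

lemma sph_part_continuous: "continuous_on (sphere 0 1) (sph_part a k)"
  unfolding sph_part_def by (intro continuous_on_sum continuous_on_mult continuous_on_const continuous_on_of_real Y_continuous)

lemma norm_sph_part_le:
  assumes "norm y = 1"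
  shows "cmod (sph_part a k y) \<le> coeff_norm a k * ybound k"
proof -
  have "cmod (sph_part a k y) \<le> (\<Sum>j=1..sph_dim TYPE('a) k. cmod (a k j * complex_of_real (Y k j y)))"
    unfolding sph_part_def by (rule norm_sum)
  also have "\<dots> \<le> (\<Sum>j=1..sph_dim TYPE('a) k. cmod (a k j) * ybound k)"
    by (rule sum_mono) (auto simp: norm_mult intro!: mult_left_mono Y_le_ybound assms)
  finally show ?thesis by (simp add: coeff_norm_def sum_distrib_right)
qed

lemma norm_sph_term_le:
  assumes x: "norm x \<le> R"
  shows "cmod (sph_term Y a x k) \<le> \<bar>coeff_norm a k * ybound k\<bar> * R ^ k"
proof -
  have "sph_term Y a x k = complex_of_real (norm x ^ k) * sph_part a k (unit_dir x)"
    by (simp add: sph_term_def sph_part_def)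
  then have "cmod (sph_term Y a x k) = norm x ^ k * cmod (sph_part a k (unit_dir x))" by (simp add: norm_mult norm_power)
  also have "\<dots> \<le> R ^ k * (coeff_norm a k * ybound k)"
    using x order_trans[OF norm_ge_zero x] by (intro mult_mono power_mono norm_sph_part_le unit_dir) (auto intro: order_trans[OF norm_ge_zero])
  finally show ?thesis using ybound_ge_1[of k] by (simp add: mult.commute)
qed

lemma summable_bound:
  assumes a: "subexp (coeff_norm a)" and R: "0 \<le> R" "R < 1"
  shows "summable (\<lambda>k. \<bar>coeff_norm a k * ybound k\<bar> * R ^ k)"
  by (rule subexp_summable[OF subexp_mult[OF a subexp_ybound] R])

lemma sph_term_summable_norm:
  assumes a: "subexp (coeff_norm a)" and x: "norm x < 1"
  shows "summable (\<lambda>k. cmod (sph_term Y a x k))"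
  by (rule summable_comparison_test[OF _ summable_bound[OF a norm_ge_zero x]])
     (use norm_sph_term_le[OF order_refl, of a x] in auto)

lemma subexp_sums:
  assumes "subexp (coeff_norm a)" "norm x < 1"
  shows "sph_term Y a x sums sph_series Y a x"
  unfolding sph_series_def using sph_term_summable_norm[OF assms] summable_norm_cancel by (intro summable_sums) blast

lemma subexp_convergent: "subexp (coeff_norm a) \<Longrightarrow> sph_convergent Y a"
  unfolding sph_convergent_def using subexp_sums sums_summable by (metis mem_ball_0)

lemma sph_term_continuous: "continuous_on S (\<lambda>x. sph_term Y a x k)"
  unfolding sph_term_eq_H by (intro continuous_on_sum continuous_on_mult continuous_on_const continuous_on_of_real H_continuous)

text \<open>Convergence is uniform on each smaller concentric ball, and these balls exhaust the unit
  ball.\<close>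

lemma sph_series_continuous:
  assumes a: "subexp (coeff_norm a)"
  shows "continuous_on (ball 0 1) (sph_series Y a)"
proof -
  have "continuous_on (ball 0 R) (sph_series Y a)" if R: "0 \<le> R" "R < 1" for R
  proof (rule uniform_limit_theorem)
    show "uniform_limit (ball 0 R) (\<lambda>n x. \<Sum>k<n. sph_term Y a x k) (sph_series Y a) sequentially"
      unfolding sph_series_def
      by (rule Weierstrass_m_test[OF _ summable_bound[OF a R]]) (auto intro!: norm_sph_term_le)
    show "\<forall>\<^sub>F n in sequentially. continuous_on (ball 0 R) (\<lambda>x. \<Sum>k<n. sph_term Y a x k)"
      by (intro always_eventually allI continuous_on_sum sph_term_continuous)
  qed auto
  then have "continuous_on (\<Union>R\<in>{0..<1}. ball 0 R) (sph_series Y a)"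
    by (intro continuous_on_open_UN) auto
  moreover have "(\<Union>R\<in>{0..<1::real}. ball 0 R) = ball (0::'a) 1"
  proof -
    have "x \<in> (\<Union>R\<in>{0..<1::real}. ball 0 R)" if "norm x < 1" for x :: 'a
      using that by (intro UN_I[of "(1 + norm x) / 2"]) (auto simp: field_simps add_pos_nonneg)
    then show ?thesis by auto
  qed
  ultimately show ?thesis by simp
qed

lemma sph_series_sphere_continuous:
  assumes a: "subexp (coeff_norm a)" and r: "0 \<le> r" "r < 1"
  shows "continuous_on (sphere 0 1) (\<lambda>y. sph_series Y a (r *\<^sub>R y))"
  by (rule continuous_on_compose2[OF sph_series_continuous[OF a]]) (use r in \<open>auto intro!: continuous_intros\<close>)

text \<open>The map \<open>p\<close> lets one termwise integration cover spheres about the origin,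
  which give the coefficients, and off-centre spheres, which give the mean value property.\<close>

lemma sph_series_integral_sums:
  assumes a: "subexp (coeff_norm a)" and R: "0 \<le> R" "R < 1"
    and p: "continuous_on (sphere 0 1) p" "\<And>y. norm y = 1 \<Longrightarrow> norm (p y) \<le> R"
    and h: "continuous_on (sphere 0 1) h"
  shows "(\<lambda>k. \<integral>y. sph_term Y a (p y) k * h y \<partial>\<sigma>) sums (\<integral>y. sph_series Y a (p y) * (h y :: complex) \<partial>\<sigma>)"
proof -
  let ?M = "\<lambda>k. \<bar>coeff_norm a k * ybound k\<bar> * R ^ k"
  have "bounded (h ` sphere 0 1)"
    using h by (intro compact_imp_bounded compact_continuous_image) auto
  then obtain B where B: "\<And>y. norm y = 1 \<Longrightarrow> cmod (h y) \<le> B" unfolding bounded_iff by fastforce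
  obtain y0 :: 'a where y0: "norm y0 = 1" using sphere_nonempty by blast
  have B0: "0 \<le> B" using B[OF y0] norm_ge_zero[of "h y0"] by linarith
  have bd: "cmod (sph_term Y a (p y) k * h y) \<le> ?M k * B" if "norm y = 1" for y k
    unfolding norm_mult using that by (intro mult_mono norm_sph_term_le p B) (use R in auto)
  have c: "continuous_on (sphere 0 1) (\<lambda>y. sph_term Y a (p y) k * h y)" for k
    by (intro continuous_on_mult h continuous_on_compose2[OF sph_term_continuous[of UNIV] p(1)]) auto
  have sM: "summable (\<lambda>k. ?M k * B)" by (intro summable_mult2 summable_bound[OF a R])
  have "(\<lambda>k. \<integral>y. sph_term Y a (p y) k * h y \<partial>\<sigma>) sums (\<integral>y. (\<Sum>k. sph_term Y a (p y) k * h y) \<partial>\<sigma>)"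
  proof (rule sums_integral)
    show "integrable \<sigma> (\<lambda>y. sph_term Y a (p y) k * h y)" for k by (rule integrable_\<sigma>[OF c])
    show "AE y in \<sigma>. summable (\<lambda>k. norm (sph_term Y a (p y) k * h y))"
      by (rule AE_I2, rule summable_comparison_test'[OF sM, of 0]) (use bd in auto)
    show "summable (\<lambda>k. \<integral>y. norm (sph_term Y a (p y) k * h y) \<partial>\<sigma>)"
    proof (rule summable_comparison_test'[of "\<lambda>k. \<omega> * (?M k * B)" 0])
      show "summable (\<lambda>k. \<omega> * (?M k * B))" by (intro summable_mult sM)
      fix k :: nat
      have "(\<integral>y. norm (sph_term Y a (p y) k * h y) \<partial>\<sigma>) \<le> (\<integral>y. ?M k * B \<partial>\<sigma>)"
        by (rule integral_mono) (use bd integrable_\<sigma>[OF continuous_on_norm[OF c]] in auto)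
      moreover have "0 \<le> (\<integral>y. norm (sph_term Y a (p y) k * h y) \<partial>\<sigma>)" by simp
      ultimately show "norm (\<integral>y. norm (sph_term Y a (p y) k * h y) \<partial>\<sigma>) \<le> \<omega> * (?M k * B)" by simp
    qed
  qed
  also have "(\<integral>y. (\<Sum>k. sph_term Y a (p y) k * h y) \<partial>\<sigma>) = (\<integral>y. sph_series Y a (p y) * h y \<partial>\<sigma>)"
  proof (rule Bochner_Integration.integral_cong[OF refl])
    fix y assume "y \<in> space \<sigma>"
    then have "norm (p y) < 1" using p(2)[of y] R by simp
    from sums_mult2[OF subexp_sums[OF a this], of "h y"]
    show "(\<Sum>k. sph_term Y a (p y) k * h y) = sph_series Y a (p y) * h y"
      by (rule sums_unique[symmetric])
  qed
  finally show ?thesis .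
qed

lemma sph_part_coefficient:
  assumes j: "j \<in> {1..sph_dim TYPE('a) k}"
  shows "(\<integral>y. sph_part a l y * complex_of_real (Y k j y) \<partial>\<sigma>) = (if l = k then a k j else 0)"
proof -
  have "(\<integral>y. sph_part a l y * complex_of_real (Y k j y) \<partial>\<sigma>)
      = (\<integral>y. (\<Sum>i=1..sph_dim TYPE('a) l. a l i * complex_of_real (Y l i y * Y k j y)) \<partial>\<sigma>)"
    unfolding sph_part_def sum_distrib_right by (simp add: mult_ac)
  also have "\<dots> = (\<Sum>i=1..sph_dim TYPE('a) l. a l i * (\<integral>y. complex_of_real (Y l i y * Y k j y) \<partial>\<sigma>))"
    by (subst Bochner_Integration.integral_sum)
       (intro integrable_\<sigma> continuous_on_mult continuous_on_const continuous_on_of_real Y_continuous j, assumption, simp)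
  also have "\<dots> = (\<Sum>i=1..sph_dim TYPE('a) l. a l i * (if l = k \<and> i = j then 1 else 0))"
    by (rule sum.cong[OF refl]) (simp only: integral_complex_of_real Y_orthonormal[OF _ j] of_real_eq_iff, simp)
  also have "\<dots> = (if l = k then a k j else 0)"
    using j by (auto simp: if_distrib sum.delta cong: if_cong)
  finally show ?thesis .
qed

lemma sph_series_coefficient:
  assumes a: "subexp (coeff_norm a)" and r: "0 \<le> r" "r < 1" and j: "j \<in> {1..sph_dim TYPE('a) k}"
  shows "(\<integral>y. sph_series Y a (r *\<^sub>R y) * complex_of_real (Y k j y) \<partial>\<sigma>) = complex_of_real (r ^ k) * a k j"
proof -
  have "(\<lambda>l. \<integral>y. sph_term Y a (r *\<^sub>R y) l * complex_of_real (Y k j y) \<partial>\<sigma>) sums (\<integral>y. sph_series Y a (r *\<^sub>R y) * complex_of_real (Y k j y) \<partial>\<sigma>)"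
    by (rule sph_series_integral_sums[OF a r]) (use r j in \<open>auto intro!: continuous_intros Y_continuous\<close>)
  moreover have "(\<integral>y. sph_term Y a (r *\<^sub>R y) l * complex_of_real (Y k j y) \<partial>\<sigma>) = (if l = k then complex_of_real (r ^ k) * a k j else 0)" for l
  proof -
    have "(\<integral>y. sph_term Y a (r *\<^sub>R y) l * complex_of_real (Y k j y) \<partial>\<sigma>) = (\<integral>y. complex_of_real (r ^ l) * (sph_part a l y * complex_of_real (Y k j y)) \<partial>\<sigma>)"
      by (rule Bochner_Integration.integral_cong) (simp_all add: sph_term_polar)
    also have "\<dots> = complex_of_real (r ^ l) * (\<integral>y. sph_part a l y * complex_of_real (Y k j y) \<partial>\<sigma>)" by (rule integral_mult_right_zero)
    finally show ?thesis unfolding sph_part_coefficient[OF j] by auto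
  qed
  ultimately have "(\<lambda>l. if l = k then complex_of_real (r ^ k) * a k j else 0) sums (\<integral>y. sph_series Y a (r *\<^sub>R y) * complex_of_real (Y k j y) \<partial>\<sigma>)"
    by simp
  moreover have "(\<lambda>l. if l = k then complex_of_real (r ^ k) * a k j else 0) sums (complex_of_real (r ^ k) * a k j)"
    using sums_single[of k "\<lambda>_. complex_of_real (r ^ k) * a k j"] by simp
  ultimately show ?thesis by (rule sums_unique2)
qed

text \<open>Moving x to the origin turns the mean value property into the constancy of the
  coefficient of order zero.\<close>

lemma mean_value:
  fixes f :: "'a \<Rightarrow> real"
  assumes f: "harmonic_on UNIV f" and r: "0 \<le> r" "r < 1"
  shows "(\<integral>y. f (x + r *\<^sub>R y) \<partial>\<sigma>) = \<omega> * f x"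
proof -
  have "harmonic_on UNIV (\<lambda>_::'a. 1::real)"
    by (rule harmonic_on_grad[of _ _ "\<lambda>_. 0" "\<lambda>_ _. 0"]) (simp add: harmonic_grad_def)
  from coefficient_power[OF harmonic_on_translate[OF f] this, of 0 x] obtain b
    where b: "\<And>r. r \<in> {0..<1} \<Longrightarrow> (\<integral>y. f (x + r *\<^sub>R y) \<partial>\<sigma>) = b"
    by auto
  have "b = \<omega> * f x" using b[of 0] by simp
  then show ?thesis using b[of r] r by simp
qed

lemma sph_series_mean_value:
  assumes a: "subexp (coeff_norm a)" and r: "0 \<le> r" "norm x + r < 1"
  shows "(\<integral>y. sph_series Y a (x + r *\<^sub>R y) \<partial>\<sigma>) = \<omega> * sph_series Y a x"
proof -
  have r1: "r < 1" using r norm_ge_zero[of x] by linarith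
  have "(\<lambda>k. \<integral>y. sph_term Y a (x + r *\<^sub>R y) k * 1 \<partial>\<sigma>) sums (\<integral>y. sph_series Y a (x + r *\<^sub>R y) * 1 \<partial>\<sigma>)"
  proof (rule sph_series_integral_sums[OF a _ r(2)])
    show "norm (x + r *\<^sub>R y) \<le> norm x + r" if "norm y = 1" for y
      using norm_triangle_ineq[of x "r *\<^sub>R y"] r that by simp
  qed (use r in \<open>auto intro!: continuous_intros\<close>)
  moreover have "(\<integral>y. sph_term Y a (x + r *\<^sub>R y) k * 1 \<partial>\<sigma>) = complex_of_real \<omega> * sph_term Y a x k" for k
  proof -
    have "(\<integral>y. sph_term Y a (x + r *\<^sub>R y) k * 1 \<partial>\<sigma>) = (\<integral>y. (\<Sum>j=1..sph_dim TYPE('a) k. a k j * complex_of_real (H k j (x + r *\<^sub>R y))) \<partial>\<sigma>)"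
      by (simp add: sph_term_eq_H)
    also have "\<dots> = (\<Sum>j=1..sph_dim TYPE('a) k. (\<integral>y. a k j * complex_of_real (H k j (x + r *\<^sub>R y)) \<partial>\<sigma>))"
    proof (rule Bochner_Integration.integral_sum, rule integrable_\<sigma>)
      fix j assume j: "j \<in> {1..sph_dim TYPE('a) k}"
      show "continuous_on (sphere 0 1) (\<lambda>y. a k j * complex_of_real (H k j (x + r *\<^sub>R y)))"
        by (intro continuous_on_mult continuous_on_const continuous_on_of_real continuous_on_compose2[OF H_continuous[OF j, of UNIV]])
           (auto intro!: continuous_intros)
    qed
    also have "\<dots> = (\<Sum>j=1..sph_dim TYPE('a) k. a k j * complex_of_real (\<omega> * H k j x))"
      by (rule sum.cong[OF refl]) (simp add: mean_value[OF H_harmonic r(1) r1])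
    finally show ?thesis by (simp add: sph_term_eq_H sum_distrib_left mult_ac)
  qed
  ultimately have "(\<lambda>k. complex_of_real \<omega> * sph_term Y a x k) sums (\<integral>y. sph_series Y a (x + r *\<^sub>R y) \<partial>\<sigma>)" by simp
  moreover have "(\<lambda>k. complex_of_real \<omega> * sph_term Y a x k) sums (complex_of_real \<omega> * sph_series Y a x)"
    using r by (intro sums_mult subexp_sums[OF a]) auto
  ultimately show ?thesis by (rule sums_unique2)
qed

text \<open>Differentiating the series twice is avoided: the mean value property passes to the sum
  by termwise integration, and together with continuity it implies harmonicity.\<close>

lemma sph_series_harmonic:
  assumes a: "subexp (coeff_norm a)"
  shows "sph_series Y a \<in> harmonic_ball"
proof -
  have \<omega>S: "\<omega> = \<kappa> * measure surface_measure (sphere 0 1 :: 'a set)"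
  proof -
    have "\<omega> = enn2real (emeasure \<sigma> (sphere 0 1))" by (simp only: \<omega>_def measure_def)
    also have "emeasure \<sigma> (sphere 0 1) = ennreal \<kappa> * emeasure surface_measure (sphere 0 1 :: 'a set)"
      by (subst \<sigma>_eq) simp
    finally show ?thesis using \<kappa> by (simp add: enn2real_mult measure_def)
  qed
  have cont: "continuous_on (sphere 0 1) (\<lambda>y. sph_series Y a (x + r *\<^sub>R y))" if "0 \<le> r" "norm x + r < 1" for x r
  proof (rule continuous_on_compose2[OF sph_series_continuous[OF a]])
    show "(\<lambda>y. x + r *\<^sub>R y) ` sphere 0 1 \<subseteq> ball 0 1"
    proof
      fix z assume "z \<in> (\<lambda>y. x + r *\<^sub>R y) ` sphere 0 1"
      then obtain y where "norm y = 1" "z = x + r *\<^sub>R y" by auto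
      then show "z \<in> ball 0 1" using that norm_triangle_ineq[of x "r *\<^sub>R y"] by simp
    qed
  qed (intro continuous_intros)
  \<comment> \<open>\<open>L\<close> stands for the real and the imaginary part; the listed
    properties are what both share.\<close>
  have "harmonic_on (ball 0 1) (\<lambda>x. L (sph_series Y a x))"
    if L: "bounded_linear L" "\<And>f. integrable \<sigma> f \<Longrightarrow> (\<integral>y. L (f y) \<partial>\<sigma>) = L (\<integral>y. f y \<partial>\<sigma>)" "\<And>c z. L (complex_of_real c * z) = c * L z"
    for L :: "complex \<Rightarrow> real"
  proof (rule harmonic_on_local)
    fix x :: 'a assume x: "x \<in> ball 0 1"
    \<comment> \<open>With this e, the closed ball of radius 2 * e about x and every sphere of
      radius below e about a point of \<open>ball x e\<close> lie in the unit ball.\<close>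
    define e where "e = (1 - norm x) / 4"
    have e4: "norm x + 4 * e = 1" by (simp add: e_def field_simps)
    have e0: "0 < e" using x by (simp add: e_def)
    have "e < 1" using e4 e0 norm_ge_zero[of x] by linarith
    note e = e0 this e4
    have sub: "cball x (2 * e) \<subseteq> ball 0 1"
    proof
      fix z assume "z \<in> cball x (2 * e)"
      then have "norm z \<le> norm x + 2 * e" using norm_triangle_sub[of z x] by (simp add: dist_norm norm_minus_commute)
      then show "z \<in> ball 0 1" using e by simp
    qed
    have "harmonic_on (ball x e) (\<lambda>x. L (sph_series Y a x))"
    proof (rule harmonic_of_mean_value[OF _ e(1,2)])
      show "continuous_on (cball x (2 * e)) (\<lambda>x. L (sph_series Y a x))"
        by (intro bounded_linear.continuous_on[OF L(1)] continuous_on_subset[OF sph_series_continuous[OF a] sub])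
      fix z r assume z: "z \<in> ball x e" and r: "0 < r" "r < e"
      have nz: "norm z + r < 1" using z r e norm_triangle_sub[of z x] by (simp add: dist_norm norm_minus_commute)
      note c = cont[OF less_imp_le[OF r(1)] nz]
      have "\<kappa> * (\<integral>y. L (sph_series Y a (z + r *\<^sub>R y)) \<partial>surface_measure) = (\<integral>y. L (sph_series Y a (z + r *\<^sub>R y)) \<partial>\<sigma>)"
        using integral_\<sigma>[OF meas_\<sigma>[OF bounded_linear.continuous_on[OF L(1) c]]] by simp
      also have "\<dots> = L (\<integral>y. sph_series Y a (z + r *\<^sub>R y) \<partial>\<sigma>)" by (rule L(2)[OF integrable_\<sigma>[OF c]])
      also have "\<dots> = \<omega> * L (sph_series Y a z)" using sph_series_mean_value[OF a less_imp_le[OF r(1)] nz] L(3) by simp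
      also have "\<dots> = \<kappa> * (L (sph_series Y a z) * measure surface_measure (sphere 0 1 :: 'a set))" by (simp add: \<omega>S)
      finally show "(\<integral>y. L (sph_series Y a (z + r *\<^sub>R y)) \<partial>surface_measure) = L (sph_series Y a z) * measure surface_measure (sphere 0 1 :: 'a set)"
        using \<kappa> by simp
    qed
    moreover have "ball x e \<subseteq> ball 0 1" using sub e by auto
    ultimately show "\<exists>T. open T \<and> x \<in> T \<and> T \<subseteq> ball 0 1 \<and> harmonic_on T (\<lambda>x. L (sph_series Y a x))"
      using e by (intro exI[of _ "ball x e"]) auto
  qed
  note this[of Re] this[of Im]
  then show ?thesis
    by (simp add: harmonic_ball_def harmonic_on_complex_iff bounded_linear_Re bounded_linear_Im)
qed

text \<open>\<open>v\<close> is orthogonal to every finite combination s of basis functions, so its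
  squared norm is at most that of v - s, which density makes arbitrarily small. Continuity gives the
  pointwise statement.\<close>

lemma completeness:
  assumes v: "continuous_on (sphere 0 1) v"
    and z: "\<And>k j. j \<in> {1..sph_dim TYPE('a) k} \<Longrightarrow> (\<integral>y. v y * complex_of_real (Y k j y) \<partial>\<sigma>) = 0"
    and y: "norm y = 1"
  shows "v y = 0"
proof -
  have cv2: "continuous_on (sphere 0 1) (\<lambda>y. (cmod (v y))^2)" by (intro continuous_intros v)
  have "(\<integral>y. (cmod (v y))^2 \<partial>\<sigma>) < \<epsilon>" if \<epsilon>: "\<epsilon> > 0" for \<epsilon>
  proof -
    have "v \<in> borel_measurable \<sigma>" "integrable \<sigma> (\<lambda>y. (cmod (v y))^2)"
      by (rule meas_\<sigma>[OF v], rule integrable_\<sigma>[OF cv2])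
    then obtain N a where a: "(\<integral>x. (cmod (v x - (\<Sum>k\<le>N. \<Sum>j=1..sph_dim TYPE('a) k. a k j * complex_of_real (Y k j x))))\<^sup>2 \<partial>\<sigma>) < \<epsilon>"
      using basis \<epsilon> unfolding spherical_harmonic_basis_def by blast
    define s where "s x = (\<Sum>k\<le>N. sph_part a k x)" for x
    have cs: "continuous_on (sphere 0 1) s" unfolding s_def by (intro continuous_on_sum sph_part_continuous)
    have cY: "continuous_on (sphere 0 1) (\<lambda>x. v x * cnj (a k j * complex_of_real (Y k j x)))" if "j \<in> {1..sph_dim TYPE('a) k}" for k j
      using that by (intro continuous_on_mult v continuous_on_cnj continuous_on_const continuous_on_of_real Y_continuous)
    have "(\<integral>x. v x * cnj (s x) \<partial>\<sigma>) = (\<integral>x. (\<Sum>k\<le>N. \<Sum>j=1..sph_dim TYPE('a) k. v x * cnj (a k j * complex_of_real (Y k j x))) \<partial>\<sigma>)"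
      unfolding s_def sph_part_def by (simp add: sum_distrib_left)
    also have "\<dots> = (\<Sum>k\<le>N. (\<integral>x. (\<Sum>j=1..sph_dim TYPE('a) k. v x * cnj (a k j * complex_of_real (Y k j x))) \<partial>\<sigma>))"
      by (rule Bochner_Integration.integral_sum) (intro Bochner_Integration.integrable_sum integrable_\<sigma> cY)
    also have "\<dots> = (\<Sum>k\<le>N. (\<Sum>j=1..sph_dim TYPE('a) k. \<integral>x. v x * cnj (a k j * complex_of_real (Y k j x)) \<partial>\<sigma>))"
      by (rule sum.cong[OF refl], rule Bochner_Integration.integral_sum) (intro integrable_\<sigma> cY)
    also have "\<dots> = 0"
    proof (intro sum.neutral ballI)
      fix k j assume j: "j \<in> {1..sph_dim TYPE('a) k}"
      have "(\<integral>x. v x * cnj (a k j * complex_of_real (Y k j x)) \<partial>\<sigma>) = (\<integral>x. cnj (a k j) * (v x * complex_of_real (Y k j x)) \<partial>\<sigma>)"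
        by (simp add: mult_ac)
      also have "\<dots> = cnj (a k j) * (\<integral>x. v x * complex_of_real (Y k j x) \<partial>\<sigma>)" by (rule integral_mult_right_zero)
      finally show "(\<integral>x. v x * cnj (a k j * complex_of_real (Y k j x)) \<partial>\<sigma>) = 0" using z[OF j] by simp
    qed
    finally have cross: "(\<integral>x. Re (v x * cnj (s x)) \<partial>\<sigma>) = 0"
      using integral_Re[OF integrable_\<sigma>[OF continuous_on_mult[OF v continuous_on_cnj[OF cs]]]] by simp
    define g where "g y = Re (v y * cnj (s y))" for y
    have "(\<integral>y. (cmod (v y))^2 \<partial>\<sigma>) \<le> (\<integral>y. (cmod (v y))^2 \<partial>\<sigma>) - 2 * (\<integral>x. g x \<partial>\<sigma>) + (\<integral>y. (cmod (s y))^2 \<partial>\<sigma>)"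
      unfolding g_def cross by simp
    also have "\<dots> = (\<integral>y. (cmod (v y))^2 - 2 * g y + (cmod (s y))^2 \<partial>\<sigma>)"
    proof -
      have "integrable \<sigma> (\<lambda>y. (cmod (v y))^2)" "integrable \<sigma> g" "integrable \<sigma> (\<lambda>y. (cmod (s y))^2)"
        unfolding g_def by (intro integrable_\<sigma> continuous_on_power continuous_on_norm continuous_on_Re continuous_on_mult continuous_on_cnj v cs)+
      then show ?thesis by simp
    qed
    also have "\<dots> = (\<integral>y. (cmod (v y - s y))^2 \<partial>\<sigma>)"
      by (rule Bochner_Integration.integral_cong[OF refl]) (unfold g_def cmod_power2, simp add: power2_eq_square algebra_simps)
    also have "\<dots> < \<epsilon>" using a by (simp add: s_def sph_part_def)
    finally show ?thesis .
  qed
  then have "(\<integral>y. (cmod (v y))^2 \<partial>\<sigma>) \<le> 0" by (meson less_irrefl not_le)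
  moreover have "0 \<le> (\<integral>y. (cmod (v y))^2 \<partial>\<sigma>)" by simp
  ultimately have "(\<integral>y. (cmod (v y))^2 \<partial>\<sigma>) = 0" by linarith
  from integral_\<sigma>_eq_0D[OF cv2 _ this y] show ?thesis by simp
qed

section \<open>Expansion of harmonic functions and its uniqueness\<close>

lemma harmonic_ball_coefficient:
  assumes f: "f \<in> harmonic_ball" and j: "j \<in> {1..sph_dim TYPE('a) k}"
  shows "\<exists>b. \<forall>r\<in>{0..<1}. (\<integral>y. f (r *\<^sub>R y) * complex_of_real (Y k j y) \<partial>\<sigma>) = b * complex_of_real (r ^ k)"
proof -
  have h: "harmonic_on (ball 0 1) (\<lambda>x. Re (f x))" "harmonic_on (ball 0 1) (\<lambda>x. Im (f x))"
    using f by (auto simp: harmonic_ball_def harmonic_on_complex_iff)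
  obtain b1 where b1: "\<And>r. r \<in> {0..<1} \<Longrightarrow> (\<integral>y. Re (f (r *\<^sub>R y)) * H k j y \<partial>\<sigma>) = b1 * r ^ k"
    using coefficient_power[OF h(1) H_harmonic[OF j] H_hom[OF j]] by blast
  obtain b2 where b2: "\<And>r. r \<in> {0..<1} \<Longrightarrow> (\<integral>y. Im (f (r *\<^sub>R y)) * H k j y \<partial>\<sigma>) = b2 * r ^ k"
    using coefficient_power[OF h(2) H_harmonic[OF j] H_hom[OF j]] by blast
  have "(\<integral>y. f (r *\<^sub>R y) * complex_of_real (Y k j y) \<partial>\<sigma>) = Complex b1 b2 * complex_of_real (r ^ k)" if r: "r \<in> {0..<1}" for r
  proof -
    have "continuous_on (sphere 0 1) (\<lambda>y. f (r *\<^sub>R y))"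
      by (rule continuous_on_compose2[OF harmonic_on_continuous])
         (use f r in \<open>auto intro!: continuous_intros simp: harmonic_ball_def\<close>)
    then have i: "integrable \<sigma> (\<lambda>y. f (r *\<^sub>R y) * complex_of_real (Y k j y))"
      by (intro integrable_\<sigma> continuous_on_mult continuous_on_of_real Y_continuous j)
    have "Re (\<integral>y. f (r *\<^sub>R y) * complex_of_real (Y k j y) \<partial>\<sigma>) = (\<integral>y. Re (f (r *\<^sub>R y)) * H k j y \<partial>\<sigma>)"
      unfolding integral_Re[OF i, symmetric] by (rule Bochner_Integration.integral_cong) (auto simp: Y_eq_H[OF j])
    moreover have "Im (\<integral>y. f (r *\<^sub>R y) * complex_of_real (Y k j y) \<partial>\<sigma>) = (\<integral>y. Im (f (r *\<^sub>R y)) * H k j y \<partial>\<sigma>)"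
      unfolding integral_Im[OF i, symmetric] by (rule Bochner_Integration.integral_cong) (auto simp: Y_eq_H[OF j])
    ultimately show ?thesis using b1[OF r] b2[OF r] by (simp add: complex_eq_iff)
  qed
  then show ?thesis by blast
qed

lemma harmonic_ball_sphere_continuous:
  assumes f: "f \<in> harmonic_ball" and r: "0 \<le> r" "r < 1"
  shows "continuous_on (sphere 0 1) (\<lambda>y::'a. f (r *\<^sub>R y))"
  by (rule continuous_on_compose2[OF harmonic_on_continuous[of "ball 0 1" f]])
     (use f r in \<open>auto intro!: continuous_intros simp: harmonic_ball_def\<close>)

text \<open>The power law in the radius defines \<open>b\<close>. On each sphere the difference of f
  and the series is then orthogonal to all basis functions and vanishes by completeness.\<close>

theorem harmonic_ball_expansion:
  assumes f: "f \<in> harmonic_ball"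
  obtains b where "\<And>k j. j \<notin> {1..sph_dim TYPE('a) k} \<Longrightarrow> b k j = 0" "subexp (coeff_norm b)"
    "\<And>x. norm x < 1 \<Longrightarrow> sph_series Y b x = f x"
proof -
  define b where "b k j = (if j \<in> {1..sph_dim TYPE('a) k} then SOME b. \<forall>r\<in>{0..<1}. (\<integral>y. f (r *\<^sub>R y) * complex_of_real (Y k j y) \<partial>\<sigma>) = b * complex_of_real (r ^ k) else 0)" for k j
  have b: "(\<integral>y. f (r *\<^sub>R y) * complex_of_real (Y k j y) \<partial>\<sigma>) = b k j * complex_of_real (r ^ k)"
    if "j \<in> {1..sph_dim TYPE('a) k}" "0 \<le> r" "r < 1" for k j r
  proof -
    have "b k j = (SOME b. \<forall>r\<in>{0..<1}. (\<integral>y. f (r *\<^sub>R y) * complex_of_real (Y k j y) \<partial>\<sigma>) = b * complex_of_real (r ^ k))"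
      by (simp only: b_def that(1) if_True)
    then have "\<forall>r\<in>{0..<1}. (\<integral>y. f (r *\<^sub>R y) * complex_of_real (Y k j y) \<partial>\<sigma>) = b k j * complex_of_real (r ^ k)"
      using someI_ex[OF harmonic_ball_coefficient[OF f that(1)]] by (simp only:)
    then show ?thesis using that(2,3) by auto
  qed
  note cf = harmonic_ball_sphere_continuous[OF f]
  have sub: "subexp (coeff_norm b)"
    unfolding subexp_def
  proof
    fix r :: real assume r: "r \<in> {0<..<1}"
    \<comment> \<open>Of r^k = s^k * s^k, one factor is spent on the bound of f over the sphere of
      radius s, the other on the growth of \<open>ybound\<close>.\<close>
    define s where "s = sqrt r"
    have s: "0 < s" "s < 1" "s * s = r" using r by (auto simp: s_def)
    have "bounded ((\<lambda>y. f (s *\<^sub>R y)) ` sphere 0 1)"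
      using cf[of s] s by (intro compact_imp_bounded compact_continuous_image) auto
    then obtain B where B: "\<And>y. norm y = 1 \<Longrightarrow> cmod (f (s *\<^sub>R y)) \<le> B" unfolding bounded_iff by fastforce
    obtain y0 :: 'a where y0: "norm y0 = 1" using sphere_nonempty by blast
    have B0: "0 \<le> B" using B[OF y0] norm_ge_zero[of "f (s *\<^sub>R y0)"] by linarith
    have bs: "cmod (b k j) * s ^ k \<le> \<omega> * (B * ybound k)" if j: "j \<in> {1..sph_dim TYPE('a) k}" for k j
    proof -
      have "cmod (b k j) * s ^ k = cmod (\<integral>y. f (s *\<^sub>R y) * complex_of_real (Y k j y) \<partial>\<sigma>)"
        using b[OF j, of s] s by (simp add: norm_mult norm_power)
      also have "\<dots> \<le> (\<integral>y. cmod (f (s *\<^sub>R y) * complex_of_real (Y k j y)) \<partial>\<sigma>)" by (rule integral_norm_bound)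
      also have "\<dots> \<le> (\<integral>y. B * ybound k \<partial>\<sigma>)"
      proof (rule integral_mono)
        show "integrable \<sigma> (\<lambda>y. cmod (f (s *\<^sub>R y) * complex_of_real (Y k j y)))"
          using s by (intro integrable_\<sigma> continuous_on_norm continuous_on_mult continuous_on_of_real cf Y_continuous j) auto
        show "cmod (f (s *\<^sub>R y) * complex_of_real (Y k j y)) \<le> B * ybound k" if "y \<in> space \<sigma>" for y
          using that B0 by (auto simp: norm_mult intro!: mult_mono B Y_le_ybound[OF j])
      qed auto
      finally show ?thesis by simp
    qed
    have cs: "coeff_norm b k * s ^ k \<le> \<bar>\<omega> * \<omega> * B * (ybound k * ybound k)\<bar>" for k
    proof -
      have "coeff_norm b k * s ^ k \<le> (\<Sum>j=1..sph_dim TYPE('a) k. \<omega> * (B * ybound k))"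
        unfolding coeff_norm_def sum_distrib_right by (rule sum_mono) (rule bs)
      also have "\<dots> = real (sph_dim TYPE('a) k) * (\<omega> * (B * ybound k))" by simp
      also have "\<dots> \<le> (\<omega> * ybound k) * (\<omega> * (B * ybound k))"
        using \<omega>_pos B0 ybound_ge_1[of k] by (intro mult_right_mono d_le_ybound mult_nonneg_nonneg) auto
      also have "\<dots> \<le> \<bar>\<omega> * \<omega> * B * (ybound k * ybound k)\<bar>" by (simp add: mult_ac)
      finally show ?thesis .
    qed
    have "subexp (\<lambda>k. \<omega> * \<omega> * B * (ybound k * ybound k))"
      by (intro subexp_mult subexp_const subexp_ybound)
    from subexpD[OF this s(1,2)] obtain C where C: "\<And>k. \<bar>\<omega> * \<omega> * B * (ybound k * ybound k)\<bar> * s ^ k \<le> C" by auto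
    have "\<bar>coeff_norm b k\<bar> * r ^ k \<le> C" for k
    proof -
      have "\<bar>coeff_norm b k\<bar> * r ^ k = (coeff_norm b k * s ^ k) * s ^ k" by (simp flip: s(3) add: power_mult_distrib)
      also have "\<dots> \<le> \<bar>\<omega> * \<omega> * B * (ybound k * ybound k)\<bar> * s ^ k" using s by (intro mult_right_mono cs) auto
      also have "\<dots> \<le> C" by (rule C)
      finally show ?thesis .
    qed
    then show "\<exists>C. \<forall>k. \<bar>coeff_norm b k\<bar> * r ^ k \<le> C" by blast
  qed
  have "sph_series Y b x = f x" if x: "norm x < 1" for x
  proof -
    let ?v = "\<lambda>y. f (norm x *\<^sub>R y) - sph_series Y b (norm x *\<^sub>R y)"
    note cc = cf[OF norm_ge_zero x] and cs = sph_series_sphere_continuous[OF sub norm_ge_zero x]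
    have "?v (unit_dir x) = 0"
    proof (rule completeness[of ?v])
      show "continuous_on (sphere 0 1) ?v" by (intro continuous_on_diff cc cs)
      fix k j assume j: "j \<in> {1..sph_dim TYPE('a) k}"
      have "(\<integral>y. ?v y * complex_of_real (Y k j y) \<partial>\<sigma>) =
         (\<integral>y. f (norm x *\<^sub>R y) * complex_of_real (Y k j y) \<partial>\<sigma>) - (\<integral>y. sph_series Y b (norm x *\<^sub>R y) * complex_of_real (Y k j y) \<partial>\<sigma>)"
        unfolding left_diff_distrib
        by (rule Bochner_Integration.integral_diff) (intro integrable_\<sigma> continuous_on_mult continuous_on_of_real cc cs Y_continuous j)+
      also have "\<dots> = 0"
        using b[OF j norm_ge_zero x] sph_series_coefficient[OF sub norm_ge_zero x j] by simp
      finally show "(\<integral>y. ?v y * complex_of_real (Y k j y) \<partial>\<sigma>) = 0" .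
    qed (rule unit_dir)
    then show ?thesis by (simp add: norm_scaleR_unit_dir)
  qed
  with sub show ?thesis by (intro that[of b]) (auto simp: b_def)
qed

text \<open>On each ray the two expansions are power series in the radius with the same sum, so
  their parts of order k agree; orthonormality then separates the coefficients.\<close>

lemma expansion_unique:
  assumes a: "\<And>x. norm x < 1 \<Longrightarrow> sph_term Y a x sums f x" and b: "\<And>x. norm x < 1 \<Longrightarrow> sph_term Y b x sums f x"
    and j: "j \<in> {1..sph_dim TYPE('a) k}"
  shows "a k j = b k j"
proof -
  have eq: "sph_part a k y = sph_part b k y" if y: "norm y = 1" for y
  proof -
    have "sph_part a k y - sph_part b k y = 0"
    proof (rule power_series_zero_imp_coeff_zero)
      fix r :: real assume r: "0 < r" "r < 1"
      have "(\<lambda>k. sph_term Y a (r *\<^sub>R y) k - sph_term Y b (r *\<^sub>R y) k) sums (f (r *\<^sub>R y) - f (r *\<^sub>R y))"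
        using r y by (intro sums_diff a b) auto
      then show "(\<lambda>k. complex_of_real (r ^ k) * (sph_part a k y - sph_part b k y)) sums 0"
        by (simp add: sph_term_polar[OF y] right_diff_distrib)
    qed
    then show ?thesis by simp
  qed
  have "a k j = (\<integral>y. sph_part a k y * complex_of_real (Y k j y) \<partial>\<sigma>)" by (simp add: sph_part_coefficient[OF j])
  also have "\<dots> = (\<integral>y. sph_part b k y * complex_of_real (Y k j y) \<partial>\<sigma>)"
    by (rule Bochner_Integration.integral_cong) (auto simp: eq)
  also have "\<dots> = b k j" by (simp add: sph_part_coefficient[OF j])
  finally show ?thesis .
qed

lemma sph_term_cong:
  assumes "\<And>j. j \<in> {1..sph_dim TYPE('a) k} \<Longrightarrow> a k j = b k j"
  shows "sph_term Y a x k = sph_term Y b x k"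
  unfolding sph_term_def using assms by (intro arg_cong2[where f = "(*)"] sum.cong) auto

lemma sph_series_cong:
  assumes "\<And>k j. j \<in> {1..sph_dim TYPE('a) k} \<Longrightarrow> a k j = b k j"
  shows "sph_series Y a x = sph_series Y b x"
  unfolding sph_series_def using sph_term_cong[of _ a b] assms by (intro suminf_cong) blast

lemma coeff_norm_cong:
  assumes "\<And>k j. j \<in> {1..sph_dim TYPE('a) k} \<Longrightarrow> a k j = b k j"
  shows "coeff_norm a = coeff_norm b"
  unfolding coeff_norm_def using assms by (intro ext sum.cong) auto

text \<open>Resolves the definite description in \<open>sph_coeff\<close>. Entries outside the index
  range are first set to zero, since uniqueness holds only after that.\<close>

lemma sph_coeff_eqI:
  assumes a: "\<And>x. norm x < 1 \<Longrightarrow> sph_term Y a x sums f x" and j: "j \<in> {1..sph_dim TYPE('a) k}"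
  shows "sph_coeff Y f k j = a k j"
proof -
  define b where "b k j = (if j \<in> {1..sph_dim TYPE('a) k} then a k j else 0)" for k j
  have tb: "sph_term Y b x = sph_term Y a x" for x by (intro ext sph_term_cong) (auto simp: b_def)
  have "sph_coeff Y f = b"
    unfolding sph_coeff_def
  proof (rule the_equality)
    show "(\<forall>k j. j \<notin> {1..sph_dim TYPE('a) k} \<longrightarrow> b k j = 0) \<and> (\<forall>x\<in>ball 0 1. sph_term Y b x sums f x)"
      using a by (auto simp: b_def tb)
    fix c assume c: "(\<forall>k j. j \<notin> {1..sph_dim TYPE('a) k} \<longrightarrow> c k j = 0) \<and> (\<forall>x\<in>ball 0 1. sph_term Y c x sums f x)"
    show "c = b"
    proof (intro ext)
      fix k j
      show "c k j = b k j"
      proof (cases "j \<in> {1..sph_dim TYPE('a) k}")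
        case True
        then show ?thesis using expansion_unique[of c f a, OF _ a True] c by (simp add: b_def)
      next
        case False
        then have "c k j = 0" using c by blast
        then show ?thesis by (simp only: b_def False if_False)
      qed
    qed
  qed
  then show ?thesis using j by (simp add: b_def)
qed

lemma
  assumes f: "f \<in> harmonic_ball"
  shows sph_coeff_subexp: "subexp (coeff_norm (sph_coeff Y f))"
    and sph_series_sph_coeff: "norm x < 1 \<Longrightarrow> sph_series Y (sph_coeff Y f) x = f x"
proof -
  obtain b where b: "subexp (coeff_norm b)" "\<And>x. norm x < 1 \<Longrightarrow> sph_series Y b x = f x"
    using harmonic_ball_expansion[OF f] by metis
  have eq: "sph_coeff Y f k j = b k j" if "j \<in> {1..sph_dim TYPE('a) k}" for k j
    by (rule sph_coeff_eqI[OF _ that]) (metis b subexp_sums)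
  show "subexp (coeff_norm (sph_coeff Y f))" using b(1) coeff_norm_cong[OF eq] by simp
  show "norm x < 1 \<Longrightarrow> sph_series Y (sph_coeff Y f) x = f x" using b(2) sph_series_cong[OF eq] by simp
qed

lemma sph_coeff_sph_series:
  assumes "sph_convergent Y a" "j \<in> {1..sph_dim TYPE('a) k}"
  shows "sph_coeff Y (sph_series Y a) k j = a k j"
  by (rule sph_coeff_eqI[OF _ assms(2)])
     (use assms(1) in \<open>auto simp: sph_series_def sph_convergent_def intro: summable_sums\<close>)

text \<open>Turns the qualitative assumption that a series is harmonic into the growth condition
  with which all estimates work.\<close>

lemma subexp_of_harmonic_series:
  assumes "sph_convergent Y a" "sph_series Y a \<in> harmonic_ball"
  shows "subexp (coeff_norm a)"
  using sph_coeff_subexp[OF assms(2)] coeff_norm_cong[of "sph_coeff Y (sph_series Y a)" a] sph_coeff_sph_series[OF assms(1)] by simp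

sublocale sp: pair_sigma_finite \<sigma> \<sigma> by unfold_locales

lemma Y_measurable: "j \<in> {1..sph_dim TYPE('a) k} \<Longrightarrow> Y k j \<in> borel_measurable \<sigma>"
  by (rule meas_\<sigma>[OF Y_continuous])

section \<open>Kernels and convolutions\<close>

text \<open>For unit vectors, the value at r x of the convolution of the series \<open>a\<close>
  with the Poisson kernel at y. Written as a plain sum of products of basis functions it is jointly
  measurable for every \<open>a\<close>.\<close>

definition kern :: "(nat \<Rightarrow> nat \<Rightarrow> complex) \<Rightarrow> real \<Rightarrow> 'a \<Rightarrow> 'a \<Rightarrow> complex" where
  "kern a r x y = (\<Sum>k. complex_of_real (r ^ k) * (\<Sum>j=1..sph_dim TYPE('a) k. a k j * complex_of_real (Y k j x * Y k j y)))"

lemma borel_measurable_complex_of_real: "g \<in> borel_measurable M \<Longrightarrow> (\<lambda>x. complex_of_real (g x)) \<in> borel_measurable M"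
  by measurable

lemma kern_measurable:
  assumes "f \<in> measurable M \<sigma>" "g \<in> measurable M \<sigma>" "\<rho> \<in> borel_measurable M"
  shows "(\<lambda>z. kern a (\<rho> z) (f z) (g z)) \<in> borel_measurable M"
  unfolding kern_def
  by (intro borel_measurable_suminf borel_measurable_times borel_measurable_complex_of_real borel_measurable_power borel_measurable_sum
      borel_measurable_const measurable_compose[OF assms(1) Y_measurable] measurable_compose[OF assms(2) Y_measurable] assms(3))

lemma kern_sym: "kern a r x y = kern a r y x"
  unfolding kern_def by (simp add: mult.commute)

abbreviation kcoeff :: "(nat \<Rightarrow> nat \<Rightarrow> complex) \<Rightarrow> 'a \<Rightarrow> nat \<Rightarrow> nat \<Rightarrow> complex" where
  "kcoeff a y \<equiv> \<lambda>k j. a k j * complex_of_real (Y k j y)"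

lemma kern_eq_series:
  assumes "norm x = 1"
  shows "sph_series Y (kcoeff a y) (r *\<^sub>R x) = kern a r x y"
  unfolding sph_series_def kern_def sph_term_polar[OF assms] sph_part_def by (simp add: mult_ac)

lemma coeff_norm_mult_le: "coeff_norm (\<lambda>k j. a k j * b k j) k \<le> coeff_norm a k * coeff_norm b k"
proof -
  have "coeff_norm (\<lambda>k j. a k j * b k j) k \<le> (\<Sum>j=1..sph_dim TYPE('a) k. cmod (a k j) * coeff_norm b k)"
    unfolding coeff_norm_def[of "\<lambda>k j. a k j * b k j"]
  proof (rule sum_mono)
    fix j assume "j \<in> {1..sph_dim TYPE('a) k}"
    then have "cmod (b k j) \<le> coeff_norm b k"
      unfolding coeff_norm_def by (intro member_le_sum) auto
    then show "cmod (a k j * b k j) \<le> cmod (a k j) * coeff_norm b k"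
      by (simp add: norm_mult mult_left_mono)
  qed
  then show ?thesis by (simp add: coeff_norm_def sum_distrib_right)
qed

lemma subexp_coeff_mult:
  assumes "subexp (coeff_norm a)" "subexp (coeff_norm b)"
  shows "subexp (coeff_norm (\<lambda>k j. a k j * b k j))"
  by (rule subexp_mono[OF subexp_mult[OF assms]]) (use coeff_norm_mult_le in \<open>auto intro: order_trans[OF _ abs_ge_self]\<close>)

lemma subexp_scalar:
  assumes "subexp l"
  shows "subexp (coeff_norm (\<lambda>k j. complex_of_real (l k)))"
proof (rule subexp_mono[OF subexp_mult[OF subexp_mult[OF subexp_const[of \<omega>] subexp_ybound] assms]])
  fix k
  have "coeff_norm (\<lambda>k j. complex_of_real (l k)) k = real (sph_dim TYPE('a) k) * \<bar>l k\<bar>" by (simp add: coeff_norm_def)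
  also have "\<dots> \<le> (\<omega> * ybound k) * \<bar>l k\<bar>" by (intro mult_right_mono d_le_ybound) auto
  also have "\<dots> = \<bar>\<omega> * ybound k * l k\<bar>" using \<omega>_pos ybound_ge_1[of k] by (simp add: abs_mult)
  finally show "\<bar>coeff_norm (\<lambda>k j. complex_of_real (l k)) k\<bar> \<le> \<bar>\<omega> * ybound k * l k\<bar>" by simp
qed

lemma subexp_Y:
  assumes y: "norm y = 1"
  shows "subexp (coeff_norm (\<lambda>k j. complex_of_real (Y k j y)))"
proof (rule subexp_mono[OF subexp_scalar[OF subexp_ybound]])
  fix k
  have "coeff_norm (\<lambda>k j. complex_of_real (Y k j y)) k \<le> coeff_norm (\<lambda>k j. complex_of_real (ybound k)) k"
    unfolding coeff_norm_def by (rule sum_mono) (use Y_le_ybound[OF _ y] ybound_ge_1 in \<open>auto intro: order_trans[OF _ abs_ge_self]\<close>)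
  then show "\<bar>coeff_norm (\<lambda>k j. complex_of_real (Y k j y)) k\<bar> \<le> \<bar>coeff_norm (\<lambda>k j. complex_of_real (ybound k)) k\<bar>"
    by simp
qed

lemma subexp_kcoeff: "subexp (coeff_norm a) \<Longrightarrow> norm y = 1 \<Longrightarrow> subexp (coeff_norm (kcoeff a y))"
  by (rule subexp_coeff_mult[OF _ subexp_Y])

lemma kern_continuous:
  assumes "subexp (coeff_norm a)" "norm y = 1" "0 \<le> r" "r < 1"
  shows "continuous_on (sphere 0 1) (\<lambda>x. kern a r x y)"
  by (rule continuous_on_eq[OF sph_series_sphere_continuous[OF subexp_kcoeff[OF assms(1,2)] assms(3,4)]])
     (simp add: kern_eq_series)

text \<open>Orthonormality collapses the product of the two expansions; the dilation by r s factors
  into r on the kernel and s on the function.\<close>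

lemma kern_convolution:
  assumes a: "subexp (coeff_norm a)" and b: "subexp (coeff_norm b)" and r: "0 \<le> r" "r < 1" and s: "0 \<le> s" "s < 1" and x: "norm x = 1"
  shows "sph_series Y (\<lambda>k j. a k j * b k j) ((r * s) *\<^sub>R x) = (\<integral>y. kern a r x y * sph_series Y b (s *\<^sub>R y) \<partial>\<sigma>)"
proof -
  let ?h = "\<lambda>y. kern a r x y"
  have ch: "continuous_on (sphere 0 1) ?h"
    using kern_continuous[OF a x r] by (simp add: kern_sym)
  have "(\<lambda>k. \<integral>y. sph_term Y b (s *\<^sub>R y) k * ?h y \<partial>\<sigma>) sums (\<integral>y. sph_series Y b (s *\<^sub>R y) * ?h y \<partial>\<sigma>)"
    by (rule sph_series_integral_sums[OF b s _ _ ch]) (use s in \<open>auto intro!: continuous_intros\<close>)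
  moreover have "(\<integral>y. sph_term Y b (s *\<^sub>R y) k * ?h y \<partial>\<sigma>) = sph_term Y (\<lambda>k j. a k j * b k j) ((r * s) *\<^sub>R x) k" for k
  proof -
    have "(\<integral>y. sph_term Y b (s *\<^sub>R y) k * ?h y \<partial>\<sigma>)
       = (\<integral>y. (\<Sum>j=1..sph_dim TYPE('a) k. complex_of_real (s ^ k) * b k j * (sph_series Y (kcoeff a x) (r *\<^sub>R y) * complex_of_real (Y k j y))) \<partial>\<sigma>)"
    proof (rule Bochner_Integration.integral_cong[OF refl])
      fix y assume "y \<in> space \<sigma>"
      then have y: "norm y = 1" by simp
      show "sph_term Y b (s *\<^sub>R y) k * ?h y = (\<Sum>j=1..sph_dim TYPE('a) k. complex_of_real (s ^ k) * b k j * (sph_series Y (kcoeff a x) (r *\<^sub>R y) * complex_of_real (Y k j y)))"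
        unfolding sph_term_polar[OF y] kern_eq_series[OF y] sph_part_def kern_sym[of a r y x]
        by (simp add: sum_distrib_left sum_distrib_right mult_ac)
    qed
    also have "\<dots> = (\<Sum>j=1..sph_dim TYPE('a) k. complex_of_real (s ^ k) * b k j * (\<integral>y. sph_series Y (kcoeff a x) (r *\<^sub>R y) * complex_of_real (Y k j y) \<partial>\<sigma>))"
      by (subst Bochner_Integration.integral_sum)
         (intro integrable_\<sigma> continuous_on_mult continuous_on_const continuous_on_of_real Y_continuous
            sph_series_sphere_continuous[OF subexp_kcoeff[OF a x] r], assumption, simp)
    also have "\<dots> = (\<Sum>j=1..sph_dim TYPE('a) k. complex_of_real (s ^ k) * b k j * (complex_of_real (r ^ k) * (a k j * complex_of_real (Y k j x))))"
      by (rule sum.cong[OF refl]) (simp add: sph_series_coefficient[OF subexp_kcoeff[OF a x] r])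
    also have "\<dots> = sph_term Y (\<lambda>k j. a k j * b k j) ((r * s) *\<^sub>R x) k"
      unfolding sph_term_polar[OF x] sph_part_def by (simp add: sum_distrib_left power_mult_distrib mult_ac)
    finally show ?thesis .
  qed
  ultimately have "sph_term Y (\<lambda>k j. a k j * b k j) ((r * s) *\<^sub>R x) sums (\<integral>y. sph_series Y b (s *\<^sub>R y) * ?h y \<partial>\<sigma>)"
    by simp
  then show ?thesis unfolding sph_series_def[of Y "\<lambda>k j. a k j * b k j"] by (simp add: sums_iff mult.commute)
qed

text \<open>The L^1 mean as an extended nonnegative integral, so that Tonelli's theorem applies
  without integrability conditions.\<close>

definition nmean :: "('a \<Rightarrow> complex) \<Rightarrow> real \<Rightarrow> ennreal" where
  "nmean f r = (\<integral>\<^sup>+y. ennreal (cmod (f (r *\<^sub>R y))) \<partial>\<sigma>)"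

text \<open>Young's inequality for this convolution: take absolute values under the integral,
  exchange the order of integration and integrate the kernel over x first.\<close>

lemma nmean_mult_le:
  assumes a: "subexp (coeff_norm a)" and b: "subexp (coeff_norm b)" and r: "0 \<le> r" "r < 1" and s: "0 \<le> s" "s < 1"
    and B: "\<And>y. norm y = 1 \<Longrightarrow> (\<integral>\<^sup>+x. ennreal (cmod (kern a r x y)) \<partial>\<sigma>) \<le> B"
  shows "nmean (sph_series Y (\<lambda>k j. a k j * b k j)) (r * s) \<le> B * nmean (sph_series Y b) s"
proof -
  have cb: "continuous_on (sphere 0 1) (\<lambda>y. sph_series Y b (s *\<^sub>R y))" by (rule sph_series_sphere_continuous[OF b s])
  have mb: "(\<lambda>y. sph_series Y b (s *\<^sub>R y)) \<in> borel_measurable \<sigma>" by (rule meas_\<sigma>[OF cb])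
  have m: "(\<lambda>z. ennreal (cmod (kern a r (fst z) (snd z))) * ennreal (cmod (sph_series Y b (s *\<^sub>R snd z)))) \<in> borel_measurable (\<sigma> \<Otimes>\<^sub>M \<sigma>)"
  proof -
    have [measurable]: "(\<lambda>z. kern a r (fst z) (snd z)) \<in> borel_measurable (\<sigma> \<Otimes>\<^sub>M \<sigma>)"
      by (rule kern_measurable[OF measurable_fst measurable_snd]) simp
    have [measurable]: "(\<lambda>z. sph_series Y b (s *\<^sub>R snd z)) \<in> borel_measurable (\<sigma> \<Otimes>\<^sub>M \<sigma>)"
      by (rule measurable_compose[OF measurable_snd mb])
    show ?thesis by measurable
  qed
  have mk: "(\<lambda>x. ennreal (cmod (kern a r x y))) \<in> borel_measurable \<sigma>" if "y \<in> space \<sigma>" for y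
    using kern_measurable[of "\<lambda>x. x" \<sigma> "\<lambda>_. y" "\<lambda>_. r" a] that by simp
  have "nmean (sph_series Y (\<lambda>k j. a k j * b k j)) (r * s)
      \<le> (\<integral>\<^sup>+x. (\<integral>\<^sup>+y. ennreal (cmod (kern a r x y)) * ennreal (cmod (sph_series Y b (s *\<^sub>R y))) \<partial>\<sigma>) \<partial>\<sigma>)"
    unfolding nmean_def
  proof (rule nn_integral_mono)
    fix x assume "x \<in> space \<sigma>"
    then have x: "norm x = 1" by simp
    have ck: "continuous_on (sphere 0 1) (\<lambda>y. kern a r x y * sph_series Y b (s *\<^sub>R y))"
      using kern_continuous[OF a x r] cb by (intro continuous_on_mult) (simp_all add: kern_sym)
    have "ennreal (cmod (sph_series Y (\<lambda>k j. a k j * b k j) ((r * s) *\<^sub>R x)))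
       \<le> (\<integral>\<^sup>+y. ennreal (cmod (kern a r x y * sph_series Y b (s *\<^sub>R y))) \<partial>\<sigma>)"
      unfolding kern_convolution[OF a b r s x] by (rule integral_norm_bound_ennreal[OF integrable_\<sigma>[OF ck]])
    then show "ennreal (cmod (sph_series Y (\<lambda>k j. a k j * b k j) ((r * s) *\<^sub>R x)))
       \<le> (\<integral>\<^sup>+y. ennreal (cmod (kern a r x y)) * ennreal (cmod (sph_series Y b (s *\<^sub>R y))) \<partial>\<sigma>)"
      by (simp add: norm_mult ennreal_mult)
  qed
  also have "\<dots> = (\<integral>\<^sup>+y. (\<integral>\<^sup>+x. ennreal (cmod (kern a r x y)) * ennreal (cmod (sph_series Y b (s *\<^sub>R y))) \<partial>\<sigma>) \<partial>\<sigma>)"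
    by (rule sp.Fubini'[symmetric]) (use m in \<open>simp add: case_prod_beta'\<close>)
  also have "\<dots> \<le> (\<integral>\<^sup>+y. B * ennreal (cmod (sph_series Y b (s *\<^sub>R y))) \<partial>\<sigma>)"
  proof (rule nn_integral_mono)
    fix y assume y: "y \<in> space \<sigma>"
    have "(\<integral>\<^sup>+x. ennreal (cmod (kern a r x y)) * ennreal (cmod (sph_series Y b (s *\<^sub>R y))) \<partial>\<sigma>)
       = (\<integral>\<^sup>+x. ennreal (cmod (kern a r x y)) \<partial>\<sigma>) * ennreal (cmod (sph_series Y b (s *\<^sub>R y)))"
      by (rule nn_integral_multc[OF mk[OF y]])
    also have "\<dots> \<le> B * ennreal (cmod (sph_series Y b (s *\<^sub>R y)))" using y by (intro mult_right_mono B) auto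
    finally show "(\<integral>\<^sup>+x. ennreal (cmod (kern a r x y)) * ennreal (cmod (sph_series Y b (s *\<^sub>R y))) \<partial>\<sigma>) \<le> B * ennreal (cmod (sph_series Y b (s *\<^sub>R y)))" .
  qed
  also have "\<dots> = B * nmean (sph_series Y b) s"
    unfolding nmean_def by (rule nn_integral_cmult) (use mb in measurable)
  finally show ?thesis .
qed

text \<open>Both sides are continuous on the sphere and have the same coefficient against every
  basis function, so completeness identifies them.\<close>

lemma kern_one:
  assumes x: "norm x = 1" and y: "norm y = 1" and r: "0 \<le> r" "r < 1"
  shows "kern (\<lambda>k j. 1) r x y = complex_of_real (poisson_kernel (r *\<^sub>R x) y / \<omega>)"
proof -
  have s1: "subexp (coeff_norm (\<lambda>k j. 1))" using subexp_scalar[OF subexp_const[of 1]] by simp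
  let ?v = "\<lambda>x. kern (\<lambda>k j. 1) r x y - complex_of_real (poisson_kernel (r *\<^sub>R x) y / \<omega>)"
  have ck: "continuous_on (sphere 0 1) (\<lambda>x. kern (\<lambda>k j. 1) r x y)" by (rule kern_continuous[OF s1 y r])
  have cp: "continuous_on (sphere 0 1) (\<lambda>x. complex_of_real (poisson_kernel (r *\<^sub>R x) y / \<omega>))"
    using \<omega>_pos by (intro continuous_on_of_real continuous_on_divide poisson_kernel_continuous[OF r y] continuous_on_const) auto
  have "?v x = 0"
  proof (rule completeness[of ?v])
    show "continuous_on (sphere 0 1) ?v" by (intro continuous_on_diff ck cp)
    fix k j assume j: "j \<in> {1..sph_dim TYPE('a) k}"
    have "(\<integral>x. ?v x * complex_of_real (Y k j x) \<partial>\<sigma>) = (\<integral>x. kern (\<lambda>k j. 1) r x y * complex_of_real (Y k j x) \<partial>\<sigma>)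
       - (\<integral>x. complex_of_real (poisson_kernel (r *\<^sub>R x) y / \<omega>) * complex_of_real (Y k j x) \<partial>\<sigma>)"
      unfolding left_diff_distrib
      by (rule Bochner_Integration.integral_diff) (intro integrable_\<sigma> continuous_on_mult continuous_on_of_real[of _ "Y k j"] ck cp Y_continuous j)+
    also have "(\<integral>x. kern (\<lambda>k j. 1) r x y * complex_of_real (Y k j x) \<partial>\<sigma>) = (\<integral>x. sph_series Y (kcoeff (\<lambda>k j. 1) y) (r *\<^sub>R x) * complex_of_real (Y k j x) \<partial>\<sigma>)"
      by (rule Bochner_Integration.integral_cong) (simp_all add: kern_eq_series[of _ "\<lambda>k j. 1" y r, symmetric])
    also have "\<dots> = complex_of_real (r ^ k) * (1 * complex_of_real (Y k j y))"
      by (rule sph_series_coefficient[OF subexp_kcoeff[OF s1 y] r j])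
    also have "(\<integral>x. complex_of_real (poisson_kernel (r *\<^sub>R x) y / \<omega>) * complex_of_real (Y k j x) \<partial>\<sigma>)
       = (\<integral>x. complex_of_real ((poisson_kernel (r *\<^sub>R x) y * Y k j x) / \<omega>) \<partial>\<sigma>)" by simp
    also have "\<dots> = complex_of_real ((\<integral>x. poisson_kernel (r *\<^sub>R x) y * Y k j x \<partial>\<sigma>) / \<omega>)"
      by (simp only: integral_complex_of_real integral_divide_zero)
    also have "\<dots> = complex_of_real (Y k j y * r ^ k)"
      unfolding poisson_kernel_coefficient[OF j r y] using \<omega>_pos by simp
    finally show "(\<integral>x. ?v x * complex_of_real (Y k j x) \<partial>\<sigma>) = 0" by (simp add: mult.commute)
  qed (rule x)
  then show ?thesis by simp
qed

text \<open>By positivity the L^1 mean of the Poisson kernel is its integral.\<close>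

lemma kern_one_integral:
  assumes y: "norm y = 1" and r: "0 \<le> r" "r < 1"
  shows "(\<integral>\<^sup>+x. ennreal (cmod (kern (\<lambda>k j. 1) r x y)) \<partial>\<sigma>) \<le> 1"
proof -
  have nn: "0 \<le> poisson_kernel (r *\<^sub>R x) y / \<omega>" if "norm x = 1" for x
    using r that \<omega>_pos by (intro divide_nonneg_pos poisson_kernel_nonneg) auto
  have "(\<integral>\<^sup>+x. ennreal (cmod (kern (\<lambda>k j. 1) r x y)) \<partial>\<sigma>) = (\<integral>\<^sup>+x. ennreal (poisson_kernel (r *\<^sub>R x) y / \<omega>) \<partial>\<sigma>)"
  proof (rule nn_integral_cong)
    fix x assume "x \<in> space \<sigma>"
    then have x: "norm x = 1" by simp
    show "ennreal (cmod (kern (\<lambda>k j. 1) r x y)) = ennreal (poisson_kernel (r *\<^sub>R x) y / \<omega>)"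
      by (simp only: kern_one[OF x y r] norm_of_real abs_of_nonneg[OF nn[OF x]])
  qed
  also have "\<dots> = ennreal (\<integral>x. poisson_kernel (r *\<^sub>R x) y / \<omega> \<partial>\<sigma>)"
    using \<omega>_pos nn by (intro nn_integral_eq_integral integrable_\<sigma> continuous_on_divide poisson_kernel_continuous[OF r y] continuous_on_const AE_I2) auto
  also have "\<dots> = 1" using poisson_kernel_integral[OF r y] \<omega>_pos by simp
  finally show ?thesis by simp
qed

lemma nmean_cong: "(\<And>x. norm x < 1 \<Longrightarrow> f x = g x) \<Longrightarrow> 0 \<le> r \<Longrightarrow> r < 1 \<Longrightarrow> nmean f r = nmean g r"
  unfolding nmean_def by (rule nn_integral_cong) simp

text \<open>The dilate of f by r is the Poisson integral, with parameter r/s, of the dilate by s,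
  and the Poisson kernel has mass 1.\<close>

lemma nmean_mono:
  assumes f: "f \<in> harmonic_ball" and r: "0 \<le> r" "r \<le> s" "s < 1"
  shows "nmean f r \<le> nmean f s"
proof (cases "r = s")
  case False
  define b where "b = sph_coeff Y f"
  have b: "subexp (coeff_norm b)" "\<And>x. norm x < 1 \<Longrightarrow> f x = sph_series Y b x"
    using sph_coeff_subexp[OF f] sph_series_sph_coeff[OF f] by (auto simp: b_def)
  have s1: "subexp (coeff_norm (\<lambda>k j. 1))" using subexp_scalar[OF subexp_const[of 1]] by simp
  have q: "0 \<le> r / s" "r / s < 1" "r / s * s = r" "0 \<le> s" using False r by auto
  have "nmean (sph_series Y (\<lambda>k j. 1 * b k j)) (r / s * s) \<le> 1 * nmean (sph_series Y b) s"
    by (rule nmean_mult_le[OF s1 b(1) q(1,2,4) r(3)]) (use kern_one_integral q in auto)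
  then have "nmean (sph_series Y b) r \<le> nmean (sph_series Y b) s" using q by simp
  moreover have "nmean f r = nmean (sph_series Y b) r" "nmean f s = nmean (sph_series Y b) s"
    using r by (auto intro!: nmean_cong b(2))
  ultimately show ?thesis by simp
qed simp

section \<open>Kernels whose coefficients depend on the order alone\<close>

lemma kern_scalar:
  assumes l: "subexp l" and x: "norm x = 1" and y: "norm y = 1" and r: "0 \<le> r" "r < 1"
  shows "(\<lambda>k. l k * Z k x y * r ^ k) sums Re (kern (\<lambda>k j. complex_of_real (l k)) r x y)"
    and "kern (\<lambda>k j. complex_of_real (l k)) r x y = complex_of_real (Re (kern (\<lambda>k j. complex_of_real (l k)) r x y))"
proof -
  have "norm (r *\<^sub>R x) < 1" using r x by simp
  from subexp_sums[OF subexp_kcoeff[OF subexp_scalar[OF l] y] this]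
  have "(\<lambda>k. sph_term Y (kcoeff (\<lambda>k j. complex_of_real (l k)) y) (r *\<^sub>R x) k) sums kern (\<lambda>k j. complex_of_real (l k)) r x y"
    by (simp add: kern_eq_series[OF x])
  moreover have "sph_term Y (kcoeff (\<lambda>k j. complex_of_real (l k)) y) (r *\<^sub>R x) k = complex_of_real (l k * Z k x y * r ^ k)" for k
    unfolding sph_term_polar[OF x] sph_part_def Z_def by (simp add: sum_distrib_left mult_ac)
  ultimately have *: "(\<lambda>k. complex_of_real (l k * Z k x y * r ^ k)) sums kern (\<lambda>k j. complex_of_real (l k)) r x y" by simp
  from sums_Re[OF this] show **: "(\<lambda>k. l k * Z k x y * r ^ k) sums Re (kern (\<lambda>k j. complex_of_real (l k)) r x y)" by simp
  show "kern (\<lambda>k j. complex_of_real (l k)) r x y = complex_of_real (Re (kern (\<lambda>k j. complex_of_real (l k)) r x y))"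
    by (rule sums_unique2[OF *]) (use sums_of_real[OF **] in simp)
qed

text \<open>The logarithmic derivative is at most (n + 2) / (1 - r): the numerator gives at most 2 /
  (1 - r), and each of the n factors of the distance at most 1 / (1 - r). Since the bound is a
  multiple of the positive kernel, it can be integrated over the sphere at once.\<close>

lemma poisson_kernel_radial_derivative:
  fixes x y :: 'a
  assumes x: "norm x = 1" and y: "norm y = 1" and r: "0 \<le> r" "r < 1"
  shows "\<exists>D. ((\<lambda>r. poisson_kernel (r *\<^sub>R x) y) has_real_derivative D) (at r) \<and>
     \<bar>D\<bar> \<le> (real DIM('a) + 2) / (1 - r) * poisson_kernel (r *\<^sub>R x) y"
proof -
  define n where "n = DIM('a)"
  define q where "q s = norm (s *\<^sub>R x - y)" for s
  have q: "1 - r \<le> q r" using norm_triangle_ineq3[of "r *\<^sub>R x" y] r x y by (simp add: q_def)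
  have q0: "q r > 0" using q r by linarith
  obtain D1 where D1: "(q has_real_derivative D1) (at r)" "\<bar>D1\<bar> \<le> 1"
  proof -
    have ne: "r *\<^sub>R x - y \<noteq> 0" using q0 by (auto simp: q_def)
    have "(q has_derivative (\<lambda>h. sgn (r *\<^sub>R x - y) \<bullet> (h *\<^sub>R x))) (at r)"
      unfolding q_def
      by (rule has_derivative_compose[where g = norm]) (auto intro!: derivative_eq_intros has_derivative_norm ne simp: fun_eq_iff inner_commute)
    then have "(q has_real_derivative (sgn (r *\<^sub>R x - y) \<bullet> x)) (at r)"
      by (simp add: has_field_derivative_def mult.commute[of _ "sgn (r *\<^sub>R x - y) \<bullet> x"])
    moreover have "\<bar>sgn (r *\<^sub>R x - y) \<bullet> x\<bar> \<le> 1"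
      using Cauchy_Schwarz_ineq2[of "sgn (r *\<^sub>R x - y)" x] x ne by (simp add: norm_sgn)
    ultimately show ?thesis by (rule that)
  qed
  define P where "P = (1 - r^2) / q r ^ n"
  have P0: "P \<ge> 0" using r q0 by (simp add: P_def power_le_one)
  have eq: "poisson_kernel (s *\<^sub>R x) y = (1 - s^2) / q s ^ n" for s
    by (simp add: poisson_kernel_def q_def n_def x)
  define D where "D = (- 2 * r * q r ^ n - (1 - r^2) * (real n * q r ^ (n - 1) * D1)) / (q r ^ n * q r ^ n)"
  have d1: "((\<lambda>s. (1 - s^2) / q s ^ n) has_real_derivative D) (at r)"
    unfolding D_def using q0 by (auto intro!: derivative_eq_intros D1(1))
  have d2: "\<bar>D\<bar> \<le> (real n + 2) / (1 - r) * P"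
  proof -
    have n1: "n \<ge> 1" by (simp add: n_def)
    have "q r ^ n = q r * q r ^ (n - 1)" using n1 by (cases n) auto
    then have "D = - (2 * r) / q r ^ n - P * (real n * D1 / q r)"
      using q0 by (simp add: D_def P_def field_simps)
    moreover have "\<bar>(2 * r) / q r ^ n\<bar> \<le> 2 / (1 - r) * P"
    proof -
      have "r * (1 - r) \<le> 1 - r^2" using r by (simp add: power2_eq_square algebra_simps mult_le_one)
      then have "2 * r \<le> 2 / (1 - r) * (1 - r^2)" using r by (simp add: field_simps)
      then have "(2 * r) / q r ^ n \<le> (2 / (1 - r) * (1 - r^2)) / q r ^ n" using q0 by (intro divide_right_mono) auto
      then show ?thesis using q0 r by (simp add: P_def)
    qed
    moreover have "\<bar>P * (real n * D1 / q r)\<bar> \<le> P * (real n / (1 - r))"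
    proof -
      have "\<bar>real n * D1 / q r\<bar> \<le> real n * 1 / (1 - r)"
        unfolding abs_mult abs_divide using D1 q q0 r by (intro frac_le) (auto simp: mult_left_le)
      then have bd: "\<bar>real n * D1 / q r\<bar> \<le> real n / (1 - r)" by simp
      have "\<bar>P * (real n * D1 / q r)\<bar> = P * \<bar>real n * D1 / q r\<bar>" using P0 by (subst abs_mult) simp
      also have "\<dots> \<le> P * (real n / (1 - r))" by (rule mult_left_mono[OF bd P0])
      finally show ?thesis .
    qed
    ultimately have "\<bar>D\<bar> \<le> 2 / (1 - r) * P + P * (real n / (1 - r))" by linarith
    also have "\<dots> = (real n + 2) / (1 - r) * P" by (simp add: add_divide_distrib algebra_simps)
    finally show ?thesis .
  qed
  show ?thesis using d1 d2 unfolding eq P_def n_def by blast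
qed

text \<open>Multiplying the part of order k by k is the operator r d/dr, so the bound on the radial
  derivative of the Poisson kernel applies.\<close>

lemma kern_index_le:
  assumes x: "norm x = 1" and y: "norm y = 1" and r: "0 \<le> r" "r < 1"
  shows "cmod (kern (\<lambda>k j. complex_of_real (real k)) r x y) \<le> (real DIM('a) + 2) / (1 - r) * cmod (kern (\<lambda>k j. 1) r x y)"
proof (cases "r = 0")
  case True
  have "kern (\<lambda>k j. complex_of_real (real k)) 0 x y = 0"
  proof -
    have "(\<lambda>k. complex_of_real (0 ^ k) * (\<Sum>j=1..sph_dim TYPE('a) k. complex_of_real (real k) * complex_of_real (Y k j x * Y k j y))) = (\<lambda>_. 0)"
    proof
      fix k show "complex_of_real (0 ^ k) * (\<Sum>j=1..sph_dim TYPE('a) k. complex_of_real (real k) * complex_of_real (Y k j x * Y k j y)) = 0"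
        by (cases k) auto
    qed
    then show ?thesis unfolding kern_def by simp
  qed
  then show ?thesis using True by simp
next
  case False
  define c where "c k = Z k x y" for k
  have S: "(\<lambda>k. c k * s ^ k) sums (poisson_kernel (s *\<^sub>R x) y / \<omega>)" if "0 \<le> s" "s < 1" for s
    using kern_scalar(1)[OF subexp_const[of 1] x y that] by (simp add: kern_one[OF x y that] c_def)
  define K where "K = (1 + r) / 2"
  have K: "r < K" "K < 1" "0 \<le> K" using r by (auto simp: K_def)
  have "summable (\<lambda>n. c n * K ^ n)" using S[of K] K sums_summable by auto
  then have der: "((\<lambda>s. \<Sum>n. c n * s ^ n) has_real_derivative (\<Sum>n. diffs c n * r ^ n)) (at r)"
    using K r by (intro termdiffs_strong) auto
  have "((\<lambda>s. poisson_kernel (s *\<^sub>R x) y / \<omega>) has_real_derivative (\<Sum>n. diffs c n * r ^ n)) (at r)"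
  proof (rule has_field_derivative_transform_within_open[OF der, of "{0<..<1}"])
    show "(\<Sum>n. c n * s ^ n) = poisson_kernel (s *\<^sub>R x) y / \<omega>" if "s \<in> {0<..<1}" for s
      using S[of s] that by (simp add: sums_iff)
  qed (use r False in auto)
  moreover obtain D where D: "((\<lambda>r. poisson_kernel (r *\<^sub>R x) y) has_real_derivative D) (at r)"
     "\<bar>D\<bar> \<le> (real DIM('a) + 2) / (1 - r) * poisson_kernel (r *\<^sub>R x) y"
    using poisson_kernel_radial_derivative[OF x y r] by blast
  moreover have "((\<lambda>s. poisson_kernel (s *\<^sub>R x) y / \<omega>) has_real_derivative D / \<omega>) (at r)"
    using D(1) by (rule DERIV_cdivide)
  ultimately have eqD: "(\<Sum>n. diffs c n * r ^ n) = D / \<omega>" using DERIV_unique by blast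
  have sm: "summable (\<lambda>n. diffs c n * r ^ n)"
  proof (rule termdiff_converges[where K = 1])
    show "summable (\<lambda>n. c n * s ^ n)" if "norm s < 1" for s :: real
      using powser_inside[of c "(1 + \<bar>s\<bar>) / 2" s] S[of "(1 + \<bar>s\<bar>) / 2"] that sums_summable by auto
  qed (use r in auto)
  have "(\<lambda>n. r * (of_nat n * c n * r ^ (n - Suc 0))) sums (r * (D / \<omega>))"
    using diffs_equiv[OF sm] unfolding eqD by (rule sums_mult)
  moreover have "r * (of_nat n * c n * r ^ (n - Suc 0)) = real n * Z n x y * r ^ n" for n
    by (cases n) (auto simp: c_def)
  moreover have "subexp real" by (rule subexp_mono[OF subexp_Suc]) simp
  ultimately have "Re (kern (\<lambda>k j. complex_of_real (real k)) r x y) = r * (D / \<omega>)"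
    using kern_scalar(1)[OF _ x y r, of real] sums_unique2 by (metis (no_types, lifting) sums_cong)
  then have "cmod (kern (\<lambda>k j. complex_of_real (real k)) r x y) = \<bar>r * (D / \<omega>)\<bar>"
    using kern_scalar(2)[OF \<open>subexp real\<close> x y r] by (metis norm_of_real)
  also have "\<dots> \<le> 1 * (\<bar>D\<bar> / \<omega>)"
    unfolding abs_mult using r \<omega>_pos by (intro mult_mono) (auto simp: abs_divide)
  also have "\<dots> \<le> ((real DIM('a) + 2) / (1 - r) * poisson_kernel (r *\<^sub>R x) y) / \<omega>"
    unfolding mult_1 using \<omega>_pos by (intro divide_right_mono[OF D(2)]) simp
  also have "\<dots> = (real DIM('a) + 2) / (1 - r) * (poisson_kernel (r *\<^sub>R x) y / \<omega>)" by simp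
  also have "poisson_kernel (r *\<^sub>R x) y / \<omega> = cmod (kern (\<lambda>k j. 1) r x y)"
    unfolding kern_one[OF x y r] norm_of_real using r x \<omega>_pos by (intro abs_of_nonneg[symmetric] divide_nonneg_pos poisson_kernel_nonneg) auto
  finally show ?thesis .
qed

lemma kern_linear_integral:
  assumes y: "norm y = 1" and r: "0 \<le> r" "r < 1" and c: "0 \<le> c"
  shows "(\<integral>\<^sup>+x. ennreal (cmod (kern (\<lambda>k j. complex_of_real (real k + c)) r x y)) \<partial>\<sigma>) \<le> ennreal ((real DIM('a) + 2 + c) / (1 - r))"
proof -
  have sr: "subexp real" by (rule subexp_mono[OF subexp_Suc]) simp
  have le: "cmod (kern (\<lambda>k j. complex_of_real (real k + c)) r x y) \<le> (real DIM('a) + 2 + c) / (1 - r) * cmod (kern (\<lambda>k j. 1) r x y)" if x: "norm x = 1" for x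
  proof -
    note k1 = kern_scalar[OF sr x y r] and k2 = kern_scalar[OF subexp_const[of c] x y r] and k3 = kern_scalar[OF subexp_const[of 1] x y r]
      and k4 = kern_scalar[OF subexp_add[OF sr subexp_const[of c]] x y r]
    have "(\<lambda>k. c * (1 * Z k x y * r ^ k)) sums (c * Re (kern (\<lambda>k j. complex_of_real 1) r x y))"
      by (rule sums_mult[OF k3(1)])
    from sums_add[OF k1(1) this] have "(\<lambda>k. (real k + c) * Z k x y * r ^ k) sums (Re (kern (\<lambda>k j. complex_of_real (real k)) r x y) + c * Re (kern (\<lambda>k j. complex_of_real 1) r x y))"
      by (simp add: algebra_simps)
    from sums_unique2[OF k4(1) this] have "Re (kern (\<lambda>k j. complex_of_real (real k + c)) r x y) = Re (kern (\<lambda>k j. complex_of_real (real k)) r x y) + c * Re (kern (\<lambda>k j. complex_of_real 1) r x y)" .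
    then have "cmod (kern (\<lambda>k j. complex_of_real (real k + c)) r x y) = \<bar>Re (kern (\<lambda>k j. complex_of_real (real k)) r x y) + c * Re (kern (\<lambda>k j. complex_of_real 1) r x y)\<bar>"
      using k4(2) by (metis norm_of_real)
    also have "\<dots> \<le> cmod (kern (\<lambda>k j. complex_of_real (real k)) r x y) + c * cmod (kern (\<lambda>k j. 1) r x y)"
      using c abs_Re_le_cmod by (intro order_trans[OF abs_triangle_ineq] add_mono) (auto simp: abs_mult intro!: mult_left_mono)
    also have "\<dots> \<le> (real DIM('a) + 2) / (1 - r) * cmod (kern (\<lambda>k j. 1) r x y) + c / (1 - r) * cmod (kern (\<lambda>k j. 1) r x y)"
    proof (intro add_mono kern_index_le[OF x y r] mult_right_mono)
      show "c \<le> c / (1 - r)" using c r by (simp add: field_simps mult_left_le)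
    qed auto
    finally show ?thesis by (simp add: add_divide_distrib distrib_right)
  qed
  have "(\<integral>\<^sup>+x. ennreal (cmod (kern (\<lambda>k j. complex_of_real (real k + c)) r x y)) \<partial>\<sigma>)
     \<le> (\<integral>\<^sup>+x. ennreal ((real DIM('a) + 2 + c) / (1 - r)) * ennreal (cmod (kern (\<lambda>k j. 1) r x y)) \<partial>\<sigma>)"
  proof (rule nn_integral_mono)
    fix x assume "x \<in> space \<sigma>"
    then have "norm x = 1" by simp
    from le[OF this] show "ennreal (cmod (kern (\<lambda>k j. complex_of_real (real k + c)) r x y)) \<le> ennreal ((real DIM('a) + 2 + c) / (1 - r)) * ennreal (cmod (kern (\<lambda>k j. 1) r x y))"
      using c r by (subst ennreal_mult[symmetric]) (auto intro: ennreal_leI)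
  qed
  also have "\<dots> = ennreal ((real DIM('a) + 2 + c) / (1 - r)) * (\<integral>\<^sup>+x. ennreal (cmod (kern (\<lambda>k j. 1) r x y)) \<partial>\<sigma>)"
    by (rule nn_integral_cmult) (use kern_measurable[of "\<lambda>x. x" \<sigma> "\<lambda>_. y" "\<lambda>_. r" "\<lambda>k j. 1"] y in simp)
  also have "\<dots> \<le> ennreal ((real DIM('a) + 2 + c) / (1 - r)) * 1"
    by (intro mult_left_mono kern_one_integral[OF y r]) auto
  finally show ?thesis by simp
qed

lemma subexp_pochhammer: "0 \<le> c \<Longrightarrow> subexp (\<lambda>k. pochhammer (real k + c) N)"
proof (induction N)
  case (Suc N)
  have "subexp (\<lambda>k. real (Suc k) + (c + real N))" by (intro subexp_add subexp_Suc subexp_const)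
  then have "subexp (\<lambda>k. real k + c + real N)" by (rule subexp_mono) (use Suc.prems in auto)
  from subexp_mult[OF Suc.IH[OF Suc.prems] this] show ?case by (simp add: pochhammer_Suc)
qed simp

text \<open>A Pochhammer symbol is a product of linear factors k + c + i. Each one is a convolution
  with a kernel of mean O(1 / (1 - r)), so N of them cost \<open>(1 / (1 - r)) ^ N\<close>.\<close>

lemma kern_pochhammer_integral:
  assumes c: "0 \<le> c"
  shows "\<exists>C\<ge>0. \<forall>r y. 0 \<le> r \<longrightarrow> r < 1 \<longrightarrow> norm y = 1 \<longrightarrow>
     (\<integral>\<^sup>+x. ennreal (cmod (kern (\<lambda>k j. complex_of_real (pochhammer (real k + c) N)) r x y)) \<partial>\<sigma>) \<le> ennreal (C * (1 / (1 - r)) ^ N)"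
proof (induction N)
  case 0
  show ?case by (rule exI[of _ 1]) (use kern_one_integral in auto)
next
  case (Suc N)
  then obtain C where C: "0 \<le> C" "\<And>r y. 0 \<le> r \<Longrightarrow> r < 1 \<Longrightarrow> norm y = 1 \<Longrightarrow>
     (\<integral>\<^sup>+x. ennreal (cmod (kern (\<lambda>k j. complex_of_real (pochhammer (real k + c) N)) r x y)) \<partial>\<sigma>) \<le> ennreal (C * (1 / (1 - r)) ^ N)"
    by blast
  define L where "L = real DIM('a) + 2 + (c + real N)"
  have L: "0 \<le> L" using c by (simp add: L_def)
  show ?case
  proof (intro exI[of _ "C * L * 2 ^ Suc N"] conjI allI impI)
    show "0 \<le> C * L * 2 ^ Suc N" using C L by simp
    fix r :: real and y :: 'a assume r: "0 \<le> r" "r < 1" and y: "norm y = 1"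
    \<comment> \<open>Splitting r = s * s gives both convolution factors the same radius; 1 - r
      \<le> 2 * (1 - s) accounts for the factor \<open>2 ^ Suc N\<close>.\<close>
    define s where "s = sqrt r"
    have s: "0 \<le> s" "s < 1" "s * s = r" using r by (auto simp: s_def)
    let ?a = "\<lambda>k j. complex_of_real (real k + (c + real N))" and ?b = "kcoeff (\<lambda>k j. complex_of_real (pochhammer (real k + c) N)) y"
    have sa: "subexp (coeff_norm ?a)"
      by (rule subexp_scalar, rule subexp_add[OF _ subexp_const], rule subexp_mono[OF subexp_Suc]) simp
    have sb: "subexp (coeff_norm ?b)" by (rule subexp_kcoeff[OF subexp_scalar[OF subexp_pochhammer[OF c]] y])
    have "(\<integral>\<^sup>+x. ennreal (cmod (kern (\<lambda>k j. complex_of_real (pochhammer (real k + c) (Suc N))) r x y)) \<partial>\<sigma>)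
       = nmean (sph_series Y (\<lambda>k j. ?a k j * ?b k j)) (s * s)"
      unfolding nmean_def
    proof (rule nn_integral_cong)
      fix x assume "x \<in> space \<sigma>"
      then have x: "norm x = 1" by simp
      have "(\<lambda>k j. ?a k j * ?b k j) = kcoeff (\<lambda>k j. complex_of_real (pochhammer (real k + c) (Suc N))) y"
        by (simp add: pochhammer_Suc fun_eq_iff mult_ac add_ac)
      then show "ennreal (cmod (kern (\<lambda>k j. complex_of_real (pochhammer (real k + c) (Suc N))) r x y)) =
          ennreal (cmod (sph_series Y (\<lambda>k j. ?a k j * ?b k j) ((s * s) *\<^sub>R x)))"
        by (simp only: kern_eq_series[OF x] s(3))
    qed
    also have "\<dots> \<le> ennreal (L / (1 - s)) * nmean (sph_series Y ?b) s"
      by (rule nmean_mult_le[OF sa sb s(1,2) s(1,2)]) (use kern_linear_integral[OF _ s(1,2), of _ "c + real N"] c in \<open>simp add: L_def\<close>)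
    also have "nmean (sph_series Y ?b) s = (\<integral>\<^sup>+x. ennreal (cmod (kern (\<lambda>k j. complex_of_real (pochhammer (real k + c) N)) s x y)) \<partial>\<sigma>)"
      unfolding nmean_def by (rule nn_integral_cong) (simp add: kern_eq_series)
    also have "ennreal (L / (1 - s)) * \<dots> \<le> ennreal (L / (1 - s)) * ennreal (C * (1 / (1 - s)) ^ N)"
      by (intro mult_left_mono C(2) s y) auto
    also have "\<dots> = ennreal (C * L * (1 / (1 - s)) ^ Suc N)"
      using s L C by (subst ennreal_mult[symmetric]) (auto simp: mult_ac)
    also have "\<dots> \<le> ennreal (C * L * (2 / (1 - r)) ^ Suc N)"
    proof (intro ennreal_leI mult_left_mono power_mono)
      have "1 - r \<le> 2 * (1 - s)" using zero_le_power2[of "1 - s"] s by (simp add: power2_eq_square algebra_simps)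
      then show "1 / (1 - s) \<le> 2 / (1 - r)" using s r by (simp add: field_simps)
    qed (use C L s in auto)
    also have "C * L * (2 / (1 - r)) ^ Suc N = C * L * 2 ^ Suc N * (1 / (1 - r)) ^ Suc N" by (simp add: power_divide)
    finally show "(\<integral>\<^sup>+x. ennreal (cmod (kern (\<lambda>k j. complex_of_real (pochhammer (real k + c) (Suc N))) r x y)) \<partial>\<sigma>)
      \<le> ennreal (C * L * 2 ^ Suc N * (1 / (1 - r)) ^ Suc N)" .
  qed
qed

end

section \<open>Fractional integrals and derivatives\<close>

text \<open>Its k-th moment is Beta (k + a) b, so averaging dilations against it multiplies the part
  of order k by that number.\<close>

definition beta_measure :: "real \<Rightarrow> real \<Rightarrow> real measure" where
  "beta_measure a b = density lborel (\<lambda>s. ennreal (indicator {0<..<1} s * (s powr (a - 1) * (1 - s) powr (b - 1))))"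

lemma sets_beta_measure [measurable_cong, simp]: "sets (beta_measure a b) = sets borel"
  and space_beta_measure [simp]: "space (beta_measure a b) = UNIV"
  by (simp_all add: beta_measure_def)

lemma nn_integral_beta_measure:
  assumes "f \<in> borel_measurable borel"
  shows "(\<integral>\<^sup>+s. f s \<partial>beta_measure a b) = (\<integral>\<^sup>+s. ennreal (indicator {0<..<1} s * (s powr (a - 1) * (1 - s) powr (b - 1))) * f s \<partial>lborel)"
  unfolding beta_measure_def by (rule nn_integral_density) (use assms in auto)

lemma AE_beta_measure: "AE s in beta_measure a b. 0 < s \<and> s < 1"
  unfolding beta_measure_def by (subst AE_density) (auto simp: indicator_def)

lemma beta_moment:
  assumes a: "0 < a" and b: "0 < b"
  shows "(\<integral>\<^sup>+s. ennreal (s ^ k) \<partial>beta_measure a b) = ennreal (Beta (real k + a) b)"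
proof -
  let ?f = "\<lambda>s. s powr (real k + a - 1) * (1 - s) powr (b - 1)"
  have "(\<integral>\<^sup>+s. ennreal (s ^ k) \<partial>beta_measure a b) = (\<integral>\<^sup>+s. ennreal (indicator {0<..<1} s * (s powr (a - 1) * (1 - s) powr (b - 1))) * ennreal (s ^ k) \<partial>lborel)"
    by (rule nn_integral_beta_measure) auto
  also have "\<dots> = (\<integral>\<^sup>+s. ennreal (if s \<in> {0<..<1} then ?f s else 0) \<partial>lborel)"
  proof (rule nn_integral_cong)
    fix s :: real
    show "ennreal (indicator {0<..<1} s * (s powr (a - 1) * (1 - s) powr (b - 1))) * ennreal (s ^ k) = ennreal (if s \<in> {0<..<1} then ?f s else 0)"
    proof (cases "s \<in> {0<..<1}")
      case True
      then have "s powr (real k + a - 1) = s powr (a - 1) * s ^ k"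
        by (simp add: powr_realpow[symmetric] flip: powr_add) (simp add: algebra_simps)
      then show ?thesis using True by (subst ennreal_mult[symmetric]) (auto simp: mult_ac)
    qed simp
  qed
  also have "\<dots> = ennreal (Beta (real k + a) b)"
  proof (rule nn_integral_has_integral_lborel)
    have "(?f has_integral Beta (real k + a) b) {0<..<1}"
      using has_integral_Beta_real[of "real k + a" b] a b by (simp add: has_integral_Icc_iff_Ioo)
    then show "((\<lambda>s. if s \<in> {0<..<1} then ?f s else 0) has_integral Beta (real k + a) b) UNIV"
      by (subst has_integral_restrict_UNIV)
  qed auto
  finally show ?thesis .
qed

lemma Beta_pos: "0 < a \<Longrightarrow> 0 < b \<Longrightarrow> 0 < (Beta a b :: real)"
  unfolding Beta_def by (intro divide_pos_pos mult_pos_pos Gamma_real_pos) auto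

lemma finite_beta_measure:
  assumes "0 < a" "0 < b" shows "finite_measure (beta_measure a b)"
  using beta_moment[OF assms, of 0] by (intro finite_measureI) simp

lemma beta_moment_integral:
  assumes a: "0 < a" and b: "0 < b"
  shows "integrable (beta_measure a b) (\<lambda>s. s ^ k)" "(\<integral>s. s ^ k \<partial>beta_measure a b) = Beta (real k + a) b"
proof -
  have "has_bochner_integral (beta_measure a b) (\<lambda>s. s ^ k) (Beta (real k + a) b)"
  proof (rule has_bochner_integral_nn_integral[OF _ _ _ beta_moment[OF a b]])
    show "AE s in beta_measure a b. 0 \<le> s ^ k" using AE_beta_measure by eventually_elim auto
    show "0 \<le> Beta (real k + a) b" using Beta_pos[of "real k + a" b] a b by simp
  qed auto
  then show "integrable (beta_measure a b) (\<lambda>s. s ^ k)" "(\<integral>s. s ^ k \<partial>beta_measure a b) = Beta (real k + a) b"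
    by (auto simp: has_bochner_integral_iff)
qed

lemma Beta_le:
  assumes a: "0 < a" and b: "0 < b"
  shows "Beta (real k + a) b \<le> Beta a b"
proof -
  interpret finite_measure "beta_measure a b" by (rule finite_beta_measure[OF assms])
  have "(\<integral>s. s ^ k \<partial>beta_measure a b) \<le> (\<integral>s. s ^ 0 \<partial>beta_measure a b)"
  proof (rule integral_mono_AE)
    show "AE s in beta_measure a b. s ^ k \<le> s ^ 0"
      using AE_beta_measure by eventually_elim (auto simp: power_le_one)
  qed (rule beta_moment_integral[OF assms])+
  then show ?thesis unfolding beta_moment_integral(2)[OF assms] by simp
qed

lemma nn_integral_powr_tail:
  assumes b: "0 < b" and r: "r \<le> 1"
  shows "(\<integral>\<^sup>+s. ennreal (indicator {r..<1} s * (1 - s) powr (b - 1)) \<partial>lborel) = ennreal ((1 - r) powr b / b)"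
proof -
  have "(\<integral>\<^sup>+s. ennreal (indicator {r..<1} s * (1 - s) powr (b - 1)) \<partial>lborel)
    = ennreal \<bar>-1\<bar> * (\<integral>\<^sup>+u. ennreal (indicator {r..<1} (1 + -1 * u) * (1 - (1 + -1 * u)) powr (b - 1)) \<partial>lborel)"
    by (rule nn_integral_real_affine) auto
  also have "\<dots> = (\<integral>\<^sup>+u. ennreal (if u \<in> {0..1 - r} then u powr (b - 1) else 0) \<partial>lborel)"
    by (simp, rule nn_integral_cong_AE, rule eventually_mono[OF AE_lborel_singleton[of 0]]) (auto simp: indicator_def)
  also have "\<dots> = ennreal ((1 - r) powr (b - 1 + 1) / (b - 1 + 1))"
  proof (rule nn_integral_has_integral_lborel)
    have "((\<lambda>x. x powr (b - 1)) has_integral (1 - r) powr (b - 1 + 1) / (b - 1 + 1)) {0..1 - r}"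
      using b r by (intro has_integral_powr_from_0) auto
    then show "((\<lambda>u. if u \<in> {0..1 - r} then u powr (b - 1) else 0) has_integral (1 - r) powr (b - 1 + 1) / (b - 1 + 1)) UNIV"
      by (subst has_integral_restrict_UNIV)
  qed auto
  finally show ?thesis by simp
qed

lemma nn_integral_powr_head:
  assumes t: "0 < t" and r: "0 \<le> r" "r < 1"
  shows "(\<integral>\<^sup>+s. ennreal (indicator {0..r} s * (1 - s) powr (- t - 1)) \<partial>lborel) \<le> ennreal ((1 - r) powr (- t) / t)"
proof -
  have "(\<integral>\<^sup>+s. ennreal (indicator {0..r} s * (1 - s) powr (- t - 1)) \<partial>lborel) = (\<integral>\<^sup>+s. ennreal ((1 - s) powr (- t - 1)) * indicator {0..r} s \<partial>lborel)"
    by (rule nn_integral_cong) (auto simp: indicator_def)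
  also have "\<dots> = ennreal ((1 - r) powr (- t) / t - (1 - 0) powr (- t) / t)"
  proof (rule nn_integral_FTC_Icc[where F = "\<lambda>s. (1 - s) powr (- t) / t"])
    fix x :: real assume x: "x \<in> {0..r}"
    have "((\<lambda>s. (1 - s) powr (- t)) has_real_derivative t * (1 - x) powr (- t - 1)) (at x)"
      using r x by (auto intro!: derivative_eq_intros simp: powr_diff)
    from DERIV_cdivide[OF this, of t]
    show "((\<lambda>s. (1 - s) powr (- t) / t) has_real_derivative (1 - x) powr (- t - 1)) (at x)"
      using t by simp
  qed (use r in auto)
  also have "\<dots> \<le> ennreal ((1 - r) powr (- t) / t)" using t by (intro ennreal_leI) auto
  finally show ?thesis .
qed

text \<open>Split at s = r. Below, 1 - r s is at least 1 - s; above, it is at least 1 - r. The two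
  pieces give the terms 1/t and 1/(N - t).\<close>

lemma fractional_integral_estimate:
  fixes N :: real
  assumes t: "0 < t" "t < N" and r: "0 \<le> r" "r < 1"
  shows "(\<integral>\<^sup>+s. ennreal (indicator {0<..<1} s * (1 - s) powr (N - t - 1)) * ennreal ((1 - r * s) powr (- N)) \<partial>lborel)
     \<le> ennreal ((1 / t + 1 / (N - t)) * (1 - r) powr (- t))"
proof -
  have N: "0 < N - t" using t by simp
  have "(\<integral>\<^sup>+s. ennreal (indicator {0<..<1} s * (1 - s) powr (N - t - 1)) * ennreal ((1 - r * s) powr (- N)) \<partial>lborel)
     \<le> (\<integral>\<^sup>+s. ennreal (indicator {0..r} s * (1 - s) powr (- t - 1)) + ennreal ((1 - r) powr (- N)) * ennreal (indicator {r..<1} s * (1 - s) powr (N - t - 1)) \<partial>lborel)"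
  proof (rule nn_integral_mono)
    fix s :: real
    show "ennreal (indicator {0<..<1} s * (1 - s) powr (N - t - 1)) * ennreal ((1 - r * s) powr (- N))
       \<le> ennreal (indicator {0..r} s * (1 - s) powr (- t - 1)) + ennreal ((1 - r) powr (- N)) * ennreal (indicator {r..<1} s * (1 - s) powr (N - t - 1))"
    proof (cases "s \<in> {0<..<1}")
      case True
      then have s: "0 < s" "s < 1" by auto
      have rs: "r * s \<le> s" "r * s \<le> r" using r s by (auto simp: mult_left_le mult_left_le_one_le)
      show ?thesis
      proof (cases "s \<le> r")
        case True
        have "(1 - r * s) powr (- N) \<le> (1 - s) powr (- N)" using rs s t by (intro powr_mono2') auto
        then have "(1 - s) powr (N - t - 1) * (1 - r * s) powr (- N) \<le> (1 - s) powr (N - t - 1) * (1 - s) powr (- N)"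
          by (intro mult_left_mono) auto
        also have "\<dots> = (1 - s) powr (- t - 1)" by (simp flip: powr_add)
        finally have "ennreal ((1 - s) powr (N - t - 1) * (1 - r * s) powr (- N)) \<le> ennreal ((1 - s) powr (- t - 1))" by (rule ennreal_leI)
        then show ?thesis using s True by (simp add: ennreal_mult add_increasing2)
      next
        case False
        have "(1 - r * s) powr (- N) \<le> (1 - r) powr (- N)" using rs r t by (intro powr_mono2') auto
        then have "ennreal ((1 - r * s) powr (- N)) \<le> ennreal ((1 - r) powr (- N))" by (rule ennreal_leI)
        from mult_right_mono[OF this, of "ennreal ((1 - s) powr (N - t - 1))"]
        show ?thesis using s False by (simp add: mult.commute)
      qed
    qed simp
  qed
  also have "\<dots> = (\<integral>\<^sup>+s. ennreal (indicator {0..r} s * (1 - s) powr (- t - 1)) \<partial>lborel)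
      + ennreal ((1 - r) powr (- N)) * (\<integral>\<^sup>+s. ennreal (indicator {r..<1} s * (1 - s) powr (N - t - 1)) \<partial>lborel)"
    by (subst nn_integral_add) (auto simp: nn_integral_cmult)
  also have "\<dots> \<le> ennreal ((1 - r) powr (- t) / t) + ennreal ((1 - r) powr (- N)) * ennreal ((1 - r) powr (N - t) / (N - t))"
    using nn_integral_powr_tail[OF N, of r] r by (intro add_mono nn_integral_powr_head t r) auto
  also have "\<dots> = ennreal ((1 - r) powr (- t) / t + (1 - r) powr (- N) * ((1 - r) powr (N - t) / (N - t)))"
    using t N by (simp add: ennreal_mult[symmetric] ennreal_plus[symmetric] del: ennreal_plus)
  also have "(1 - r) powr (- N) * ((1 - r) powr (N - t) / (N - t)) = (1 - r) powr (- t) / (N - t)"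
    by (simp flip: powr_add)
  also have "(1 - r) powr (- t) / t + (1 - r) powr (- t) / (N - t) = (1 / t + 1 / (N - t)) * (1 - r) powr (- t)"
    by (simp add: algebra_simps)
  finally show ?thesis .
qed

section \<open>Fractional integrals as averages of dilations\<close>

context sphere_basis
begin

lemma sph_part_scale: "sph_part (\<lambda>k j. l k * a k j) k y = l k * sph_part a k y"
  unfolding sph_part_def by (simp add: sum_distrib_left mult_ac)

lemma coeff_norm_scale: "coeff_norm (\<lambda>k j. complex_of_real (l k) * a k j) k = \<bar>l k\<bar> * coeff_norm a k"
  unfolding coeff_norm_def by (simp add: norm_mult sum_distrib_left)

lemma subexp_coeff_scale:
  assumes "subexp l" "subexp (coeff_norm a)"
  shows "subexp (coeff_norm (\<lambda>k j. complex_of_real (l k) * a k j))"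
  by (rule subexp_mono[OF subexp_mult[OF assms]]) (simp add: coeff_norm_scale abs_mult)

lemma subexp_Beta: "0 < p \<Longrightarrow> 0 < q \<Longrightarrow> subexp (\<lambda>k. Beta (real k + p) q)"
proof (rule subexp_mono[OF subexp_const])
  fix k assume "0 < p" "0 < q"
  then show "\<bar>Beta (real k + p) q\<bar> \<le> \<bar>Beta p q\<bar>"
    using Beta_le[of p q k] Beta_pos[of "real k + p" q] by simp
qed

text \<open>The term of order k at radius r s is s^k times the one at r, so integration in s
  produces the k-th moment. All moments are at most the total mass, which justifies the
  interchange.\<close>

lemma sph_series_Beta:
  assumes a: "subexp (coeff_norm a)" and p: "0 < p" "0 < q" and r: "0 \<le> r" "r < 1" and x: "norm x = 1"
  shows "sph_series Y (\<lambda>k j. complex_of_real (Beta (real k + p) q) * a k j) (r *\<^sub>R x)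
     = (\<integral>s. sph_series Y a ((r * s) *\<^sub>R x) \<partial>beta_measure p q)"
    and "integrable (beta_measure p q) (\<lambda>s. sph_series Y a ((r * s) *\<^sub>R x))"
proof -
  define c where "c k = sph_term Y a (r *\<^sub>R x) k" for k
  have rx: "norm (r *\<^sub>R x) < 1" using r x by simp
  have sc: "summable (\<lambda>k. cmod (c k))" unfolding c_def by (rule sph_term_summable_norm[OF a rx])
  have tm: "sph_term Y a ((r * s) *\<^sub>R x) k = complex_of_real (s ^ k) * c k" for s k
    unfolding c_def sph_term_polar[OF x] by (simp add: power_mult_distrib)
  have int: "integrable (beta_measure p q) (\<lambda>s. complex_of_real (s ^ k) * c k)" for k
    using beta_moment_integral(1)[OF p] by (intro integrable_mult_left) (simp only: complex_of_real_integrable_eq)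
  have sn: "AE s in beta_measure p q. summable (\<lambda>k. norm (complex_of_real (s ^ k) * c k))"
    using AE_beta_measure
  proof eventually_elim
    case (elim s)
    show ?case
      by (rule summable_comparison_test'[OF sc, of 0])
         (use elim in \<open>auto simp: norm_mult norm_power intro!: mult_left_le_one_le power_le_one\<close>)
  qed
  have sI: "summable (\<lambda>k. \<integral>s. norm (complex_of_real (s ^ k) * c k) \<partial>beta_measure p q)"
  proof (rule summable_comparison_test'[of "\<lambda>k. Beta p q * cmod (c k)" 0])
    show "summable (\<lambda>k. Beta p q * cmod (c k))" by (rule summable_mult[OF sc])
    fix k :: nat
    have "(\<integral>s. norm (complex_of_real (s ^ k) * c k) \<partial>beta_measure p q) = (\<integral>s. s ^ k * cmod (c k) \<partial>beta_measure p q)"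
    proof (rule integral_cong_AE)
      show "AE s in beta_measure p q. norm (complex_of_real (s ^ k) * c k) = s ^ k * cmod (c k)"
        using AE_beta_measure[of p q] by eventually_elim (simp add: norm_mult norm_power)
    qed auto
    also have "\<dots> = Beta (real k + p) q * cmod (c k)" using beta_moment_integral(2)[OF p] by simp
    also have "\<dots> \<le> Beta p q * cmod (c k)" by (intro mult_right_mono Beta_le p) auto
    finally show "norm (\<integral>s. norm (complex_of_real (s ^ k) * c k) \<partial>beta_measure p q) \<le> Beta p q * cmod (c k)" by simp
  qed
  have series: "(\<Sum>k. complex_of_real (s ^ k) * c k) = sph_series Y a ((r * s) *\<^sub>R x)" for s
    unfolding sph_series_def tm ..
  show "integrable (beta_measure p q) (\<lambda>s. sph_series Y a ((r * s) *\<^sub>R x))"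
    using integrable_suminf[OF int sn sI] by (simp only: series)
  have "(\<lambda>k. \<integral>s. complex_of_real (s ^ k) * c k \<partial>beta_measure p q) sums (\<integral>s. sph_series Y a ((r * s) *\<^sub>R x) \<partial>beta_measure p q)"
    using sums_integral[OF int sn sI] by (simp only: series)
  moreover have "(\<integral>s. complex_of_real (s ^ k) * c k \<partial>beta_measure p q) = sph_term Y (\<lambda>k j. complex_of_real (Beta (real k + p) q) * a k j) (r *\<^sub>R x) k" for k
  proof -
    have "(\<integral>s. complex_of_real (s ^ k) * c k \<partial>beta_measure p q) = (\<integral>s. complex_of_real (s ^ k) \<partial>beta_measure p q) * c k"
      by (rule integral_mult_left_zero)
    also have "(\<integral>s. complex_of_real (s ^ k) \<partial>beta_measure p q) = complex_of_real (Beta (real k + p) q)"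
      by (simp only: integral_complex_of_real beta_moment_integral(2)[OF p])
    finally show ?thesis unfolding c_def sph_term_polar[OF x] sph_part_scale by (simp add: mult_ac)
  qed
  ultimately show "sph_series Y (\<lambda>k j. complex_of_real (Beta (real k + p) q) * a k j) (r *\<^sub>R x)
     = (\<integral>s. sph_series Y a ((r * s) *\<^sub>R x) \<partial>beta_measure p q)"
    unfolding sph_series_def[of Y "\<lambda>k j. complex_of_real (Beta (real k + p) q) * a k j"] by (simp add: sums_iff)
qed

lemma sph_part_measurable: "sph_part a k \<in> borel_measurable \<sigma>"
  by (rule meas_\<sigma>[OF sph_part_continuous])

text \<open>As p \<ge> 1, the weight s^(p - 1) is at most 1 and is dropped; only the weight at the
  end s = 1 remains.\<close>

lemma nmean_Beta_le:
  assumes a: "subexp (coeff_norm a)" and p: "1 \<le> p" "0 < q" and r: "0 \<le> r" "r < 1"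
    and B: "\<And>s. 0 < s \<Longrightarrow> s < 1 \<Longrightarrow> nmean (sph_series Y a) (r * s) \<le> \<phi> s" and \<phi> [measurable]: "\<phi> \<in> borel_measurable borel"
  shows "nmean (sph_series Y (\<lambda>k j. complex_of_real (Beta (real k + p) q) * a k j)) r
     \<le> (\<integral>\<^sup>+s. ennreal (indicator {0<..<1} s * (1 - s) powr (q - 1)) * \<phi> s \<partial>lborel)"
proof -
  have p0: "0 < p" using p by simp
  interpret \<beta>: finite_measure "beta_measure p q" by (rule finite_beta_measure[OF p0 p(2)])
  interpret \<beta>\<sigma>: pair_sigma_finite "beta_measure p q" \<sigma> by unfold_locales
  define g where "g s x = (\<Sum>k. complex_of_real ((r * s) ^ k) * sph_part a k x)" for s x
  have g: "sph_series Y a ((r * s) *\<^sub>R x) = g s x" if "norm x = 1" for s x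
    unfolding g_def sph_series_def sph_term_polar[OF that] ..
  have fm: "fst \<in> borel_measurable (beta_measure p q \<Otimes>\<^sub>M \<sigma>)"
    using measurable_fst[of "beta_measure p q" \<sigma>] measurable_cong_sets[OF refl sets_beta_measure] by blast
  have gm: "(\<lambda>z. g (fst z) (snd z)) \<in> borel_measurable (beta_measure p q \<Otimes>\<^sub>M \<sigma>)"
    unfolding g_def
    by (intro borel_measurable_suminf borel_measurable_times borel_measurable_complex_of_real borel_measurable_power
        measurable_compose[OF measurable_snd sph_part_measurable] borel_measurable_const fm)
  have "nmean (sph_series Y (\<lambda>k j. complex_of_real (Beta (real k + p) q) * a k j)) r
     \<le> (\<integral>\<^sup>+x. (\<integral>\<^sup>+s. ennreal (cmod (g s x)) \<partial>beta_measure p q) \<partial>\<sigma>)"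
    unfolding nmean_def
  proof (rule nn_integral_mono)
    fix x assume "x \<in> space \<sigma>"
    then have x: "norm x = 1" by simp
    show "ennreal (cmod (sph_series Y (\<lambda>k j. complex_of_real (Beta (real k + p) q) * a k j) (r *\<^sub>R x)))
       \<le> (\<integral>\<^sup>+s. ennreal (cmod (g s x)) \<partial>beta_measure p q)"
      unfolding sph_series_Beta(1)[OF a p0 p(2) r x]
      using integral_norm_bound_ennreal[OF sph_series_Beta(2)[OF a p0 p(2) r x]] by (simp add: g[OF x])
  qed
  also have "\<dots> = (\<integral>\<^sup>+s. (\<integral>\<^sup>+x. ennreal (cmod (g s x)) \<partial>\<sigma>) \<partial>beta_measure p q)"
    by (rule \<beta>\<sigma>.Fubini') (use gm in \<open>simp add: case_prod_beta'\<close>)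
  also have "\<dots> = (\<integral>\<^sup>+s. nmean (sph_series Y a) (r * s) \<partial>beta_measure p q)"
    unfolding nmean_def by (intro nn_integral_cong) (simp add: g)
  also have "\<dots> \<le> (\<integral>\<^sup>+s. \<phi> s \<partial>beta_measure p q)"
  proof (rule nn_integral_mono_AE)
    show "AE s in beta_measure p q. nmean (sph_series Y a) (r * s) \<le> \<phi> s"
      using AE_beta_measure[of p q] by eventually_elim (simp add: B)
  qed
  also have "\<dots> = (\<integral>\<^sup>+s. ennreal (indicator {0<..<1} s * (s powr (p - 1) * (1 - s) powr (q - 1))) * \<phi> s \<partial>lborel)"
    by (rule nn_integral_beta_measure) measurable
  also have "\<dots> \<le> (\<integral>\<^sup>+s. ennreal (indicator {0<..<1} s * (1 - s) powr (q - 1)) * \<phi> s \<partial>lborel)"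
  proof (intro nn_integral_mono mult_right_mono ennreal_leI)
    fix s :: real
    show "indicator {0<..<1} s * (s powr (p - 1) * (1 - s) powr (q - 1)) \<le> indicator {0<..<1} s * (1 - s) powr (q - 1)"
      using p by (auto simp: indicator_def intro!: mult_left_le_one_le powr_le1)
  qed auto
  finally show ?thesis .
qed

text \<open>The factor by which the fractional derivative of order t acts on order k; for t > 0 it
  equals 1 / Beta (k + n/2) t.\<close>

definition gam :: "real \<Rightarrow> nat \<Rightarrow> real" where
  "gam t k = Gamma (real k + real DIM('a) / 2 + t) / (Gamma (real k + real DIM('a) / 2) * Gamma t)"

lemma Beta_gam:
  assumes t: "0 < t"
  shows "Beta (real k + real DIM('a) / 2) t * gam t k = 1"
proof -
  have "0 < real k + real DIM('a) / 2" by (auto intro: add_nonneg_pos)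
  then have "Gamma (real k + real DIM('a) / 2) > 0" "Gamma (real k + real DIM('a) / 2 + t) > 0" "Gamma t > 0"
    using t by (auto intro!: Gamma_real_pos)
  then show ?thesis by (simp add: Beta_def gam_def)
qed

text \<open>A derivative of order t is an integer derivative of order N > t followed by a fractional
  integral of order N - t. The former is controlled by repeated convolution, the latter by Beta
  averages.\<close>

lemma gam_eq_pochhammer:
  assumes t: "0 < t" "t < real N"
  shows "gam t k = Beta (real k + (real DIM('a) / 2 + t)) (real N - t) * (1 / (Gamma t * Gamma (real N - t)) * pochhammer (real k + real DIM('a) / 2) N)"
proof -
  define h where "h = real k + real DIM('a) / 2"
  have h: "0 < h" unfolding h_def by (auto intro: add_nonneg_pos)
  have "pochhammer h N = Gamma (h + of_nat N) / Gamma h"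
    using h by (intro pochhammer_Gamma) auto
  moreover have "Gamma (h + real N) > 0" "Gamma h > 0" "Gamma t > 0" "Gamma (real N - t) > 0" "Gamma (h + t) > 0"
    using h t by (auto intro!: Gamma_real_pos)
  ultimately show ?thesis
    unfolding gam_def h_def[symmetric] Beta_def add.assoc[symmetric] by (simp add: add_ac)
qed

lemma subexp_gam:
  assumes t: "0 < t" shows "subexp (gam t)"
proof -
  obtain N where N: "t < real N" using reals_Archimedean2 by blast
  have "subexp (\<lambda>k. Beta (real k + (real DIM('a) / 2 + t)) (real N - t) * (1 / (Gamma t * Gamma (real N - t)) * pochhammer (real k + real DIM('a) / 2) N))"
    using t N by (intro subexp_mult subexp_Beta subexp_const subexp_pochhammer) auto
  then show ?thesis by (simp only: gam_eq_pochhammer[OF t N, symmetric, abs_def])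
qed

text \<open>The integer order gives the growth (1 - r)^(-N); averaging it over dilations against (1
  - s)^(N - t - 1) brings the exponent back to -t.\<close>

lemma kern_gam_integral:
  assumes t: "0 < t"
  shows "\<exists>C\<ge>0. \<forall>r y. 0 \<le> r \<longrightarrow> r < 1 \<longrightarrow> norm y = 1 \<longrightarrow>
     (\<integral>\<^sup>+x. ennreal (cmod (kern (\<lambda>k j. complex_of_real (gam t k)) r x y)) \<partial>\<sigma>) \<le> ennreal (C * (1 - r) powr (- t))"
proof -
  obtain N where N: "t < real N" using reals_Archimedean2 by blast
  define h where "h = real DIM('a) / 2"
  have h: "1 \<le> h" using dim by (simp add: h_def)
  define c where "c = 1 / (Gamma t * Gamma (real N - t))"
  have c: "0 \<le> c" using t N by (simp add: c_def Gamma_real_pos less_imp_le)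
  obtain C where C: "0 \<le> C" "\<And>r y. 0 \<le> r \<Longrightarrow> r < 1 \<Longrightarrow> norm y = 1 \<Longrightarrow>
     (\<integral>\<^sup>+x. ennreal (cmod (kern (\<lambda>k j. complex_of_real (pochhammer (real k + h) N)) r x y)) \<partial>\<sigma>) \<le> ennreal (C * (1 / (1 - r)) ^ N)"
    using kern_pochhammer_integral[of h N] h by auto
  define K where "K = c * C * (1 / t + 1 / (real N - t))"
  show ?thesis
  proof (intro exI[of _ K] conjI allI impI)
    show "0 \<le> K" using c C t N by (simp add: K_def)
    fix r :: real and y :: 'a assume r: "0 \<le> r" "r < 1" and y: "norm y = 1"
    define a where "a = (\<lambda>k j. complex_of_real (c * pochhammer (real k + h) N) * complex_of_real (Y k j y))"
    have sa: "subexp (coeff_norm a)"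
      unfolding a_def using h by (intro subexp_kcoeff subexp_scalar subexp_mult subexp_const subexp_pochhammer y) auto
    have bd: "nmean (sph_series Y a) (r * s) \<le> ennreal (c * C) * ennreal ((1 - r * s) powr (- real N))" if s: "0 < s" "s < 1" for s
    proof -
      have "r * s \<le> r" using r s by (simp add: mult_left_le)
      then have rs: "0 \<le> r * s" "r * s < 1" using r s by auto
      have "nmean (sph_series Y a) (r * s) = (\<integral>\<^sup>+x. ennreal c * ennreal (cmod (kern (\<lambda>k j. complex_of_real (pochhammer (real k + h) N)) (r * s) x y)) \<partial>\<sigma>)"
        unfolding nmean_def
      proof (rule nn_integral_cong)
        fix x assume "x \<in> space \<sigma>"
        then have x: "norm x = 1" by simp
        have a_eq: "a = (\<lambda>k j. complex_of_real c * kcoeff (\<lambda>k j. complex_of_real (pochhammer (real k + h) N)) y k j)"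
          by (simp add: a_def fun_eq_iff mult_ac)
        have sb: "subexp (coeff_norm (kcoeff (\<lambda>k j. complex_of_real (pochhammer (real k + h) N)) y))"
          using h by (intro subexp_kcoeff subexp_scalar subexp_pochhammer y) auto
        have nx: "norm ((r * s) *\<^sub>R x) < 1" using rs x by simp
        have "sph_term Y a ((r * s) *\<^sub>R x) k = complex_of_real c * sph_term Y (kcoeff (\<lambda>k j. complex_of_real (pochhammer (real k + h) N)) y) ((r * s) *\<^sub>R x) k" for k
          unfolding a_eq sph_term_polar[OF x] by (subst sph_part_scale[where l = "\<lambda>_. complex_of_real c"]) (simp add: mult_ac)
        then have "sph_series Y a ((r * s) *\<^sub>R x) = complex_of_real c * sph_series Y (kcoeff (\<lambda>k j. complex_of_real (pochhammer (real k + h) N)) y) ((r * s) *\<^sub>R x)"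
          using suminf_mult[OF sums_summable[OF subexp_sums[OF sb nx]], of "complex_of_real c"] by (simp add: sph_series_def)
        then have "cmod (sph_series Y a ((r * s) *\<^sub>R x)) = c * cmod (kern (\<lambda>k j. complex_of_real (pochhammer (real k + h) N)) (r * s) x y)"
          using c by (simp add: kern_eq_series[OF x] norm_mult)
        then show "ennreal (cmod (sph_series Y a ((r * s) *\<^sub>R x))) = ennreal c * ennreal (cmod (kern (\<lambda>k j. complex_of_real (pochhammer (real k + h) N)) (r * s) x y))"
          using c by (simp add: ennreal_mult)
      qed
      also have "\<dots> = ennreal c * (\<integral>\<^sup>+x. ennreal (cmod (kern (\<lambda>k j. complex_of_real (pochhammer (real k + h) N)) (r * s) x y)) \<partial>\<sigma>)"
        by (rule nn_integral_cmult) (use kern_measurable[of "\<lambda>x. x" \<sigma> "\<lambda>_. y" "\<lambda>_. r * s" "\<lambda>k j. complex_of_real (pochhammer (real k + h) N)"] y in simp)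
      also have "\<dots> \<le> ennreal c * ennreal (C * (1 / (1 - r * s)) ^ N)" by (intro mult_left_mono C(2) rs y) auto
      also have "(1 / (1 - r * s)) ^ N = (1 - r * s) powr (- real N)"
        using rs by (simp add: powr_minus powr_realpow divide_inverse power_inverse)
      also have "ennreal c * ennreal (C * (1 - r * s) powr (- real N)) = ennreal (c * C) * ennreal ((1 - r * s) powr (- real N))"
        using c C by (simp add: ennreal_mult mult.assoc)
      finally show ?thesis .
    qed
    have "(\<integral>\<^sup>+x. ennreal (cmod (kern (\<lambda>k j. complex_of_real (gam t k)) r x y)) \<partial>\<sigma>)
       = nmean (sph_series Y (\<lambda>k j. complex_of_real (Beta (real k + (h + t)) (real N - t)) * a k j)) r"
      unfolding nmean_def
    proof (rule nn_integral_cong)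
      fix x assume "x \<in> space \<sigma>"
      then have x: "norm x = 1" by simp
      have "kcoeff (\<lambda>k j. complex_of_real (gam t k)) y = (\<lambda>k j. complex_of_real (Beta (real k + (h + t)) (real N - t)) * a k j)"
        unfolding a_def gam_eq_pochhammer[OF t N] h_def c_def by (simp add: fun_eq_iff)
      then show "ennreal (cmod (kern (\<lambda>k j. complex_of_real (gam t k)) r x y))
        = ennreal (cmod (sph_series Y (\<lambda>k j. complex_of_real (Beta (real k + (h + t)) (real N - t)) * a k j) (r *\<^sub>R x)))"
        by (simp only: kern_eq_series[OF x, symmetric])
    qed
    also have "\<dots> \<le> (\<integral>\<^sup>+s. ennreal (indicator {0<..<1} s * (1 - s) powr (real N - t - 1)) * (ennreal (c * C) * ennreal ((1 - r * s) powr (- real N))) \<partial>lborel)"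
      by (rule nmean_Beta_le[OF sa _ _ r bd]) (use h t N in auto)
    also have "\<dots> = ennreal (c * C) * (\<integral>\<^sup>+s. ennreal (indicator {0<..<1} s * (1 - s) powr (real N - t - 1)) * ennreal ((1 - r * s) powr (- real N)) \<partial>lborel)"
      by (subst nn_integral_cmult[symmetric]) (auto simp: mult_ac)
    also have "\<dots> \<le> ennreal (c * C) * ennreal ((1 / t + 1 / (real N - t)) * (1 - r) powr (- t))"
      by (intro mult_left_mono fractional_integral_estimate t N r) auto
    also have "\<dots> = ennreal (K * (1 - r) powr (- t))"
      using c C t N by (subst ennreal_mult[symmetric]) (auto simp: K_def mult_ac)
    finally show "(\<integral>\<^sup>+x. ennreal (cmod (kern (\<lambda>k j. complex_of_real (gam t k)) r x y)) \<partial>\<sigma>) \<le> ennreal (K * (1 - r) powr (- t))" .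
  qed
qed

text \<open>The common majorant \<open>s\<close> and the summability of \<open>\<mu>\<close> make
  the double series over l and k absolutely convergent, so summing coefficients and summing values
  agree. The triangle inequality is then integrated.\<close>

lemma nmean_countable_subadditive:
  fixes \<mu> :: "nat \<Rightarrow> real"
  assumes s: "subexp s" and a: "\<And>l k j. j \<in> {1..sph_dim TYPE('a) k} \<Longrightarrow> cmod (a l k j) \<le> s k"
    and \<mu>: "\<And>l. 0 \<le> \<mu> l" "summable \<mu>" and r: "0 \<le> r" "r < 1"
  shows "subexp (coeff_norm (\<lambda>k j. \<Sum>l. complex_of_real (\<mu> l) * a l k j))"
    and "nmean (sph_series Y (\<lambda>k j. \<Sum>l. complex_of_real (\<mu> l) * a l k j)) r \<le> (\<Sum>l. ennreal (\<mu> l) * nmean (sph_series Y (a l)) r)"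
proof -
  have sum1: "summable (\<lambda>l. norm (complex_of_real (\<mu> l) * a l k j))" if "j \<in> {1..sph_dim TYPE('a) k}" for k j
    by (rule summable_comparison_test'[OF summable_mult2[OF \<mu>(2), of "s k"], of 0])
       (use \<mu> a[OF that] in \<open>auto simp: norm_mult intro!: mult_left_mono\<close>)
  have le: "cmod (\<Sum>l. complex_of_real (\<mu> l) * a l k j) \<le> suminf \<mu> * \<bar>s k\<bar>" if j: "j \<in> {1..sph_dim TYPE('a) k}" for k j
  proof -
    have "cmod (\<Sum>l. complex_of_real (\<mu> l) * a l k j) \<le> (\<Sum>l. norm (complex_of_real (\<mu> l) * a l k j))"
      by (rule summable_norm[OF sum1[OF j]])
    also have "\<dots> \<le> (\<Sum>l. \<mu> l * \<bar>s k\<bar>)"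
      using \<mu> order_trans[OF a[OF j] abs_ge_self]
      by (intro suminf_le sum1 j summable_mult2) (auto simp: norm_mult intro!: mult_left_mono)
    also have "\<dots> = suminf \<mu> * \<bar>s k\<bar>" by (rule suminf_mult2[OF \<mu>(2), symmetric])
    finally show ?thesis .
  qed
  have cn: "coeff_norm (a l) k \<le> \<bar>coeff_norm (\<lambda>k j. complex_of_real (s k)) k\<bar>" for l k
    unfolding coeff_norm_def by (rule order_trans[OF sum_mono abs_ge_self]) (use order_trans[OF a abs_ge_self] in auto)
  show sub: "subexp (coeff_norm (\<lambda>k j. \<Sum>l. complex_of_real (\<mu> l) * a l k j))"
  proof (rule subexp_mono[OF subexp_mult[OF subexp_const[of "suminf \<mu>"] subexp_scalar[OF s]]])
    fix k
    have "coeff_norm (\<lambda>k j. \<Sum>l. complex_of_real (\<mu> l) * a l k j) k \<le> (\<Sum>j=1..sph_dim TYPE('a) k. suminf \<mu> * \<bar>s k\<bar>)"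
      unfolding coeff_norm_def by (rule sum_mono[OF le])
    also have "\<dots> = suminf \<mu> * coeff_norm (\<lambda>k j. complex_of_real (s k)) k" by (simp add: coeff_norm_def)
    also have "\<dots> \<le> \<bar>\<dots>\<bar>" by simp
    finally show "\<bar>coeff_norm (\<lambda>k j. \<Sum>l. complex_of_real (\<mu> l) * a l k j) k\<bar> \<le> \<bar>suminf \<mu> * coeff_norm (\<lambda>k j. complex_of_real (s k)) k\<bar>" by simp
  qed
  define M where "M k = \<bar>coeff_norm (\<lambda>k j. complex_of_real (s k)) k * ybound k\<bar> * r ^ k" for k
  have sM: "summable M" unfolding M_def by (rule summable_bound[OF subexp_scalar[OF s] r])
  have tM: "cmod (sph_term Y (a l) (r *\<^sub>R x) k) \<le> M k" if x: "norm x = 1" for l x k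
  proof -
    have "cmod (sph_term Y (a l) (r *\<^sub>R x) k) \<le> \<bar>coeff_norm (a l) k * ybound k\<bar> * r ^ k"
      using r x by (intro norm_sph_term_le) auto
    also have "\<dots> \<le> M k" unfolding M_def abs_mult using cn[of l k] r by (intro mult_right_mono) auto
    finally show ?thesis .
  qed
  have ca: "subexp (coeff_norm (a l))" for l
    by (rule subexp_mono[OF subexp_scalar[OF s]]) (use cn[of l] in simp)
  have eq: "sph_series Y (\<lambda>k j. \<Sum>l. complex_of_real (\<mu> l) * a l k j) (r *\<^sub>R x) = (\<Sum>l. complex_of_real (\<mu> l) * sph_series Y (a l) (r *\<^sub>R x))"
    and sm: "summable (\<lambda>l. norm (complex_of_real (\<mu> l) * sph_series Y (a l) (r *\<^sub>R x)))" if x: "norm x = 1" for x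
  proof -
    define t where "t l k = sph_term Y (a l) (r *\<^sub>R x) k" for l k
    have nx: "norm (r *\<^sub>R x) < 1" using r x by simp
    have nt: "norm (t l k) \<le> M k" for l k using tM[OF x] by (simp add: t_def)
    have st: "summable (\<lambda>k. norm (t l k))" for l
      by (rule summable_comparison_test'[OF sM, of 0]) (use nt in auto)
    have ts: "(\<Sum>k. t l k) = sph_series Y (a l) (r *\<^sub>R x)" for l by (simp add: t_def sph_series_def)
    have bs: "cmod (sph_series Y (a l) (r *\<^sub>R x)) \<le> suminf M" for l
      unfolding ts[symmetric] by (rule order_trans[OF summable_norm[OF st] suminf_le[OF nt st sM]])
    show "summable (\<lambda>l. norm (complex_of_real (\<mu> l) * sph_series Y (a l) (r *\<^sub>R x)))"
      by (rule summable_comparison_test'[OF summable_mult2[OF \<mu>(2), of "suminf M"], of 0])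
         (use \<mu> bs in \<open>auto simp: norm_mult intro!: mult_left_mono\<close>)
    have i: "integrable (count_space UNIV) (\<lambda>k. complex_of_real (\<mu> l) * t l k)" for l
      unfolding integrable_count_space_nat_iff norm_mult by (rule summable_mult[OF st])
    have smk: "summable (\<lambda>l. norm (complex_of_real (\<mu> l) * t l k))" for k
      by (rule summable_comparison_test'[OF summable_mult2[OF \<mu>(2), of "M k"], of 0])
         (use \<mu> nt in \<open>auto simp: norm_mult intro!: mult_left_mono\<close>)
    have ni: "(\<integral>k. norm (complex_of_real (\<mu> l) * t l k) \<partial>count_space UNIV) = \<mu> l * (\<Sum>k. norm (t l k))" for l
    proof -
      have "integrable (count_space UNIV) (\<lambda>k. norm (complex_of_real (\<mu> l) * t l k))" using i by (rule integrable_norm)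
      from sums_unique[OF sums_integral_count_space_nat[OF this]]
      have "(\<integral>k. norm (complex_of_real (\<mu> l) * t l k) \<partial>count_space UNIV) = (\<Sum>k. \<mu> l * norm (t l k))" using \<mu> by (simp add: norm_mult)
      then show ?thesis by (simp add: suminf_mult[OF st])
    qed
    \<comment> \<open>The sum over k is written as an integral over counting measure, so that
      exchanging the sums is an instance of termwise integration.\<close>
    have "(\<lambda>l. \<integral>k. complex_of_real (\<mu> l) * t l k \<partial>count_space UNIV) sums (\<integral>k. (\<Sum>l. complex_of_real (\<mu> l) * t l k) \<partial>count_space UNIV)"
    proof (rule sums_integral[OF i AE_I2[OF smk]])
      show "summable (\<lambda>l. \<integral>k. norm (complex_of_real (\<mu> l) * t l k) \<partial>count_space UNIV)"
        unfolding ni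
      proof (rule summable_comparison_test'[OF summable_mult2[OF \<mu>(2), of "suminf M"], of 0])
        fix l :: nat
        have "0 \<le> (\<Sum>k. norm (t l k))" by (rule suminf_nonneg[OF st]) simp
        moreover have "(\<Sum>k. norm (t l k)) \<le> suminf M" by (rule suminf_le[OF nt st sM])
        ultimately show "norm (\<mu> l * (\<Sum>k. norm (t l k))) \<le> \<mu> l * suminf M"
          using \<mu>(1)[of l] by (simp add: abs_mult mult_left_mono)
      qed
    qed
    moreover have "(\<integral>k. complex_of_real (\<mu> l) * t l k \<partial>count_space UNIV) = complex_of_real (\<mu> l) * sph_series Y (a l) (r *\<^sub>R x)" for l
      using sums_unique[OF sums_integral_count_space_nat[OF i]] suminf_mult[OF summable_norm_cancel[OF st]] by (simp add: ts)
    moreover have "(\<Sum>l. complex_of_real (\<mu> l) * t l k) = sph_term Y (\<lambda>k j. \<Sum>l. complex_of_real (\<mu> l) * a l k j) (r *\<^sub>R x) k" for k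
    proof -
      have "(\<Sum>l. complex_of_real (\<mu> l) * t l k) = (\<Sum>l. \<Sum>j=1..sph_dim TYPE('a) k. complex_of_real (H k j (r *\<^sub>R x)) * (complex_of_real (\<mu> l) * a l k j))"
        unfolding t_def sph_term_eq_H by (simp add: sum_distrib_left mult_ac)
      also have "\<dots> = (\<Sum>j=1..sph_dim TYPE('a) k. \<Sum>l. complex_of_real (H k j (r *\<^sub>R x)) * (complex_of_real (\<mu> l) * a l k j))"
        by (rule suminf_sum) (intro summable_mult summable_norm_cancel[OF sum1])
      also have "\<dots> = (\<Sum>j=1..sph_dim TYPE('a) k. complex_of_real (H k j (r *\<^sub>R x)) * (\<Sum>l. complex_of_real (\<mu> l) * a l k j))"
        by (intro sum.cong refl suminf_mult summable_norm_cancel[OF sum1])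
      finally show ?thesis unfolding sph_term_eq_H by (simp add: mult.commute)
    qed
    ultimately have L: "(\<lambda>l. complex_of_real (\<mu> l) * sph_series Y (a l) (r *\<^sub>R x)) sums (\<integral>k. sph_term Y (\<lambda>k j. \<Sum>l. complex_of_real (\<mu> l) * a l k j) (r *\<^sub>R x) k \<partial>count_space UNIV)"
      by (simp only:)
    have "integrable (count_space UNIV) (sph_term Y (\<lambda>k j. \<Sum>l. complex_of_real (\<mu> l) * a l k j) (r *\<^sub>R x))"
      unfolding integrable_count_space_nat_iff by (rule sph_term_summable_norm[OF sub nx])
    from sums_unique[OF sums_integral_count_space_nat[OF this]]
    have "(\<integral>k. sph_term Y (\<lambda>k j. \<Sum>l. complex_of_real (\<mu> l) * a l k j) (r *\<^sub>R x) k \<partial>count_space UNIV) = sph_series Y (\<lambda>k j. \<Sum>l. complex_of_real (\<mu> l) * a l k j) (r *\<^sub>R x)"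
      by (simp add: sph_series_def)
    with sums_unique[OF L] show "sph_series Y (\<lambda>k j. \<Sum>l. complex_of_real (\<mu> l) * a l k j) (r *\<^sub>R x) = (\<Sum>l. complex_of_real (\<mu> l) * sph_series Y (a l) (r *\<^sub>R x))"
      by simp
  qed
  have "nmean (sph_series Y (\<lambda>k j. \<Sum>l. complex_of_real (\<mu> l) * a l k j)) r
      \<le> (\<integral>\<^sup>+x. (\<Sum>l. ennreal (\<mu> l) * ennreal (cmod (sph_series Y (a l) (r *\<^sub>R x)))) \<partial>\<sigma>)"
    unfolding nmean_def
  proof (rule nn_integral_mono)
    fix x assume "x \<in> space \<sigma>"
    then have x: "norm x = 1" by simp
    have "ennreal (cmod (sph_series Y (\<lambda>k j. \<Sum>l. complex_of_real (\<mu> l) * a l k j) (r *\<^sub>R x)))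
       \<le> ennreal (\<Sum>l. norm (complex_of_real (\<mu> l) * sph_series Y (a l) (r *\<^sub>R x)))"
      unfolding eq[OF x] by (rule ennreal_leI[OF summable_norm[OF sm[OF x]]])
    also have "\<dots> = (\<Sum>l. ennreal (norm (complex_of_real (\<mu> l) * sph_series Y (a l) (r *\<^sub>R x))))"
      by (rule suminf_ennreal2[symmetric, OF _ sm[OF x]]) simp
    also have "\<dots> = (\<Sum>l. ennreal (\<mu> l) * ennreal (cmod (sph_series Y (a l) (r *\<^sub>R x))))"
      using \<mu>(1) by (simp add: norm_mult ennreal_mult)
    finally show "ennreal (cmod (sph_series Y (\<lambda>k j. \<Sum>l. complex_of_real (\<mu> l) * a l k j) (r *\<^sub>R x)))
       \<le> (\<Sum>l. ennreal (\<mu> l) * ennreal (cmod (sph_series Y (a l) (r *\<^sub>R x))))" .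
  qed
  also have "\<dots> = (\<Sum>l. \<integral>\<^sup>+x. ennreal (\<mu> l) * ennreal (cmod (sph_series Y (a l) (r *\<^sub>R x))) \<partial>\<sigma>)"
    by (rule nn_integral_suminf) (use meas_\<sigma>[OF sph_series_sphere_continuous[OF ca r]] in measurable)
  also have "\<dots> = (\<Sum>l. ennreal (\<mu> l) * nmean (sph_series Y (a l)) r)"
    unfolding nmean_def by (intro suminf_cong nn_integral_cmult) (use meas_\<sigma>[OF sph_series_sphere_continuous[OF ca r]] in measurable)
  finally show "nmean (sph_series Y (\<lambda>k j. \<Sum>l. complex_of_real (\<mu> l) * a l k j)) r \<le> (\<Sum>l. ennreal (\<mu> l) * nmean (sph_series Y (a l)) r)" .
qed

end

section \<open>Dyadic form of the mixed norms\<close>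

text \<open>After scaling to x + y = 1 this is the inequality z \<le> z^p on [0, 1].\<close>

lemma powr_add_le:
  fixes x y p :: real
  assumes "0 \<le> x" "0 \<le> y" "0 < p" "p \<le> 1"
  shows "(x + y) powr p \<le> x powr p + y powr p"
proof (cases "x + y = 0")
  case False
  then have s: "0 < x + y" using assms by linarith
  have le: "z / (x + y) \<le> (z / (x + y)) powr p" if "0 \<le> z" "z \<le> x + y" for z
    using powr_mono'[of p 1 "z / (x + y)"] that s assms by simp
  have "1 = x / (x + y) + y / (x + y)" using s by (simp flip: add_divide_distrib)
  also have "\<dots> \<le> (x / (x + y)) powr p + (y / (x + y)) powr p" using assms by (intro add_mono le) auto
  also have "\<dots> = (x powr p + y powr p) / (x + y) powr p"
    using assms s by (simp add: powr_divide add_divide_distrib)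
  finally show ?thesis using s by (simp add: field_simps)
qed (use assms in auto)

lemma powr_sum_le:
  fixes y :: "'i \<Rightarrow> real"
  assumes "\<And>i. i \<in> I \<Longrightarrow> 0 \<le> y i" "0 < p" "p \<le> 1"
  shows "(\<Sum>i\<in>I. y i) powr p \<le> (\<Sum>i\<in>I. y i powr p)"
  using assms(1)
proof (induction I rule: infinite_finite_induct)
  case (insert i I)
  have "(\<Sum>i\<in>insert i I. y i) powr p \<le> y i powr p + (\<Sum>i\<in>I. y i) powr p"
    using insert assms powr_add_le[of "y i" "\<Sum>i\<in>I. y i" p] by (auto intro: sum_nonneg)
  also have "\<dots> \<le> y i powr p + (\<Sum>i\<in>I. y i powr p)" using insert by auto
  finally show ?case using insert by simp
qed auto

lemma powr_suminf_le:
  fixes y :: "nat \<Rightarrow> real"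
  assumes y: "\<And>i. 0 \<le> y i" "summable y" and p: "0 < p" "p \<le> 1" and sp: "summable (\<lambda>i. y i powr p)"
  shows "(\<Sum>i. y i) powr p \<le> (\<Sum>i. y i powr p)"
proof (rule LIMSEQ_le[of "\<lambda>n. (\<Sum>i<n. y i) powr p" _ "\<lambda>n. \<Sum>i<n. y i powr p"])
  show "(\<lambda>n. (\<Sum>i<n. y i) powr p) \<longlonglongrightarrow> (\<Sum>i. y i) powr p"
    using summable_LIMSEQ[OF y(2)] p y(1) by (intro tendsto_powr') (auto intro!: always_eventually sum_nonneg)
  show "(\<lambda>n. \<Sum>i<n. y i powr p) \<longlonglongrightarrow> (\<Sum>i. y i powr p)" by (rule summable_LIMSEQ[OF sp])
  show "\<exists>N. \<forall>n\<ge>N. (\<Sum>i<n. y i) powr p \<le> (\<Sum>i<n. y i powr p)"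
    by (intro exI[of _ 0] allI impI powr_sum_le p y(1))
qed

text \<open>Exponents of both signs occur, because \<alpha> q - 1 in the mixed norm can be
  negative.\<close>

lemma powr_comparable:
  fixes w x e :: real
  assumes "0 < w" "w / 2 \<le> x" "x \<le> 2 * w"
  shows "x powr e \<le> 2 powr \<bar>e\<bar> * w powr e"
proof (cases "0 \<le> e")
  case True
  have "x powr e \<le> (2 * w) powr e" using assms True by (intro powr_mono2) auto
  then show ?thesis using True assms by (simp add: powr_mult)
next
  case False
  have "x powr e \<le> (w / 2) powr e" using assms False by (intro powr_mono2') auto
  also have "\<dots> = inverse (2 powr e) * w powr e" by (simp only: powr_divide divide_inverse[of "_ powr _"] mult.commute)
  also have "inverse (2 powr e) = 2 powr \<bar>e\<bar>" using False powr_minus[of 2 e] by simp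
  finally show ?thesis .
qed

abbreviation dyadic :: "nat \<Rightarrow> real" where "dyadic i \<equiv> 1 - (1 / 2) ^ i"

lemma dyadic_bounds: "0 \<le> dyadic i" "dyadic i < 1" "dyadic i \<le> dyadic (Suc i)"
  by (auto simp: power_le_one)

lemma dyadic_block:
  assumes "0 \<le> r" "r < 1"
  obtains i where "dyadic i \<le> r" "r < dyadic (Suc i)"
proof -
  obtain n where "(1 / 2) ^ n < 1 - r" using real_arch_pow_inv[of "1 - r" "1/2"] assms by auto
  then have ex: "\<exists>i. r < dyadic (Suc i)"
    using power_decreasing[of n "Suc n" "1/2::real"] by (intro exI[of _ n]) linarith
  define i where "i = (LEAST i. r < dyadic (Suc i))"
  have "r < dyadic (Suc i)" unfolding i_def by (rule LeastI_ex[OF ex])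
  moreover have "dyadic i \<le> r"
  proof (cases i)
    case (Suc j)
    then have "\<not> r < dyadic (Suc j)" using not_less_Least[of j "\<lambda>i. r < dyadic (Suc i)"] by (simp add: i_def)
    then show ?thesis using Suc by simp
  qed (use assms in simp)
  ultimately show ?thesis by (rule that[rotated])
qed

text \<open>1 - r^2 = (1 - r)(1 + r), where on the block 1 - r lies between 2^-(i+1) and 2^-i, and 1
  + r between 1 and 2.\<close>

lemma dyadic_block_weight:
  assumes "dyadic i \<le> r" "r < dyadic (Suc i)"
  shows "(1 / 2) ^ i / 2 \<le> 1 - r\<^sup>2" "1 - r\<^sup>2 \<le> 2 * (1 / 2) ^ i"
proof -
  have r: "0 \<le> r" "r < 1" using assms dyadic_bounds(1)[of i] dyadic_bounds(2)[of "Suc i"] by linarith+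
  have e: "1 - r\<^sup>2 = (1 - r) * (1 + r)" by (simp add: power2_eq_square algebra_simps)
  have "(1 / 2) ^ i / 2 \<le> (1 - r) * 1" using assms by simp
  also have "\<dots> \<le> (1 - r) * (1 + r)" using r by (intro mult_left_mono) auto
  finally show "(1 / 2) ^ i / 2 \<le> 1 - r\<^sup>2" by (simp only: e)
  have "(1 - r) * (1 + r) \<le> (1 / 2) ^ i * 2" using assms r by (intro mult_mono) auto
  then show "1 - r\<^sup>2 \<le> 2 * (1 / 2) ^ i" by (simp only: e mult.commute)
qed

section \<open>Means at dyadic radii\<close>

context sphere_basis
begin

definition mean :: "('a \<Rightarrow> complex) \<Rightarrow> real \<Rightarrow> real" where
  "mean f r = (\<integral>y. cmod (f (r *\<^sub>R y)) \<partial>\<sigma>)"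

lemma mean_nonneg: "0 \<le> mean f r"
  unfolding mean_def by simp

lemma nmean_eq_mean:
  assumes "f \<in> harmonic_ball" "0 \<le> r" "r < 1"
  shows "nmean f r = ennreal (mean f r)"
  unfolding nmean_def mean_def
  by (rule nn_integral_eq_integral) (use integrable_\<sigma>[OF continuous_on_norm[OF harmonic_ball_sphere_continuous[OF assms]]] in auto)

lemma mean_mono:
  assumes "f \<in> harmonic_ball" "0 \<le> r" "r \<le> s" "s < 1"
  shows "mean f r \<le> mean f s"
  using nmean_mono[OF assms] nmean_eq_mean[OF assms(1), of r] nmean_eq_mean[OF assms(1), of s] assms mean_nonneg by simp

lemma sph_mean_eq_mean: "sph_mean \<sigma> 1 f r = mean f r"
  using mean_nonneg[of f r] by (simp add: sph_mean_def mean_def)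

lemma mean_measurable:
  assumes f: "f \<in> harmonic_ball"
  shows "(\<lambda>r. indicator {0..<1} r * mean f r) \<in> borel_measurable borel"
proof -
  have "continuous_on ({-1<..<1} \<times> sphere 0 1) (\<lambda>z. cmod (f (fst z *\<^sub>R snd z)))"
    using f by (intro continuous_on_norm continuous_on_scaleR_ball harmonic_on_continuous) (simp add: harmonic_ball_def)
  from continuous_on_integral_param[OF finite_\<sigma> sets_\<sigma> compact_sphere this]
  have "continuous_on {0..<1} (mean f)" unfolding mean_def by (rule continuous_on_subset) auto
  then have "(\<lambda>r. if r \<in> {0..<1} then mean f r else 0) \<in> borel_measurable borel"
    by (intro borel_measurable_continuous_on_if) auto
  also have "(\<lambda>r. if r \<in> {0..<1} then mean f r else 0) = (\<lambda>r. indicator {0..<1} r * mean f r)"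
    by (auto simp: fun_eq_iff)
  finally show ?thesis .
qed

text \<open>The sequence whose l^p summability replaces finiteness of the mixed norm: the i-th
  weight is the distance 2^-i to the boundary, to the power \<alpha>.\<close>

definition dnorm :: "real \<Rightarrow> ('a \<Rightarrow> complex) \<Rightarrow> nat \<Rightarrow> real" where
  "dnorm \<alpha> f i = ((1 / 2) ^ i) powr \<alpha> * mean f (dyadic i)"

lemma dnorm_nonneg: "0 \<le> dnorm \<alpha> f i"
  unfolding dnorm_def by (simp add: mean_nonneg)

lemma dnorm_Suc: "((1 / 2) ^ i) powr \<alpha> * mean f (dyadic (Suc i)) = 2 powr \<alpha> * dnorm \<alpha> f (Suc i)"
proof -
  have "((1 / 2) ^ i :: real) = 2 * (1 / 2) ^ Suc i" by simp
  then have "((1 / 2) ^ i :: real) powr \<alpha> = 2 powr \<alpha> * ((1 / 2) ^ Suc i) powr \<alpha>" by (simp only: powr_mult)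
  then show ?thesis by (simp add: dnorm_def mult.assoc)
qed

text \<open>Means increase with the radius, so on a block they lie between their values at the ends.
  The weight of order 2^(-i (\<alpha> q - 1)) times a block length of order 2^-i gives 2^(-i
  \<alpha> q).\<close>

lemma mixed_norm_finite_iff:
  assumes f: "f \<in> harmonic_ball" and q: "0 < q"
  shows "mixed_norm \<sigma> (ereal q) 1 \<alpha> f < \<infinity> \<longleftrightarrow> summable (\<lambda>i. dnorm \<alpha> f i powr q)"
proof -
  define F where "F r = mean f r powr q * (1 - r\<^sup>2) powr (\<alpha> * q - 1) * r ^ (DIM('a) - 1)" for r
  define I where "I = (\<integral>\<^sup>+r. ennreal (F r) * indicator {0..<1} r \<partial>lborel)"
  define K where "K = 2 powr \<bar>\<alpha> * q - 1\<bar>"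
  have K: "K > 0" by (simp add: K_def)
  have "mixed_norm \<sigma> (ereal q) 1 \<alpha> f < \<infinity> \<longleftrightarrow> I < \<infinity>"
    unfolding mixed_norm_def I_def F_def by (auto simp: sph_mean_eq_mean Let_def less_top[symmetric])
  moreover have "I < \<infinity>" if sm: "summable (\<lambda>i. dnorm \<alpha> f i powr q)"
  proof -
    \<comment> \<open>Upper bound on the i-th block. The mean is taken at the right end, hence the
      shifted index in the resulting sum.\<close>
    define c where "c i = mean f (dyadic (Suc i)) powr q * (K * ((1 / 2) ^ i) powr (\<alpha> * q - 1))" for i
    have c0: "0 \<le> c i" for i using K by (simp add: c_def)
    have ci: "c i * ((1 / 2) ^ i / 2) = K / 2 * (2 powr \<alpha>) powr q * dnorm \<alpha> f (Suc i) powr q" for i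
    proof -
      have "((1 / 2) ^ i :: real) powr (\<alpha> * q - 1) * (1 / 2) ^ i = (((1 / 2) ^ i) powr \<alpha>) powr q"
        by (simp add: powr_diff powr_powr)
      then have "c i * ((1 / 2) ^ i / 2) = K / 2 * ((((1 / 2) ^ i) powr \<alpha>) powr q * mean f (dyadic (Suc i)) powr q)"
        by (simp add: c_def mult_ac)
      also have "(((1 / 2) ^ i) powr \<alpha>) powr q * mean f (dyadic (Suc i)) powr q = (((1 / 2) ^ i) powr \<alpha> * mean f (dyadic (Suc i))) powr q"
        by (simp add: powr_mult mean_nonneg)
      also have "\<dots> = (2 powr \<alpha>) powr q * dnorm \<alpha> f (Suc i) powr q"
        unfolding dnorm_Suc by (simp add: powr_mult dnorm_nonneg)
      finally show ?thesis by (simp add: mult_ac)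
    qed
    have "I \<le> (\<integral>\<^sup>+r. (\<Sum>i. ennreal (c i) * indicator {dyadic i..<dyadic (Suc i)} r) \<partial>lborel)"
      unfolding I_def
    proof (rule nn_integral_mono)
      fix r :: real
      show "ennreal (F r) * indicator {0..<1} r \<le> (\<Sum>i. ennreal (c i) * indicator {dyadic i..<dyadic (Suc i)} r)"
      proof (cases "r \<in> {0..<1}")
        case True
        then have r: "0 \<le> r" "r < 1" by auto
        then obtain i where i: "dyadic i \<le> r" "r < dyadic (Suc i)" by (rule dyadic_block)
        have "F r \<le> c i * 1"
          unfolding F_def c_def K_def using q r i dyadic_block_weight[OF i] dyadic_bounds(2)[of "Suc i"]
          by (intro mult_mono powr_mono2 mean_mono f powr_comparable power_le_one mean_nonneg) auto
        then have "ennreal (F r) * indicator {0..<1} r \<le> ennreal (c i) * indicator {dyadic i..<dyadic (Suc i)} r"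
          using True i by (simp add: ennreal_leI)
        also have "\<dots> = (\<Sum>j\<in>{i}. ennreal (c j) * indicator {dyadic j..<dyadic (Suc j)} r)" by (subst sum.insert) auto
        also have "\<dots> \<le> (\<Sum>j. ennreal (c j) * indicator {dyadic j..<dyadic (Suc j)} r)"
          by (rule sum_le_suminf) auto
        finally show ?thesis .
      qed simp
    qed
    also have "\<dots> = (\<Sum>i. \<integral>\<^sup>+r. ennreal (c i) * indicator {dyadic i..<dyadic (Suc i)} r \<partial>lborel)"
      by (rule nn_integral_suminf) auto
    also have "\<dots> = (\<Sum>i. ennreal (K / 2 * (2 powr \<alpha>) powr q * dnorm \<alpha> f (Suc i) powr q))"
    proof (rule suminf_cong)
      fix i
      have "(\<integral>\<^sup>+r. ennreal (c i) * indicator {dyadic i..<dyadic (Suc i)} r \<partial>lborel) = ennreal (c i) * ennreal ((1 / 2) ^ i / 2)"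
        by (subst nn_integral_cmult_indicator) auto
      also have "\<dots> = ennreal (c i * ((1 / 2) ^ i / 2))" by (rule ennreal_mult[symmetric]) (use c0 in auto)
      finally show "(\<integral>\<^sup>+r. ennreal (c i) * indicator {dyadic i..<dyadic (Suc i)} r \<partial>lborel) = ennreal (K / 2 * (2 powr \<alpha>) powr q * dnorm \<alpha> f (Suc i) powr q)"
        by (simp only: ci)
    qed
    also have "\<dots> < \<infinity>"
    proof -
      have "summable (\<lambda>i. K / 2 * (2 powr \<alpha>) powr q * dnorm \<alpha> f (Suc i) powr q)"
        using sm by (intro summable_mult) (simp add: summable_Suc_iff[of "\<lambda>i. dnorm \<alpha> f i powr q"])
      then show ?thesis using K by (subst suminf_ennreal2) auto
    qed
    finally show ?thesis .
  qed
  moreover have "summable (\<lambda>i. dnorm \<alpha> f i powr q)" if I: "I < \<infinity>"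
  proof -
    define L where "L = (1 / 2) ^ DIM('a) / K"
    have L: "L > 0" using K by (simp add: L_def)
    \<comment> \<open>For the lower bound the mean is taken at the left end. The blocks start at
      radius 1/2, where r^(n - 1) is bounded below.\<close>
    let ?B = "\<lambda>i. {dyadic (Suc i)..<dyadic (Suc (Suc i))}"
    have Fm: "(\<lambda>r. ennreal (F r) * indicator {0..<1} r) \<in> borel_measurable borel"
    proof -
      have "(\<lambda>r. ennreal ((indicator {0..<1} r * mean f r) powr q * (1 - r\<^sup>2) powr (\<alpha> * q - 1) * r ^ (DIM('a) - 1)) * indicator {0..<1} r) \<in> borel_measurable borel"
        using mean_measurable[OF f] by measurable
      also have "(\<lambda>r. ennreal ((indicator {0..<1} r * mean f r) powr q * (1 - r\<^sup>2) powr (\<alpha> * q - 1) * r ^ (DIM('a) - 1)) * indicator {0..<1} r) = (\<lambda>r. ennreal (F r) * indicator {0..<1} r)"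
        by (auto simp: fun_eq_iff F_def indicator_def)
      finally show ?thesis .
    qed
    have blk: "ennreal (L * dnorm \<alpha> f (Suc i) powr q) \<le> (\<integral>\<^sup>+r. (ennreal (F r) * indicator {0..<1} r) * indicator (?B i) r \<partial>lborel)" for i
    proof -
      define w where "w = ((1 / 2) ^ Suc i :: real)"
      define c where "c = mean f (dyadic (Suc i)) powr q * (w powr (\<alpha> * q - 1) / K) * (1 / 2) ^ (DIM('a) - 1)"
      have c0: "0 \<le> c" using K by (simp add: c_def)
      have w: "w > 0" by (simp add: w_def)
      have "w powr (\<alpha> * q - 1) * w = (w powr \<alpha>) powr q" using w by (simp add: powr_diff powr_powr)
      then have "c * (w / 2) = ((w powr \<alpha>) powr q * mean f (dyadic (Suc i)) powr q) * ((1 / 2) ^ (DIM('a) - 1) * (1 / 2) / K)"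
        by (simp add: c_def mult_ac)
      also have "(w powr \<alpha>) powr q * mean f (dyadic (Suc i)) powr q = dnorm \<alpha> f (Suc i) powr q"
        unfolding dnorm_def w_def by (simp add: powr_mult mean_nonneg)
      also have "(1 / 2 :: real) ^ (DIM('a) - 1) * (1 / 2) = (1 / 2) ^ DIM('a)"
        using dim power_Suc2[of "1/2::real" "DIM('a) - 1"] by simp
      finally have cw: "c * (w / 2) = L * dnorm \<alpha> f (Suc i) powr q" by (simp add: L_def mult_ac)
      have "ennreal (c * (w / 2)) = (\<integral>\<^sup>+r. ennreal c * indicator (?B i) r \<partial>lborel)"
        proof -
        have "emeasure lborel (?B i) = ennreal (w / 2)" by (simp add: w_def)
        moreover have "ennreal (c * (w / 2)) = ennreal c * ennreal (w / 2)" by (rule ennreal_mult) (use c0 w in auto)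
        ultimately show ?thesis by (simp only: nn_integral_cmult_indicator sets_lborel atLeastLessThan_borel)
      qed
      also have "\<dots> \<le> (\<integral>\<^sup>+r. (ennreal (F r) * indicator {0..<1} r) * indicator (?B i) r \<partial>lborel)"
      proof (rule nn_integral_mono)
        fix r :: real
        show "ennreal c * indicator (?B i) r \<le> (ennreal (F r) * indicator {0..<1} r) * indicator (?B i) r"
        proof (cases "r \<in> ?B i")
          case True
          then have i: "dyadic (Suc i) \<le> r" "r < dyadic (Suc (Suc i))" by auto
          have r: "0 \<le> r" "r < 1" using i dyadic_bounds(1)[of "Suc i"] dyadic_bounds(2)[of "Suc (Suc i)"] by linarith+
          have "(1 / 2 :: real) ^ Suc i \<le> 1 / 2" using power_decreasing[of 1 "Suc i" "1/2::real"] by simp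
          then have r2: "1 / 2 \<le> r" using i by linarith
          have wt: "w / 2 \<le> 1 - r\<^sup>2" "1 - r\<^sup>2 \<le> 2 * w" using dyadic_block_weight[OF i] by (simp_all add: w_def)
          have "w powr (\<alpha> * q - 1) \<le> K * (1 - r\<^sup>2) powr (\<alpha> * q - 1)"
            unfolding K_def using wt w by (intro powr_comparable) auto
          then have "w powr (\<alpha> * q - 1) / K \<le> (1 - r\<^sup>2) powr (\<alpha> * q - 1)" using K by (simp add: field_simps)
          then have "c \<le> F r"
            unfolding c_def F_def using q r r2 i K dyadic_bounds(1)[of "Suc i"]
            by (intro mult_mono powr_mono2 mean_mono f power_mono mean_nonneg mult_nonneg_nonneg) auto
          then show ?thesis using True r by (simp add: ennreal_leI)
        qed simp
      qed
      finally show ?thesis by (simp only: cw)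
    qed
    have "summable (\<lambda>i. L * dnorm \<alpha> f (Suc i) powr q)"
    proof (rule summableI_nonneg_bounded[where x = "enn2real I"])
      fix n
      have disj: "disjoint_family_on ?B {..<n}"
      proof -
        have "?B i \<inter> ?B j = {}" if "i < j" for i j
        proof -
          have "dyadic (Suc (Suc i)) \<le> dyadic (Suc j)" using power_decreasing[of "Suc (Suc i)" "Suc j" "1/2::real"] that by simp
          then show ?thesis by auto
        qed
        then show ?thesis unfolding disjoint_family_on_def by (metis Int_commute linorder_neqE_nat)
      qed
      have "ennreal (\<Sum>i<n. L * dnorm \<alpha> f (Suc i) powr q) = (\<Sum>i<n. ennreal (L * dnorm \<alpha> f (Suc i) powr q))"
        using L by (intro sum_ennreal[symmetric]) auto
      also have "\<dots> \<le> (\<Sum>i<n. \<integral>\<^sup>+r. (ennreal (F r) * indicator {0..<1} r) * indicator (?B i) r \<partial>lborel)"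
        by (rule sum_mono) (rule blk)
      also have "\<dots> = (\<integral>\<^sup>+r. (\<Sum>i<n. (ennreal (F r) * indicator {0..<1} r) * indicator (?B i) r) \<partial>lborel)"
        by (rule nn_integral_sum[symmetric]) (use Fm in measurable)
      also have "\<dots> \<le> I"
        unfolding I_def
      proof (rule nn_integral_mono)
        fix r :: real
        have "(\<Sum>i<n. (ennreal (F r) * indicator {0..<1} r) * indicator (?B i) r) = (ennreal (F r) * indicator {0..<1} r) * indicator (\<Union>i<n. ?B i) r"
          by (subst indicator_UN_disjoint[OF _ disj]) (auto simp: sum_distrib_left)
        also have "\<dots> \<le> ennreal (F r) * indicator {0..<1} r" by (auto simp: indicator_def)
        finally show "(\<Sum>i<n. (ennreal (F r) * indicator {0..<1} r) * indicator (?B i) r) \<le> ennreal (F r) * indicator {0..<1} r" .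
      qed
      finally have "ennreal (\<Sum>i<n. L * dnorm \<alpha> f (Suc i) powr q) \<le> I" .
      moreover have "I = ennreal (enn2real I)" using I by (simp add: less_top)
      ultimately show "(\<Sum>i<n. L * dnorm \<alpha> f (Suc i) powr q) \<le> enn2real I"
        by (metis enn2real_nonneg ennreal_le_iff)
    qed (use L in auto)
    then have "summable (\<lambda>i. dnorm \<alpha> f (Suc i) powr q)"
      using L summable_mult_D[of L] by auto
    then show ?thesis by (simp add: summable_Suc_iff[of "\<lambda>i. dnorm \<alpha> f i powr q"])
  qed
  ultimately show ?thesis by blast
qed

lemma mixed_norm_infinity_iff:
  assumes f: "f \<in> harmonic_ball"
  shows "mixed_norm \<sigma> \<infinity> 1 \<alpha> f < \<infinity> \<longleftrightarrow> (\<exists>C. \<forall>i. dnorm \<alpha> f i \<le> C)"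
proof -
  define S where "S = (SUP r\<in>{0..<1}. ennreal (mean f r * (1 - r\<^sup>2) powr \<alpha>))"
  define K where "K = 2 powr \<bar>\<alpha>\<bar>"
  have K: "K > 0" by (simp add: K_def)
  have "mixed_norm \<sigma> \<infinity> 1 \<alpha> f = S" unfolding mixed_norm_def S_def by (simp add: sph_mean_eq_mean)
  moreover have "\<exists>C. \<forall>i. dnorm \<alpha> f i \<le> C" if S: "S < \<infinity>"
  proof (intro exI allI)
    fix i
    have i: "dyadic i \<le> dyadic i" "dyadic i < dyadic (Suc i)" by auto
    note wt = dyadic_block_weight[OF i]
    define x where "x = 1 - (dyadic i)\<^sup>2"
    have x: "(1 / 2) ^ i \<le> 2 * x" "x \<le> 2 * (1 / 2) ^ i" using wt by (simp_all add: x_def)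
    have "0 < x" using x(1) zero_less_power[of "1/2::real" i] by linarith
    then have "((1 / 2) ^ i) powr \<alpha> \<le> K * x powr \<alpha>"
      unfolding K_def by (rule powr_comparable) (use x in auto)
    then have "((1 / 2) ^ i) powr \<alpha> \<le> K * (1 - (dyadic i)\<^sup>2) powr \<alpha>" by (simp only: x_def)
    then have "dnorm \<alpha> f i \<le> K * (1 - (dyadic i)\<^sup>2) powr \<alpha> * mean f (dyadic i)"
      unfolding dnorm_def by (rule mult_right_mono[OF _ mean_nonneg])
    then have "dnorm \<alpha> f i \<le> K * (mean f (dyadic i) * (1 - (dyadic i)\<^sup>2) powr \<alpha>)" by (simp only: mult_ac)
    moreover have "mean f (dyadic i) * (1 - (dyadic i)\<^sup>2) powr \<alpha> \<le> enn2real S"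
    proof -
      have "ennreal (mean f (dyadic i) * (1 - (dyadic i)\<^sup>2) powr \<alpha>) \<le> S"
        unfolding S_def by (rule SUP_upper) (use dyadic_bounds[of i] in auto)
      also have "S = ennreal (enn2real S)" using S by (simp add: less_top)
      finally show ?thesis by (simp add: ennreal_le_iff)
    qed
    ultimately show "dnorm \<alpha> f i \<le> K * enn2real S"
      using K by (meson mult_left_mono order_trans less_imp_le)
  qed
  moreover have "S < \<infinity>" if ex: "\<exists>C. \<forall>i. dnorm \<alpha> f i \<le> C"
  proof -
    obtain C where C: "\<And>i. dnorm \<alpha> f i \<le> C" using ex by blast
    have "S \<le> ennreal (K * (2 powr \<alpha> * C))"
      unfolding S_def
    proof (rule SUP_least, rule ennreal_leI)
      fix r :: real assume "r \<in> {0..<1}"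
      then have r: "0 \<le> r" "r < 1" by auto
      then obtain i where i: "dyadic i \<le> r" "r < dyadic (Suc i)" by (rule dyadic_block)
      have "mean f r * (1 - r\<^sup>2) powr \<alpha> \<le> mean f (dyadic (Suc i)) * (K * ((1 / 2) ^ i) powr \<alpha>)"
        unfolding K_def using r i dyadic_block_weight[OF i] dyadic_bounds(2)[of "Suc i"]
        by (intro mult_mono mean_mono f powr_comparable mean_nonneg) auto
      also have "\<dots> = K * (2 powr \<alpha> * dnorm \<alpha> f (Suc i))" unfolding dnorm_Suc[symmetric] by (simp add: mult_ac)
      also have "\<dots> \<le> K * (2 powr \<alpha> * C)" using K C by (intro mult_left_mono) auto
      finally show "mean f r * (1 - r\<^sup>2) powr \<alpha> \<le> K * (2 powr \<alpha> * C)" .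
    qed
    then show ?thesis by (auto intro: le_less_trans)
  qed
  ultimately show ?thesis by metis
qed

text \<open>Apart from harmonicity, this is the only consequence of membership in the target space
  that the necessity half uses.\<close>

lemma mixed_norm_space_dnorm_bounded:
  assumes h: "h \<in> mixed_norm_space \<sigma> q 1 \<beta>" and q: "0 < q"
  shows "\<exists>C. \<forall>i. dnorm \<beta> h i \<le> C"
proof (cases q)
  case (real s)
  have hb: "h \<in> harmonic_ball" and "mixed_norm \<sigma> (ereal s) 1 \<beta> h < \<infinity>" using h real by (auto simp: mixed_norm_space_def)
  moreover have s: "0 < s" using q real by simp
  ultimately have "summable (\<lambda>i. dnorm \<beta> h i powr s)" by (simp only: mixed_norm_finite_iff)
  then have "bounded (range (\<lambda>i. dnorm \<beta> h i powr s))" by (intro convergent_imp_bounded[OF summable_LIMSEQ_zero])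
  then obtain B where B: "\<And>i. \<bar>dnorm \<beta> h i powr s\<bar> \<le> B" unfolding bounded_iff by auto
  have "dnorm \<beta> h i \<le> B powr (1 / s)" for i
  proof -
    have "dnorm \<beta> h i = (dnorm \<beta> h i powr s) powr (1 / s)" using s by (simp add: powr_powr dnorm_nonneg)
    also have "\<dots> \<le> B powr (1 / s)" using B[of i] s by (intro powr_mono2) auto
    finally show ?thesis .
  qed
  then show ?thesis by blast
next
  case PInf
  then show ?thesis using h mixed_norm_infinity_iff[of h \<beta>] by (auto simp: mixed_norm_space_def)
qed (use q in auto)

text \<open>The inclusion of l^p in l^q: a sequence with summable p-th powers is bounded by some C,
  and x^s \<le> C^(s - p) x^p for 0 \<le> x \<le> C and s \<ge> p.\<close>

lemma mixed_norm_spaceI: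
  assumes h: "h \<in> harmonic_ball" and p: "0 < p" "ereal p \<le> q" and sm: "summable (\<lambda>i. dnorm \<beta> h i powr p)"
  shows "h \<in> mixed_norm_space \<sigma> q 1 \<beta>"
proof -
  have "bounded (range (\<lambda>i. dnorm \<beta> h i powr p))" using sm by (intro convergent_imp_bounded[OF summable_LIMSEQ_zero])
  then obtain B where B: "\<And>i. \<bar>dnorm \<beta> h i powr p\<bar> \<le> B" unfolding bounded_iff by auto
  define C where "C = B powr (1 / p)"
  have C: "dnorm \<beta> h i \<le> C" for i
  proof -
    have "dnorm \<beta> h i = (dnorm \<beta> h i powr p) powr (1 / p)" using p by (simp add: powr_powr dnorm_nonneg)
    also have "\<dots> \<le> B powr (1 / p)" using B[of i] p by (intro powr_mono2) auto
    finally show ?thesis by (simp add: C_def)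
  qed
  show ?thesis
  proof (cases q)
    case (real s)
    have sp: "p \<le> s" using p real by simp
    have "summable (\<lambda>i. dnorm \<beta> h i powr s)"
    proof (rule summable_comparison_test'[of "\<lambda>i. C powr (s - p) * dnorm \<beta> h i powr p" 0])
      show "summable (\<lambda>i. C powr (s - p) * dnorm \<beta> h i powr p)" by (rule summable_mult[OF sm])
      fix i :: nat
      have "dnorm \<beta> h i powr s = dnorm \<beta> h i powr (s - p) * dnorm \<beta> h i powr p" by (simp flip: powr_add)
      also have "\<dots> \<le> C powr (s - p) * dnorm \<beta> h i powr p"
        using sp C dnorm_nonneg by (intro mult_right_mono powr_mono2) auto
      finally show "norm (dnorm \<beta> h i powr s) \<le> C powr (s - p) * dnorm \<beta> h i powr p" by simp
    qed
    moreover have "0 < s" using p sp by linarith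
    ultimately have "mixed_norm \<sigma> (ereal s) 1 \<beta> h < \<infinity>" by (simp only: mixed_norm_finite_iff[OF h])
    then show ?thesis using h real by (simp add: mixed_norm_space_def)
  next
    case PInf
    then show ?thesis using h C mixed_norm_infinity_iff[OF h, of \<beta>] by (auto simp: mixed_norm_space_def)
  qed (use p in auto)
qed

end

section \<open>Multipliers\<close>

text \<open>The exponent is |i - L|, written with truncated subtraction; each side of L contributes
  a geometric series.\<close>

lemma truncated_geometric_sum_le:
  fixes q :: real
  assumes q: "0 \<le> q" "q < 1"
  shows "(\<Sum>i<n. q ^ ((i - L) + (L - i))) \<le> 2 / (1 - q)"
proof -
  have geo: "(\<Sum>k<m. q ^ k) \<le> 1 / (1 - q)" for m
    using sum_le_suminf[OF summable_geometric[of q], of "{..<m}"] suminf_geometric[of q] q by simp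
  have "(\<Sum>i<n. q ^ ((i - L) + (L - i))) \<le> (\<Sum>i\<in>{..<L} \<union> {L..<L + n}. q ^ ((i - L) + (L - i)))"
    using q by (intro sum_mono2) auto
  also have "\<dots> = (\<Sum>i<L. q ^ ((i - L) + (L - i))) + (\<Sum>i\<in>{L..<L + n}. q ^ ((i - L) + (L - i)))"
    by (rule sum.union_disjoint) auto
  also have "(\<Sum>i<L. q ^ ((i - L) + (L - i))) = (\<Sum>i<L. q ^ (L - i))" by (rule sum.cong) auto
  also have "\<dots> \<le> (\<Sum>i<L. q ^ (L - Suc i))" using q by (intro sum_mono power_decreasing) auto
  also have "\<dots> = (\<Sum>k<L. q ^ k)" by (rule sum.nat_diff_reindex)
  also have "(\<Sum>i\<in>{L..<L + n}. q ^ ((i - L) + (L - i))) = (\<Sum>k<n. q ^ k)"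
    by (rule sum.reindex_bij_witness[of _ "\<lambda>k. k + L" "\<lambda>i. i - L"]) auto
  finally show ?thesis using geo[of L] geo[of n] by linarith
qed

text \<open>With e = 2^-i the third bound is (1 - e/2)^2 \<ge> 1 - e: one dyadic step outwards makes
  room for squaring the radius.\<close>

lemma dyadic_sq_bounds: "0 \<le> (dyadic i)\<^sup>2" "(dyadic i)\<^sup>2 < 1" "dyadic i \<le> (dyadic (Suc i))\<^sup>2"
proof -
  show "(dyadic i)\<^sup>2 < 1" using mult_strict_mono[of "dyadic i" 1 "dyadic i" 1] dyadic_bounds(1,2)[of i] by (simp add: power2_eq_square)
  have "(dyadic (Suc i))\<^sup>2 = 1 - (1 / 2) ^ i + ((1 / 2) ^ Suc i)\<^sup>2"
    by (simp add: power2_eq_square algebra_simps)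
  then show "dyadic i \<le> (dyadic (Suc i))\<^sup>2" by simp
qed simp

section \<open>Sufficiency\<close>

context sphere_basis
begin

lemma mean_cong: "(\<And>x. norm x < 1 \<Longrightarrow> f x = g x) \<Longrightarrow> 0 \<le> r \<Longrightarrow> r < 1 \<Longrightarrow> mean f r = mean g r"
  unfolding mean_def by (rule Bochner_Integration.integral_cong) auto

lemma kern_mean:
  assumes a: "subexp (coeff_norm a)" and y: "norm y = 1" and r: "0 \<le> r" "r < 1"
  shows "(\<integral>\<^sup>+x. ennreal (cmod (kern a r x y)) \<partial>\<sigma>) = ennreal (mean (sph_series Y (kcoeff a y)) r)"
proof -
  have "(\<integral>\<^sup>+x. ennreal (cmod (kern a r x y)) \<partial>\<sigma>) = nmean (sph_series Y (kcoeff a y)) r"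
    unfolding nmean_def by (rule nn_integral_cong) (simp add: kern_eq_series)
  also have "\<dots> = ennreal (mean (sph_series Y (kcoeff a y)) r)"
    by (rule nmean_eq_mean[OF sph_series_harmonic[OF subexp_kcoeff[OF a y]] r])
  finally show ?thesis .
qed

text \<open>Identifies the integrand in \<open>N1\<close> as a kernel, whose symmetry makes the
  integration variable of \<open>N1\<close> the evaluation point.\<close>

lemma frac_deriv_hconv_poisson:
  assumes c: "subexp (coeff_norm c)" and x: "norm x = 1" and y: "norm y = 1"
  shows "frac_deriv Y t (hconv Y (sph_series Y c) (poisson Y x)) (r *\<^sub>R y) = kern (\<lambda>k j. complex_of_real (gam t k) * c k j) r x y"
proof -
  have 1: "sph_coeff Y (poisson Y x) k j = complex_of_real (Y k j x)" if "j \<in> {1..sph_dim TYPE('a) k}" for k j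
    unfolding poisson_def by (rule sph_coeff_sph_series[OF subexp_convergent[OF subexp_Y[OF x]] that])
  have 2: "sph_coeff Y (sph_series Y c) k j = c k j" if "j \<in> {1..sph_dim TYPE('a) k}" for k j
    by (rule sph_coeff_sph_series[OF subexp_convergent[OF c] that])
  have 3: "hconv Y (sph_series Y c) (poisson Y x) = sph_series Y (kcoeff c x)"
    unfolding hconv_def by (rule ext, rule sph_series_cong) (simp only: 1 2)
  have 4: "sph_coeff Y (sph_series Y (kcoeff c x)) k j = c k j * complex_of_real (Y k j x)" if "j \<in> {1..sph_dim TYPE('a) k}" for k j
    by (rule sph_coeff_sph_series[OF subexp_convergent[OF subexp_kcoeff[OF c x]] that])
  have "frac_deriv Y t (sph_series Y (kcoeff c x)) (r *\<^sub>R y) = sph_series Y (kcoeff (\<lambda>k j. complex_of_real (gam t k) * c k j) x) (r *\<^sub>R y)"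
    unfolding frac_deriv_def gam_def[symmetric] by (rule sph_series_cong) (simp only: 4 mult.assoc)
  also have "\<dots> = kern (\<lambda>k j. complex_of_real (gam t k) * c k j) r y x" by (rule kern_eq_series[OF y])
  finally show ?thesis unfolding 3 by (simp only: kern_sym)
qed

lemma N1_eq_SUP_mean:
  assumes c: "subexp (coeff_norm c)" and t: "0 < m + 1"
  shows "N1 \<sigma> Y \<alpha> \<beta> m (sph_series Y c) =
    (SUP \<rho>\<in>{0..<1}. SUP y\<in>sphere 0 1. ennreal ((1 - \<rho>) powr (m + 1 - \<alpha> + \<beta>) * mean (sph_series Y (kcoeff (\<lambda>k j. complex_of_real (gam (m + 1) k) * c k j) y)) \<rho>))"
proof -
  have "(\<integral>\<^sup>+x. ennreal (cmod (frac_deriv Y (m + 1) (hconv Y (sph_series Y c) (poisson Y x)) (\<rho> *\<^sub>R y))) \<partial>\<sigma>)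
      = ennreal (mean (sph_series Y (kcoeff (\<lambda>k j. complex_of_real (gam (m + 1) k) * c k j) y)) \<rho>)"
    if "\<rho> \<in> {0..<1}" "y \<in> sphere 0 1" for \<rho> and y :: 'a
  proof -
    have y: "norm y = 1" using that by simp
    have "(\<integral>\<^sup>+x. ennreal (cmod (frac_deriv Y (m + 1) (hconv Y (sph_series Y c) (poisson Y x)) (\<rho> *\<^sub>R y))) \<partial>\<sigma>)
      = (\<integral>\<^sup>+x. ennreal (cmod (kern (\<lambda>k j. complex_of_real (gam (m + 1) k) * c k j) \<rho> x y)) \<partial>\<sigma>)"
      by (rule nn_integral_cong) (use frac_deriv_hconv_poisson[OF c _ y] in simp)
    also have "\<dots> = ennreal (mean (sph_series Y (kcoeff (\<lambda>k j. complex_of_real (gam (m + 1) k) * c k j) y)) \<rho>)"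
      by (rule kern_mean[OF subexp_coeff_scale[OF subexp_gam[OF t] c] y]) (use that in auto)
    finally show ?thesis .
  qed
  then show ?thesis unfolding N1_def by (intro SUP_cong refl) (simp only: ennreal_mult[OF powr_ge_zero mean_nonneg])
qed

text \<open>Since Beta (k + n/2) t * gam t k = 1, the image of f is an average over s of the
  convolution of f with the differentiated multiplier at radius r s, with r = (dyadic i)^2. Writing
  r s = \<rho>^2 and evaluating both factors at \<rho>, the dyadic block of s decides the scale of
  \<rho>.\<close>

lemma multiplier_mean_estimate:
  assumes c: "subexp (coeff_norm c)" and f: "f \<in> harmonic_ball" and t: "0 < t" and \<tau>: "0 < \<tau>" and N: "0 \<le> N"
    and B: "\<And>\<rho> y. 0 \<le> \<rho> \<Longrightarrow> \<rho> < 1 \<Longrightarrow> norm y = 1 \<Longrightarrow> mean (sph_series Y (kcoeff (\<lambda>k j. complex_of_real (gam t k) * c k j) y)) \<rho> \<le> N * (1 - \<rho>) powr (- \<tau>)"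
  shows "mean (sph_series Y (\<lambda>k j. c k j * sph_coeff Y f k j)) ((dyadic i)\<^sup>2)
     \<le> (N * 4 powr \<tau> / t) * (\<Sum>j\<le>i. ((1 / 2) ^ j) powr (t - \<tau>) * mean f (dyadic (Suc (Suc j))))"
proof -
  define b where "b = sph_coeff Y f"
  define w where "w j = ((1 / 2) ^ j :: real)" for j
  have w: "0 < w j" for j by (simp add: w_def)
  have b: "subexp (coeff_norm b)" using sph_coeff_subexp[OF f] by (simp add: b_def)
  have fb: "sph_series Y b x = f x" if "norm x < 1" for x using sph_series_sph_coeff[OF f] that by (simp add: b_def)
  have gc: "subexp (coeff_norm (\<lambda>k j. complex_of_real (gam t k) * c k j))" by (rule subexp_coeff_scale[OF subexp_gam[OF t] c])
  have cb: "subexp (coeff_norm (\<lambda>k j. c k j * b k j))" by (rule subexp_coeff_mult[OF c b])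
  define a where "a = (\<lambda>k j. complex_of_real (gam t k) * c k j * b k j)"
  have a: "subexp (coeff_norm a)" unfolding a_def by (rule subexp_coeff_mult[OF gc b])
  \<comment> \<open>The bound for one block: 1 - \<rho> \<ge> w j / 4 controls the kernel, and the
    same inequality puts \<rho> below \<open>dyadic (Suc (Suc j))\<close>, which controls the mean
    of f.\<close>
  define V where "V j = N * (w j / 4) powr (- \<tau>) * mean f (dyadic (Suc (Suc j)))" for j
  have V: "0 \<le> V j" for j using N by (simp add: V_def mean_nonneg)
  \<comment> \<open>A measurable majorant in s. Each term extends from its block up to 1 instead of
    over the block only; this costs little, as the integral of (1 - s)^(t - 1) over the tail is w j
    powr t / t.\<close>
  define \<phi> where "\<phi> s = (\<Sum>j\<le>i. ennreal (V j) * ennreal (indicator {dyadic j..<1} s))" for s :: real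
  have \<phi> [measurable]: "\<phi> \<in> borel_measurable borel" unfolding \<phi>_def by measurable
  have est: "nmean (sph_series Y a) ((dyadic i)\<^sup>2 * s) \<le> \<phi> s" if s: "0 < s" "s < 1" for s
  proof -
    obtain j where j: "dyadic j \<le> s" "s < dyadic (Suc j)" using dyadic_block[of s] s by auto
    \<comment> \<open>Blocks beyond i bring \<rho> no closer to the boundary than
      \<open>dyadic i\<close>, so they are all counted at scale i.\<close>
    define l where "l = min j i"
    define \<rho> where "\<rho> = dyadic i * sqrt s"
    have sq: "0 < sqrt s" "sqrt s < 1" using s by auto
    have \<rho>: "0 \<le> \<rho>" "\<rho> < 1"
      unfolding \<rho>_def using sq dyadic_bounds[of i] mult_strict_mono'[of "dyadic i" 1 "sqrt s" 1] by auto
    have "w l / 4 \<le> 1 - \<rho>"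
    proof (cases "j \<le> i")
      case True
      have "1 - s = (1 - sqrt s) * (1 + sqrt s)" using s by (simp add: algebra_simps)
      also have "\<dots> \<le> (1 - sqrt s) * 2" using sq by (intro mult_left_mono) auto
      finally have "w j / 4 \<le> 1 - sqrt s" using j(2) by (simp add: w_def)
      moreover have "\<rho> \<le> sqrt s" unfolding \<rho>_def using sq dyadic_bounds[of i] by (intro mult_left_le_one_le) auto
      ultimately show ?thesis using True by (simp add: l_def min_def)
    next
      case False
      have "\<rho> \<le> dyadic i * 1" unfolding \<rho>_def using sq dyadic_bounds(1)[of i] by (intro mult_left_mono) auto
      then have "w i \<le> 1 - \<rho>" by (simp add: w_def)
      then have "w i / 4 \<le> 1 - \<rho>" using w[of i] by linarith
      then show ?thesis using False by (simp add: l_def)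
    qed
    then have w\<rho>: "w l / 4 \<le> 1 - \<rho>" .
    then have \<rho>d: "\<rho> \<le> dyadic (Suc (Suc l))" by (simp add: w_def)
    have "(1 / 2 :: real) ^ j \<le> (1 / 2) ^ l" by (rule power_decreasing) (auto simp: l_def)
    then have sl: "dyadic l \<le> s" using j(1) by linarith
    have "(dyadic i)\<^sup>2 * s = \<rho> * \<rho>" using s by (simp add: \<rho>_def power2_eq_square)
    then have "nmean (sph_series Y a) ((dyadic i)\<^sup>2 * s) = nmean (sph_series Y a) (\<rho> * \<rho>)" by (simp only:)
    also have "\<dots> \<le> ennreal (N * (1 - \<rho>) powr (- \<tau>)) * nmean (sph_series Y b) \<rho>"
      unfolding a_def
    proof (rule nmean_mult_le[OF gc b \<rho> \<rho>])
      fix y :: 'a assume y: "norm y = 1"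
      show "(\<integral>\<^sup>+x. ennreal (cmod (kern (\<lambda>k j. complex_of_real (gam t k) * c k j) \<rho> x y)) \<partial>\<sigma>) \<le> ennreal (N * (1 - \<rho>) powr (- \<tau>))"
        unfolding kern_mean[OF gc y \<rho>] by (rule ennreal_leI[OF B[OF \<rho> y]])
    qed
    also have "nmean (sph_series Y b) \<rho> = nmean f \<rho>" by (rule nmean_cong[OF fb \<rho>])
    also have "\<dots> = ennreal (mean f \<rho>)" by (rule nmean_eq_mean[OF f \<rho>])
    also have "ennreal (N * (1 - \<rho>) powr (- \<tau>)) * ennreal (mean f \<rho>) = ennreal (N * (1 - \<rho>) powr (- \<tau>) * mean f \<rho>)"
      by (rule ennreal_mult[symmetric]) (use N mean_nonneg in auto)
    also have "\<dots> \<le> ennreal (V l)"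
      unfolding V_def using N \<tau> w\<rho> w[of l] \<rho> \<rho>d dyadic_bounds(2)[of "Suc (Suc l)"]
      by (intro ennreal_leI mult_mono powr_mono2' mean_mono f order_refl mult_nonneg_nonneg mean_nonneg) auto
    also have "\<dots> = ennreal (V l) * ennreal (indicator {dyadic l..<1} s)" using sl s by simp
    also have "\<dots> \<le> \<phi> s"
      unfolding \<phi>_def by (rule member_le_sum[of l "{..i}" "\<lambda>j. ennreal (V j) * ennreal (indicator {dyadic j..<1} s)"]) (auto simp: l_def)
    finally show ?thesis .
  qed
  have r: "0 \<le> (dyadic i)\<^sup>2" "(dyadic i)\<^sup>2 < 1" by (rule dyadic_sq_bounds)+
  have n2: "1 \<le> real DIM('a) / 2" using dim by simp
  have "ennreal (mean (sph_series Y (\<lambda>k j. c k j * b k j)) ((dyadic i)\<^sup>2)) = nmean (sph_series Y (\<lambda>k j. c k j * b k j)) ((dyadic i)\<^sup>2)"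
    by (rule nmean_eq_mean[OF sph_series_harmonic[OF cb] r, symmetric])
  also have "\<dots> = nmean (sph_series Y (\<lambda>k j. complex_of_real (Beta (real k + real DIM('a) / 2) t) * a k j)) ((dyadic i)\<^sup>2)"
  proof (rule nmean_cong[OF sph_series_cong r])
    fix k j
    have "complex_of_real (Beta (real k + real DIM('a) / 2) t) * complex_of_real (gam t k) = 1"
      by (simp only: of_real_mult[symmetric] Beta_gam[OF t] of_real_1)
    then show "c k j * b k j = complex_of_real (Beta (real k + real DIM('a) / 2) t) * a k j"
      unfolding a_def by (simp only: mult.assoc[symmetric] mult_1_left)
  qed
  also have "\<dots> \<le> (\<integral>\<^sup>+s. ennreal (indicator {0<..<1} s * (1 - s) powr (t - 1)) * \<phi> s \<partial>lborel)"
    by (rule nmean_Beta_le[OF a n2 t r est \<phi>])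
  also have "\<dots> \<le> (\<integral>\<^sup>+s. (\<Sum>j\<le>i. ennreal (V j) * ennreal (indicator {dyadic j..<1} s * (1 - s) powr (t - 1))) \<partial>lborel)"
  proof (rule nn_integral_mono)
    fix s :: real
    have "ennreal (indicator {0<..<1} s * (1 - s) powr (t - 1)) * (ennreal (V j) * ennreal (indicator {dyadic j..<1} s))
      \<le> ennreal (V j) * ennreal (indicator {dyadic j..<1} s * (1 - s) powr (t - 1))" for j
      by (auto simp: indicator_def mult.commute)
    then show "ennreal (indicator {0<..<1} s * (1 - s) powr (t - 1)) * \<phi> s \<le> (\<Sum>j\<le>i. ennreal (V j) * ennreal (indicator {dyadic j..<1} s * (1 - s) powr (t - 1)))"
      unfolding \<phi>_def sum_distrib_left by (intro sum_mono)
  qed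
  also have "\<dots> = (\<Sum>j\<le>i. ennreal (V j) * ennreal (w j powr t / t))"
  proof -
    have "(\<integral>\<^sup>+s. ennreal (V j) * ennreal (indicator {dyadic j..<1} s * (1 - s) powr (t - 1)) \<partial>lborel) = ennreal (V j) * ennreal (w j powr t / t)" for j
      by (subst nn_integral_cmult) (simp_all only: nn_integral_powr_tail[OF t less_imp_le[OF dyadic_bounds(2)]] w_def diff_diff_eq2 add_diff_cancel_left', measurable)
    then show ?thesis by (subst nn_integral_sum) (auto simp del: ennreal_mult')
  qed
  also have "\<dots> = (\<Sum>j\<le>i. ennreal (V j * (w j powr t / t)))"
    by (rule sum.cong[OF refl], rule ennreal_mult[symmetric]) (use V t in auto)
  also have "\<dots> = ennreal (\<Sum>j\<le>i. V j * (w j powr t / t))"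
    by (rule sum_ennreal) (use V t in auto)
  finally have "mean (sph_series Y (\<lambda>k j. c k j * b k j)) ((dyadic i)\<^sup>2) \<le> (\<Sum>j\<le>i. V j * (w j powr t / t))"
    using V t by (subst (asm) ennreal_le_iff) (auto intro!: sum_nonneg)
  also have "\<dots> = (\<Sum>j\<le>i. (N * 4 powr \<tau> / t) * (w j powr (t - \<tau>) * mean f (dyadic (Suc (Suc j)))))"
  proof (rule sum.cong[OF refl])
    fix j
    have "(w j / 4) powr (- \<tau>) = 4 powr \<tau> * w j powr (- \<tau>)"
      using powr_minus[of 4 "- \<tau>"] powr_divide[of "w j" 4 "- \<tau>"] by (simp only: minus_minus divide_inverse[of "_ powr _"] mult.commute)
    moreover have "w j powr (- \<tau>) * w j powr t = w j powr (t - \<tau>)" by (simp only: powr_add[symmetric] diff_conv_add_uminus add.commute)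
    ultimately have 1: "(w j / 4) powr (- \<tau>) * w j powr t = 4 powr \<tau> * w j powr (t - \<tau>)" by (simp only: mult.assoc)
    have "V j * (w j powr t / t) = N / t * ((w j / 4) powr (- \<tau>) * w j powr t) * mean f (dyadic (Suc (Suc j)))"
      unfolding V_def by (simp only: times_divide_eq_right times_divide_eq_left mult_ac)
    then show "V j * (w j powr t / t) = (N * 4 powr \<tau> / t) * (w j powr (t - \<tau>) * mean f (dyadic (Suc (Suc j))))"
      unfolding 1 by (simp only: times_divide_eq_right times_divide_eq_left mult_ac)
  qed
  finally show ?thesis unfolding b_def w_def sum_distrib_left .
qed

text \<open>The exponents balance through \<beta> + (\<alpha> - \<beta>) = \<alpha>: the weight at
  scale i splits into the weight \<alpha> for f at scale j and a factor 2^(-\<beta> (i - j)), and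
  \<beta> > 0 makes the latter summable.\<close>

lemma multiplier_sufficient:
  assumes c: "subexp (coeff_norm c)" and f: "f \<in> mixed_norm_space \<sigma> (ereal p) 1 \<alpha>" and \<alpha>: "0 < \<alpha>" and \<beta>: "0 < \<beta>"
    and t: "\<alpha> < t" and p: "0 < p" "p \<le> 1" and q: "ereal p \<le> q" and N: "0 \<le> N"
    and B: "\<And>\<rho> y. 0 \<le> \<rho> \<Longrightarrow> \<rho> < 1 \<Longrightarrow> norm y = 1 \<Longrightarrow> mean (sph_series Y (kcoeff (\<lambda>k j. complex_of_real (gam t k) * c k j) y)) \<rho> \<le> N * (1 - \<rho>) powr (- (t - \<alpha> + \<beta>))"
  shows "sph_series Y (\<lambda>k j. c k j * sph_coeff Y f k j) \<in> mixed_norm_space \<sigma> q 1 \<beta>"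
proof -
  define h where "h = sph_series Y (\<lambda>k j. c k j * sph_coeff Y f k j)"
  have fh: "f \<in> harmonic_ball" using f by (simp add: mixed_norm_space_def)
  have hh: "h \<in> harmonic_ball"
    unfolding h_def by (rule sph_series_harmonic[OF subexp_coeff_mult[OF c sph_coeff_subexp[OF fh]]])
  have "mixed_norm \<sigma> (ereal p) 1 \<alpha> f < \<infinity>" using f by (simp add: mixed_norm_space_def)
  then have sD: "summable (\<lambda>i. dnorm \<alpha> f i powr p)" using mixed_norm_finite_iff[OF fh p(1)] by blast
  define w where "w j = ((1 / 2) ^ j :: real)" for j
  have w: "0 < w j" for j by (simp add: w_def)
  define D where "D j = dnorm \<alpha> f (Suc (Suc j))" for j
  have D: "0 \<le> D j" for j by (simp add: D_def dnorm_nonneg)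
  define K0 where "K0 = N * 4 powr (t - \<alpha> + \<beta>) / t"
  have t0: "0 < t" and \<tau>: "0 < t - \<alpha> + \<beta>" using \<alpha> \<beta> t by auto
  have K0: "0 \<le> K0" using N t0 by (simp add: K0_def)
  have e: "\<alpha> - \<beta> = t - (t - \<alpha> + \<beta>)" by simp
  have base: "mean h ((dyadic i)\<^sup>2) \<le> K0 * (\<Sum>j\<le>i. w j powr (\<alpha> - \<beta>) * mean f (dyadic (Suc (Suc j))))" for i
    unfolding h_def K0_def w_def e by (rule multiplier_mean_estimate[OF c fh t0 \<tau> N B])
  define K where "K = K0 * 4 powr \<alpha> * 2 powr \<beta>"
  have K: "0 \<le> K" using K0 by (simp add: K_def)
  have bd: "dnorm \<beta> h i \<le> (\<Sum>j\<le>Suc i. K * (D j * w (Suc i - j) powr \<beta>))" for i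
  proof -
    \<comment> \<open>The estimate is available at squared radii only, so the index is raised by
      one; this is the origin of the range up to \<open>Suc i\<close>.\<close>
    have "mean h (dyadic i) \<le> mean h ((dyadic (Suc i))\<^sup>2)"
      by (rule mean_mono[OF hh dyadic_bounds(1) dyadic_sq_bounds(3) dyadic_sq_bounds(2)])
    also note base[of "Suc i"]
    finally have "dnorm \<beta> h i \<le> w i powr \<beta> * (K0 * (\<Sum>j\<le>Suc i. w j powr (\<alpha> - \<beta>) * mean f (dyadic (Suc (Suc j)))))"
      unfolding dnorm_def w_def[symmetric] by (intro mult_left_mono) auto
    also have "\<dots> = (\<Sum>j\<le>Suc i. w i powr \<beta> * (K0 * (w j powr (\<alpha> - \<beta>) * mean f (dyadic (Suc (Suc j))))))"
      by (simp only: sum_distrib_left)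
    also have "\<dots> = (\<Sum>j\<le>Suc i. K * (D j * w (Suc i - j) powr \<beta>))"
    proof (rule sum.cong[OF refl])
      fix j assume "j \<in> {..Suc i}"
      then have "w (Suc i) = w (Suc i - j) * w j" unfolding w_def by (simp flip: power_add del: power_Suc)
      then have "w i = 2 * (w (Suc i - j) * w j)" by (simp add: w_def)
      then have 1: "w i powr \<beta> = 2 powr \<beta> * (w (Suc i - j) powr \<beta> * w j powr \<beta>)" by (simp only: powr_mult)
      have "w j = 4 * w (Suc (Suc j))" by (simp add: w_def)
      then have 2: "w j powr \<alpha> = 4 powr \<alpha> * w (Suc (Suc j)) powr \<alpha>" by (simp only: powr_mult)
      have 3: "w j powr \<beta> * w j powr (\<alpha> - \<beta>) = w j powr \<alpha>" using w[of j] by (simp flip: powr_add)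
      have 4: "D j = w (Suc (Suc j)) powr \<alpha> * mean f (dyadic (Suc (Suc j)))" by (simp only: D_def dnorm_def w_def)
      have "w i powr \<beta> * (K0 * (w j powr (\<alpha> - \<beta>) * mean f (dyadic (Suc (Suc j)))))
        = K0 * 2 powr \<beta> * w (Suc i - j) powr \<beta> * (w j powr \<beta> * w j powr (\<alpha> - \<beta>)) * mean f (dyadic (Suc (Suc j)))"
        unfolding 1 by (simp only: mult_ac)
      also have "\<dots> = K * (D j * w (Suc i - j) powr \<beta>)"
        unfolding 3 unfolding 2 4 K_def by (simp only: mult_ac)
      finally show "w i powr \<beta> * (K0 * (w j powr (\<alpha> - \<beta>) * mean f (dyadic (Suc (Suc j))))) = K * (D j * w (Suc i - j) powr \<beta>)" .
    qed
    finally show ?thesis .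
  qed
  have "summable (\<lambda>i. dnorm \<beta> h i powr p)"
  proof (rule summable_comparison_test')
    have sDp: "summable (\<lambda>j. D j powr p)"
      unfolding D_def using sD by (simp add: summable_Suc_iff[of "\<lambda>i. dnorm \<alpha> f (Suc i) powr p"] summable_Suc_iff[of "\<lambda>i. dnorm \<alpha> f i powr p"])
    have wp: "(w j powr \<beta>) powr p = ((1 / 2) powr (\<beta> * p)) ^ j" for j
    proof -
      have "(w j powr \<beta>) powr p = ((1 / 2) powr real j) powr (\<beta> * p)" by (simp add: w_def powr_powr powr_realpow)
      also have "\<dots> = ((1 / 2) powr (\<beta> * p)) powr real j" by (simp add: powr_powr mult.commute)
      also have "\<dots> = ((1 / 2) powr (\<beta> * p)) ^ j" by (rule powr_realpow) simp
      finally show ?thesis .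
    qed
    have sw: "summable (\<lambda>j. (w j powr \<beta>) powr p)"
      unfolding wp using \<beta> p by (intro summable_geometric) (simp add: powr01_less_one)
    have "summable (\<lambda>n. \<Sum>j\<le>n. D j powr p * (w (n - j) powr \<beta>) powr p)"
      by (rule summable_Cauchy_product) (use sDp sw in simp_all)
    then have "summable (\<lambda>i. \<Sum>j\<le>Suc i. D j powr p * (w (Suc i - j) powr \<beta>) powr p)"
      by (subst summable_Suc_iff[of "\<lambda>n. \<Sum>j\<le>n. D j powr p * (w (n - j) powr \<beta>) powr p"])
    then show "summable (\<lambda>i. K powr p * (\<Sum>j\<le>Suc i. D j powr p * (w (Suc i - j) powr \<beta>) powr p))"
      by (rule summable_mult)
  next
    fix i :: nat
    have "dnorm \<beta> h i powr p \<le> (\<Sum>j\<le>Suc i. K * (D j * w (Suc i - j) powr \<beta>)) powr p"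
      using p by (intro powr_mono2 bd dnorm_nonneg) auto
    also have "\<dots> \<le> (\<Sum>j\<le>Suc i. (K * (D j * w (Suc i - j) powr \<beta>)) powr p)"
      using K D p by (intro powr_sum_le) auto
    also have "\<dots> = K powr p * (\<Sum>j\<le>Suc i. D j powr p * (w (Suc i - j) powr \<beta>) powr p)"
      unfolding sum_distrib_left by (rule sum.cong[OF refl]) (simp add: powr_mult K D)
    finally show "norm (dnorm \<beta> h i powr p) \<le> K powr p * (\<Sum>j\<le>Suc i. D j powr p * (w (Suc i - j) powr \<beta>) powr p)" by simp
  qed
  then show ?thesis unfolding h_def[symmetric] by (intro mixed_norm_spaceI[OF hh p(1) q])
qed

end

section \<open>Interaction of dyadic scales\<close>

lemma power_powr_commute: "0 < x \<Longrightarrow> ((x::real) ^ j) powr e = (x powr e) ^ j"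
  by (induction j) (auto simp: powr_mult)

lemma half_power_ratio_le:
  assumes "a \<le> b" "0 \<le> \<delta>" "\<delta> \<le> e"
  shows "((1 / 2 :: real) ^ b) powr e * ((1 / 2) ^ a) powr (- e) \<le> ((1 / 2) powr \<delta>) ^ (b - a)"
proof -
  have "(1 / 2 :: real) ^ b = (1 / 2) ^ (b - a) * (1 / 2) ^ a" using assms by (simp flip: power_add)
  then have "((1 / 2 :: real) ^ b) powr e = ((1 / 2) ^ (b - a)) powr e * ((1 / 2) ^ a) powr e" by (simp only: powr_mult)
  moreover have "((1 / 2 :: real) ^ a) powr e * ((1 / 2) ^ a) powr (- e) = 1" by (simp flip: powr_add)
  ultimately have "((1 / 2 :: real) ^ b) powr e * ((1 / 2) ^ a) powr (- e) = ((1 / 2) ^ (b - a)) powr e"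
    by (simp only: mult.assoc mult_1_right)
  also have "\<dots> \<le> ((1 / 2) ^ (b - a)) powr \<delta>" using assms by (intro powr_mono') (auto simp: power_le_one)
  also have "\<dots> = ((1 / 2) powr \<delta>) ^ (b - a)" by (rule power_powr_commute) simp
  finally show ?thesis .
qed

text \<open>1 - (1 - a)(1 - b) is at least a and at least b. Using the larger one leaves (w i / w
  L)^\<alpha> for L \<le> i and (w L / w i)^(t - \<alpha>) for i < L, and both exponents are
  positive.\<close>

lemma dyadic_pair_weight:
  assumes "0 < \<alpha>" "\<alpha> < t"
  shows "((1 / 2) ^ i) powr \<alpha> * (((1 / 2) ^ L) powr (t - \<alpha>) * (1 - dyadic L * dyadic i) powr (- t))
     \<le> ((1 / 2) powr min \<alpha> (t - \<alpha>)) ^ ((i - L) + (L - i))"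
proof -
  define w where "w j = ((1 / 2) ^ j :: real)" for j
  have w: "0 < w j" "w j \<le> 1" for j by (simp_all add: w_def power_le_one)
  have X: "(1 - (1 - w L) * (1 - w i)) powr (- t) \<le> w j powr (- t)" if "j = i \<or> j = L" for j
  proof (rule powr_mono2')
    have "(1 - w L) * (1 - w i) \<le> 1 - w L" "(1 - w L) * (1 - w i) \<le> 1 - w i"
      using w[of L] w[of i] by (auto intro: mult_left_le mult_left_le_one_le)
    then show "w j \<le> 1 - (1 - w L) * (1 - w i)" using that by auto
  qed (use assms w in auto)
  show ?thesis
  proof (cases "L \<le> i")
    case True
    have "w i powr \<alpha> * (w L powr (t - \<alpha>) * (1 - (1 - w L) * (1 - w i)) powr (- t)) \<le> w i powr \<alpha> * (w L powr (t - \<alpha>) * w L powr (- t))"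
      using X[of L] by (intro mult_left_mono) auto
    also have "\<dots> = w i powr \<alpha> * w L powr (- \<alpha>)" using w[of L] by (simp flip: powr_add)
    also have "\<dots> \<le> ((1 / 2) powr min \<alpha> (t - \<alpha>)) ^ (i - L)"
      unfolding w_def by (rule half_power_ratio_le) (use True assms in auto)
    finally show ?thesis using True by (simp add: w_def)
  next
    case False
    have "w i powr \<alpha> * (w L powr (t - \<alpha>) * (1 - (1 - w L) * (1 - w i)) powr (- t)) \<le> w i powr \<alpha> * (w L powr (t - \<alpha>) * w i powr (- t))"
      using X[of i] by (intro mult_left_mono) auto
    also have "\<dots> = w L powr (t - \<alpha>) * w i powr (- (t - \<alpha>))"
      using w[of i] powr_add[of "w i" \<alpha> "- t"] by (simp add: mult_ac)
    also have "\<dots> \<le> ((1 / 2) powr min \<alpha> (t - \<alpha>)) ^ (L - i)"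
      unfolding w_def by (rule half_power_ratio_le) (use False assms in auto)
    finally show ?thesis using False by (simp add: w_def)
  qed
qed

lemma suminf_half_power: "summable (\<lambda>l. (1 / 2 :: real) ^ l * c)" "(\<Sum>l. (1 / 2 :: real) ^ l * c) = 2 * c"
proof -
  have "(\<lambda>l. (1 / 2 :: real) ^ l) sums 2" using geometric_sums[of "1/2::real"] by simp
  from sums_mult2[OF this, of c]
  show "summable (\<lambda>l. (1 / 2 :: real) ^ l * c)" "(\<Sum>l. (1 / 2 :: real) ^ l * c) = 2 * c" by (auto simp: sums_iff)
qed

section \<open>Necessity: test functions\<close>

context sphere_basis
begin

lemma mean_le:
  assumes f: "f \<in> harmonic_ball" and r: "0 \<le> r" "r < 1" and S: "\<And>x. norm x = 1 \<Longrightarrow> cmod (f (r *\<^sub>R x)) \<le> S"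
  shows "mean f r \<le> S * \<omega>"
proof -
  have "mean f r \<le> (\<integral>x. S \<partial>\<sigma>)"
    unfolding mean_def
  proof (rule integral_mono)
    show "integrable \<sigma> (\<lambda>y. cmod (f (r *\<^sub>R y)))"
      by (rule integrable_\<sigma>[OF continuous_on_norm[OF harmonic_ball_sphere_continuous[OF f r]]])
    show "integrable \<sigma> (\<lambda>y. S)" by (rule integrable_\<sigma>[OF continuous_on_const])
  qed (use S in simp)
  then show ?thesis by (simp add: mult.commute)
qed

text \<open>One more factor \<open>ybound\<close> makes the bound uniform in the point. It may
  depend on the radius: the gliding hump asks for a finite bound at each scale.\<close>

lemma kcoeff_mean_bounded:
  assumes a: "subexp (coeff_norm a)" and r: "0 \<le> r" "r < 1"
  shows "\<exists>B. \<forall>y. norm y = 1 \<longrightarrow> mean (sph_series Y (kcoeff a y)) r \<le> B"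
proof (intro exI allI impI)
  fix y :: 'a assume y: "norm y = 1"
  let ?g = "\<lambda>k. \<bar>coeff_norm a k * ybound k * ybound k\<bar> * r ^ k"
  have sg: "summable ?g" by (rule subexp_summable[OF subexp_mult[OF subexp_mult[OF a subexp_ybound] subexp_ybound] r])
  have ck: "coeff_norm (kcoeff a y) k \<le> coeff_norm a k * ybound k" for k
    unfolding coeff_norm_def sum_distrib_right norm_mult
    by (rule sum_mono, rule mult_left_mono) (use Y_le_ybound[OF _ y] in auto)
  show "mean (sph_series Y (kcoeff a y)) r \<le> suminf ?g * \<omega>"
  proof (rule mean_le[OF sph_series_harmonic[OF subexp_kcoeff[OF a y]] r])
    fix x :: 'a assume x: "norm x = 1"
    show "cmod (sph_series Y (kcoeff a y) (r *\<^sub>R x)) \<le> suminf ?g"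
      unfolding sph_series_def
    proof (rule norm_suminf_le[OF _ sg])
      fix k
      have "cmod (sph_term Y (kcoeff a y) (r *\<^sub>R x) k) \<le> \<bar>coeff_norm (kcoeff a y) k * ybound k\<bar> * r ^ k"
        by (rule norm_sph_term_le) (use x r in simp)
      also have "\<dots> \<le> ?g k"
        unfolding abs_mult using ck[of k] ybound_ge_1[of k] r
        by (intro mult_right_mono) (auto simp flip: abs_mult intro: order_trans[OF _ abs_ge_self])
      finally show "cmod (sph_term Y (kcoeff a y) (r *\<^sub>R x) k) \<le> ?g k" .
    qed
  qed
qed

lemma bounded_mean_in_mixed_norm_space:
  assumes f: "f \<in> harmonic_ball" and C: "\<And>i. mean f (dyadic i) \<le> C" and \<alpha>: "0 < \<alpha>" and p: "0 < p"
  shows "f \<in> mixed_norm_space \<sigma> (ereal p) 1 \<alpha>"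
proof (rule mixed_norm_spaceI[OF f p order_refl])
  have C0: "0 \<le> C" using C[of 0] mean_nonneg[of f "dyadic 0"] by linarith
  have h1: "(1 / 2 :: real) powr (\<alpha> * p) < 1" using \<alpha> p by (simp add: powr01_less_one)
  show "summable (\<lambda>i. dnorm \<alpha> f i powr p)"
  proof (rule summable_comparison_test')
    show "summable (\<lambda>i. C powr p * ((1 / 2) powr (\<alpha> * p)) ^ i)" using h1 by (intro summable_mult summable_geometric) simp
    fix i :: nat
    have "dnorm \<alpha> f i powr p \<le> (((1 / 2) ^ i) powr \<alpha> * C) powr p"
      unfolding dnorm_def using p C by (intro powr_mono2 mult_left_mono mult_nonneg_nonneg mean_nonneg) auto
    also have "\<dots> = C powr p * ((1 / 2) ^ i) powr (\<alpha> * p)" using C0 by (simp add: powr_mult powr_powr)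
    also have "((1 / 2 :: real) ^ i) powr (\<alpha> * p) = ((1 / 2) powr (\<alpha> * p)) ^ i" by (rule power_powr_commute) simp
    finally show "norm (dnorm \<alpha> f i powr p) \<le> C powr p * ((1 / 2) powr (\<alpha> * p)) ^ i" by simp
  qed
qed

text \<open>
  A single test function with slowly decaying nonzero coefficients shows that the coefficients of
  a multiplier grow subexponentially.
\<close>

lemma multiplier_coefficients_subexp:
  assumes \<alpha>: "0 < \<alpha>" and p: "0 < p"
    and c: "\<And>f. f \<in> mixed_norm_space \<sigma> (ereal p) 1 \<alpha> \<Longrightarrow>
        sph_convergent Y (\<lambda>k j. c k j * sph_coeff Y f k j) \<and> sph_series Y (\<lambda>k j. c k j * sph_coeff Y f k j) \<in> harmonic_ball"
  shows "subexp (coeff_norm c)"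
proof -
  \<comment> \<open>The weights compensate the dimension, at most
    \<open>\<omega> * ybound k\<close>, and the size of the basis functions, at most
    \<open>ybound k\<close>. What remains is 1 / (k + 1)^2, so the test series is bounded on the
    whole ball.\<close>
  define l where "l k = \<omega> * ybound k * ybound k * (real (Suc k) * real (Suc k))" for k
  have yb: "0 < ybound k" for k using ybound_ge_1[of k] by linarith
  have l: "0 < l k" for k unfolding l_def using yb[of k] \<omega>_pos by (intro mult_pos_pos) auto
  have sl: "subexp l" unfolding l_def by (intro subexp_mult subexp_const subexp_ybound subexp_Suc)
  define b where "b = (\<lambda>k (j::nat). complex_of_real (1 / l k))"
  have cb: "coeff_norm b k * ybound k \<le> inverse (real (Suc k) ^ 2)" for k
  proof -
    have "coeff_norm b k = real (sph_dim TYPE('a) k) * (1 / l k)"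
      using l[of k] by (simp add: coeff_norm_def b_def norm_divide)
    also have "\<dots> \<le> (\<omega> * ybound k) * (1 / l k)" using l[of k] by (intro mult_right_mono d_le_ybound) auto
    finally have "coeff_norm b k * ybound k \<le> (\<omega> * ybound k) * (1 / l k) * ybound k"
      using yb[of k] by (intro mult_right_mono) auto
    also have "\<dots> = inverse (real (Suc k) ^ 2)"
      using yb[of k] \<omega>_pos by (simp add: l_def power2_eq_square field_simps del: of_nat_Suc)
    finally show ?thesis .
  qed
  have sb: "subexp (coeff_norm b)"
  proof (rule subexp_mono[OF subexp_const[of 1]])
    fix k
    have "coeff_norm b k * 1 \<le> coeff_norm b k * ybound k" by (intro mult_left_mono ybound_ge_1) auto
    also note cb[of k]
    also have "inverse (real (Suc k) ^ 2) \<le> 1" by (intro inverse_le_1_iff[THEN iffD2] disjI2 one_le_power) auto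
    finally show "\<bar>coeff_norm b k\<bar> \<le> \<bar>1\<bar>" by simp
  qed
  define f where "f = sph_series Y b"
  have f: "f \<in> harmonic_ball" unfolding f_def by (rule sph_series_harmonic[OF sb])
  let ?S = "\<Sum>k. inverse (real (Suc k) ^ 2)"
  have "f \<in> mixed_norm_space \<sigma> (ereal p) 1 \<alpha>"
  proof (rule bounded_mean_in_mixed_norm_space[OF f _ \<alpha> p])
    fix i
    show "mean f (dyadic i) \<le> ?S * \<omega>"
    proof (rule mean_le[OF f dyadic_bounds(1,2)])
      fix x :: 'a assume x: "norm x = 1"
      have ss: "summable (\<lambda>k. inverse (real (Suc k) ^ 2))"
        using inverse_power_summable[of 2, where 'a = real] by (subst summable_Suc_iff[of "\<lambda>k. inverse (real k ^ 2)"]) simp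
      show "cmod (f (dyadic i *\<^sub>R x)) \<le> ?S"
        unfolding f_def sph_series_def
      proof (rule norm_suminf_le[OF _ ss])
        fix k
        have "cmod (sph_term Y b (dyadic i *\<^sub>R x) k) \<le> \<bar>coeff_norm b k * ybound k\<bar> * 1 ^ k"
          by (rule norm_sph_term_le) (use x dyadic_bounds[of i] in simp)
        also have "\<dots> = coeff_norm b k * ybound k" using yb[of k] by simp
        also note cb
        finally show "cmod (sph_term Y b (dyadic i *\<^sub>R x) k) \<le> inverse (real (Suc k) ^ 2)" .
      qed
    qed
  qed
  from c[OF this] have "subexp (coeff_norm (\<lambda>k j. c k j * sph_coeff Y f k j))" by (blast intro: subexp_of_harmonic_series)
  \<comment> \<open>\<open>l\<close> is itself subexponential, so undoing the coefficients 1 / l k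
    stays within the growth class.\<close>
  from subexp_coeff_scale[OF sl this]
  have "subexp (coeff_norm (\<lambda>k j. complex_of_real (l k) * (c k j * sph_coeff Y f k j)))" .
  also have "coeff_norm (\<lambda>k j. complex_of_real (l k) * (c k j * sph_coeff Y f k j)) = coeff_norm c"
  proof (rule coeff_norm_cong)
    fix k j assume j: "j \<in> {1..sph_dim TYPE('a) k}"
    have "sph_coeff Y f k j = complex_of_real (1 / l k)"
      unfolding f_def sph_coeff_sph_series[OF subexp_convergent[OF sb] j] by (simp only: b_def)
    then show "complex_of_real (l k) * (c k j * sph_coeff Y f k j) = c k j" using l[of k] by simp
  qed
  finally show ?thesis .
qed

lemma mean_scale:
  assumes a: "subexp (coeff_norm a)" and r: "0 \<le> r" "r < 1"
  shows "mean (sph_series Y (\<lambda>k j. z * a k j)) r = cmod z * mean (sph_series Y a) r"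
proof -
  have "sph_series Y (\<lambda>k j. z * a k j) (r *\<^sub>R x) = z * sph_series Y a (r *\<^sub>R x)" if x: "norm x = 1" for x
  proof -
    have "norm (r *\<^sub>R x) < 1" using r x by simp
    from suminf_mult[OF sums_summable[OF subexp_sums[OF a this]], of z]
    show ?thesis unfolding sph_series_def sph_term_polar[OF x] sph_part_scale by (simp add: mult.left_commute)
  qed
  then have "mean (sph_series Y (\<lambda>k j. z * a k j)) r = (\<integral>x. cmod z * cmod (sph_series Y a (r *\<^sub>R x)) \<partial>\<sigma>)"
    unfolding mean_def by (intro Bochner_Integration.integral_cong) (auto simp: norm_mult)
  then show ?thesis by (simp add: mean_def)
qed

text \<open>The kernel of \<open>a\<close> at y, dilated by \<open>dyadic L\<close> and scaled by
  2^(-L e). With e = t - \<alpha> and the kernel of the fractional derivative of order t it is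
  normalized on scale L.\<close>

definition atom :: "(nat \<Rightarrow> nat \<Rightarrow> complex) \<Rightarrow> real \<Rightarrow> nat \<Rightarrow> 'a \<Rightarrow> nat \<Rightarrow> nat \<Rightarrow> complex" where
  "atom a e L y = (\<lambda>k j. complex_of_real (((1 / 2) ^ L) powr e * dyadic L ^ k) * kcoeff a y k j)"

lemma dyadic_mult_bounds:
  assumes "0 \<le> r" "r < 1"
  shows "0 \<le> dyadic L * r" "dyadic L * r < 1" "dyadic L * r \<le> r" "dyadic L * r \<le> dyadic L"
proof -
  show "0 \<le> dyadic L * r" using assms dyadic_bounds[of L] by (intro mult_nonneg_nonneg) auto
  show "dyadic L * r \<le> r" using assms dyadic_bounds[of L] by (intro mult_left_le_one_le) auto
  show "dyadic L * r \<le> dyadic L" using assms dyadic_bounds[of L] by (intro mult_left_le) auto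
  show "dyadic L * r < 1" using \<open>dyadic L * r \<le> r\<close> assms by linarith
qed

lemma mean_atom:
  assumes a: "subexp (coeff_norm a)" and y: "norm y = 1" and r: "0 \<le> r" "r < 1"
  shows "mean (sph_series Y (atom a e L y)) r = ((1 / 2) ^ L) powr e * mean (sph_series Y (kcoeff a y)) (dyadic L * r)"
proof -
  define v where "v = ((1 / 2 :: real) ^ L) powr e"
  note dr = dyadic_mult_bounds[OF r, of L]
  have "sph_series Y (atom a e L y) (r *\<^sub>R x) = complex_of_real v * sph_series Y (kcoeff a y) ((dyadic L * r) *\<^sub>R x)" if x: "norm x = 1" for x
  proof -
    have term_eq: "sph_term Y (atom a e L y) (r *\<^sub>R x) k = complex_of_real v * sph_term Y (kcoeff a y) ((dyadic L * r) *\<^sub>R x) k" for k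
    proof -
      have "sph_part (atom a e L y) k x = complex_of_real (v * dyadic L ^ k) * sph_part (kcoeff a y) k x"
        unfolding atom_def v_def by (rule sph_part_scale)
      then show ?thesis unfolding sph_term_polar[OF x] by (simp only: of_real_mult power_mult_distrib mult_ac)
    qed
    have "norm ((dyadic L * r) *\<^sub>R x) < 1" using dr x by (simp del: mult_minus_left mult_minus_right add: abs_of_nonneg)
    from suminf_mult[OF sums_summable[OF subexp_sums[OF subexp_kcoeff[OF a y] this]]]
    show ?thesis unfolding sph_series_def term_eq .
  qed
  then have "mean (sph_series Y (atom a e L y)) r = (\<integral>x. v * cmod (sph_series Y (kcoeff a y) ((dyadic L * r) *\<^sub>R x)) \<partial>\<sigma>)"
    unfolding mean_def by (intro Bochner_Integration.integral_cong) (auto simp: norm_mult v_def)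
  then show ?thesis by (simp add: mean_def v_def)
qed

lemma norm_atom_le:
  assumes e: "0 \<le> e" and y: "norm y = 1" and j: "j \<in> {1..sph_dim TYPE('a) k}"
  shows "cmod (atom a e L y k j) \<le> coeff_norm a k * ybound k"
proof -
  have "((1 / 2 :: real) ^ L) powr e \<le> 1" using e by (intro powr_le1) (auto simp: power_le_one)
  moreover have "dyadic L ^ k \<le> 1" using dyadic_bounds[of L] by (intro power_le_one) auto
  ultimately have 1: "((1 / 2 :: real) ^ L) powr e * dyadic L ^ k \<le> 1 * 1"
    using dyadic_bounds(1)[of L] by (intro mult_mono) auto
  have "cmod (a k j) \<le> coeff_norm a k" unfolding coeff_norm_def using j by (intro member_le_sum) auto
  then have 2: "cmod (kcoeff a y k j) \<le> coeff_norm a k * ybound k"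
    unfolding norm_mult norm_of_real using Y_le_ybound[OF j y] by (intro mult_mono) auto
  have "cmod (atom a e L y k j) = (((1 / 2 :: real) ^ L) powr e * dyadic L ^ k) * cmod (kcoeff a y k j)"
    unfolding atom_def norm_mult[of "complex_of_real (((1 / 2 :: real) ^ L) powr e * dyadic L ^ k)"] norm_of_real
    using dyadic_bounds(1)[of L] by (subst abs_of_nonneg) auto
  also have "\<dots> \<le> 1 * (coeff_norm a k * ybound k)" using 1 2 by (intro mult_mono) auto
  finally show ?thesis by simp
qed

lemma subexp_coeff_norm_bound:
  assumes s: "subexp s" and a: "\<And>k j. j \<in> {1..sph_dim TYPE('a) k} \<Longrightarrow> cmod (a k j) \<le> s k"
  shows "subexp (coeff_norm a)"
proof (rule subexp_mono[OF subexp_scalar[OF s]])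
  fix k
  have "coeff_norm a k \<le> coeff_norm (\<lambda>k j. complex_of_real (s k)) k"
    unfolding coeff_norm_def by (rule sum_mono) (use a in \<open>auto intro: order_trans[OF _ abs_ge_self]\<close>)
  then show "\<bar>coeff_norm a k\<bar> \<le> \<bar>coeff_norm (\<lambda>k j. complex_of_real (s k)) k\<bar>" by simp
qed

lemma mean_countable_subadditive:
  fixes \<mu> :: "nat \<Rightarrow> real"
  assumes s: "subexp s" and a: "\<And>l k j. j \<in> {1..sph_dim TYPE('a) k} \<Longrightarrow> cmod (a l k j) \<le> s k"
    and \<mu>: "\<And>l. 0 \<le> \<mu> l" "summable \<mu>" and r: "0 \<le> r" "r < 1"
    and M: "\<And>l. mean (sph_series Y (a l)) r \<le> M l" "summable (\<lambda>l. \<mu> l * M l)"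
  shows "mean (sph_series Y (\<lambda>k j. \<Sum>l. complex_of_real (\<mu> l) * a l k j)) r \<le> (\<Sum>l. \<mu> l * M l)"
proof -
  have M0: "0 \<le> M l" for l using M(1)[of l] mean_nonneg[of "sph_series Y (a l)" r] by linarith
  have al: "sph_series Y (a l) \<in> harmonic_ball" for l
    by (rule sph_series_harmonic[OF subexp_coeff_norm_bound[OF s a]])
  have "ennreal (mean (sph_series Y (\<lambda>k j. \<Sum>l. complex_of_real (\<mu> l) * a l k j)) r) = nmean (sph_series Y (\<lambda>k j. \<Sum>l. complex_of_real (\<mu> l) * a l k j)) r"
    by (rule nmean_eq_mean[OF sph_series_harmonic[OF nmean_countable_subadditive(1)[OF s a \<mu> r]] r, symmetric])
  also have "\<dots> \<le> (\<Sum>l. ennreal (\<mu> l) * nmean (sph_series Y (a l)) r)"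
    by (rule nmean_countable_subadditive(2)[OF s a \<mu> r])
  also have "\<dots> \<le> (\<Sum>l. ennreal (\<mu> l * M l))"
  proof (rule suminf_le)
    fix l
    have "ennreal (\<mu> l) * nmean (sph_series Y (a l)) r \<le> ennreal (\<mu> l) * ennreal (M l)"
      unfolding nmean_eq_mean[OF al r] by (intro mult_left_mono ennreal_leI M) auto
    also have "\<dots> = ennreal (\<mu> l * M l)" by (rule ennreal_mult[symmetric]) (use \<mu> M0 in auto)
    finally show "ennreal (\<mu> l) * nmean (sph_series Y (a l)) r \<le> ennreal (\<mu> l * M l)" .
  qed auto
  also have "\<dots> = ennreal (\<Sum>l. \<mu> l * M l)" by (rule suminf_ennreal2[OF mult_nonneg_nonneg[OF \<mu>(1) M0] M(2)])
  finally show ?thesis using suminf_nonneg[OF M(2) mult_nonneg_nonneg[OF \<mu>(1) M0]] by (simp only: ennreal_le_iff)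
qed

text \<open>Scales and points are arbitrary: the weighted means of an atom decay geometrically away
  from its own scale, with constants independent of the scale and the point, and the weights 2^-l
  make the p-th powers summable over l.\<close>

lemma atomic_series_in_mixed_norm_space:
  fixes L :: "nat \<Rightarrow> nat"
  assumes \<alpha>: "0 < \<alpha>" "\<alpha> < t" and p: "0 < p" "p \<le> 1" and y: "\<And>l. norm (y l) = 1"
  defines "F \<equiv> \<lambda>k j. \<Sum>l. complex_of_real ((1 / 2) ^ l) * atom (\<lambda>k j. complex_of_real (gam t k)) (t - \<alpha>) (L l) (y l) k j"
  shows "subexp (coeff_norm F)" "sph_series Y F \<in> mixed_norm_space \<sigma> (ereal p) 1 \<alpha>"
proof -
  define g where "g = (\<lambda>k (j::nat). complex_of_real (gam t k))"
  have t: "0 < t" using \<alpha> by linarith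
  have g: "subexp (coeff_norm g)" unfolding g_def by (rule subexp_scalar[OF subexp_gam[OF t]])
  define s where "s k = coeff_norm g k * ybound k" for k
  have s: "subexp s" unfolding s_def by (rule subexp_mult[OF g subexp_ybound])
  have as: "cmod (atom g (t - \<alpha>) (L l) (y l) k j) \<le> s k" if "j \<in> {1..sph_dim TYPE('a) k}" for l k j
    unfolding s_def using \<alpha> y that by (intro norm_atom_le) auto
  have hs: "summable (\<lambda>l. (1 / 2 :: real) ^ l)" by (rule summable_geometric) simp
  obtain C where C: "0 \<le> C" and kC: "\<And>r y. 0 \<le> r \<Longrightarrow> r < 1 \<Longrightarrow> norm y = 1 \<Longrightarrow> (\<integral>\<^sup>+x. ennreal (cmod (kern g r x y)) \<partial>\<sigma>) \<le> ennreal (C * (1 - r) powr (- t))"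
    using kern_gam_integral[OF t] unfolding g_def by blast
  have mC: "mean (sph_series Y (kcoeff g z)) r \<le> C * (1 - r) powr (- t)" if "0 \<le> r" "r < 1" "norm z = 1" for r z
    using kC[OF that] C unfolding kern_mean[OF g that(3,1,2)] by (simp add: ennreal_le_iff)
  show sF: "subexp (coeff_norm F)"
    unfolding F_def g_def[symmetric] by (rule nmean_countable_subadditive(1)[OF s as _ hs order_refl zero_less_one]) auto
  then have hF: "sph_series Y F \<in> harmonic_ball" by (rule sph_series_harmonic)
  define q where "q = (1 / 2 :: real) powr min \<alpha> (t - \<alpha>)"
  have q: "0 \<le> q" "q < 1" unfolding q_def using \<alpha> by (auto simp: powr01_less_one)
  \<comment> \<open>\<open>u i l\<close> bounds the contribution of the l-th atom to the dyadic norm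
    at scale i.\<close>
  define u where "u i l = (1 / 2 :: real) ^ l * (C * q ^ ((i - L l) + (L l - i)))" for i l
  have qp: "q ^ n \<le> 1" for n using q by (intro power_le_one) auto
  have u0: "0 \<le> u i l" for i l unfolding u_def using C q by (intro mult_nonneg_nonneg) auto
  have u_le: "u i l \<le> (1 / 2) ^ l * C" for i l
    unfolding u_def using C qp by (intro mult_left_mono mult_left_le) auto
  have su: "summable (u i)" for i
    by (rule summable_comparison_test'[OF suminf_half_power(1)[of C]]) (use u0 u_le in auto)
  have dF: "dnorm \<alpha> (sph_series Y F) i \<le> (\<Sum>l. u i l)" for i
  proof -
    define w where "w = ((1 / 2 :: real) ^ i) powr \<alpha>"
    have w: "0 < w" by (simp add: w_def)
    have "mean (sph_series Y F) (dyadic i) \<le> (\<Sum>l. (1 / 2) ^ l * (C * q ^ ((i - L l) + (L l - i)) / w))"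
      unfolding F_def g_def[symmetric]
    proof (rule mean_countable_subadditive[OF s as _ hs dyadic_bounds(1,2)])
      fix l
      note d = dyadic_mult_bounds[OF dyadic_bounds(1,2)[of i], of "L l"]
      have "w * mean (sph_series Y (atom g (t - \<alpha>) (L l) (y l))) (dyadic i)
        \<le> w * (((1 / 2) ^ L l) powr (t - \<alpha>) * (C * (1 - dyadic (L l) * dyadic i) powr (- t)))"
        unfolding mean_atom[OF g y dyadic_bounds(1,2)] using w by (intro mult_left_mono mC d y) auto
      also have "\<dots> = C * (w * (((1 / 2) ^ L l) powr (t - \<alpha>) * (1 - dyadic (L l) * dyadic i) powr (- t)))"
        by (simp only: mult_ac)
      also have "\<dots> \<le> C * q ^ ((i - L l) + (L l - i))"
        unfolding w_def q_def by (intro mult_left_mono dyadic_pair_weight \<alpha> C)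
      finally show "mean (sph_series Y (atom g (t - \<alpha>) (L l) (y l))) (dyadic i) \<le> C * q ^ ((i - L l) + (L l - i)) / w"
        using w by (simp add: pos_le_divide_eq mult.commute)
    next
      show "summable (\<lambda>l. (1 / 2) ^ l * (C * q ^ ((i - L l) + (L l - i)) / w))"
        using summable_divide[OF su[of i], of w] by (simp add: u_def)
    qed auto
    also have "\<dots> = (\<Sum>l. u i l) / w"
      unfolding u_def times_divide_eq_right by (rule suminf_divide) (use su[of i] in \<open>simp only: u_def[abs_def]\<close>)
    finally show ?thesis using w unfolding dnorm_def w_def[symmetric] by (simp add: pos_le_divide_eq mult.commute)
  qed
  define B where "B l = C powr p * ((1 / 2) powr p) ^ l" for l
  have hp: "(1 / 2 :: real) powr p < 1" using p by (simp add: powr01_less_one)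
  have B0: "0 \<le> B l" for l unfolding B_def by simp
  have sB: "summable B" unfolding B_def using hp by (intro summable_mult summable_geometric) simp
  have up: "u i l powr p = B l * (q powr p) ^ ((i - L l) + (L l - i))" for i l
  proof -
    have "(q ^ n) powr p = (q powr p) ^ n" for n by (rule power_powr_commute) (simp add: q_def)
    moreover have "((1 / 2 :: real) ^ l) powr p = ((1 / 2) powr p) ^ l" by (rule power_powr_commute) simp
    ultimately show ?thesis using C q by (simp add: u_def B_def powr_mult mult_ac)
  qed
  have qpp: "0 \<le> q powr p" "q powr p < 1" using q p by (auto simp: q_def powr01_less_one)
  have sup: "summable (\<lambda>l. u i l powr p)" for i
    by (rule summable_comparison_test'[OF sB])
       (use B0 qpp in \<open>auto simp: up intro!: mult_left_le power_le_one\<close>)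
  have "summable (\<lambda>i. dnorm \<alpha> (sph_series Y F) i powr p)"
  proof (rule summableI_nonneg_bounded)
    fix n
    have "(\<Sum>i<n. dnorm \<alpha> (sph_series Y F) i powr p) \<le> (\<Sum>i<n. \<Sum>l. u i l powr p)"
    proof (rule sum_mono)
      fix i
      have "dnorm \<alpha> (sph_series Y F) i powr p \<le> (\<Sum>l. u i l) powr p"
        using p by (intro powr_mono2 dF dnorm_nonneg) auto
      also have "\<dots> \<le> (\<Sum>l. u i l powr p)" by (rule powr_suminf_le[OF u0 su p sup])
      finally show "dnorm \<alpha> (sph_series Y F) i powr p \<le> (\<Sum>l. u i l powr p)" .
    qed
    \<comment> \<open>Summing over the scales i first gives each atom a total that is bounded
      whatever its own scale, and independent of n.\<close>
    also have "\<dots> = (\<Sum>l. \<Sum>i<n. u i l powr p)" by (rule suminf_sum[symmetric]) (rule sup)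
    also have "\<dots> \<le> (\<Sum>l. B l * (2 / (1 - q powr p)))"
    proof (rule suminf_le)
      fix l
      show "(\<Sum>i<n. u i l powr p) \<le> B l * (2 / (1 - q powr p))"
        unfolding up sum_distrib_left[symmetric] by (intro mult_left_mono truncated_geometric_sum_le qpp B0)
      show "summable (\<lambda>l. \<Sum>i<n. u i l powr p)" by (rule summable_sum) (rule sup)
      show "summable (\<lambda>l. B l * (2 / (1 - q powr p)))" by (rule summable_mult2[OF sB])
    qed
    finally show "(\<Sum>i<n. dnorm \<alpha> (sph_series Y F) i powr p) \<le> (\<Sum>l. B l * (2 / (1 - q powr p)))" .
  qed simp
  then show "sph_series Y F \<in> mixed_norm_space \<sigma> (ereal p) 1 \<alpha>" by (intro mixed_norm_spaceI[OF hF p(1) order_refl])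
qed

text \<open>
  Gliding hump: if the weighted means of the kernels were unbounded, then they would be large along
  scales \<open>L\<^sub>l\<close> so sparse that in the image of the single function
  \<open>\<Sum>l. 2\<^sup>-\<^sup>l g\<^sub>l\<close>, with \<open>g\<^sub>l\<close> concentrated on scale \<open>L\<^sub>l\<close>, no other term
  can compensate the \<open>l\<close>-th one on that scale.
\<close>

lemma multiplier_necessary:
  assumes \<alpha>: "0 < \<alpha>" "\<alpha> < t" and \<beta>: "0 < \<beta>" and p: "0 < p" "p \<le> 1" and q: "0 < q"
    and c: "subexp (coeff_norm c)"
    and mult: "\<And>f. f \<in> mixed_norm_space \<sigma> (ereal p) 1 \<alpha> \<Longrightarrow> sph_series Y (\<lambda>k j. c k j * sph_coeff Y f k j) \<in> mixed_norm_space \<sigma> q 1 \<beta>"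
  shows "\<exists>M. \<forall>L y. norm y = 1 \<longrightarrow>
     ((1 / 2) ^ L) powr (t - \<alpha> + \<beta>) * mean (sph_series Y (kcoeff (\<lambda>k j. complex_of_real (gam t k) * c k j) y)) ((dyadic L)\<^sup>2) \<le> M"
proof (rule ccontr)
  define g where "g = (\<lambda>k (j::nat). complex_of_real (gam t k))"
  define A where "A = (\<lambda>k j. complex_of_real (gam t k) * c k j)"
  define W where "W r y = mean (sph_series Y (kcoeff A y)) r" for r and y :: 'a
  define w where "w j = ((1 / 2) ^ j :: real)" for j
  \<comment> \<open>The squared radius appears because an atom already dilated by
    \<open>dyadic L\<close> is observed at radius \<open>dyadic L\<close>.\<close>
  define \<Phi> where "\<Phi> L y = w L powr (t - \<alpha> + \<beta>) * W ((dyadic L)\<^sup>2) y" for L and y :: 'a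
  assume "\<not> ?thesis"
  then have unb: "\<exists>L y. norm y = 1 \<and> M < \<Phi> L y" for M
    unfolding \<Phi>_def W_def A_def w_def not_ex not_all not_imp not_le by blast
  have t: "0 < t" using \<alpha> by linarith
  have w: "0 < w j" "w j \<le> 1" for j by (simp_all add: w_def power_le_one)
  have w1: "w j powr e \<le> 1" if "0 \<le> e" for j e using w[of j] that by (intro powr_le1) auto
  have A: "subexp (coeff_norm A)" unfolding A_def by (rule subexp_coeff_scale[OF subexp_gam[OF t] c])
  have W0: "0 \<le> W r y" for r and y :: 'a unfolding W_def by (rule mean_nonneg)
  have W_mono: "W r y \<le> W s y" if "norm y = 1" "0 \<le> r" "r \<le> s" "s < 1" for r s and y :: 'a
    unfolding W_def by (rule mean_mono[OF sph_series_harmonic[OF subexp_kcoeff[OF A]]]) (use that in auto)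
  have "\<forall>L. \<exists>B. \<forall>y. norm y = 1 \<longrightarrow> W (dyadic L) y \<le> B"
    unfolding W_def using kcoeff_mean_bounded[OF A dyadic_bounds(1,2)] by blast
  then obtain B where B: "\<And>L y. norm y = 1 \<Longrightarrow> W (dyadic L) y \<le> B L" by metis
  \<comment> \<open>A majorant of the kernel means at \<open>dyadic L\<close>, uniform in the point
    and made increasing in L by summing.\<close>
  define E where "E L = (\<Sum>l\<le>L. \<bar>B l\<bar>)" for L
  have E_mono: "E L \<le> E L'" if "L \<le> L'" for L L' unfolding E_def using that by (intro sum_mono2) auto
  have E0: "0 \<le> E L" for L unfolding E_def by (rule sum_nonneg) auto
  have E: "W (dyadic L) y \<le> E L" if y: "norm y = 1" for L and y :: 'a
  proof -
    have "W (dyadic L) y \<le> \<bar>B L\<bar>" using B[OF y, of L] by linarith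
    also have "\<dots> \<le> E L" unfolding E_def by (rule member_le_sum) auto
    finally show ?thesis .
  qed
  have \<Phi>E: "\<Phi> L y \<le> E L" if y: "norm y = 1" for L and y :: 'a
  proof -
    have "\<Phi> L y \<le> 1 * W ((dyadic L)\<^sup>2) y"
      unfolding \<Phi>_def using \<alpha> \<beta> by (intro mult_right_mono w1 W0) auto
    also have "\<dots> \<le> W (dyadic L) y"
      unfolding mult_1_left using dyadic_bounds[of L]
      by (intro W_mono y) (auto simp: power2_eq_square intro: mult_left_le)
    also have "\<dots> \<le> E L" by (rule E[OF y])
    finally show ?thesis .
  qed
  \<comment> \<open>The new scale is so large that the damping 2^(-L (t - \<alpha>)) beats the means
    at the current scale. In the lower bound for \<Phi>, the factor \<open>2 ^ Suc n\<close> offsets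
    the weight of the new atom, n makes the result unbounded, and 2 * (1 + E) absorbs all other
    atoms.\<close>
  have step: "\<exists>x'. norm (snd x') = 1 \<and> (fst x < fst x' \<and> (\<forall>L'\<ge>fst x'. w L' powr (t - \<alpha>) * E (fst x) \<le> 1) \<and>
      2 ^ Suc n * (real n + 2 * (1 + E (fst x))) \<le> \<Phi> (fst x') (snd x'))" for n and x :: "nat \<times> 'a"
  proof -
    have w_lim: "(\<lambda>L. w L powr (t - \<alpha>) * E (fst x)) \<longlonglongrightarrow> 0"
    proof -
      have "w L powr (t - \<alpha>) = ((1 / 2) powr (t - \<alpha>)) ^ L" for L unfolding w_def by (rule power_powr_commute) simp
      moreover have "(\<lambda>L. ((1 / 2 :: real) powr (t - \<alpha>)) ^ L) \<longlonglongrightarrow> 0"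
        by (rule LIMSEQ_power_zero) (use \<alpha> in \<open>simp add: powr01_less_one\<close>)
      ultimately show ?thesis by (simp add: tendsto_mult_left_zero)
    qed
    have "\<forall>\<^sub>F L in sequentially. w L powr (t - \<alpha>) * E (fst x) < 1" by (rule order_tendstoD(2)[OF w_lim]) simp
    then obtain L0 where L0: "\<And>L. L0 \<le> L \<Longrightarrow> w L powr (t - \<alpha>) * E (fst x) < 1" unfolding eventually_sequentially by blast
    define L1 where "L1 = max L0 (fst x)"
    \<comment> \<open>Exceeding \<open>E L1\<close> as well forces the new scale beyond L1, because
      \<open>\<Phi>\<close> is at most \<open>E\<close> and \<open>E\<close> increases.\<close>
    obtain L' y' where y': "norm y' = 1" and big: "max (E L1) (2 ^ Suc n * (real n + 2 * (1 + E (fst x)))) < \<Phi> L' y'" using unb by blast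
    have "\<not> L' \<le> L1" using big \<Phi>E[OF y', of L'] E_mono[of L' L1] by linarith
    then have "fst x < L'" "L0 \<le> L'" by (simp_all add: L1_def)
    moreover have "\<forall>M\<ge>L'. w M powr (t - \<alpha>) * E (fst x) \<le> 1" using L0 \<open>L0 \<le> L'\<close> by (meson less_imp_le order_trans)
    moreover have "2 ^ Suc n * (real n + 2 * (1 + E (fst x))) \<le> \<Phi> L' y'" using big by linarith
    ultimately show ?thesis using y' by (intro exI[of _ "(L', y')"]) simp
  qed
  obtain y0 :: 'a where "norm y0 = 1" using sphere_nonempty by blast
  then have "\<exists>x::nat \<times> 'a. norm (snd x) = 1" by (intro exI[of _ "(0, y0)"]) simp
  from dependent_nat_choice[where P = "\<lambda>n (x::nat \<times> 'a). norm (snd x) = 1"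
      and Q = "\<lambda>n x x'. fst x < fst x' \<and> (\<forall>L'\<ge>fst x'. w L' powr (t - \<alpha>) * E (fst x) \<le> 1) \<and> 2 ^ Suc n * (real n + 2 * (1 + E (fst x))) \<le> \<Phi> (fst x') (snd x')",
      OF this step]
  obtain x :: "nat \<Rightarrow> nat \<times> 'a" where x: "\<And>n. norm (snd (x n)) = 1"
      "\<And>n. fst (x n) < fst (x (Suc n)) \<and> (\<forall>L'\<ge>fst (x (Suc n)). w L' powr (t - \<alpha>) * E (fst (x n)) \<le> 1) \<and>
         2 ^ Suc n * (real n + 2 * (1 + E (fst (x n)))) \<le> \<Phi> (fst (x (Suc n))) (snd (x (Suc n)))" by blast
  define L where "L n = fst (x n)" for n
  define y where "y n = snd (x n)" for n
  have y: "norm (y n) = 1" for n using x by (simp add: y_def)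
  have L_mono: "strict_mono L" unfolding strict_mono_Suc_iff L_def using x(2) by blast
  have wE: "w L' powr (t - \<alpha>) * E (L n) \<le> 1" if "L (Suc n) \<le> L'" for n L' using x(2)[of n] that unfolding L_def by blast
  have big: "2 ^ Suc n * (real n + 2 * (1 + E (L n))) \<le> \<Phi> (L (Suc n)) (y (Suc n))" for n using x(2)[of n] unfolding L_def y_def by blast
  define F where "F = (\<lambda>k j. \<Sum>l. complex_of_real ((1 / 2) ^ l) * atom g (t - \<alpha>) (L l) (y l) k j)"
  have F: "subexp (coeff_norm F)" "sph_series Y F \<in> mixed_norm_space \<sigma> (ereal p) 1 \<alpha>"
    unfolding F_def g_def by (rule atomic_series_in_mixed_norm_space[OF \<alpha> p y])+
  define G where "G l = atom A (t - \<alpha>) (L l) (y l)" for l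
  define s where "s k = coeff_norm A k * ybound k" for k
  have s: "subexp s" unfolding s_def by (rule subexp_mult[OF A subexp_ybound])
  have Gs: "cmod (G l k j) \<le> s k" if "j \<in> {1..sph_dim TYPE('a) k}" for l k j
    unfolding s_def G_def using \<alpha> y that by (intro norm_atom_le) auto
  have G: "subexp (coeff_norm (G l))" for l by (rule subexp_coeff_norm_bound[OF s Gs])
  \<comment> \<open>The image of the test function: multiplication by c turns atoms of the
    differentiated Poisson kernel into atoms of the differentiated multiplier.\<close>
  define H where "H = (\<lambda>k j. \<Sum>l. complex_of_real ((1 / 2) ^ l) * G l k j)"
  have hG: "cmod (complex_of_real ((1 / 2) ^ l) * G l k j) \<le> (1 / 2) ^ l * s k" if "j \<in> {1..sph_dim TYPE('a) k}" for l k j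
    unfolding norm_mult norm_of_real using Gs[OF that] by (simp add: mult_left_mono)
  have sumG: "summable (\<lambda>l. complex_of_real ((1 / 2) ^ l) * G l k j)" if "j \<in> {1..sph_dim TYPE('a) k}" for k j
    by (rule summable_comparison_test'[OF suminf_half_power(1)[of "s k"], of 0]) (rule hG[OF that])
  have Hs: "cmod (H k j) \<le> 2 * s k" if "j \<in> {1..sph_dim TYPE('a) k}" for k j
    unfolding H_def using norm_suminf_le[OF hG[OF that] suminf_half_power(1)] by (simp only: suminf_half_power(2))
  have H: "subexp (coeff_norm H)" by (rule subexp_coeff_norm_bound[OF subexp_mult[OF subexp_const s] Hs])
  have cF: "c k j * F k j = H k j" if j: "j \<in> {1..sph_dim TYPE('a) k}" for k j
  proof -
    have sg: "summable (\<lambda>l. complex_of_real ((1 / 2) ^ l) * atom g (t - \<alpha>) (L l) (y l) k j)"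
    proof (rule summable_comparison_test'[OF suminf_half_power(1)[of "coeff_norm g k * ybound k"], of 0])
      fix l :: nat
      have "cmod (atom g (t - \<alpha>) (L l) (y l) k j) \<le> coeff_norm g k * ybound k" using \<alpha> y j by (intro norm_atom_le) auto
      then show "norm (complex_of_real ((1 / 2) ^ l) * atom g (t - \<alpha>) (L l) (y l) k j) \<le> (1 / 2) ^ l * (coeff_norm g k * ybound k)"
        unfolding norm_mult[of "complex_of_real ((1 / 2) ^ l)"] norm_of_real by (simp add: mult_left_mono)
    qed
    have "c k j * F k j = (\<Sum>l. c k j * (complex_of_real ((1 / 2) ^ l) * atom g (t - \<alpha>) (L l) (y l) k j))"
      unfolding F_def by (rule suminf_mult[OF sg, symmetric])
    also have "\<dots> = H k j" unfolding H_def G_def atom_def A_def g_def by (rule suminf_cong) (simp only: mult_ac)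
    finally show ?thesis .
  qed
  have hH: "sph_series Y H \<in> mixed_norm_space \<sigma> q 1 \<beta>"
  proof -
    have "sph_series Y (\<lambda>k j. c k j * sph_coeff Y (sph_series Y F) k j) = sph_series Y H"
      by (rule ext, rule sph_series_cong) (simp only: sph_coeff_sph_series[OF subexp_convergent[OF F(1)]] cF)
    then show ?thesis using mult[OF F(2)] by simp
  qed
  obtain C where C: "\<And>i. dnorm \<beta> (sph_series Y H) i \<le> C" using mixed_norm_space_dnorm_bounded[OF hH q] by blast
  have "real i \<le> C" for i
  proof -
    define n where "n = Suc i"
    define r where "r = dyadic (L n)"
    have r: "0 \<le> r" "r < 1" unfolding r_def by (rule dyadic_bounds)+
    \<comment> \<open>Bounds the mean at radius r of every hump other than the n-th.\<close>
    define T where "T = 1 + E (L i)"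
    \<comment> \<open>The n-th hump is the image minus all other humps. With \<open>H\<close> in
      slot n at weight 1 and - G l in the other slots, it becomes one countable superposition, so
      subadditivity plays the part of the reverse triangle inequality.\<close>
    define a where "a l = (if l = n then H else (\<lambda>k j. - 1 * G l k j))" for l
    define \<mu> where "\<mu> l = (if l = n then 1 else (1 / 2 :: real) ^ l)" for l
    define m where "m = mean (sph_series Y H) r"
    define M where "M l = (if l = n then m else T)" for l
    have \<mu>_sums: "(\<lambda>l. \<mu> l * f l) sums ((\<Sum>l. (1 / 2) ^ l * f l) + (1 - (1 / 2) ^ n) * f n)" if "summable (\<lambda>l. (1 / 2) ^ l * f l)" for f :: "nat \<Rightarrow> real"
    proof -
      have "(\<lambda>l. (1 / 2) ^ l * f l + (if l = n then (1 - (1 / 2) ^ l) * f l else 0)) sums ((\<Sum>l. (1 / 2) ^ l * f l) + (1 - (1 / 2) ^ n) * f n)"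
        by (rule sums_add[OF summable_sums[OF that] sums_single])
      also have "(\<lambda>l. (1 / 2) ^ l * f l + (if l = n then (1 - (1 / 2) ^ l) * f l else 0)) = (\<lambda>l. \<mu> l * f l)"
        by (auto simp: \<mu>_def fun_eq_iff algebra_simps)
      finally show ?thesis .
    qed
    have "mean (sph_series Y (\<lambda>k j. \<Sum>l. complex_of_real (\<mu> l) * a l k j)) r \<le> (\<Sum>l. \<mu> l * M l)"
    proof (rule mean_countable_subadditive[OF subexp_mult[OF subexp_const[of 2] s] _ _ _ r])
      show "cmod (a l k j) \<le> 2 * s k" if j: "j \<in> {1..sph_dim TYPE('a) k}" for l k j
      proof (cases "l = n")
        case True then show ?thesis using Hs[OF j] by (simp add: a_def)
      next
        case False
        have "cmod (G l k j) \<le> 2 * s k" using Gs[OF j, of l] norm_ge_zero[of "G l k j"] by linarith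
        then show ?thesis using False by (simp add: a_def)
      qed
      show "0 \<le> \<mu> l" for l by (simp add: \<mu>_def)
      show "summable \<mu>" using \<mu>_sums[of "\<lambda>_. 1"] suminf_half_power(1)[of 1] by (simp add: sums_iff)
      show "mean (sph_series Y (a l)) r \<le> M l" for l
      proof (cases "l = n")
        case False
        have "mean (sph_series Y (a l)) r = mean (sph_series Y (G l)) r"
          using mean_scale[OF G r, of "- 1" l] False by (simp add: a_def)
        also have "\<dots> = w (L l) powr (t - \<alpha>) * W (dyadic (L l) * r) (y l)"
          unfolding G_def W_def w_def by (rule mean_atom[OF A y r])
        \<comment> \<open>Earlier atoms: their own dilation keeps the kernel within radius
          \<open>dyadic (L l)\<close>, hence below \<open>E (L i)\<close>. Later atoms: the damping
          chosen with their scale makes them at most 1.\<close>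
        also have "\<dots> \<le> T"
        proof (cases "l \<le> i")
          case True
          have "w (L l) powr (t - \<alpha>) * W (dyadic (L l) * r) (y l) \<le> 1 * W (dyadic (L l)) (y l)"
            using \<alpha> by (intro mult_mono w1 W_mono y dyadic_mult_bounds[OF r] dyadic_bounds W0) auto
          also have "\<dots> \<le> E (L l)" using E[OF y] by simp
          also have "\<dots> \<le> E (L i)" using True L_mono by (intro E_mono) (simp add: strict_mono_less_eq)
          finally show ?thesis by (simp add: T_def)
        next
          case False
          then have "n < l" using \<open>l \<noteq> n\<close> by (simp add: n_def)
          then have nl: "L (Suc n) \<le> L l" using L_mono by (simp add: strict_mono_less_eq)
          have "w (L l) powr (t - \<alpha>) * W (dyadic (L l) * r) (y l) \<le> w (L l) powr (t - \<alpha>) * W (dyadic (L n)) (y l)"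
            using dyadic_mult_bounds[OF r, of "L l"] r unfolding r_def by (intro mult_left_mono W_mono y) auto
          also have "\<dots> \<le> w (L l) powr (t - \<alpha>) * E (L n)" by (intro mult_left_mono E y) auto
          also have "\<dots> \<le> 1" by (rule wE[OF nl])
          also have "\<dots> \<le> T" using E0 by (simp add: T_def)
          finally show ?thesis .
        qed
        finally show ?thesis using False by (simp add: M_def)
      qed (simp add: a_def M_def m_def)
      have "summable (\<lambda>l. (1 / 2) ^ l * T + (if l = n then (1 / 2) ^ l * (m - T) else 0))"
        by (rule summable_add[OF suminf_half_power(1) sums_summable[OF sums_single]])
      also have "(\<lambda>l. (1 / 2) ^ l * T + (if l = n then (1 / 2) ^ l * (m - T) else 0)) = (\<lambda>l. (1 / 2) ^ l * M l)"
        by (auto simp: M_def fun_eq_iff algebra_simps)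
      finally show "summable (\<lambda>l. \<mu> l * M l)" using \<mu>_sums by (blast intro: sums_summable)
    qed
    also have "(\<Sum>l. \<mu> l * M l) \<le> m + 2 * T"
    proof -
      have "(\<lambda>l. (1 / 2) ^ l * T + (if l = n then m - (1 / 2) ^ l * T else 0)) sums (2 * T + (m - (1 / 2) ^ n * T))"
        by (rule sums_add[OF _ sums_single]) (use suminf_half_power[of T] in \<open>simp add: sums_iff\<close>)
      also have "(\<lambda>l. (1 / 2) ^ l * T + (if l = n then m - (1 / 2) ^ l * T else 0)) = (\<lambda>l. \<mu> l * M l)"
        by (auto simp: M_def \<mu>_def fun_eq_iff)
      finally show ?thesis using E0[of "L i"] by (simp add: sums_iff T_def)
    qed
    also have "mean (sph_series Y (\<lambda>k j. \<Sum>l. complex_of_real (\<mu> l) * a l k j)) r = (1 / 2) ^ n * mean (sph_series Y (G n)) r"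
    proof -
      have eq: "(\<Sum>l. complex_of_real (\<mu> l) * a l k j) = complex_of_real ((1 / 2) ^ n) * G n k j" if j: "j \<in> {1..sph_dim TYPE('a) k}" for k j
      proof -
        let ?T = "\<lambda>l. complex_of_real ((1 / 2) ^ l) * G l k j"
        have "(\<lambda>l. - ?T l + (if l = n then H k j + ?T l else 0)) sums (- H k j + (H k j + ?T n))"
          unfolding H_def by (rule sums_add[OF sums_minus[OF summable_sums[OF sumG[OF j]]] sums_single])
        also have "(\<lambda>l. - ?T l + (if l = n then H k j + ?T l else 0)) = (\<lambda>l. complex_of_real (\<mu> l) * a l k j)"
          by (auto simp: \<mu>_def a_def fun_eq_iff)
        finally show ?thesis by (simp add: sums_iff)
      qed
      have "mean (sph_series Y (\<lambda>k j. \<Sum>l. complex_of_real (\<mu> l) * a l k j)) r = mean (sph_series Y (\<lambda>k j. complex_of_real ((1 / 2) ^ n) * G n k j)) r"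
        by (rule mean_cong[OF sph_series_cong r]) (rule eq)
      also have "\<dots> = cmod (complex_of_real ((1 / 2) ^ n)) * mean (sph_series Y (G n)) r" by (rule mean_scale[OF G r])
      finally show ?thesis by (simp add: norm_power norm_divide)
    qed
    also have "mean (sph_series Y (G n)) r = w (L n) powr (t - \<alpha>) * W (r * r) (y n)"
      unfolding G_def W_def w_def mean_atom[OF A y r] by (simp only: r_def)
    finally have up: "(1 / 2) ^ n * (w (L n) powr (t - \<alpha>) * W (r * r) (y n)) \<le> m + 2 * T" .
    have T0: "0 \<le> T" using E0[of "L i"] by (simp add: T_def)
    \<comment> \<open>The remaining weight 2^(-L \<beta>) turns the mean m of the image into its
      dyadic norm, which is at most C.\<close>
    have "\<Phi> (L n) (y n) = w (L n) powr \<beta> * (w (L n) powr (t - \<alpha>) * W (r * r) (y n))"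
      unfolding \<Phi>_def r_def power2_eq_square powr_add by (simp only: mult_ac)
    then have "(1 / 2) ^ n * \<Phi> (L n) (y n) = w (L n) powr \<beta> * ((1 / 2) ^ n * (w (L n) powr (t - \<alpha>) * W (r * r) (y n)))"
      by (simp only: mult.left_commute)
    also have "\<dots> \<le> w (L n) powr \<beta> * (m + 2 * T)" by (rule mult_left_mono[OF up]) simp
    also have "\<dots> = dnorm \<beta> (sph_series Y H) (L n) + w (L n) powr \<beta> * (2 * T)"
      unfolding dnorm_def m_def r_def w_def by (rule distrib_left)
    also have "\<dots> \<le> C + 1 * (2 * T)" using \<beta> T0 by (intro add_mono C mult_right_mono w1) auto
    finally have 1: "(1 / 2) ^ n * \<Phi> (L n) (y n) \<le> C + 2 * T" by simp
    have "(1 / 2) ^ n * (2 ^ n * (real i + 2 * T)) \<le> (1 / 2) ^ n * \<Phi> (L n) (y n)"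
      using big[of i] unfolding n_def T_def by (rule mult_left_mono) simp
    also have "(1 / 2) ^ n * (2 ^ n * (real i + 2 * T)) = real i + 2 * T" by (simp add: power_one_over)
    finally show ?thesis using 1 by linarith
  qed
  then show False using reals_Archimedean2[of C] by (metis not_less)
qed

text \<open>Each \<rho> lies below (dyadic L)^2 with L two steps beyond the index of its block,
  where still 1 - \<rho> \<le> 4 * 2^-L. As means increase, passing to dyadic radii costs a factor
  4^(m + 1 - \<alpha> + \<beta>).\<close>

lemma N1_finite_of_dyadic_bound:
  assumes c: "subexp (coeff_norm c)" and t: "0 < m + 1" and \<tau>: "0 < m + 1 - \<alpha> + \<beta>"
    and M: "\<And>L y. norm y = 1 \<Longrightarrow>
     ((1 / 2) ^ L) powr (m + 1 - \<alpha> + \<beta>) * mean (sph_series Y (kcoeff (\<lambda>k j. complex_of_real (gam (m + 1) k) * c k j) y)) ((dyadic L)\<^sup>2) \<le> M"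
  shows "N1 \<sigma> Y \<alpha> \<beta> m (sph_series Y c) < \<infinity>"
proof -
  define \<tau> where "\<tau> = m + 1 - \<alpha> + \<beta>"
  have \<tau>0: "0 < \<tau>" using \<tau> by (simp add: \<tau>_def)
  have "N1 \<sigma> Y \<alpha> \<beta> m (sph_series Y c) \<le> ennreal (4 powr \<tau> * M)"
    unfolding N1_eq_SUP_mean[OF c t]
  proof (intro SUP_least ennreal_leI)
    fix \<rho> and y :: 'a assume "\<rho> \<in> {0..<1::real}" "y \<in> sphere 0 1"
    then have \<rho>: "0 \<le> \<rho>" "\<rho> < 1" and y: "norm y = 1" by auto
    obtain i where i: "dyadic i \<le> \<rho>" "\<rho> < dyadic (Suc i)" using dyadic_block[OF \<rho>] by blast
    define L where "L = Suc (Suc i)"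
    let ?f = "sph_series Y (kcoeff (\<lambda>k j. complex_of_real (gam (m + 1) k) * c k j) y)"
    have f: "?f \<in> harmonic_ball" by (rule sph_series_harmonic[OF subexp_kcoeff[OF subexp_coeff_scale[OF subexp_gam[OF t] c] y]])
    have "\<rho> \<le> (dyadic L)\<^sup>2" using i(2) dyadic_sq_bounds(3)[of "Suc i"] unfolding L_def by linarith
    moreover have "1 - \<rho> \<le> 4 * (1 / 2) ^ L" using i(1) by (simp add: L_def)
    ultimately have "(1 - \<rho>) powr \<tau> * mean ?f \<rho> \<le> (4 * (1 / 2) ^ L) powr \<tau> * mean ?f ((dyadic L)\<^sup>2)"
      using \<rho> \<tau>0 dyadic_sq_bounds(2)[of L] by (intro mult_mono powr_mono2 mean_mono f mean_nonneg) auto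
    also have "\<dots> = 4 powr \<tau> * (((1 / 2) ^ L) powr \<tau> * mean ?f ((dyadic L)\<^sup>2))" by (simp only: powr_mult mult.assoc)
    also have "\<dots> \<le> 4 powr \<tau> * M" unfolding \<tau>_def by (intro mult_left_mono M y) auto
    finally show "(1 - \<rho>) powr (m + 1 - \<alpha> + \<beta>) * mean ?f \<rho> \<le> 4 powr \<tau> * M" by (simp only: \<tau>_def)
  qed
  then show ?thesis by (rule le_less_trans) simp
qed

lemma mean_bound_of_N1_finite:
  assumes c: "subexp (coeff_norm c)" and t: "0 < m + 1" and fin: "N1 \<sigma> Y \<alpha> \<beta> m (sph_series Y c) < \<infinity>"
  shows "\<exists>N\<ge>0. \<forall>\<rho> y. 0 \<le> \<rho> \<longrightarrow> \<rho> < 1 \<longrightarrow> norm y = 1 \<longrightarrow>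
     mean (sph_series Y (kcoeff (\<lambda>k j. complex_of_real (gam (m + 1) k) * c k j) y)) \<rho> \<le> N * (1 - \<rho>) powr (- (m + 1 - \<alpha> + \<beta>))"
proof (intro exI[of _ "enn2real (N1 \<sigma> Y \<alpha> \<beta> m (sph_series Y c))"] conjI allI impI)
  fix \<rho> and y :: 'a assume \<rho>: "0 \<le> \<rho>" "\<rho> < (1::real)" and y: "norm y = 1"
  define v where "v = (1 - \<rho>) powr (m + 1 - \<alpha> + \<beta>)"
  have v: "0 < v" using \<rho> by (simp add: v_def)
  let ?f = "sph_series Y (kcoeff (\<lambda>k j. complex_of_real (gam (m + 1) k) * c k j) y)"
  have "ennreal (v * mean ?f \<rho>) \<le> N1 \<sigma> Y \<alpha> \<beta> m (sph_series Y c)"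
    unfolding N1_eq_SUP_mean[OF c t] v_def
    by (rule SUP_upper2[of \<rho>], use \<rho> in simp, rule SUP_upper) (use y in simp)
  also have "\<dots> = ennreal (enn2real (N1 \<sigma> Y \<alpha> \<beta> m (sph_series Y c)))" using fin by (simp add: less_top)
  finally have "v * mean ?f \<rho> \<le> enn2real (N1 \<sigma> Y \<alpha> \<beta> m (sph_series Y c))" by (simp add: ennreal_le_iff)
  then have "mean ?f \<rho> \<le> enn2real (N1 \<sigma> Y \<alpha> \<beta> m (sph_series Y c)) * inverse v"
    using v by (simp add: field_simps)
  then show "mean ?f \<rho> \<le> enn2real (N1 \<sigma> Y \<alpha> \<beta> m (sph_series Y c)) * (1 - \<rho>) powr (- (m + 1 - \<alpha> + \<beta>))"
    unfolding v_def powr_minus .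
qed simp

end

theorem theorem6:
  fixes \<sigma> :: "'a::euclidean_space measure"
    and Y :: "nat \<Rightarrow> nat \<Rightarrow> 'a \<Rightarrow> real"
    and c :: "nat \<Rightarrow> nat \<Rightarrow> complex"
    and \<kappa> \<alpha> \<beta> m :: real
    and p q :: ereal
  assumes "DIM('a) \<ge> 2"
    and "\<kappa> > 0" and "\<sigma> = scale_measure (ennreal \<kappa>) surface_measure"
    and "spherical_harmonic_basis \<sigma> Y"
    and "\<alpha> > 0" and "\<beta> > 0"
    and "0 < p" and "p \<le> 1" and "p \<le> q"
    and "m > \<alpha> - 1"
  shows "c \<in> multipliers Y (mixed_norm_space \<sigma> p 1 \<alpha>) (mixed_norm_space \<sigma> q 1 \<beta>) \<longleftrightarrow>
         sph_convergent Y c \<and> sph_series Y c \<in> harmonic_ball \<and>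
         N1 \<sigma> Y \<alpha> \<beta> m (sph_series Y c) < \<infinity>"
proof -
  interpret sphere_basis \<sigma> Y \<kappa> by unfold_locales (rule assms)+
  \<comment> \<open>The bounds 0 < p \<le> 1 make p a real number, while q may be infinite.\<close>
  obtain s where s: "p = ereal s" using assms(7,8) by (cases p) auto
  have s01: "0 < s" "s \<le> 1" using assms(7,8) by (auto simp: s)
  have q0: "0 < q" using assms(7,9) by (rule less_le_trans)
  have t: "\<alpha> < m + 1" "0 < m + 1" using assms(5,10) by auto
  show ?thesis
  proof
    assume mul: "c \<in> multipliers Y (mixed_norm_space \<sigma> p 1 \<alpha>) (mixed_norm_space \<sigma> q 1 \<beta>)"
    have m1: "sph_convergent Y (\<lambda>k j. c k j * sph_coeff Y f k j)"
      and m2: "sph_series Y (\<lambda>k j. c k j * sph_coeff Y f k j) \<in> mixed_norm_space \<sigma> q 1 \<beta>"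
      if "f \<in> mixed_norm_space \<sigma> (ereal s) 1 \<alpha>" for f
      using mul that unfolding multipliers_def s by blast+
    have c: "subexp (coeff_norm c)"
    proof (rule multiplier_coefficients_subexp[OF assms(5) s01(1)], rule conjI)
      fix f assume f: "f \<in> mixed_norm_space \<sigma> (ereal s) 1 \<alpha>"
      show "sph_convergent Y (\<lambda>k j. c k j * sph_coeff Y f k j)" by (rule m1[OF f])
      show "sph_series Y (\<lambda>k j. c k j * sph_coeff Y f k j) \<in> harmonic_ball" using m2[OF f] by (simp add: mixed_norm_space_def)
    qed
    obtain M where M: "\<And>L y. norm y = 1 \<Longrightarrow> ((1 / 2) ^ L) powr (m + 1 - \<alpha> + \<beta>) *
        mean (sph_series Y (kcoeff (\<lambda>k j. complex_of_real (gam (m + 1) k) * c k j) y)) ((dyadic L)\<^sup>2) \<le> M"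
      using multiplier_necessary[OF assms(5) t(1) assms(6) s01 q0 c m2] by blast
    have "N1 \<sigma> Y \<alpha> \<beta> m (sph_series Y c) < \<infinity>"
      by (rule N1_finite_of_dyadic_bound[OF c t(2) _ M]) (use t(1) assms(6) in simp)
    then show "sph_convergent Y c \<and> sph_series Y c \<in> harmonic_ball \<and> N1 \<sigma> Y \<alpha> \<beta> m (sph_series Y c) < \<infinity>"
      using subexp_convergent[OF c] sph_series_harmonic[OF c] by blast
  next
    assume *: "sph_convergent Y c \<and> sph_series Y c \<in> harmonic_ball \<and> N1 \<sigma> Y \<alpha> \<beta> m (sph_series Y c) < \<infinity>"
    then have c: "subexp (coeff_norm c)" by (blast intro: subexp_of_harmonic_series)
    obtain N where N: "0 \<le> N" and NB: "\<And>\<rho> y. 0 \<le> \<rho> \<Longrightarrow> \<rho> < 1 \<Longrightarrow> norm y = 1 \<Longrightarrow>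
        mean (sph_series Y (kcoeff (\<lambda>k j. complex_of_real (gam (m + 1) k) * c k j) y)) \<rho> \<le> N * (1 - \<rho>) powr (- (m + 1 - \<alpha> + \<beta>))"
      using mean_bound_of_N1_finite[OF c t(2)] * by blast
    have "sph_convergent Y (\<lambda>k j. c k j * sph_coeff Y f k j) \<and>
        sph_series Y (\<lambda>k j. c k j * sph_coeff Y f k j) \<in> mixed_norm_space \<sigma> q 1 \<beta>"
      if f: "f \<in> mixed_norm_space \<sigma> (ereal s) 1 \<alpha>" for f
    proof
      have "f \<in> harmonic_ball" using f by (simp add: mixed_norm_space_def)
      then show "sph_convergent Y (\<lambda>k j. c k j * sph_coeff Y f k j)"
        by (intro subexp_convergent subexp_coeff_mult c sph_coeff_subexp)
      show "sph_series Y (\<lambda>k j. c k j * sph_coeff Y f k j) \<in> mixed_norm_space \<sigma> q 1 \<beta>"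
        by (rule multiplier_sufficient[OF c f assms(5,6) t(1) s01 _ N NB]) (use assms(9) s in auto)
    qed
    then show "c \<in> multipliers Y (mixed_norm_space \<sigma> p 1 \<alpha>) (mixed_norm_space \<sigma> q 1 \<beta>)"
      unfolding multipliers_def s by blast
  qed
qed

end
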